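(* Let $p$ be a prime, let $X$ be a nonempty totally ordered set, let $S$ be the free profinite group on the basis $X$, and let $n\geq 2$. The pullbacks $\alpha_{w,n}=(\bar\rho^w)^*\gamma_{n,s}\in H^2(S^{[n,p]},\mathbb{Z}/p)$, where $w$ ranges over all Lyndon words of length $1\leq s\leq n$ in the alphabet $X$ (with $s=|w|$), form a linear basis of $H^2(S^{[n,p]},\mathbb{Z}/p)$ over $\mathbb{Z}/p$.
   Context: For a profinite group $G$, the lower $p$-central filtration is $G^{(1,p)}=G$, $G^{(n+1,p)}=(G^{(n,p)})^p[G,G^{(n,p)}]$, i.e. $G^{(n+1,p)}$ is the closed subgroup generated by all $h^p$ and $[g,h]=g^{-1}h^{-1}gh$ with $g\in G$, $h\in G^{(n,p)}$; and $G^{[n,p]}=G/G^{(n,p)}$. Cohomology is profinite (continuous) cohomology with trivial action on $\mathbb{Z}/p$. The free profinite group $S=S_X$ on basis $X$: $X\subseteq S$ generates $S$ topologically, the inclusion converges to $1$ (every open normal subgroup contains all but finitely many elements of $X$), and every map $X\to G$ to a profinite group converging to $1$ extends uniquely to a continuous homomorphism $S\to G$. $X^*$ is the free monoid of words in $X$; $|w|$ is the length of $w$. The alphabetical order on $X^*$: $w_1\leq_{\rm alp}w_2$ iff $w_2=w_1v$ for some $v\in X^*$, or $w_1=vx_1u_1$, $w_2=vx_2u_2$ with $v,u_1,u_2\in X^*$, letters $x_1<x_2$. A nonempty word is a Lyndon word if it is strictly smaller in $\leq_{\rm alp}$ than all its nontrivial proper suffixes. For a finite commutative ring $R$ (more generally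 a profinite one), $R\langle\langle X\rangle\rangle$ is the ring of formal power series in non-commuting variables $x\in X$ (with the product topology on $R^{X^*}$), and the Magnus homomorphism $\Lambda_R\colon S\to R\langle\langle X\rangle\rangle^\times$ is the continuous homomorphism with $\Lambda_R(x)=1+x$ for $x\in X$. Write $\Lambda_R(\sigma)=\sum_{w\in X^*}\epsilon_{w,R}(\sigma)w$. For $1\leq s\leq n$ let $\mathbb{U}=\mathbb{U}_{s+1}(\mathbb{Z}/p^{n-s+1})$ be the group of all unipotent upper-triangular $(s+1)\times(s+1)$ matrices over $\mathbb{Z}/p^{n-s+1}$. It is known that $\mathbb{U}^{(n,p)}=I_{s+1}+\mathbb{Z}p^{n-s}E_{1,s+1}$ ($E_{ij}$ the matrix with $1$ at entry $(i,j)$ and $0$ elsewhere) is central in $\mathbb{U}$; identifying it with $\mathbb{Z}/p$ via $I_{s+1}+ap^{n-s}E_{1,s+1}\mapsto a \pmod p$ gives a central extension $0\to\mathbb{Z}/p\to\mathbb{U}\to\mathbb{U}^{[n,p]}\to1$, and $\gamma_{n,s}\in H^2(\mathbb{U}^{[n,p]},\mathbb{Z}/p)$ is the corresponding cohomology class. For a word $w=(x_1\cdots x_s)$ with $1\le s\le n$, $\rho^w\colon S\to\mathbb{U}_{s+1}(\mathbb{Z}/p^{n-s+1})$ is the continuous homomorphism whose $(i,j)$ entry at $\sigma$, for $i<j$, is $\epsilon_{(x_i\cdots x_{j-1}),\mathbb{Z}/p^{n-s+1}}(\sigma)$, and $\bar\rho^w\colon S^{[n,p]}\to\mathbb{U}^{[n,p]}$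 is the induced homomorphism; $(\bar\rho^w)^*$ is pullback on $H^2(-,\mathbb{Z}/p)$. *)

theory Defs
  imports
    "HOL-Analysis.Abstract_Topological_Spaces"
    "HOL-Algebra.Generated_Groups"
    "HOL-Number_Theory.Residues"
    "Jordan_Normal_Form.Matrix"
    "Jordan_Normal_Form.Missing_VectorSpace"
begin

section \<open>Profinite groups\<close>

definition topological_group :: "('a, 'm) monoid_scheme \<Rightarrow> 'a topology \<Rightarrow> bool" where
  "topological_group G T \<longleftrightarrow> group G \<and> topspace T = carrier G \<and>
     continuous_map (prod_topology T T) T (\<lambda>(x, y). x \<otimes>\<^bsub>G\<^esub> y) \<and>
     continuous_map T T (\<lambda>x. inv\<^bsub>G\<^esub> x)"

definition profinite_group :: "('a, 'm) monoid_scheme \<Rightarrow> 'a topology \<Rightarrow> bool" where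
  "profinite_group G T \<longleftrightarrow> topological_group G T \<and> compact_space T \<and> Hausdorff_space T \<and>
     (\<forall>C. connectedin T C \<longrightarrow> (\<exists>x. C \<subseteq> {x}))"

definition continuous_hom ::
  "('a, 'm) monoid_scheme \<Rightarrow> 'a topology \<Rightarrow> ('b, 'n) monoid_scheme \<Rightarrow> 'b topology \<Rightarrow> ('a \<Rightarrow> 'b) set" where
  "continuous_hom G T H U = {f \<in> hom G H \<inter> extensional (carrier G). continuous_map T U f}"

definition quotient_topology ::
  "('a, 'm) monoid_scheme \<Rightarrow> 'a topology \<Rightarrow> 'a set \<Rightarrow> 'a set topology" where
  "quotient_topology G T N = topology (\<lambda>\<U>. \<U> \<subseteq> rcosets\<^bsub>G\<^esub> N \<and> openin T (\<Union>\<U>))"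

text \<open>The homomorphism \<open>G/N \<rightarrow> H/M\<close> induced by a homomorphism \<open>f\<close> with \<open>f(N) \<subseteq> M\<close>.\<close>

definition induced_hom ::
  "('b, 'n) monoid_scheme \<Rightarrow> 'b set \<Rightarrow> ('a \<Rightarrow> 'b) \<Rightarrow> 'a set \<Rightarrow> 'b set" where
  "induced_hom H M f C = the_elem ((\<lambda>g. M #>\<^bsub>H\<^esub> f g) ` C)"

definition converges_to_1 ::
  "'x set \<Rightarrow> ('x \<Rightarrow> 'a) \<Rightarrow> ('a, 'm) monoid_scheme \<Rightarrow> 'a topology \<Rightarrow> bool" where
  "converges_to_1 X \<phi> G T \<longleftrightarrow> \<phi> \<in> X \<rightarrow> carrier G \<and>
     (\<forall>N. N \<lhd> G \<and> openin T N \<longrightarrow> finite {x \<in> X. \<phi> x \<notin> N})"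

text \<open>The universal property of a free profinite group, tested on the profinite groups whose
  elements have type \<open>'h\<close>.\<close>

definition free_extension_property ::
  "'h itself \<Rightarrow> ('a, 'm) monoid_scheme \<Rightarrow> 'a topology \<Rightarrow> 'a set \<Rightarrow> bool" where
  "free_extension_property _ S T X \<longleftrightarrow>
     (\<forall>(G :: 'h monoid) U \<phi>. profinite_group G U \<and> converges_to_1 X \<phi> G U \<longrightarrow>
        (\<exists>!f. f \<in> continuous_hom S T G U \<and> (\<forall>x\<in>X. f x = \<phi> x)))"

text \<open>HOL cannot quantify over all types inside a formula, so the target groups are taken in
  one large type.  A profinite group generated by the image of a map from \<open>X\<close> converging to 1 has
  at most \<open>2 ^ max |X| \<aleph>\<^sub>0\<close> elements, hence a copy in the type below; so nothing is lost.
  Lemma \<open>free_profinite_group_universal\<close> proves the property for target groups of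
  arbitrary type.\<close>

definition free_profinite_group ::
  "('a, 'm) monoid_scheme \<Rightarrow> 'a topology \<Rightarrow> 'a set \<Rightarrow> bool" where
  "free_profinite_group S T X \<longleftrightarrow> profinite_group S T \<and> X \<subseteq> carrier S \<and>
     T closure_of (generate S X) = carrier S \<and>
     converges_to_1 X (\<lambda>x. x) S T \<and>
     free_extension_property TYPE(('a + nat) set) S T X"

subsection \<open>The universal property for target groups of arbitrary type\<close>

lemma translation_continuous:
  assumes "topological_group G T" "a \<in> carrier G" "b \<in> carrier G"
  shows "continuous_map T T (\<lambda>x. a \<otimes>\<^bsub>G\<^esub> x \<otimes>\<^bsub>G\<^esub> b)"
proof -
  have top: "topspace T = carrier G"
    and m: "continuous_map (prod_topology T T) T (\<lambda>(x, y). x \<otimes>\<^bsub>G\<^esub> y)"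
    using assms(1) by (auto simp: topological_group_def)
  have "continuous_map T (prod_topology T T) (\<lambda>x. (a, x))"
    using assms top by (auto intro!: continuous_intros)
  from continuous_map_compose[OF this m] have 1: "continuous_map T T (\<lambda>x. a \<otimes>\<^bsub>G\<^esub> x)"
    by (simp add: o_def)
  have "continuous_map T (prod_topology T T) (\<lambda>x. (a \<otimes>\<^bsub>G\<^esub> x, b))"
    using assms top 1 by (auto intro!: continuous_intros)
  from continuous_map_compose[OF this m] show ?thesis
    by (simp add: o_def)
qed

lemma open_coset:
  assumes "topological_group G T" "N \<lhd> G" "openin T N" "C \<in> rcosets\<^bsub>G\<^esub> N"
  shows "openin T C"
proof -
  interpret normal N G by fact
  have top: "topspace T = carrier G" using assms(1) by (auto simp: topological_group_def)
  obtain a where a: "a \<in> carrier G" "C = N #>\<^bsub>G\<^esub> a" using assms(4) by (auto simp: RCOSETS_def)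
  have "openin T {x \<in> topspace T. \<one>\<^bsub>G\<^esub> \<otimes>\<^bsub>G\<^esub> x \<otimes>\<^bsub>G\<^esub> inv\<^bsub>G\<^esub> a \<in> N}"
    using translation_continuous[OF assms(1), of "\<one>\<^bsub>G\<^esub>" "inv\<^bsub>G\<^esub> a"] a assms(3)
    by (auto intro: openin_continuous_map_preimage)
  also have "{x \<in> topspace T. \<one>\<^bsub>G\<^esub> \<otimes>\<^bsub>G\<^esub> x \<otimes>\<^bsub>G\<^esub> inv\<^bsub>G\<^esub> a \<in> N} = C"
    unfolding a(2) top using a(1) subset by (auto simp: r_coset_def m_assoc intro!: bexI[where x = "_ \<otimes>\<^bsub>G\<^esub> inv\<^bsub>G\<^esub> a"])
  finally show ?thesis .
qed

lemma closed_coset: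
  assumes "topological_group G T" "N \<lhd> G" "openin T N" "C \<in> rcosets\<^bsub>G\<^esub> N"
  shows "closedin T C"
proof -
  interpret normal N G by fact
  have top: "topspace T = carrier G" using assms(1) by (auto simp: topological_group_def)
  have sub: "subgroup N G" by (rule subgroup_axioms)
  have "topspace T - C = \<Union>(rcosets\<^bsub>G\<^esub> N - {C})"
    using rcosets_part_G[OF sub] rcos_disjoint[OF sub] assms(4) top
    by (auto simp: pairwise_def disjnt_iff)
  then have "openin T (topspace T - C)"
    using open_coset[OF assms(1-3)] by auto
  then show ?thesis
    using assms(4) top rcosets_part_G[OF sub] by (auto simp: closedin_def)
qed

lemma finite_rcosets:
  assumes "topological_group G T" "compact_space T" "N \<lhd> G" "openin T N"
  shows "finite (rcosets\<^bsub>G\<^esub> N)"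
proof -
  interpret normal N G by fact
  have top: "topspace T = carrier G" using assms(1) by (auto simp: topological_group_def)
  have sub: "subgroup N G" by (rule subgroup_axioms)
  obtain \<F> where F: "finite \<F>" "\<F> \<subseteq> rcosets\<^bsub>G\<^esub> N" "carrier G \<subseteq> \<Union>\<F>"
    using assms(2) open_coset[OF assms(1,3,4)] rcosets_part_G[OF sub]
    unfolding compact_space_alt top by (metis order_refl)
  have "C \<in> \<F>" if C: "C \<in> rcosets\<^bsub>G\<^esub> N" for C
  proof -
    obtain a where a: "a \<in> carrier G" "C = N #>\<^bsub>G\<^esub> a" using C by (auto simp: RCOSETS_def)
    then have "a \<in> C" using rcos_self sub by auto
    moreover obtain D where "D \<in> \<F>" "a \<in> D" using F a by auto
    ultimately show ?thesis
      using rcos_disjoint[OF sub] C F(2) unfolding pairwise_def disjnt_iff by (metis subsetD)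
  qed
  then show ?thesis using F by (meson finite_subset subsetI)
qed

lemma profinite_separation:
  fixes G (structure)
  assumes prof: "profinite_group G T" and x: "x \<in> carrier G" "x \<noteq> \<one>\<^bsub>G\<^esub>"
  obtains N where "N \<lhd> G" "openin T N" "x \<notin> N"
proof -
  interpret group G using prof by (auto simp: profinite_group_def topological_group_def)
  have tg: "topological_group G T" and top: "topspace T = carrier G"
    and m: "continuous_map (prod_topology T T) T (\<lambda>(x, y). x \<otimes>\<^bsub>G\<^esub> y)"
    and comp: "compact_space T" and hd: "Hausdorff_space T"
    and td: "\<And>C. connectedin T C \<Longrightarrow> \<exists>x. C \<subseteq> {x}"
    using prof by (auto simp: profinite_group_def topological_group_def)
  have "\<not> connected_component_of T \<one> x"
  proof
    assume "connected_component_of T \<one> x"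
    then obtain C where "connectedin T C" "\<one> \<in> C" "x \<in> C"
      by (auto simp: connected_component_of_def)
    with td[of C] x show False by auto
  qed
  moreover have "quasi_component_of T \<one> = connected_component_of T \<one>"
    by (rule quasi_eq_connected_component_of) (use comp hd in auto)
  ultimately have "\<not> quasi_component_of T \<one> x" by simp
  then obtain V where V: "closedin T V" "openin T V" "\<one> \<in> V" "x \<notin> V"
    using x top unfolding quasi_component_of by auto
  define N where "N = {y \<in> carrier G. \<forall>a\<in>carrier G. \<forall>b\<in>carrier G.
    (a \<otimes> b \<in> V \<longleftrightarrow> a \<otimes> y \<otimes> b \<in> V)}"
  have iff: "a \<otimes> b \<in> V \<longleftrightarrow> a \<otimes> y \<otimes> b \<in> V"
    if "y \<in> N" "a \<in> carrier G" "b \<in> carrier G" for y a b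
    using that by (auto simp: N_def)
  have car: "y \<in> carrier G" if "y \<in> N" for y using that by (auto simp: N_def)
  have sub: "subgroup N G"
  proof (rule subgroupI)
    show "N \<subseteq> carrier G" "N \<noteq> {}" by (auto simp: N_def intro!: exI[of _ \<one>])
  next
    fix y assume y: "y \<in> N"
    have "a \<otimes> b \<in> V \<longleftrightarrow> a \<otimes> inv y \<otimes> b \<in> V" if "a \<in> carrier G" "b \<in> carrier G" for a b
      using iff[OF y, of "a \<otimes> inv y" b] that car[OF y] by (simp add: m_assoc)
    then show "inv y \<in> N" using car[OF y] by (auto simp: N_def)
  next
    fix y z assume y: "y \<in> N" and z: "z \<in> N"
    have "a \<otimes> b \<in> V \<longleftrightarrow> a \<otimes> (y \<otimes> z) \<otimes> b \<in> V" if "a \<in> carrier G" "b \<in> carrier G" for a b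
      using iff[OF z, of "a \<otimes> y" b] iff[OF y, of a b] that car[OF y] car[OF z]
      by (simp add: m_assoc)
    then show "y \<otimes> z \<in> N" using car[OF y] car[OF z] by (auto simp: N_def)
  qed
  moreover have "g \<otimes> y \<otimes> inv g \<in> N" if g: "g \<in> carrier G" and y: "y \<in> N" for g y
  proof -
    have "a \<otimes> b \<in> V \<longleftrightarrow> a \<otimes> (g \<otimes> y \<otimes> inv g) \<otimes> b \<in> V" if "a \<in> carrier G" "b \<in> carrier G" for a b
      using iff[OF y, of "a \<otimes> g" "inv g \<otimes> b"] that car[OF y] g
      by (simp add: m_assoc inv_solve_left, metis inv_closed l_one m_assoc r_inv)
    then show ?thesis using car[OF y] g by (auto simp: N_def)
  qed
  ultimately have nor: "N \<lhd> G" by (simp add: normal_inv_iff)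
  have op: "openin T N"
  proof -
    let ?P = "prod_topology (prod_topology T T) T"
    define A where "A = {u \<in> topspace ?P. fst (fst u) \<otimes> snd (fst u) \<in> V}"
    define B where "B = {u \<in> topspace ?P. fst (fst u) \<otimes> snd u \<otimes> snd (fst u) \<in> V}"
    have mult: "continuous_map ?P T (\<lambda>u. f u \<otimes> g u)"
      if "continuous_map ?P T f" "continuous_map ?P T g" for f g
    proof -
      have "continuous_map ?P (prod_topology T T) (\<lambda>u. (f u, g u))"
        using that by (auto intro!: continuous_intros)
      from continuous_map_compose[OF this m] show ?thesis by (simp add: o_def)
    qed
    have c1: "continuous_map ?P T (\<lambda>u. fst (fst u))"
      using continuous_map_compose[OF continuous_map_fst continuous_map_fst] by (simp add: o_def)
    have c2: "continuous_map ?P T (\<lambda>u. snd (fst u))"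
      using continuous_map_compose[OF continuous_map_fst continuous_map_snd] by (simp add: o_def)
    have c3: "continuous_map ?P T (\<lambda>u. snd u)"
      by (rule continuous_map_snd)
    have "openin ?P A" "closedin ?P A"
      unfolding A_def
      by (rule openin_continuous_map_preimage[OF mult[OF c1 c2] V(2)],
          rule closedin_continuous_map_preimage[OF mult[OF c1 c2] V(1)])
    moreover have "openin ?P B" "closedin ?P B"
      unfolding B_def
      by (rule openin_continuous_map_preimage[OF mult[OF mult[OF c1 c3] c2] V(2)],
          rule closedin_continuous_map_preimage[OF mult[OF mult[OF c1 c3] c2] V(1)])
    ultimately have cl: "closedin ?P ((A - B) \<union> (B - A))"
      by (intro closedin_Un closedin_diff)
    have "closed_map ?P T snd"
      by (rule closed_map_snd) (use comp in \<open>simp add: compact_space_prod_topology\<close>)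
    with cl have "closedin T (snd ` ((A - B) \<union> (B - A)))"
      by (simp add: closed_map_def)
    moreover have "snd ` ((A - B) \<union> (B - A)) = topspace T - N"
    proof (rule Set.set_eqI)
      fix y
      have "y \<in> snd ` ((A - B) \<union> (B - A)) \<longleftrightarrow>
          (\<exists>a b. ((a, b), y) \<in> (A - B) \<union> (B - A))"
        by (auto simp: image_iff Bex_def simp del: Un_iff Diff_iff)
      also have "\<dots> \<longleftrightarrow> y \<in> topspace T - N"
        by (auto simp: A_def B_def N_def top)
      finally show "y \<in> snd ` ((A - B) \<union> (B - A)) \<longleftrightarrow> y \<in> topspace T - N" .
    qed
    moreover have "N \<subseteq> topspace T" using car top by auto
    ultimately show ?thesis by (simp add: openin_closedin)
  qed
  have "x \<notin> N"
    using iff[of x \<one> \<one>] V x by auto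
  then show ?thesis using that nor op by blast
qed

lemma finite_discrete_profinite:
  assumes "group K" "finite (carrier K)"
  shows "profinite_group K (discrete_topology (carrier K))"
proof -
  interpret group K by fact
  show ?thesis
    using assms
    by (auto simp: profinite_group_def topological_group_def compact_space_discrete_topology
        connectedin_discrete_topology simp flip: prod_topology_discrete_topology)
qed


lemma finite_quotient_extension:
  fixes S :: "('a, 'm) monoid_scheme" and H :: "('h, 'n) monoid_scheme"
  assumes free: "free_profinite_group S T X" and prof: "profinite_group H U"
    and conv: "converges_to_1 X \<phi> H U" and N: "N \<lhd> H" "openin U N"
  obtains F where "F \<in> hom S (H Mod N)" "\<And>C. openin T {s \<in> carrier S. F s = C}"
    "\<And>x. x \<in> X \<Longrightarrow> F x = N #>\<^bsub>H\<^esub> \<phi> x"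
proof -
  interpret normal N H by fact
  interpret Q: group "H Mod N" by (rule factorgroup_is_group)
  let ?Q = "H Mod N"
  have tgH: "topological_group H U" and compH: "compact_space U"
    using prof by (auto simp: profinite_group_def)
  have topS: "topspace T = carrier S" and XS: "X \<subseteq> carrier S"
    using free by (auto simp: free_profinite_group_def profinite_group_def topological_group_def)
  have fin: "finite (carrier ?Q)"
    using finite_rcosets[OF tgH compH N] by (simp add: FactGroup_def)
  obtain k :: "'h set \<Rightarrow> nat" where k: "inj_on k (carrier ?Q)"
    using finite_imp_inj_to_nat_seg[OF fin] by auto
  define e :: "'h set \<Rightarrow> ('a + nat) set" where "e = (\<lambda>C. {Inr (k C)})"
  have inj: "inj_on e (carrier ?Q)" using k by (auto simp: e_def inj_on_def)
  define d where "d = inv_into (carrier ?Q) e"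
  have de: "d (e C) = C" if "C \<in> carrier ?Q" for C
    unfolding d_def using inj that by simp
  define M :: "('a + nat) set monoid"
    where "M = \<lparr>carrier = UNIV, monoid.mult = (\<lambda>x y. e (d x \<otimes>\<^bsub>?Q\<^esub> d y)), one = e \<one>\<^bsub>?Q\<^esub>\<rparr>"
  define K where "K = M \<lparr>carrier := e ` carrier ?Q, one := e \<one>\<^bsub>?Q\<^esub>\<rparr>"
  have "e \<in> hom ?Q M" by (auto simp: hom_def M_def de)
  then have grpK: "group K" unfolding K_def by (rule Q.hom_imp_img_group)
  then interpret K: group K .
  have carK: "carrier K = e ` carrier ?Q" by (simp add: K_def)
  have multK: "x \<otimes>\<^bsub>K\<^esub> y = e (d x \<otimes>\<^bsub>?Q\<^esub> d y)" for x y by (simp add: K_def M_def)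
  have oneK: "\<one>\<^bsub>K\<^esub> = e \<one>\<^bsub>?Q\<^esub>" by (simp add: K_def)
  have profK: "profinite_group K (discrete_topology (carrier K))"
    using finite_discrete_profinite[OF grpK] fin by (simp add: carK)
  have \<phi>: "\<phi> x \<in> carrier H" if "x \<in> X" for x
    using conv that by (auto simp: converges_to_1_def)
  have cos: "N #>\<^bsub>H\<^esub> \<phi> x \<in> carrier ?Q" if "x \<in> X" for x
    using \<phi>[OF that] by (auto simp: carrier_FactGroup)
  have convK: "converges_to_1 X (\<lambda>x. e (N #>\<^bsub>H\<^esub> \<phi> x)) K (discrete_topology (carrier K))"
    unfolding converges_to_1_def
  proof (intro conjI allI impI)
    show "(\<lambda>x. e (N #>\<^bsub>H\<^esub> \<phi> x)) \<in> X \<rightarrow> carrier K" using cos by (auto simp: carK)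
    fix L assume L: "L \<lhd> K \<and> openin (discrete_topology (carrier K)) L"
    then have "\<one>\<^bsub>K\<^esub> \<in> L" by (meson normal_def subgroup.one_closed)
    then have 1: "e N \<in> L" by (simp add: oneK FactGroup_def)
    have "{x \<in> X. e (N #>\<^bsub>H\<^esub> \<phi> x) \<notin> L} \<subseteq> {x \<in> X. \<phi> x \<notin> N}"
      using 1 rcos_const[OF is_group] by auto
    moreover have "finite {x \<in> X. \<phi> x \<notin> N}" using conv N by (auto simp: converges_to_1_def)
    ultimately show "finite {x \<in> X. e (N #>\<^bsub>H\<^esub> \<phi> x) \<notin> L}" by (rule finite_subset)
  qed
  have ep: "free_extension_property TYPE(('a + nat) set) S T X"
    using free by (simp add: free_profinite_group_def)
  then obtain f where f: "f \<in> continuous_hom S T K (discrete_topology (carrier K))"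
    and fx: "\<And>x. x \<in> X \<Longrightarrow> f x = e (N #>\<^bsub>H\<^esub> \<phi> x)"
    using ep[unfolded free_extension_property_def, rule_format, OF conjI[OF profK convK]] by metis
  have fhom: "f \<in> hom S K" and fcont: "continuous_map T (discrete_topology (carrier K)) f"
    using f by (auto simp: continuous_hom_def)
  have fcar: "f s \<in> e ` carrier ?Q" if "s \<in> carrier S" for s
    using fhom that by (auto simp: hom_def carK)
  define F where "F = (\<lambda>s. d (f s))"
  have "F \<in> hom S ?Q"
  proof (rule homI)
    fix s t assume s: "s \<in> carrier S" and t: "t \<in> carrier S"
    show Fs: "F s \<in> carrier ?Q" using fcar[OF s] by (auto simp: F_def de)
    have Ft: "F t \<in> carrier ?Q" using fcar[OF t] by (auto simp: F_def de)
    have "f (s \<otimes>\<^bsub>S\<^esub> t) = e (F s \<otimes>\<^bsub>?Q\<^esub> F t)"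
      using fhom s t by (simp add: hom_mult multK F_def)
    then show "F (s \<otimes>\<^bsub>S\<^esub> t) = F s \<otimes>\<^bsub>?Q\<^esub> F t"
      using Fs Ft by (simp add: F_def de del: mult_FactGroup)
  qed
  moreover have "openin T {s \<in> carrier S. F s = C}" for C
  proof -
    have "openin T {s \<in> topspace T. f s \<in> {y \<in> carrier K. d y = C}}"
      by (rule openin_continuous_map_preimage[OF fcont]) auto
    also have "{s \<in> topspace T. f s \<in> {y \<in> carrier K. d y = C}} = {s \<in> carrier S. F s = C}"
      using fcar by (auto simp: topS F_def carK)
    finally show ?thesis .
  qed
  moreover have "F x = N #>\<^bsub>H\<^esub> \<phi> x" if "x \<in> X" for x
    using fx[OF that] cos[OF that] by (simp add: F_def de)
  ultimately show ?thesis using that by blast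
qed

lemma quotient_extensions_compatible:
  assumes free: "free_profinite_group S T X" and H: "group H"
    and N: "N \<lhd> H" and M: "M \<lhd> H" and "M \<subseteq> N"
    and F: "F \<in> hom S (H Mod M)" "\<And>C. openin T {s \<in> carrier S. F s = C}"
       "\<And>x. x \<in> X \<Longrightarrow> F x = M #>\<^bsub>H\<^esub> \<phi> x"
    and E: "E \<in> hom S (H Mod N)" "\<And>C. openin T {s \<in> carrier S. E s = C}"
       "\<And>x. x \<in> X \<Longrightarrow> E x = N #>\<^bsub>H\<^esub> \<phi> x"
    and s: "s \<in> carrier S"
  shows "F s \<subseteq> E s"
proof -
  interpret S: group S
    using free by (auto simp: free_profinite_group_def profinite_group_def topological_group_def)
  have topS: "topspace T = carrier S" and XS: "X \<subseteq> carrier S"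
    and dense: "T closure_of (generate S X) = carrier S"
    using free by (auto simp: free_profinite_group_def profinite_group_def topological_group_def)
  interpret N: normal N H by fact
  interpret M: normal M H by fact
  interpret Fh: group_hom S "H Mod M" F
    using F(1) M.factorgroup_is_group by (simp add: group_hom_def group_hom_axioms_def S.is_group)
  interpret Eh: group_hom S "H Mod N" E
    using E(1) N.factorgroup_is_group by (simp add: group_hom_def group_hom_axioms_def S.is_group)
  have gen: "F t \<subseteq> E t" if "t \<in> generate S X" for t
    using that
  proof (induction rule: generate.induct)
    case one
    then show ?case using Fh.hom_one Eh.hom_one \<open>M \<subseteq> N\<close> by (simp add: FactGroup_def)
  next
    case (incl h)
    then show ?case using F(3) E(3) \<open>M \<subseteq> N\<close> by (auto simp: r_coset_def)
  next
    case (inv h)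
    then have h: "h \<in> carrier S" using XS by auto
    have "F h \<subseteq> E h" using inv F(3) E(3) \<open>M \<subseteq> N\<close> by (auto simp: r_coset_def)
    moreover have "F (inv\<^bsub>S\<^esub> h) = set_inv\<^bsub>H\<^esub> (F h)" "E (inv\<^bsub>S\<^esub> h) = set_inv\<^bsub>H\<^esub> (E h)"
      using M.inv_FactGroup[OF Fh.hom_closed[OF h]] N.inv_FactGroup[OF Eh.hom_closed[OF h]]
        Fh.hom_inv[OF h] Eh.hom_inv[OF h] by auto
    ultimately show ?case by (auto simp: SET_INV_def)
  next
    case (eng h1 h2)
    then have "h1 \<in> carrier S" "h2 \<in> carrier S" using S.generate_incl[OF XS] by auto
    then have "F (h1 \<otimes>\<^bsub>S\<^esub> h2) = F h1 <#>\<^bsub>H\<^esub> F h2" "E (h1 \<otimes>\<^bsub>S\<^esub> h2) = E h1 <#>\<^bsub>H\<^esub> E h2"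
      using Fh.hom_mult Eh.hom_mult by (auto simp: FactGroup_def)
    moreover have "A <#>\<^bsub>H\<^esub> B \<subseteq> A' <#>\<^bsub>H\<^esub> B'" if "A \<subseteq> A'" "B \<subseteq> B'" for A A' B B'
      using that by (auto simp: set_mult_def)
    ultimately show ?case using eng.IH by simp
  qed
  have "openin T (\<Union>(C, D) \<in> {(C, D). \<not> C \<subseteq> D}. {s \<in> carrier S. F s = C} \<inter> {s \<in> carrier S. E s = D})"
    using F(2) E(2) by (intro openin_Union) auto
  also have "(\<Union>(C, D) \<in> {(C, D). \<not> C \<subseteq> D}. {s \<in> carrier S. F s = C} \<inter> {s \<in> carrier S. E s = D})
      = topspace T - {s \<in> topspace T. F s \<subseteq> E s}"
    by (auto simp: topS)
  finally have "closedin T {s \<in> topspace T. F s \<subseteq> E s}"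
    by (auto simp: closedin_def)
  then show ?thesis
    using forall_in_closure_of[of s T "generate S X" "\<lambda>s. F s \<subseteq> E s"] gen s dense by auto
qed

theorem free_profinite_group_universal:
  fixes S :: "('a, 'm) monoid_scheme"
  assumes free: "free_profinite_group S T X"
  shows "free_extension_property TYPE('h) S T X"
  unfolding free_extension_property_def
proof (intro allI impI)
  fix H :: "'h monoid" and U \<phi>
  assume A: "profinite_group H U \<and> converges_to_1 X \<phi> H U"
  then have prof: "profinite_group H U" and conv: "converges_to_1 X \<phi> H U" by auto
  have tgH: "topological_group H U" and topH: "topspace U = carrier H" and compH: "compact_space U"
    and hdH: "Hausdorff_space U"
    using prof by (auto simp: profinite_group_def topological_group_def)
  interpret H: group H using tgH by (auto simp: topological_group_def)
  interpret S: group S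
    using free by (auto simp: free_profinite_group_def profinite_group_def topological_group_def)
  have topS: "topspace T = carrier S" and XS: "X \<subseteq> carrier S"
    and dense: "T closure_of (generate S X) = carrier S"
    using free by (auto simp: free_profinite_group_def profinite_group_def topological_group_def)
  define \<N> where "\<N> = {N. N \<lhd> H \<and> openin U N}"
  define ext where "ext = (\<lambda>N F. F \<in> hom S (H Mod N) \<and>
    (\<forall>C. openin T {s \<in> carrier S. F s = C}) \<and> (\<forall>x\<in>X. F x = N #>\<^bsub>H\<^esub> \<phi> x))"
  have "\<forall>N\<in>\<N>. \<exists>F. ext N F"
  proof
    fix N assume "N \<in> \<N>"
    then have "N \<lhd> H" "openin U N" by (auto simp: \<N>_def)
    from finite_quotient_extension[OF free prof conv this] show "\<exists>F. ext N F"
      unfolding ext_def by metis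
  qed
  then obtain F where F: "\<And>N. N \<in> \<N> \<Longrightarrow> ext N (F N)" by metis
  have compat: "F M s \<subseteq> F N s" if "M \<in> \<N>" "N \<in> \<N>" "M \<subseteq> N" "s \<in> carrier S" for M N s
    using quotient_extensions_compatible[OF free H.is_group, of N M "F M" \<phi> "F N" s]
      F[OF that(1)] F[OF that(2)] that by (auto simp: ext_def \<N>_def)
  have cosF: "F N s \<in> rcosets\<^bsub>H\<^esub> N" if "N \<in> \<N>" "s \<in> carrier S" for N s
    using F[OF that(1)] that(2) by (auto simp: ext_def hom_def FactGroup_def)
  have inN: "carrier H \<in> \<N>"
    using H.subgroup_self openin_topspace[of U] by (auto simp: \<N>_def H.normal_inv_iff topH)
  have int: "\<Inter>\<F> \<in> \<N>" if "finite \<F>" "\<F> \<noteq> {}" "\<F> \<subseteq> \<N>" for \<F>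
    using that
  proof (induction rule: finite_ne_induct)
    case (insert N \<F>)
    then have "N \<inter> \<Inter>\<F> \<in> \<N>"
      using H.normal_subgroup_intersect[of N "\<Inter>\<F>"] by (auto simp: \<N>_def)
    then show ?case by simp
  qed auto
  have ne: "F N s \<noteq> {}" if "N \<in> \<N>" "s \<in> carrier S" for N s
    using cosF[OF that] that(1) H.rcos_self by (fastforce simp: \<N>_def RCOSETS_def normal_def)
  have key: "(\<Inter>N\<in>\<N>. F N s) \<inter> Z \<noteq> {}"
    if s: "s \<in> carrier S" and Z: "closedin U Z" and meets: "\<And>N. N \<in> \<N> \<Longrightarrow> F N s \<inter> Z \<noteq> {}" for s Z
  proof -
    have clo: "\<forall>C\<in>(\<lambda>N. F N s \<inter> Z) ` \<N>. closedin U C"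
      using closed_coset[OF tgH] cosF s Z by (auto simp: \<N>_def intro!: closedin_Int)
    have fip: "\<Inter>((\<lambda>N. F N s \<inter> Z) ` \<F>) \<noteq> {}" if \<F>: "finite \<F>" "\<F> \<subseteq> \<N>" for \<F>
    proof (cases "\<F> = {}")
      case False
      have M: "\<Inter>\<F> \<in> \<N>" using int \<F> False by auto
      have "F (\<Inter>\<F>) s \<inter> Z \<subseteq> \<Inter>((\<lambda>N. F N s \<inter> Z) ` \<F>)"
        using compat[OF M _ _ s] \<F> by blast
      then show ?thesis using meets[OF M] by (metis subset_empty)
    qed auto
    have "\<Inter>((\<lambda>N. F N s \<inter> Z) ` \<N>) \<noteq> {}"
      using compH[unfolded compact_space_fip, rule_format, of "(\<lambda>N. F N s \<inter> Z) ` \<N>"] clo fip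
      by (metis (no_types, lifting) finite_subset_image)
    moreover have "\<N> \<noteq> {}" using inN by auto
    ultimately show ?thesis by simp
  qed
  have uniq: "h = h'" if h: "\<And>N. N \<in> \<N> \<Longrightarrow> h \<in> F N s" "\<And>N. N \<in> \<N> \<Longrightarrow> h' \<in> F N s"
    and s: "s \<in> carrier S" for h h' s
  proof (rule ccontr)
    assume "h \<noteq> h'"
    have car: "h \<in> carrier H" "h' \<in> carrier H"
      using h[OF inN] cosF[OF inN s] H.rcosets_part_G[OF H.subgroup_self] by auto
    have "h \<otimes>\<^bsub>H\<^esub> inv\<^bsub>H\<^esub> h' \<noteq> \<one>\<^bsub>H\<^esub>"
      using \<open>h \<noteq> h'\<close> car by (metis H.inv_equality H.inv_inv H.inv_closed)
    then obtain N where N: "N \<lhd> H" "openin U N" "h \<otimes>\<^bsub>H\<^esub> inv\<^bsub>H\<^esub> h' \<notin> N"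
      using profinite_separation[OF prof] car by (metis H.inv_closed H.m_closed)
    then have "N \<in> \<N>" by (auto simp: \<N>_def)
    interpret N: normal N H by fact
    obtain a where a: "a \<in> carrier H" "F N s = N #>\<^bsub>H\<^esub> a"
      using cosF[OF \<open>N \<in> \<N>\<close> s] by (auto simp: RCOSETS_def)
    have "N #>\<^bsub>H\<^esub> h' = N #>\<^bsub>H\<^esub> a" "N #>\<^bsub>H\<^esub> h = N #>\<^bsub>H\<^esub> a"
      using h[OF \<open>N \<in> \<N>\<close>] a H.repr_independence[OF _ a(1) N.subgroup_axioms] by auto
    then have "h \<in> N #>\<^bsub>H\<^esub> h'" using H.rcos_self[OF car(1) N.subgroup_axioms] by simp
    then have "h \<otimes>\<^bsub>H\<^esub> inv\<^bsub>H\<^esub> h' \<in> N"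
      using car by (auto simp: r_coset_def H.m_assoc N.subset[THEN subsetD])
    with N show False by simp
  qed
  have "\<exists>h. \<forall>N\<in>\<N>. h \<in> F N s" if s: "s \<in> carrier S" for s
  proof -
    have "F N s \<inter> topspace U \<noteq> {}" if N: "N \<in> \<N>" for N
    proof -
      have "closedin U (F N s)"
        using closed_coset[OF tgH _ _ cosF[OF N s]] N by (simp add: \<N>_def)
      then have "F N s \<subseteq> topspace U" by (rule closedin_subset)
      with ne[OF N s] show ?thesis by (metis inf.absorb1)
    qed
    from key[OF s closedin_topspace this] show ?thesis by blast
  qed
  then obtain f0 where f0: "\<And>s N. s \<in> carrier S \<Longrightarrow> N \<in> \<N> \<Longrightarrow> f0 s \<in> F N s" by metis
  define f where "f = restrict f0 (carrier S)"
  have f: "f s \<in> F N s" if "s \<in> carrier S" "N \<in> \<N>" for s N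
    using f0 that by (simp add: f_def)
  have fcar: "f s \<in> carrier H" if "s \<in> carrier S" for s
    using f[OF that inN] cosF[OF inN that] H.rcosets_part_G[OF H.subgroup_self] by auto
  have fhom: "f \<in> hom S H"
  proof (rule homI)
    fix s t assume st: "s \<in> carrier S" "t \<in> carrier S"
    then have st': "s \<otimes>\<^bsub>S\<^esub> t \<in> carrier S" by simp
    have "f s \<otimes>\<^bsub>H\<^esub> f t \<in> F N (s \<otimes>\<^bsub>S\<^esub> t)" if "N \<in> \<N>" for N
    proof -
      have "F N (s \<otimes>\<^bsub>S\<^esub> t) = F N s <#>\<^bsub>H\<^esub> F N t"
        using F[OF that] st by (auto simp: ext_def hom_def FactGroup_def)
      then show ?thesis using f[OF st(1) that] f[OF st(2) that] by (auto simp: set_mult_def)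
    qed
    then show "f (s \<otimes>\<^bsub>S\<^esub> t) = f s \<otimes>\<^bsub>H\<^esub> f t"
      using uniq[OF _ _ st'] f[OF st'] by blast
  qed (rule fcar)
  have fX: "f x = \<phi> x" if "x \<in> X" for x
  proof -
    have x: "x \<in> carrier S" "\<phi> x \<in> carrier H" using that XS conv by (auto simp: converges_to_1_def)
    have "\<phi> x \<in> F N x" if "N \<in> \<N>" for N
      using F[OF that] \<open>x \<in> X\<close> H.rcos_self[OF x(2)] that by (auto simp: ext_def \<N>_def normal_def)
    then show ?thesis using uniq[OF _ _ x(1)] f[OF x(1)] by blast
  qed
  have fcont: "continuous_map T U f"
    unfolding continuous_map_closedin
  proof (intro conjI allI impI)
    show "f \<in> topspace T \<rightarrow> topspace U" using fcar by (auto simp: topS topH)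
    fix Z assume Z: "closedin U Z"
    have "f s \<in> Z" if s: "s \<in> carrier S" and m: "\<forall>N\<in>\<N>. F N s \<inter> Z \<noteq> {}" for s
    proof -
      obtain h where "h \<in> Z" "\<And>N. N \<in> \<N> \<Longrightarrow> h \<in> F N s" using key[OF s Z] m by blast
      then show ?thesis using uniq[OF _ _ s] f[OF s] by metis
    qed
    then have eq: "{s \<in> topspace T. f s \<in> Z} = (\<Inter>N\<in>\<N>. {s \<in> topspace T. F N s \<inter> Z \<noteq> {}})"
      using f inN by (auto simp: topS)
    have "closedin T {s \<in> topspace T. F N s \<inter> Z \<noteq> {}}" if "N \<in> \<N>" for N
    proof -
      have "openin T (\<Union>C \<in> {C. C \<inter> Z = {}}. {s \<in> carrier S. F N s = C})"
        using F[OF that] by (intro openin_Union) (auto simp: ext_def)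
      also have "(\<Union>C \<in> {C. C \<inter> Z = {}}. {s \<in> carrier S. F N s = C})
          = topspace T - {s \<in> topspace T. F N s \<inter> Z \<noteq> {}}" by (auto simp: topS)
      finally show ?thesis by (auto simp: closedin_def)
    qed
    then show "closedin T {s \<in> topspace T. f s \<in> Z}"
      unfolding eq using inN by (intro closedin_Inter) auto
  qed
  show "\<exists>!f. f \<in> continuous_hom S T H U \<and> (\<forall>x\<in>X. f x = \<phi> x)"
  proof (rule ex1I[of _ f])
    show "f \<in> continuous_hom S T H U \<and> (\<forall>x\<in>X. f x = \<phi> x)"
      using fhom fcont fX by (auto simp: continuous_hom_def f_def)
  next
    fix g assume g: "g \<in> continuous_hom S T H U \<and> (\<forall>x\<in>X. g x = \<phi> x)"
    then have ghom: "g \<in> hom S H" and gcont: "continuous_map T U g"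
      and gext: "g \<in> extensional (carrier S)" and gX: "\<And>x. x \<in> X \<Longrightarrow> g x = \<phi> x"
      by (auto simp: continuous_hom_def)
    interpret f: group_hom S H f
      using fhom by (simp add: group_hom_def group_hom_axioms_def S.is_group H.is_group)
    interpret g: group_hom S H g
      using ghom by (simp add: group_hom_def group_hom_axioms_def S.is_group H.is_group)
    have "g t = f t" if "t \<in> generate S X" for t
      using that
    proof (induction rule: generate.induct)
      case (inv h)
      then have "h \<in> carrier S" using XS by auto
      with inv show ?case using fX gX by simp
    next
      case (eng h1 h2)
      then have "h1 \<in> carrier S" "h2 \<in> carrier S" using S.generate_incl[OF XS] by auto
      with eng show ?case by simp
    qed (use fX gX in auto)
    then have "g s = f s" if "s \<in> carrier S" for s
      using forall_in_closure_of_eq[OF _ hdH gcont fcont, of s "generate S X"] dense that by auto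
    then show "g = f"
      using gext by (auto simp: f_def intro!: extensionalityI[of _ "carrier S"])
  qed
qed

subsection \<open>The lower \<open>p\<close>-central filtration\<close>

text \<open>Index 0 is a dummy: the filtration starts at index 1.\<close>

fun lower_p_central :: "nat \<Rightarrow> ('a, 'm) monoid_scheme \<Rightarrow> 'a topology \<Rightarrow> nat \<Rightarrow> 'a set" where
  "lower_p_central p G T 0 = carrier G"
| "lower_p_central p G T (Suc 0) = carrier G"
| "lower_p_central p G T (Suc (Suc n)) = T closure_of (generate G
     ({h [^]\<^bsub>G\<^esub> p | h. h \<in> lower_p_central p G T (Suc n)} \<union>
      {inv\<^bsub>G\<^esub> g \<otimes>\<^bsub>G\<^esub> inv\<^bsub>G\<^esub> h \<otimes>\<^bsub>G\<^esub> g \<otimes>\<^bsub>G\<^esub> h | g h.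
         g \<in> carrier G \<and> h \<in> lower_p_central p G T (Suc n)}))"

section \<open>Continuous cohomology in degree 2 with coefficients \<open>\<int>/p\<close>\<close>

text \<open>The coefficients are \<open>residue_ring p\<close>, that is \<open>{0..p - 1}\<close> with arithmetic modulo \<open>p\<close>,
  with trivial action; cochains are inhomogeneous.\<close>

definition cocycles2 ::
  "nat \<Rightarrow> ('a, 'm) monoid_scheme \<Rightarrow> 'a topology \<Rightarrow> (int, 'a \<times> 'a \<Rightarrow> int) module" where
  "cocycles2 p G T =
     \<lparr>carrier = {f \<in> extensional (carrier G \<times> carrier G).
        continuous_map (prod_topology T T) (discrete_topology {0..int p - 1}) f \<and>
        (\<forall>a\<in>carrier G. \<forall>b\<in>carrier G. \<forall>c\<in>carrier G.
           (f (b, c) - f (a \<otimes>\<^bsub>G\<^esub> b, c) + f (a, b \<otimes>\<^bsub>G\<^esub> c) - f (a, b)) mod int p = 0)},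
      monoid.mult = undefined, one = undefined,
      zero = \<lambda>_ \<in> carrier G \<times> carrier G. 0,
      add = \<lambda>f g. \<lambda>x \<in> carrier G \<times> carrier G. (f x + g x) mod int p,
      smult = \<lambda>k f. \<lambda>x \<in> carrier G \<times> carrier G. (k * f x) mod int p\<rparr>"

definition coboundaries2 ::
  "nat \<Rightarrow> ('a, 'm) monoid_scheme \<Rightarrow> 'a topology \<Rightarrow> ('a \<times> 'a \<Rightarrow> int) set" where
  "coboundaries2 p G T =
     {\<lambda>(a, b) \<in> carrier G \<times> carrier G. (u b - u (a \<otimes>\<^bsub>G\<^esub> b) + u a) mod int p | u.
        continuous_map T (discrete_topology {0..int p - 1}) u}"

definition quotient_module :: "('r, 'a, 'm) module_scheme \<Rightarrow> 'a set \<Rightarrow> ('r, 'a set) module" where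
  "quotient_module M B =
     \<lparr>carrier = a_rcosets\<^bsub>M\<^esub> B, monoid.mult = undefined, one = undefined, zero = B,
      add = \<lambda>C D. C <+>\<^bsub>M\<^esub> D, smult = \<lambda>k C. \<Union>f\<in>C. B +>\<^bsub>M\<^esub> (k \<odot>\<^bsub>M\<^esub> f)\<rparr>"

definition H2 ::
  "nat \<Rightarrow> ('a, 'm) monoid_scheme \<Rightarrow> 'a topology \<Rightarrow> (int, ('a \<times> 'a \<Rightarrow> int) set) module" where
  "H2 p G T = quotient_module (cocycles2 p G T) (coboundaries2 p G T)"

definition class2 ::
  "nat \<Rightarrow> ('a, 'm) monoid_scheme \<Rightarrow> 'a topology \<Rightarrow> ('a \<times> 'a \<Rightarrow> int) \<Rightarrow> ('a \<times> 'a \<Rightarrow> int) set" where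
  "class2 p G T f = coboundaries2 p G T +>\<^bsub>cocycles2 p G T\<^esub> f"

definition pullback2 ::
  "nat \<Rightarrow> ('a, 'm) monoid_scheme \<Rightarrow> 'a topology \<Rightarrow> ('a \<Rightarrow> 'b)
     \<Rightarrow> ('b \<times> 'b \<Rightarrow> int) set \<Rightarrow> ('a \<times> 'a \<Rightarrow> int) set" where
  "pullback2 p G T \<phi> C =
     the_elem ((\<lambda>f. class2 p G T (\<lambda>(a, b) \<in> carrier G \<times> carrier G. f (\<phi> a, \<phi> b))) ` C)"

text \<open>Factor sets of the central extension \<open>0 \<rightarrow> \<int>/p \<rightarrow> E \<rightarrow> E/N \<rightarrow> 1\<close> with
  \<open>\<iota> : \<int>/p \<cong> N\<close>.  As the elements of \<open>E/N\<close> are cosets, a section \<open>s\<close> of the projection is a map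
  with \<open>s c \<in> c\<close>.\<close>

definition factor_sets ::
  "nat \<Rightarrow> ('e, 'm) monoid_scheme \<Rightarrow> 'e topology \<Rightarrow> 'e set \<Rightarrow> (int \<Rightarrow> 'e) \<Rightarrow> ('e set \<times> 'e set \<Rightarrow> int) set" where
  "factor_sets p E T N \<iota> = {f \<in> carrier (cocycles2 p (E Mod N) (quotient_topology E T N)).
     \<exists>s. continuous_map (quotient_topology E T N) T s \<and>
       (\<forall>c\<in>carrier (E Mod N). s c \<in> c) \<and>
       (\<forall>c\<in>carrier (E Mod N). \<forall>d\<in>carrier (E Mod N).
          s c \<otimes>\<^bsub>E\<^esub> s d = \<iota> (f (c, d)) \<otimes>\<^bsub>E\<^esub> s (c \<otimes>\<^bsub>E Mod N\<^esub> d))}"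

text \<open>All factor sets of an extension lie in a single class.\<close>

definition extension_class ::
  "nat \<Rightarrow> ('e, 'm) monoid_scheme \<Rightarrow> 'e topology \<Rightarrow> 'e set \<Rightarrow> (int \<Rightarrow> 'e) \<Rightarrow> ('e set \<times> 'e set \<Rightarrow> int) set" where
  "extension_class p E T N \<iota> =
     the_elem (class2 p (E Mod N) (quotient_topology E T N) ` factor_sets p E T N \<iota>)"

section \<open>The Magnus homomorphism\<close>

text \<open>Formal power series over \<open>\<int>/m = {0..m - 1}\<close> in non-commuting variables from \<open>X\<close>,
  as coefficient functions on the words \<open>lists X\<close>.\<close>

definition nc_series :: "int \<Rightarrow> 'x set \<Rightarrow> ('x list \<Rightarrow> int) ring" where
  "nc_series m X =
     \<lparr>carrier = lists X \<rightarrow>\<^sub>E {0..m - 1},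
      monoid.mult = \<lambda>f g. \<lambda>w \<in> lists X. (\<Sum>i\<le>length w. f (take i w) * g (drop i w)) mod m,
      one = \<lambda>w \<in> lists X. if w = [] then 1 else 0,
      zero = \<lambda>w \<in> lists X. 0,
      add = \<lambda>f g. \<lambda>w \<in> lists X. (f w + g w) mod m\<rparr>"

definition nc_var :: "'x set \<Rightarrow> 'x \<Rightarrow> 'x list \<Rightarrow> int" where
  "nc_var X x = (\<lambda>w \<in> lists X. if w = [x] then 1 else 0)"

definition nc_series_topology :: "int \<Rightarrow> 'x set \<Rightarrow> ('x list \<Rightarrow> int) topology" where
  "nc_series_topology m X = product_topology (\<lambda>_. discrete_topology {0..m - 1}) (lists X)"

definition magnus ::
  "int \<Rightarrow> ('a, 'm) monoid_scheme \<Rightarrow> 'a topology \<Rightarrow> 'a set \<Rightarrow> 'a \<Rightarrow> 'a list \<Rightarrow> int" where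
  "magnus m S T X = (THE \<Lambda>.
     \<Lambda> \<in> continuous_hom S T (units_of (nc_series m X))
       (subtopology (nc_series_topology m X) (Units (nc_series m X))) \<and>
     (\<forall>x\<in>X. \<Lambda> x = \<one>\<^bsub>nc_series m X\<^esub> \<oplus>\<^bsub>nc_series m X\<^esub> nc_var X x))"

definition magnus_coeff ::
  "('a, 'm) monoid_scheme \<Rightarrow> 'a topology \<Rightarrow> 'a set \<Rightarrow> 'a list \<Rightarrow> int \<Rightarrow> 'a \<Rightarrow> int" where
  "magnus_coeff S T X w m \<sigma> = magnus m S T X \<sigma> w"

section \<open>Unipotent matrices\<close>

text \<open>Matrices over \<open>\<int>/m\<close> have entries in \<open>{0..m - 1}\<close>, and their rows and columns are
  numbered from 0.\<close>

definition unitriangular :: "nat \<Rightarrow> int \<Rightarrow> int mat monoid" where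
  "unitriangular d m =
     \<lparr>carrier = {A \<in> carrier_mat d d. elements_mat A \<subseteq> {0..m - 1} \<and>
        upper_triangular A \<and> (\<forall>i<d. A $$ (i, i) = 1)},
      monoid.mult = \<lambda>A B. map_mat (\<lambda>a. a mod m) (A * B),
      one = 1\<^sub>m d\<rparr>"

definition UU :: "nat \<Rightarrow> nat \<Rightarrow> nat \<Rightarrow> int mat monoid" where
  "UU p n s = unitriangular (s + 1) (int p ^ (n - s + 1))"

abbreviation UU_topology :: "nat \<Rightarrow> nat \<Rightarrow> nat \<Rightarrow> int mat topology" where
  "UU_topology p n s \<equiv> discrete_topology (carrier (UU p n s))"

definition UU_filt :: "nat \<Rightarrow> nat \<Rightarrow> nat \<Rightarrow> int mat set" where
  "UU_filt p n s = lower_p_central p (UU p n s) (UU_topology p n s) n"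

definition corner :: "nat \<Rightarrow> nat \<Rightarrow> nat \<Rightarrow> int \<Rightarrow> int mat" where
  "corner p n s a = mat (s + 1) (s + 1)
     (\<lambda>(i, j). if i = j then 1 else if i = 0 \<and> j = s then a * int p ^ (n - s) else 0)"

definition gamma :: "nat \<Rightarrow> nat \<Rightarrow> nat \<Rightarrow> (int mat set \<times> int mat set \<Rightarrow> int) set" where
  "gamma p n s = extension_class p (UU p n s) (UU_topology p n s) (UU_filt p n s) (corner p n s)"

section \<open>The classes of Lyndon words\<close>

definition alp_le :: "'x rel \<Rightarrow> 'x list \<Rightarrow> 'x list \<Rightarrow> bool" where
  "alp_le r w\<^sub>1 w\<^sub>2 \<longleftrightarrow> (\<exists>v. w\<^sub>2 = w\<^sub>1 @ v) \<or>
     (\<exists>v x\<^sub>1 u\<^sub>1 x\<^sub>2 u\<^sub>2. w\<^sub>1 = v @ x\<^sub>1 # u\<^sub>1 \<and> w\<^sub>2 = v @ x\<^sub>2 # u\<^sub>2 \<and> (x\<^sub>1, x\<^sub>2) \<in> r \<and> x\<^sub>1 \<noteq> x\<^sub>2)"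

definition lyndon :: "'x rel \<Rightarrow> 'x list \<Rightarrow> bool" where
  "lyndon r w \<longleftrightarrow> w \<noteq> [] \<and>
     (\<forall>u v. w = u @ v \<and> u \<noteq> [] \<and> v \<noteq> [] \<longrightarrow> alp_le r w v \<and> w \<noteq> v)"

definition lyndon_words :: "'x set \<Rightarrow> 'x rel \<Rightarrow> nat \<Rightarrow> 'x list set" where
  "lyndon_words X r n = {w \<in> lists X. lyndon r w \<and> 1 \<le> length w \<and> length w \<le> n}"

text \<open>With entries numbered from 0, the subword \<open>x\<^sub>i \<dots> x\<^bsub>j-1\<^esub>\<close> of \<open>w = x\<^sub>1 \<dots> x\<^sub>s\<close> at the entry
  \<open>(i, j)\<close> becomes \<open>take (j - i) (drop i w)\<close>.\<close>

definition rho ::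
  "nat \<Rightarrow> ('a, 'm) monoid_scheme \<Rightarrow> 'a topology \<Rightarrow> 'a set \<Rightarrow> nat \<Rightarrow> 'a list \<Rightarrow> 'a \<Rightarrow> int mat" where
  "rho p S T X n w \<sigma> = (let s = length w in mat (s + 1) (s + 1)
     (\<lambda>(i, j). if i < j then magnus_coeff S T X (take (j - i) (drop i w)) (int p ^ (n - s + 1)) \<sigma>
               else if i = j then 1 else 0))"

definition rho_bar ::
  "nat \<Rightarrow> ('a, 'm) monoid_scheme \<Rightarrow> 'a topology \<Rightarrow> 'a set \<Rightarrow> nat \<Rightarrow> 'a list \<Rightarrow> 'a set \<Rightarrow> int mat set" where
  "rho_bar p S T X n w =
     induced_hom (UU p n (length w)) (UU_filt p n (length w)) (rho p S T X n w)"

definition p_quotient ::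
  "nat \<Rightarrow> ('a, 'm) monoid_scheme \<Rightarrow> 'a topology \<Rightarrow> nat \<Rightarrow> 'a set monoid" where
  "p_quotient p S T n = S Mod lower_p_central p S T n"

definition p_quotient_topology ::
  "nat \<Rightarrow> ('a, 'm) monoid_scheme \<Rightarrow> 'a topology \<Rightarrow> nat \<Rightarrow> 'a set topology" where
  "p_quotient_topology p S T n = quotient_topology S T (lower_p_central p S T n)"

definition alpha ::
  "nat \<Rightarrow> ('a, 'm) monoid_scheme \<Rightarrow> 'a topology \<Rightarrow> 'a set \<Rightarrow> nat \<Rightarrow> 'a list
     \<Rightarrow> ('a set \<times> 'a set \<Rightarrow> int) set" where
  "alpha p S T X n w =
     pullback2 p (p_quotient p S T n) (p_quotient_topology p S T n)
       (rho_bar p S T X n w) (gamma p n (length w))"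

end

theory Submission
  imports Defs
begin

text \<open>
  A class in \<open>H\<^sup>2\<close> of \<open>Q = S/S\<^sup>(\<^sup>n\<^sup>,\<^sup>p\<^sup>)\<close>, represented by a cocycle \<open>c\<close>, becomes trivial on the free group
  \<open>S\<close>: it is the coboundary of some locally constant \<open>u\<close>. On \<open>S\<^sup>(\<^sup>n\<^sup>,\<^sup>p\<^sup>)\<close> the map \<open>h \<mapsto> u h - u 1\<close> is
  an invariant homomorphism to \<open>\<int>/p\<close> (the transgression), and it determines the class.

  Modulo \<open>S\<^sup>(\<^sup>n\<^sup>+\<^sup>1\<^sup>,\<^sup>p\<^sup>)\<close> the group \<open>S\<^sup>(\<^sup>n\<^sup>,\<^sup>p\<^sup>)\<close> is topologically generated by the elements
  \<open>\<tau>\<^sub>w ^ (p ^ (n - |w|))\<close>, where \<open>w\<close> runs through the Lyndon words of length at most \<open>n\<close> and \<open>\<tau>\<^sub>w\<close> is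
  the iterated commutator that follows the standard factorization of \<open>w\<close>. So a class is determined by
  the values of its transgression at these elements, almost all of which vanish.
  The transgression of \<open>\<alpha>\<^sub>w\<close> is minus the Magnus coefficient at \<open>w\<close> divided by \<open>p ^ (n - |w|)\<close>, and
  the Magnus expansion of \<open>\<tau>\<^sub>u\<close> is \<open>1 + u\<close> plus terms that are longer than \<open>u\<close>, or of the same length
  and alphabetically larger. Hence the matrix of values is triangular with invertible diagonal for
  the order by length and then alphabetically, restricted to words with letters in a common finite set.
\<close>

section \<open>Lyndon words\<close>

text \<open>As \<open>X\<close> may be infinite, no count of dimensions is available: spanning comes
  from generation of the filtration term, independence from triangularity. Expressing a class by
  finitely many \<open>alpha\<close> requires that a word has only finitely many predecessors.
  Therefore the order also asks that the letters of the smaller word occur in the larger one; this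
  is compatible with the Magnus coefficients, because setting a letter to zero trivializes every
  commutator that contains it. The generation statement quantifies over all closed subgroups
  \<open>K\<close> that contain the next filtration term. So the induction can be applied to sets
  such as the \<open>h\<close> with \<open>[g, h]\<close> in \<open>K\<close>, and multilinear
  calculations become statements that certain sets are subgroups. In the lowest degree p-th powers
  are not additive modulo \<open>K\<close> for reasons of weight alone, so the passage from the
  second to the third term treats brackets of two letters by hand. The division by p^(n - |w|)
  reflects the top right entry of a unitriangular matrix modulo p^(n - |w| + 1), the only entry
  above the diagonal that survives in the n-th filtration term.\<close>

locale ordered_alphabet =
  fixes X :: "'x set" and r :: "'x rel"
  assumes lin: "linear_order_on X r"
begin

section \<open>The alphabetical order as a strict lexicographic order\<close>

abbreviation rs :: "'x rel" where "rs \<equiv> r - Id"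
abbreviation lt :: "'x list \<Rightarrow> 'x list \<Rightarrow> bool" where "lt u v \<equiv> (u, v) \<in> lexord rs"

lemma trans_rs: "trans rs" and irrefl_rs: "irrefl rs"
  using lin by (auto simp: linear_order_on_def partial_order_on_def preorder_on_def trans_diff_Id irrefl_def)

lemma lt_trans: "lt u v \<Longrightarrow> lt v w \<Longrightarrow> lt u w"
  by (rule lexord_trans[OF _ _ trans_rs])

lemma lt_irrefl: "\<not> lt u u"
  by (rule lexord_irreflexive) auto

lemma lt_linear: "u \<in> lists X \<Longrightarrow> v \<in> lists X \<Longrightarrow> lt u v \<or> u = v \<or> lt v u"
proof (induction u arbitrary: v)
  case Nil
  then show ?case by (cases v) auto
next
  case (Cons a u)
  show ?case
  proof (cases v)
    case (Cons b v')
    with Cons.prems Cons.IH[of v'] lin show ?thesis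
      by (auto simp: linear_order_on_def total_on_def)
  qed simp
qed

lemma lt_append_same: "lt (u @ v) (u @ w) \<longleftrightarrow> lt v w"
  by (rule lexord_same_pref_if_irrefl[OF irrefl_rs])

lemma lt_append_length: "lt u v \<Longrightarrow> length v \<le> length u \<Longrightarrow> lt (u @ a) (v @ b)"
  by (rule lexord_sufI)

lemma lt_append_right: "lt u v \<Longrightarrow> lt u (v @ w)"
  by (auto simp: lexord_def) blast

lemma lt_self_append: "v \<noteq> [] \<Longrightarrow> lt u (u @ v)"
  by (rule lexord_append_rightI) (cases v, auto)

text \<open>A word precedes another one either as a proper prefix or through a smaller letter at the
  first difference. Only in the second case does the inequality survive arbitrary continuations of
  both words; the proofs about Lyndon words branch on this.\<close>

lemma lt_append_cases:
  assumes "lt u v"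
  shows "(\<exists>z. z \<noteq> [] \<and> v = u @ z) \<or> (\<forall>a b. lt (u @ a) (v @ b))"
proof -
  consider a z where "v = u @ a # z" | y a b s t where "(a, b) \<in> rs" "u = y @ a # s" "v = y @ b # t"
    using assms unfolding lexord_def by blast
  then show ?thesis
  proof cases
    case 2
    then have "lt (u @ a) (v @ b)" for a b by (simp add: lexord_append_left_rightI)
    then show ?thesis by blast
  qed auto
qed

lemma alp_le_iff: "alp_le r u v \<longleftrightarrow> u = v \<or> lt u v"
proof -
  have "(\<exists>z. v = u @ z) \<longleftrightarrow> u = v \<or> (\<exists>a z. v = u @ a # z)"
    by (metis append_Nil2 neq_Nil_conv)
  then show ?thesis unfolding alp_le_def lexord_def by blast
qed

section \<open>Lyndon words and their concatenation\<close>

lemma lyndon_iff: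
  "lyndon r w \<longleftrightarrow> w \<noteq> [] \<and> (\<forall>u v. w = u @ v \<and> u \<noteq> [] \<and> v \<noteq> [] \<longrightarrow> lt w v)"
  unfolding lyndon_def alp_le_iff by (metis append_self_conv2 lt_irrefl)

lemma lyndon_suffix: "lyndon r (u @ v) \<Longrightarrow> u \<noteq> [] \<Longrightarrow> v \<noteq> [] \<Longrightarrow> lt (u @ v) v"
  unfolding lyndon_iff by blast

lemma lyndon_not_Nil: "lyndon r w \<Longrightarrow> w \<noteq> []"
  by (simp add: lyndon_iff)

lemma lyndon_letter: "lyndon r [x]"
  by (auto simp: lyndon_iff Cons_eq_append_conv)

lemma append_suffix_cases:
  assumes "l @ m = u @ v"
  obtains z where "m = z @ v" | t where "t \<noteq> []" "l = u @ t" "v = t @ m"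
  using assms unfolding append_eq_append_conv2 by (metis append_Nil append_Nil2)

text \<open>If \<open>m\<close> is \<open>l\<close> followed by \<open>z\<close>, then
  \<open>m\<close> precedes its suffix \<open>z\<close>, and putting \<open>l\<close> in front of
  both gives the claim. Otherwise \<open>l\<close> and \<open>m\<close> differ at a letter.\<close>

lemma lyndon_append_lt:
  assumes l: "lyndon r l" and m: "lyndon r m" and lm: "lt l m"
  shows "lt (l @ m) m"
  using lt_append_cases[OF lm]
proof
  assume "\<exists>z. z \<noteq> [] \<and> m = l @ z"
  then obtain z where z: "z \<noteq> []" "m = l @ z" by blast
  then have "lt m z" using lyndon_suffix m lyndon_not_Nil[OF l] by blast
  then show ?thesis using z lt_append_same by simp
next
  assume "\<forall>a b. lt (l @ a) (m @ b)"
  then show ?thesis by (metis append_Nil2)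
qed

text \<open>A proper suffix of \<open>l m\<close> is a suffix of \<open>m\<close>, or it is
  \<open>t m\<close> with \<open>t\<close> a proper suffix of \<open>l\<close>. In the latter case
  \<open>l\<close> precedes the shorter word \<open>t\<close>, hence at a letter, so the inequality
  persists after appending.\<close>

lemma lyndon_append:
  assumes l: "lyndon r l" and m: "lyndon r m" and lm: "lt l m"
  shows "lyndon r (l @ m)"
  unfolding lyndon_iff
proof (intro conjI allI impI)
  show "l @ m \<noteq> []" using lyndon_not_Nil[OF l] by simp
next
  fix u v assume A: "l @ m = u @ v \<and> u \<noteq> [] \<and> v \<noteq> []"
  have lmm: "lt (l @ m) m" by (rule lyndon_append_lt[OF assms])
  show "lt (l @ m) v"
    using A[THEN conjunct1]
  proof (cases rule: append_suffix_cases)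
    case (1 z)
    then show ?thesis using lmm lyndon_suffix[of z v] m A lt_trans by (cases "z = []") auto
  next
    case (2 t)
    then have "lt l t" using lyndon_suffix[of u t] l A by blast
    then show ?thesis using 2 lt_append_length[of l t m m] by simp
  qed
qed

text \<open>The standard factorization cuts a word before its least proper suffix.\<close>

definition std :: "'x list \<Rightarrow> 'x list \<Rightarrow> bool" where
  "std u v \<longleftrightarrow> u \<noteq> [] \<and> v \<noteq> [] \<and>
     (\<forall>a b. u @ v = a @ b \<and> a \<noteq> [] \<and> b \<noteq> [] \<longrightarrow> b = v \<or> lt v b)"

text \<open>Proper suffixes that start at different places have different lengths, so a least one
  exists in the total order. This covers all words of length at least 2, which lets
  \<open>tau\<close> be treated for words that are not Lyndon.\<close>

lemma std_exists:
  assumes "w \<in> lists X" "2 \<le> length w"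
  shows "\<exists>u v. w = u @ v \<and> std u v"
proof -
  have "\<exists>i\<in>I. \<forall>j\<in>I. j = i \<or> lt (drop i w) (drop j w)"
    if "finite I" "I \<noteq> {}" "I \<subseteq> {0<..<length w}" for I
    using that
  proof (induction rule: finite_ne_induct)
    case (insert i I)
    then obtain k where k: "k \<in> I" "\<forall>j\<in>I. j = k \<or> lt (drop k w) (drop j w)" by auto
    have "i \<noteq> k" "i < length w" "k < length w" using insert.prems insert.hyps k(1) by auto
    then have "length (drop i w) \<noteq> length (drop k w)" by simp
    then have "drop i w \<noteq> drop k w" by metis
    moreover have "drop i w \<in> lists X" "drop k w \<in> lists X"
      using assms(1) by (auto dest: in_set_dropD)
    ultimately have "lt (drop i w) (drop k w) \<or> lt (drop k w) (drop i w)"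
      using lt_linear by blast
    then show ?case
    proof
      assume *: "lt (drop i w) (drop k w)"
      have "j = i \<or> lt (drop i w) (drop j w)" if "j \<in> insert i I" for j
        using that k(2) * lt_trans[OF *] by auto
      then show ?thesis by blast
    qed (use k in auto)
  qed auto
  moreover have "1 \<in> {0<..<length w}" using assms(2) by simp
  ultimately have "\<exists>i\<in>{0<..<length w}. \<forall>j\<in>{0<..<length w}. j = i \<or> lt (drop i w) (drop j w)"
    by blast
  then obtain i where i: "0 < i" "i < length w"
    "\<And>j. 0 < j \<Longrightarrow> j < length w \<Longrightarrow> j = i \<or> lt (drop i w) (drop j w)"
    by auto
  have "std (take i w) (drop i w)"
    unfolding std_def
  proof (intro conjI allI impI)
    fix a b assume A: "take i w @ drop i w = a @ b \<and> a \<noteq> [] \<and> b \<noteq> []"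
    then have "w = a @ b" by simp
    then have "b = drop (length a) w" "length a < length w" "0 < length a" using A by auto
    then show "b = drop i w \<or> lt (drop i w) b" using i(3)[of "length a"] by auto
  qed (use i in auto)
  then show ?thesis by (metis append_take_drop_id)
qed

lemma std_unique:
  assumes "std u v" "std u' v'" "u @ v = u' @ v'"
  shows "u = u' \<and> v = v'"
proof -
  have "v' = v \<or> lt v v'" "v = v' \<or> lt v' v" using assms unfolding std_def by metis+
  then have "v = v'" using lt_trans lt_irrefl by blast
  then show ?thesis using assms(3) by simp
qed

text \<open>For a proper suffix \<open>t\<close> of \<open>u\<close> suppose that \<open>t\<close>
  precedes \<open>u\<close>. If \<open>u\<close> is \<open>t\<close> followed by \<open>z\<close>,
  then \<open>z v\<close> precedes \<open>v\<close>, against the minimality of \<open>v\<close>; if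
  they differ at a letter, then \<open>t v\<close> precedes \<open>u v\<close>, against the Lyndon
  property of \<open>u v\<close>.\<close>

lemma std_lyndon:
  assumes w: "lyndon r (u @ v)" "u @ v \<in> lists X" and uv: "std u v"
  shows "lyndon r u" "lyndon r v" "lt u v"
proof -
  have ne: "u \<noteq> []" "v \<noteq> []" and min: "\<And>a b. u @ v = a @ b \<Longrightarrow> a \<noteq> [] \<Longrightarrow> b \<noteq> [] \<Longrightarrow> b = v \<or> lt v b"
    using uv unfolding std_def by blast+
  have wv: "lt (u @ v) v" using lyndon_suffix[OF w(1)] ne by blast
  have "lt v b" if "v = a @ b" "a \<noteq> []" "b \<noteq> []" for a b
    using min[of "u @ a" b] that by auto
  then show "lyndon r v" using ne by (simp add: lyndon_iff)
  show "lt u v" using lt_trans[OF lt_self_append[OF ne(2)] wv] .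
  have "lt u t" if t: "u = s @ t" "s \<noteq> []" "t \<noteq> []" for s t
  proof (rule ccontr)
    assume nl: "\<not> lt u t"
    have wt: "lt (u @ v) (t @ v)" using lyndon_suffix[of s "t @ v"] w t by simp
    have "u \<noteq> t" using t by auto
    then have "lt t u" using nl lt_linear[of u t] w(2) t(1) by auto
    from lt_append_cases[OF this] show False
    proof
      assume "\<exists>z. z \<noteq> [] \<and> u = t @ z"
      then obtain z where z: "z \<noteq> []" "u = t @ z" by blast
      then have "lt (z @ v) v" using wt lt_append_same by simp
      moreover have "z @ v = v \<or> lt v (z @ v)" using min[of t "z @ v"] z t by auto
      ultimately show False using z(1) lt_trans lt_irrefl by auto
    next
      assume "\<forall>a b. lt (t @ a) (u @ b)"
      then show False using wt lt_trans lt_irrefl by blast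
    qed
  qed
  then show "lyndon r u" using ne by (simp add: lyndon_iff)
qed

lemma std_letter: "lyndon r m \<Longrightarrow> std [x] m"
  unfolding std_def lyndon_iff
  by (auto simp: Cons_eq_append_conv)

text \<open>Used in contraposition: if cutting \<open>l1 m1 m\<close> before \<open>m\<close> is not
  standard, then \<open>m1\<close> precedes \<open>m\<close>. This is the situation in which a
  bracket can be rewritten by the Jacobi identity.\<close>

lemma std_append:
  assumes m: "lyndon r m" and l: "std l1 m1" and mm: "m = m1 \<or> lt m m1"
  shows "std (l1 @ m1) m"
  unfolding std_def
proof (intro conjI allI impI)
  fix a b assume A: "(l1 @ m1) @ m = a @ b \<and> a \<noteq> [] \<and> b \<noteq> []"
  show "b = m \<or> lt m b"
    using A[THEN conjunct1]
  proof (cases rule: append_suffix_cases)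
    case (1 z)
    then show ?thesis using lyndon_suffix[of z b] m A by (cases "z = []") auto
  next
    case (2 t)
    then have "t = m1 \<or> lt m1 t" using l A unfolding std_def by blast
    then have "t = m \<or> lt m t" using mm lt_trans by blast
    then show ?thesis using 2 lt_append_right lt_self_append lyndon_not_Nil[OF m] by auto
  qed
qed (use l m lyndon_not_Nil in \<open>auto simp: std_def\<close>)

end

section \<open>Commutators and central filtrations\<close>

definition commutator :: "('a, 'm) monoid_scheme \<Rightarrow> 'a \<Rightarrow> 'a \<Rightarrow> 'a" where
  "commutator G g h = inv\<^bsub>G\<^esub> g \<otimes>\<^bsub>G\<^esub> inv\<^bsub>G\<^esub> h \<otimes>\<^bsub>G\<^esub> g \<otimes>\<^bsub>G\<^esub> h"

context group
begin

abbreviation comm where "comm \<equiv> commutator G"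

lemma cancel_left: "x \<in> carrier G \<Longrightarrow> y \<in> carrier G \<Longrightarrow> x \<otimes> (inv x \<otimes> y) = y"
  and cancel_left': "x \<in> carrier G \<Longrightarrow> y \<in> carrier G \<Longrightarrow> inv x \<otimes> (x \<otimes> y) = y"
  by (simp_all flip: m_assoc)

text \<open>Association to the right, inverses moved to single letters and cancellation of
  neighbours bring a group word into reduced form, so identities of free groups follow by
  simplification.\<close>

lemmas word_simps = commutator_def m_assoc inv_mult_group cancel_left cancel_left'

lemma comm_closed [simp, intro]: "g \<in> carrier G \<Longrightarrow> h \<in> carrier G \<Longrightarrow> comm g h \<in> carrier G"
  by (simp add: commutator_def)

lemma comm_swap: "g \<in> carrier G \<Longrightarrow> h \<in> carrier G \<Longrightarrow> comm h g = inv (comm g h)"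
  by (simp add: word_simps)

lemma comm_self [simp]: "g \<in> carrier G \<Longrightarrow> comm g g = \<one>"
  by (simp add: word_simps)

lemma comm_one_left [simp]: "g \<in> carrier G \<Longrightarrow> comm \<one> g = \<one>"
  and comm_one_right [simp]: "g \<in> carrier G \<Longrightarrow> comm g \<one> = \<one>"
  by (simp_all add: word_simps)

lemma mult_comm: "g \<in> carrier G \<Longrightarrow> h \<in> carrier G \<Longrightarrow> g \<otimes> h = h \<otimes> g \<otimes> comm g h"
  by (simp add: word_simps)

lemma comm_mult_right:
  "\<lbrakk>g \<in> carrier G; h \<in> carrier G; k \<in> carrier G\<rbrakk> \<Longrightarrow>
     comm g (h \<otimes> k) = comm g k \<otimes> (inv k \<otimes> comm g h \<otimes> k)"
  by (simp add: word_simps)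

lemma comm_inv_right:
  "\<lbrakk>g \<in> carrier G; h \<in> carrier G\<rbrakk> \<Longrightarrow>
     comm g (inv h) = inv (inv h) \<otimes> inv (comm g h) \<otimes> inv h"
  by (simp add: word_simps)

text \<open>An identity of the free group on three letters, due to Hall and Witt; modulo higher
  commutators it becomes the Jacobi identity.\<close>

lemma hall_witt:
  "\<lbrakk>a \<in> carrier G; b \<in> carrier G; c \<in> carrier G\<rbrakk> \<Longrightarrow>
     (inv b \<otimes> comm (comm a (inv b)) c \<otimes> b) \<otimes> (inv c \<otimes> comm (comm b (inv c)) a \<otimes> c)
       \<otimes> (inv a \<otimes> comm (comm c (inv a)) b \<otimes> a) = \<one>"
  by (simp add: word_simps)

text \<open>In \<open>G Mod N\<close> the images of \<open>a\<close> and \<open>b\<close> commute,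
  so powers of their product split there. The error term can be placed on the right because left and
  right cosets of \<open>N\<close> agree.\<close>

lemma mult_pow_modulo:
  fixes m :: nat
  assumes N: "N \<lhd> G" and a: "a \<in> carrier G" and b: "b \<in> carrier G" and ab: "comm b a \<in> N"
  obtains k where "k \<in> N" "(a \<otimes> b) [^] m = a [^] m \<otimes> b [^] m \<otimes> k"
proof -
  interpret normal N G by fact
  interpret Q: group "G Mod N" by (rule factorgroup_is_group)
  let ?q = "\<lambda>g. N #> g"
  have hom: "?q \<in> hom G (G Mod N)" by (rule r_coset_hom_Mod)
  interpret q: group_hom G "G Mod N" ?q
    by unfold_locales (rule hom)
  have "?q (b \<otimes> a) = ?q (a \<otimes> b) \<otimes>\<^bsub>G Mod N\<^esub> ?q (comm b a)"
    using mult_comm[OF b a] a b q.hom_mult[of "a \<otimes> b" "comm b a"] by simp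
  moreover have "?q (comm b a) = \<one>\<^bsub>G Mod N\<^esub>"
    using ab by (simp add: FactGroup_def rcos_const is_group)
  ultimately have "?q b \<otimes>\<^bsub>G Mod N\<^esub> ?q a = ?q a \<otimes>\<^bsub>G Mod N\<^esub> ?q b"
    using q.hom_mult[OF a b] q.hom_mult[OF b a] q.hom_closed a b
    by (metis Q.r_one Q.m_closed)
  then have "(?q a \<otimes>\<^bsub>G Mod N\<^esub> ?q b) [^]\<^bsub>G Mod N\<^esub> m = ?q a [^]\<^bsub>G Mod N\<^esub> m \<otimes>\<^bsub>G Mod N\<^esub> ?q b [^]\<^bsub>G Mod N\<^esub> m"
    using Q.pow_mult_distrib q.hom_closed a b by metis
  then have "?q ((a \<otimes> b) [^] m) = ?q (a [^] m \<otimes> b [^] m)"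
    using q.hom_nat_pow[of "a \<otimes> b" m] q.hom_nat_pow[of a m] q.hom_nat_pow[of b m]
      q.hom_mult[of a b] q.hom_mult[of "a [^] m" "b [^] m"] a b by simp
  then have "(a \<otimes> b) [^] m \<in> N #> (a [^] m \<otimes> b [^] m)"
    using rcos_self[of "(a \<otimes> b) [^] m", OF _ subgroup_axioms] a b by simp
  then have "(a \<otimes> b) [^] m \<in> (a [^] m \<otimes> b [^] m) <# N"
    using coset_eq a b by simp
  then show ?thesis using that by (auto simp: l_coset_def)
qed

end

section \<open>Central filtrations: bilinearity and the Jacobi identity modulo the next term\<close>

locale central_filtration = group G for G (structure) +
  fixes F :: "nat \<Rightarrow> 'a set"
  assumes F_subgroup: "subgroup (F i) G"
    and F_Suc: "F (Suc i) \<subseteq> F i"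
    and F_comm: "g \<in> F i \<Longrightarrow> h \<in> F j \<Longrightarrow> commutator G g h \<in> F (i + j)"
    and F_1: "F 1 = carrier G"
begin

lemma F_carrier: "g \<in> F i \<Longrightarrow> g \<in> carrier G"
  using subgroup.subset[OF F_subgroup] by blast

lemma F_mono: "i \<le> j \<Longrightarrow> F j \<subseteq> F i"
  by (rule lift_Suc_antimono_le[of F, OF F_Suc])

text \<open>Conjugation changes \<open>k\<close> by \<open>[k, g]\<close>, which lies in the next
  filtration term and thus in \<open>K\<close>. So \<open>K\<close> behaves like a normal subgroup
  on \<open>F m\<close>.\<close>

lemma conj_mem:
  assumes "subgroup K G" "F (Suc m) \<subseteq> K" "k \<in> K" "k \<in> F m" "g \<in> carrier G"
  shows "inv g \<otimes> k \<otimes> g \<in> K"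
proof -
  have k: "k \<in> carrier G" using F_carrier assms(4) .
  have "comm k g \<in> K" using F_comm[of k m g 1] assms F_1 by auto
  moreover have "inv g \<otimes> k \<otimes> g = k \<otimes> comm k g" using k assms(5) by (simp add: word_simps)
  ultimately show ?thesis using assms subgroup.m_closed by metis
qed

lemma conj_mem_iff:
  assumes K: "subgroup K G" "F (Suc m) \<subseteq> K" and k: "k \<in> F m" and g: "g \<in> carrier G"
  shows "inv g \<otimes> k \<otimes> g \<in> K \<longleftrightarrow> k \<in> K"
proof
  assume "inv g \<otimes> k \<otimes> g \<in> K"
  moreover have "inv g \<otimes> k \<otimes> g \<in> F m"
    using conj_mem[OF F_subgroup F_Suc k k g] .
  ultimately have "inv (inv g) \<otimes> (inv g \<otimes> k \<otimes> g) \<otimes> inv g \<in> K"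
    using conj_mem[OF K, of _ "inv g"] g by blast
  then show "k \<in> K" using F_carrier[OF k] g by (simp add: m_assoc cancel_left)
qed (use conj_mem[OF K _ k g] in blast)

lemma normal_Int:
  assumes "subgroup K G" "F (Suc m) \<subseteq> K"
  shows "K \<inter> F m \<lhd> G"
  unfolding normal_inv_iff
proof (intro conjI ballI)
  show "subgroup (K \<inter> F m) G" using subgroups_Inter_pair[OF assms(1) F_subgroup] .
  fix g k assume g: "g \<in> carrier G" and k: "k \<in> K \<inter> F m"
  have "inv (inv g) \<otimes> k \<otimes> inv g \<in> K" "inv (inv g) \<otimes> k \<otimes> inv g \<in> F m"
    using conj_mem[OF assms, of k "inv g"] conj_mem[OF F_subgroup F_Suc, of k m "inv g"] k g by auto
  then show "g \<otimes> k \<otimes> inv g \<in> K \<inter> F m" using g by simp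
qed

text \<open>Linearity of the bracket in the second argument modulo the next term, phrased as closure
  under the group operations. In this form a commutator condition has to be checked on generators
  only.\<close>

lemma comm_subgroup_right:
  assumes K: "subgroup K G" "F (Suc (i + j)) \<subseteq> K" and g: "g \<in> F i"
  shows "subgroup {h \<in> F j. comm g h \<in> K} G"
proof -
  have gc: "g \<in> carrier G" using F_carrier g .
  show ?thesis
  proof (rule subgroupI)
    show "{h \<in> F j. comm g h \<in> K} \<subseteq> carrier G" using F_carrier by blast
    show "{h \<in> F j. comm g h \<in> K} \<noteq> {}"
      using subgroup.one_closed[OF F_subgroup] subgroup.one_closed[OF K(1)] gc by (auto intro!: exI[of _ \<one>])
  next
    fix h assume h: "h \<in> {h \<in> F j. comm g h \<in> K}"
    then have hc: "h \<in> carrier G" and i: "inv (comm g h) \<in> F (i + j)" "inv (comm g h) \<in> K"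
      using F_carrier F_comm[OF g] K(1) by (auto intro: subgroup.m_inv_closed[OF F_subgroup] subgroup.m_inv_closed)
    have "comm g (inv h) \<in> K"
      unfolding comm_inv_right[OF gc hc] using conj_mem[OF K i(2,1), of "inv h"] hc by simp
    then show "inv h \<in> {h \<in> F j. comm g h \<in> K}"
      using h subgroup.m_inv_closed[OF F_subgroup] by auto
  next
    fix h k assume h: "h \<in> {h \<in> F j. comm g h \<in> K}" and k: "k \<in> {h \<in> F j. comm g h \<in> K}"
    then have c: "h \<in> carrier G" "k \<in> carrier G" using F_carrier by auto
    have "inv k \<otimes> comm g h \<otimes> k \<in> K"
      using conj_mem[OF K, of "comm g h" k] h F_comm[OF g] c by blast
    then have "comm g (h \<otimes> k) \<in> K"
      unfolding comm_mult_right[OF gc c] using k subgroup.m_closed[OF K(1)] by blast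
    then show "h \<otimes> k \<in> {h \<in> F j. comm g h \<in> K}"
      using h k subgroup.m_closed[OF F_subgroup] by auto
  qed
qed

lemma comm_swap_mem:
  assumes "subgroup K G" "g \<in> carrier G" "h \<in> carrier G"
  shows "comm g h \<in> K \<longleftrightarrow> comm h g \<in> K"
  using assms by (metis comm_closed comm_swap inv_inv subgroup.m_inv_closed)

lemma comm_subgroup_left:
  assumes K: "subgroup K G" "F (Suc (i + j)) \<subseteq> K" and g: "g \<in> F j"
  shows "subgroup {h \<in> F i. comm h g \<in> K} G"
proof -
  have "{h \<in> F i. comm h g \<in> K} = {h \<in> F i. comm g h \<in> K}"
    using comm_swap_mem[OF K(1)] F_carrier g by blast
  then show ?thesis using comm_subgroup_right[of K j i g] K g by (simp add: add.commute)
qed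

lemma comm_next_left: "F (Suc (i + j)) \<subseteq> K \<Longrightarrow> g \<in> F j \<Longrightarrow> F (Suc i) \<subseteq> {h \<in> F i. comm h g \<in> K}"
  using F_comm[of _ "Suc i" g j] F_Suc by auto

lemma comm_next_right: "F (Suc (i + j)) \<subseteq> K \<Longrightarrow> g \<in> F i \<Longrightarrow> F (Suc j) \<subseteq> {h \<in> F j. comm g h \<in> K}"
  using F_comm[of g i _ "Suc j"] F_Suc by auto

text \<open>The Hall-Witt identity involves inverses of the middle entries. They can be removed
  because the elements \<open>h\<close> of \<open>F j\<close> for which \<open>[[a, h], c]\<close>
  lies in \<open>K\<close> form a subgroup, by two applications of linearity.\<close>

lemma comm_comm_inv_right:
  assumes K: "subgroup K G" "F (Suc (i + j + k)) \<subseteq> K"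
    and a: "a \<in> F i" and b: "b \<in> F j" and c: "c \<in> F k"
  shows "comm (comm a (inv b)) c \<in> K \<longleftrightarrow> comm (comm a b) c \<in> K"
proof -
  let ?D = "{h \<in> F (i + j). comm h c \<in> K}"
  have D: "subgroup ?D G" by (rule comm_subgroup_left[OF K c])
  have "subgroup {h \<in> F j. comm a h \<in> ?D} G"
    by (rule comm_subgroup_right[OF D comm_next_left[OF K(2) c] a])
  moreover have "b \<in> carrier G" "inv b \<in> F j" using F_carrier b subgroup.m_inv_closed[OF F_subgroup] by auto
  ultimately have "inv b \<in> {h \<in> F j. comm a h \<in> ?D} \<longleftrightarrow> b \<in> {h \<in> F j. comm a h \<in> ?D}"
    by (metis (no_types, lifting) inv_inv subgroup.m_inv_closed)
  then show ?thesis using b \<open>inv b \<in> F j\<close> F_comm[OF a] by blast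
qed

text \<open>Of the three factors in the Hall-Witt identity two lie in \<open>K\<close> by
  assumption, hence also the third. The conjugations there do not matter, since all three
  commutators have weight \<open>i + j + k\<close> and \<open>K\<close> contains the next
  term.\<close>

lemma comm_jacobi:
  assumes K: "subgroup K G" "F (Suc (i + j + k)) \<subseteq> K"
    and a: "a \<in> F i" and b: "b \<in> F j" and c: "c \<in> F k"
    and 1: "comm (comm b c) a \<in> K" and 2: "comm (comm c a) b \<in> K"
  shows "comm (comm a b) c \<in> K"
proof -
  have car: "a \<in> carrier G" "b \<in> carrier G" "c \<in> carrier G" using F_carrier a b c by blast+
  have inv: "inv a \<in> F i" "inv b \<in> F j" "inv c \<in> F k"
    using a b c subgroup.m_inv_closed[OF F_subgroup] by blast+
  define u where "u = inv b \<otimes> comm (comm a (inv b)) c \<otimes> b"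
  define v where "v = inv c \<otimes> comm (comm b (inv c)) a \<otimes> c"
  define w where "w = inv a \<otimes> comm (comm c (inv a)) b \<otimes> a"
  have F3: "comm (comm a (inv b)) c \<in> F (i + j + k)" "comm (comm b (inv c)) a \<in> F (i + j + k)"
     "comm (comm c (inv a)) b \<in> F (i + j + k)"
    using F_comm[OF F_comm[OF a inv(2)] c] F_comm[OF F_comm[OF b inv(3)] a]
      F_comm[OF F_comm[OF c inv(1)] b] by (simp_all add: ac_simps)
  have "comm (comm b (inv c)) a \<in> K" "comm (comm c (inv a)) b \<in> K"
    using comm_comm_inv_right[of K j k i b c a] comm_comm_inv_right[of K k i j c a b] K a b c 1 2
    by (simp_all add: ac_simps)
  then have vw: "v \<in> K" "w \<in> K"
    unfolding v_def w_def using conj_mem_iff[OF K F3(2) car(3)] conj_mem_iff[OF K F3(3) car(1)] by blast+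
  have carr: "u \<in> carrier G" "v \<in> carrier G" "w \<in> carrier G"
    using car unfolding u_def v_def w_def by auto
  have "u \<otimes> v \<otimes> w = \<one>" unfolding u_def v_def w_def using hall_witt car by blast
  then have "u = inv (v \<otimes> w)" using carr by (metis inv_equality m_assoc m_closed)
  then have "u \<in> K" using vw K(1) by (simp add: subgroup.m_closed subgroup.m_inv_closed)
  then have "comm (comm a (inv b)) c \<in> K"
    unfolding u_def using conj_mem_iff[OF K F3(1) car(2)] by blast
  then show ?thesis using comm_comm_inv_right[OF K a b c] by blast
qed

end

section \<open>Lyndon commutators\<close>

locale lyndon_commutators = central_filtration G F + ordered_alphabet X r
  for G :: "('a, 'm) monoid_scheme" (structure) and F and X :: "'a set" and r +
  assumes X_carrier: "X \<subseteq> carrier G"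
begin

text \<open>The guard on \<open>i\<close> ensures termination before anything is known about the
  choice. Since standard factorizations exist and are unique, it always holds for words over
  \<open>X\<close> of length at least 2.\<close>

function tau :: "'a list \<Rightarrow> 'a" where
  "tau w = (if length w \<le> 1 then hd w else
     let i = SOME i. std (take i w) (drop i w)
     in if 0 < i \<and> i < length w then comm (tau (take i w)) (tau (drop i w)) else \<one>)"
  by pat_completeness auto
termination by (relation "measure length") auto

declare tau.simps [simp del]

lemma tau_letter [simp]: "tau [x] = x"
  by (simp add: tau.simps)

lemma tau_append:
  assumes "std u v"
  shows "tau (u @ v) = comm (tau u) (tau v)"
proof -
  define i where "i = (SOME i. std (take i (u @ v)) (drop i (u @ v)))"
  have ne: "u \<noteq> []" "v \<noteq> []" using assms by (auto simp: std_def)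
  have "std (take (length u) (u @ v)) (drop (length u) (u @ v))" using assms by simp
  then have "std (take i (u @ v)) (drop i (u @ v))" unfolding i_def by (rule someI)
  then have "take i (u @ v) = u \<and> drop i (u @ v) = v"
    using std_unique[OF _ assms] by (metis append_take_drop_id)
  moreover from this have "0 < i \<and> i < length (u @ v)" using ne
    by (metis drop_eq_Nil gr0I leI take_eq_Nil)
  moreover have "\<not> length (u @ v) \<le> 1" using ne by (cases u; cases v) auto
  then have "tau (u @ v) = (if 0 < i \<and> i < length (u @ v)
      then comm (tau (take i (u @ v))) (tau (drop i (u @ v))) else \<one>)"
    unfolding tau.simps[of "u @ v"] i_def[symmetric] Let_def by (rule if_not_P)
  ultimately show ?thesis by metis
qed

lemma tau_filtration: "w \<in> lists X \<Longrightarrow> w \<noteq> [] \<Longrightarrow> tau w \<in> F (length w)"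
proof (induction "length w" arbitrary: w rule: less_induct)
  case less
  show ?case
  proof (cases "length w = 1")
    case True
    then obtain x where "w = [x]" by (auto simp: length_Suc_conv)
    then show ?thesis using less.prems X_carrier F_1 by auto
  next
    case False
    then have "2 \<le> length w" using less.prems by (cases w) (auto simp: Suc_le_eq)
    then obtain u v where w: "w = u @ v" "std u v" using std_exists less.prems by blast
    then have "u \<noteq> []" "v \<noteq> []" by (auto simp: std_def)
    then have "tau u \<in> F (length u)" "tau v \<in> F (length v)" using less w by auto
    then show ?thesis using F_comm w tau_append by simp
  qed
qed

lemma tau_carrier: "w \<in> lists X \<Longrightarrow> w \<noteq> [] \<Longrightarrow> tau w \<in> carrier G"
  using tau_filtration F_carrier by blast

text \<open>Rewriting of brackets of Lyndon elements: if \<open>a = a\<^sub>1a\<^sub>2\<close> is the standard factorization and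
  \<open>a\<^sub>2 < b\<close>, then by the Jacobi identity \<open>[[a\<^sub>1, a\<^sub>2], b]\<close> reduces to brackets of elements below \<open>b\<close>.\<close>

lemma comm_tau_lt:
  assumes Y: "finite Y" "Y \<subseteq> X"
  shows "\<lbrakk>a \<in> lists Y; b \<in> lists Y; lyndon r a; lyndon r b; lt a b; N = length a + length b;
    c = card {w \<in> lists Y. length w \<le> N \<and> lt w b};
    subgroup K G; F (Suc N) \<subseteq> K;
    \<And>w. w \<in> lists Y \<Longrightarrow> lyndon r w \<Longrightarrow> length w = N \<Longrightarrow> lt w b \<Longrightarrow> tau w \<in> K\<rbrakk>
    \<Longrightarrow> comm (tau a) (tau b) \<in> K"
\<comment> \<open>Nested induction: on the total length \<open>N\<close>, and for fixed
  \<open>N\<close> on the number \<open>c\<close> of words over \<open>Y\<close> of length at most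
  \<open>N\<close> that precede \<open>b\<close>, a finite number because \<open>Y\<close> is
  finite. The subgroup \<open>K\<close> varies, as the bracket with a third element is absorbed into
  it.\<close>
proof (induction N arbitrary: c a b K rule: less_induct)
  case outer: (less N)
  from outer.prems show ?case
  proof (induction c arbitrary: a b K rule: less_induct)
    case (less c)
    note K = less.prems(8,9) and gens = less.prems(10)
    have aY: "a \<in> lists Y" and bY: "b \<in> lists Y" and ab: "lt a b" and la: "lyndon r a" and lb: "lyndon r b"
      and N: "N = length a + length b" and cd: "c = card {w \<in> lists Y. length w \<le> N \<and> lt w b}"
      using less.prems by auto
    have XY: "w \<in> lists X" if "w \<in> lists Y" for w using that Y by auto
    have car: "tau w \<in> carrier G" "tau w \<in> F (length w)" if "w \<in> lists Y" "lyndon r w" for w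
      using tau_carrier tau_filtration XY lyndon_not_Nil that by auto
    have IN: "comm (tau u) (tau v) \<in> K'"
      if "u \<in> lists Y" "v \<in> lists Y" "lyndon r u" "lyndon r v" "lt u v" "length u + length v < N"
        "subgroup K' G" "F (Suc (length u + length v)) \<subseteq> K'"
        "\<And>w. w \<in> lists Y \<Longrightarrow> lyndon r w \<Longrightarrow> length w = length u + length v \<Longrightarrow> lt w v \<Longrightarrow> tau w \<in> K'" for u v K'
      using outer.IH[OF that(6) that(1-5) refl refl that(7,8)] that(9) by blast
    have below1: "comm (tau u) (tau v) \<in> K"
      if uv: "u \<in> lists Y" "v \<in> lists Y" "lyndon r u" "lyndon r v" "lt v b" "length u + length v = N" "lt u v" for u v
    proof -
      have "finite {w \<in> lists Y. length w \<le> N \<and> lt w b}"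
        using finite_lists_length_le[OF Y(1), of N]
        by (rule rev_finite_subset) (auto simp: lists_eq_set)
      moreover have "v \<in> {w \<in> lists Y. length w \<le> N \<and> lt w b}" using uv by auto
      moreover have "{w \<in> lists Y. length w \<le> N \<and> lt w v} \<subseteq> {w \<in> lists Y. length w \<le> N \<and> lt w b}"
        using uv lt_trans by blast
      ultimately have "card {w \<in> lists Y. length w \<le> N \<and> lt w v} < c"
        unfolding cd using lt_irrefl by (intro psubset_card_mono) blast+
      from less.IH[OF this uv(1,2,3,4,7) uv(6)[symmetric] refl K] show ?thesis
        using gens uv(5) lt_trans by blast
    qed
    have below: "comm (tau u) (tau v) \<in> K"
      if uv: "u \<in> lists Y" "v \<in> lists Y" "lyndon r u" "lyndon r v" "lt u b" "lt v b" "length u + length v = N" for u v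
    proof -
      consider "u = v" | "lt u v" | "lt v u" using lt_linear XY uv by blast
      then show ?thesis
      proof cases
        case 1
        then show ?thesis using car uv K(1) by (simp add: subgroup.one_closed)
      next
        case 3
        then have "comm (tau v) (tau u) \<in> K" using below1 uv by (simp add: add.commute)
        then show ?thesis using comm_swap_mem[OF K(1)] car uv by blast
      qed (use below1 uv in blast)
    qed
    show ?case
    proof (cases "std a b")
      case True
      have "tau (a @ b) \<in> K"
        using gens[of "a @ b"] lyndon_append[OF la lb ab] lyndon_append_lt[OF la lb ab] N aY bY by auto
      then show ?thesis using tau_append[OF True] by simp
    next
      case False
      have "length a \<noteq> 1" using False std_letter[OF lb] by (auto simp: length_Suc_conv)
      then have "2 \<le> length a" using lyndon_not_Nil[OF la] by (cases a) (auto simp: Suc_le_eq)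
      then obtain l m where a: "a = l @ m" and lm: "std l m" using std_exists XY aY by metis
      have Lm: "lyndon r l" "lyndon r m" "lt l m" using std_lyndon[OF _ _ lm] la a XY[OF aY] by auto
      have mY: "l \<in> lists Y" "m \<in> lists Y" using aY a by auto
      \<comment> \<open>The failure of standardness forces \<open>m\<close> before \<open>b\<close>.
        So both \<open>l\<close> and \<open>m\<close> precede \<open>b\<close>, and the Jacobi
        identity leads to brackets with both factors below \<open>b\<close>.\<close>
      have "lt m b"
        using False std_append[OF lb lm] lt_linear[OF XY[OF mY(2)] XY[OF bY]] a by blast
      have lb': "lt l b" using lt_trans Lm(3) \<open>lt m b\<close> by blast
      note cl = car[OF mY(1) Lm(1)] and cm = car[OF mY(2) Lm(2)] and cb = car[OF bY lb]
      have len: "length l > 0" "length m > 0" using lm by (auto simp: std_def)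
      have K3: "F (Suc (length l + length m + length b)) \<subseteq> K" using K(2) N a by simp
      \<comment> \<open>The outer hypothesis reduces \<open>[tau m, tau b]\<close> to elements
        \<open>tau w\<close> with \<open>w\<close> below \<open>b\<close>. The bracket of such a
        \<open>tau w\<close> with \<open>tau l\<close> has total length \<open>N\<close> and both
        factors below \<open>b\<close>, so the inner hypothesis applies. Afterwards \<open>l\<close>
        and \<open>m\<close> exchange their roles.\<close>
      have "comm (tau m) (tau b) \<in> {h \<in> F (length m + length b). comm h (tau l) \<in> K}"
      proof (rule IN[OF mY(2) bY Lm(2) lb \<open>lt m b\<close>])
        show "subgroup {h \<in> F (length m + length b). comm h (tau l) \<in> K} G"
          by (rule comm_subgroup_left[OF K(1) _ cl(2)]) (use K3 in \<open>simp add: ac_simps\<close>)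
        show "F (Suc (length m + length b)) \<subseteq> {h \<in> F (length m + length b). comm h (tau l) \<in> K}"
          by (rule comm_next_left[OF _ cl(2)]) (use K3 in \<open>simp add: ac_simps\<close>)
        fix w assume w: "w \<in> lists Y" "lyndon r w" "length w = length m + length b" "lt w b"
        then show "tau w \<in> {h \<in> F (length m + length b). comm h (tau l) \<in> K}"
          using below[OF w(1) mY(1) w(2) Lm(1) w(4) lb'] car[OF w(1,2)] N a by auto
      qed (use N a len in auto)
      then have 1: "comm (comm (tau m) (tau b)) (tau l) \<in> K" by blast
      have "comm (tau l) (tau b) \<in> {h \<in> F (length l + length b). comm h (tau m) \<in> K}"
      proof (rule IN[OF mY(1) bY Lm(1) lb lb'])
        show s: "subgroup {h \<in> F (length l + length b). comm h (tau m) \<in> K} G"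
          by (rule comm_subgroup_left[OF K(1) _ cm(2)]) (use K3 in \<open>simp add: ac_simps\<close>)
        show "F (Suc (length l + length b)) \<subseteq> {h \<in> F (length l + length b). comm h (tau m) \<in> K}"
          by (rule comm_next_left[OF _ cm(2)]) (use K3 in \<open>simp add: ac_simps\<close>)
        fix w assume w: "w \<in> lists Y" "lyndon r w" "length w = length l + length b" "lt w b"
        then show "tau w \<in> {h \<in> F (length l + length b). comm h (tau m) \<in> K}"
          using below[OF w(1) mY(2) w(2) Lm(2) w(4) \<open>lt m b\<close>] car[OF w(1,2)] N a by auto
      qed (use N a len in auto)
      moreover have "subgroup {h \<in> F (length l + length b). comm h (tau m) \<in> K} G"
        by (rule comm_subgroup_left[OF K(1) _ cm(2)]) (use K3 in \<open>simp add: ac_simps\<close>)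
      ultimately have "comm (tau b) (tau l) \<in> {h \<in> F (length l + length b). comm h (tau m) \<in> K}"
        using comm_swap_mem cl(1) cb(1) by blast
      then have 2: "comm (comm (tau b) (tau l)) (tau m) \<in> K" by blast
      have "comm (comm (tau l) (tau m)) (tau b) \<in> K"
        by (rule comm_jacobi[OF K(1) K3 cl(2) cm(2) cb(2) 1 2])
      then show ?thesis using a tau_append[OF lm] by simp
    qed
  qed
qed

text \<open>The letters of \<open>a\<close> and \<open>b\<close> form the finite alphabet that the
  counting argument requires; if \<open>b\<close> is the smaller word, the commutator is
  inverted.\<close>

lemma comm_tau:
  assumes a: "a \<in> lists X" "lyndon r a" and b: "b \<in> lists X" "lyndon r b"
    and K: "subgroup K G" "F (Suc (length a + length b)) \<subseteq> K"
    and gens: "\<And>w. w \<in> lists X \<Longrightarrow> lyndon r w \<Longrightarrow> length w = length a + length b \<Longrightarrow> tau w \<in> K"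
  shows "comm (tau a) (tau b) \<in> K"
proof -
  define Y where "Y = set a \<union> set b"
  have Y: "finite Y" "Y \<subseteq> X" "a \<in> lists Y" "b \<in> lists Y" "lists Y \<subseteq> lists X"
    using a b by (auto simp: Y_def)
  have car: "tau a \<in> carrier G" "tau b \<in> carrier G" using tau_carrier a b lyndon_not_Nil by auto
  consider "a = b" | "lt a b" | "lt b a" using lt_linear a b by blast
  then show ?thesis
  proof cases
    case 1
    then show ?thesis using car K(1) by (simp add: subgroup.one_closed)
  next
    case 2
    from comm_tau_lt[OF Y(1-4) a(2) b(2) 2 refl refl K] show ?thesis using gens Y(5) by blast
  next
    case 3
    from comm_tau_lt[OF Y(1,2,4,3) b(2) a(2) 3 refl refl K(1)] have "comm (tau b) (tau a) \<in> K"
      using gens Y(5) K(2) by (simp add: add.commute) blast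
    then show ?thesis using comm_swap_mem[OF K(1)] car by blast
  qed
qed

end

section \<open>The lower p-central filtration of a topological group\<close>

locale topological_grp = group G for G (structure) +
  fixes T :: "'a topology" and p :: nat
  assumes tg: "topological_group G T"
begin

lemma topspace_carrier: "topspace T = carrier G"
  using tg by (simp add: topological_group_def)

lemma cont_mult:
  assumes "continuous_map Z T f" "continuous_map Z T g"
  shows "continuous_map Z T (\<lambda>z. f z \<otimes> g z)"
proof -
  have "continuous_map Z (prod_topology T T) (\<lambda>z. (f z, g z))"
    using assms by (auto intro!: continuous_intros)
  moreover have "continuous_map (prod_topology T T) T (\<lambda>(x, y). x \<otimes> y)"
    using tg by (simp add: topological_group_def)
  ultimately show ?thesis using continuous_map_compose by (fastforce simp: o_def)
qed

lemma cont_inv: "continuous_map Z T f \<Longrightarrow> continuous_map Z T (\<lambda>z. inv (f z))"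
  using continuous_map_compose[of Z T f T "\<lambda>x. inv x"] tg by (simp add: topological_group_def o_def)

lemma cont_const: "c \<in> carrier G \<Longrightarrow> continuous_map Z T (\<lambda>z. c)"
  by (simp add: topspace_carrier)

lemma cont_pow: "continuous_map Z T f \<Longrightarrow> continuous_map Z T (\<lambda>z. f z [^] (m :: nat))"
proof (induction m)
  case 0
  then show ?case using cont_const[OF one_closed] by simp
next
  case (Suc m)
  then show ?case using cont_mult by simp
qed

lemma cont_comm:
  "continuous_map Z T f \<Longrightarrow> continuous_map Z T g \<Longrightarrow> continuous_map Z T (\<lambda>z. comm (f z) (g z))"
  unfolding commutator_def by (intro cont_mult cont_inv)

lemma cont_id: "continuous_map T T (\<lambda>z. z)"
  by (rule continuous_map_id[unfolded id_def])

lemma closed_preimage: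
  assumes "continuous_map T T f" "closedin T K" "closedin T L"
  shows "closedin T {x \<in> L. f x \<in> K}"
proof -
  have "{x \<in> L. f x \<in> K} = L \<inter> {x \<in> topspace T. f x \<in> K}"
    using closedin_subset[OF assms(3)] by auto
  then show ?thesis using closedin_continuous_map_preimage[OF assms(1,2)] assms(3) by auto
qed

text \<open>Products are treated one factor at a time: an element of \<open>H\<close> times a limit
  is a limit by continuity in the right factor, and then a limit times a limit by continuity in the
  left factor.\<close>

lemma closure_subgroup:
  assumes H: "subgroup H G"
  shows "subgroup (T closure_of H) G"
proof -
  let ?C = "T closure_of H"
  have HC: "H \<subseteq> ?C" using closure_of_subset[of H T] subgroup.subset[OF H] topspace_carrier by simp
  have CG: "?C \<subseteq> carrier G" using closure_of_subset_topspace topspace_carrier by metis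
  have img: "f x \<in> ?C" if "continuous_map T T f" "f ` H \<subseteq> ?C" "x \<in> ?C" for f x
  proof -
    have "f ` ?C \<subseteq> T closure_of (f ` H)" by (rule continuous_map_image_closure_subset[OF that(1)])
    also have "\<dots> \<subseteq> T closure_of ?C" by (rule closure_of_mono[OF that(2)])
    finally show ?thesis using that(3) by auto
  qed
  have left: "h \<otimes> x \<in> ?C" if "h \<in> H" "x \<in> ?C" for h x
    by (rule img[OF cont_mult[OF cont_const cont_id] _ that(2)])
      (use that H HC subgroup.m_closed[OF H] subgroup.mem_carrier[OF H] in auto)
  show ?thesis
  proof (rule subgroupI)
    show "?C \<subseteq> carrier G" by (rule CG)
    show "?C \<noteq> {}" using HC subgroup.one_closed[OF H] by auto
  next
    fix x assume "x \<in> ?C"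
    then show "inv x \<in> ?C"
      by (rule img[OF cont_inv[OF cont_id], rotated]) (use HC subgroup.m_inv_closed[OF H] in auto)
  next
    fix x y assume x: "x \<in> ?C" and y: "y \<in> ?C"
    show "x \<otimes> y \<in> ?C"
      by (rule img[OF cont_mult[OF cont_id cont_const] _ x]) (use left y CG in auto)
  qed
qed

section \<open>Closed subgroups and the lower p-central filtration\<close>

definition closed_subgroup :: "'a set \<Rightarrow> bool" where
  "closed_subgroup K \<longleftrightarrow> subgroup K G \<and> closedin T K"

lemma closure_generate_minimal:
  assumes "closed_subgroup K" "A \<subseteq> K"
  shows "T closure_of (generate G A) \<subseteq> K"
  using assms generate_subgroup_incl[of A K] closure_of_minimal[of _ K T]
  by (auto simp: closed_subgroup_def)

abbreviation L :: "nat \<Rightarrow> 'a set" where "L \<equiv> lower_p_central p G T"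

lemma L_Suc_Suc:
  "L (Suc (Suc n)) = T closure_of (generate G
     ({h [^] p | h. h \<in> L (Suc n)} \<union> {comm g h | g h. g \<in> carrier G \<and> h \<in> L (Suc n)}))"
  by (simp add: commutator_def)

declare lower_p_central.simps(3) [simp del]

lemma L_closed_subgroup: "closed_subgroup (L n)"
proof (induction n)
  case 0
  then show ?case using closedin_topspace[of T] by (simp add: closed_subgroup_def topspace_carrier subgroup_self)
next
  case (Suc n)
  show ?case
  proof (cases n)
    case 0
    then show ?thesis using closedin_topspace[of T] by (simp add: closed_subgroup_def topspace_carrier subgroup_self)
  next
    case (Suc m)
    then have "L (Suc m) \<subseteq> carrier G" using Suc.IH subgroup.subset by (auto simp: closed_subgroup_def)
    then have "{h [^] p | h. h \<in> L (Suc m)} \<union> {comm g h | g h. g \<in> carrier G \<and> h \<in> L (Suc m)} \<subseteq> carrier G"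
      by auto
    then show ?thesis
      unfolding Suc L_Suc_Suc closed_subgroup_def using closure_subgroup generate_is_subgroup by simp
  qed
qed

lemma L_subgroup: "subgroup (L n) G" and L_closed: "closedin T (L n)"
  using L_closed_subgroup by (auto simp: closed_subgroup_def)

lemma L_carrier: "h \<in> L n \<Longrightarrow> h \<in> carrier G"
  using subgroup.mem_carrier[OF L_subgroup] .

text \<open>The closure and the generated subgroup in the definition are absorbed here once and for
  all; upper bounds for filtration terms are then tested on p-th powers and commutators.\<close>

lemma L_minimal:
  assumes "closed_subgroup K" "\<And>h. h \<in> L (Suc n) \<Longrightarrow> h [^] p \<in> K"
    "\<And>g h. g \<in> carrier G \<Longrightarrow> h \<in> L (Suc n) \<Longrightarrow> comm g h \<in> K"
  shows "L (Suc (Suc n)) \<subseteq> K"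
  unfolding L_Suc_Suc by (rule closure_generate_minimal[OF assms(1)]) (use assms in auto)

lemma L_gens: "{h [^] p | h. h \<in> L (Suc n)} \<union> {comm g h | g h. g \<in> carrier G \<and> h \<in> L (Suc n)} \<subseteq> L (Suc (Suc n))"
proof -
  let ?A = "{h [^] p | h. h \<in> L (Suc n)} \<union> {comm g h | g h. g \<in> carrier G \<and> h \<in> L (Suc n)}"
  have "?A \<subseteq> carrier G" using L_carrier by auto
  then have "generate G ?A \<subseteq> carrier G" by (rule generate_incl)
  then have "generate G ?A \<subseteq> T closure_of (generate G ?A)"
    by (intro closure_of_subset) (simp add: topspace_carrier)
  moreover have "?A \<subseteq> generate G ?A" by (rule subsetI) (rule generate.incl)
  ultimately show ?thesis unfolding L_Suc_Suc by blast
qed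

lemma L_pow: "h \<in> L (Suc n) \<Longrightarrow> h [^] p \<in> L (Suc (Suc n))"
  using L_gens by blast

lemma L_comm_carrier: "g \<in> carrier G \<Longrightarrow> h \<in> L (Suc n) \<Longrightarrow> comm g h \<in> L (Suc (Suc n))"
  using L_gens by blast

lemma conj_hom: "g \<in> carrier G \<Longrightarrow> (\<lambda>h. inv g \<otimes> h \<otimes> g) \<in> hom G G"
  by (rule homI) (simp_all add: word_simps)


text \<open>Conjugation is a continuous automorphism and carries the generators of a term to
  generators of the same kind, so the preimage of \<open>L n\<close> is a closed subgroup that
  contains them.\<close>

lemma L_conj: "g \<in> carrier G \<Longrightarrow> h \<in> L n \<Longrightarrow> inv g \<otimes> h \<otimes> g \<in> L n"
proof (induction n arbitrary: h rule: less_induct)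
  case (less n)
  note g = less.prems(1)
  interpret c: group_hom G G "\<lambda>h. inv g \<otimes> h \<otimes> g"
    using conj_hom[OF g] by unfold_locales
  show ?case
  proof (cases "n \<le> 1")
    case True
    then have "n = 0 \<or> n = Suc 0" by auto
    then show ?thesis using less.prems by auto
  next
    case False
    then obtain m where n: "n = Suc (Suc m)" by (metis Suc_eq_plus1 add.commute le_add_same_cancel1 nat_le_iff_add not_less_eq_eq plus_1_eq_Suc le0 less_eq_Suc_le not_less_eq old.nat.exhaust le_SucI One_nat_def)
    let ?K = "{h \<in> carrier G. inv g \<otimes> h \<otimes> g \<in> L n}"
    have "closedin T ?K"
      by (rule closed_preimage[OF cont_mult[OF cont_mult[OF cont_const cont_id] cont_const]])
        (use g L_closed closedin_topspace[of T] in \<open>auto simp: topspace_carrier\<close>)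
    moreover have "subgroup ?K G"
      by (rule subgroupI) (auto simp: subgroup.one_closed[OF L_subgroup] subgroup.m_closed[OF L_subgroup]
        subgroup.m_inv_closed[OF L_subgroup] simp del: c.hom_mult c.hom_inv simp add: c.hom_mult[unfolded] c.hom_inv[unfolded] intro!: exI[of _ \<one>])
    ultimately have "closed_subgroup ?K" by (simp add: closed_subgroup_def)
    then have "L (Suc (Suc m)) \<subseteq> ?K"
    proof (rule L_minimal)
      fix h assume h: "h \<in> L (Suc m)"
      then have "(inv g \<otimes> h \<otimes> g) [^] p \<in> L n" using less.IH[of "Suc m" h] n g L_pow by simp
      then show "h [^] p \<in> ?K" using L_carrier[OF h] c.hom_nat_pow[of h p] by simp
    next
      fix a h assume a: "a \<in> carrier G" and h: "h \<in> L (Suc m)"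
      have "comm (inv g \<otimes> a \<otimes> g) (inv g \<otimes> h \<otimes> g) \<in> L n"
        using less.IH[of "Suc m" h] n g a h L_comm_carrier by simp
      moreover have "comm (inv g \<otimes> a \<otimes> g) (inv g \<otimes> h \<otimes> g) = inv g \<otimes> comm a h \<otimes> g"
        using g a L_carrier[OF h] by (simp add: word_simps)
      ultimately show "comm a h \<in> ?K" using a L_carrier[OF h] by simp
    qed
    then show ?thesis using less.prems n by blast
  qed
qed

lemma L_normal: "L n \<lhd> G"
  unfolding normal_inv_iff using L_subgroup L_conj[of "inv _"] by fastforce

lemma comm_normal: "N \<lhd> G \<Longrightarrow> g \<in> carrier G \<Longrightarrow> h \<in> N \<Longrightarrow> comm g h \<in> N"
  unfolding commutator_def
  by (metis inv_closed inv_inv normal_inv_iff subgroup.m_closed subgroup.m_inv_closed)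

lemma pow_mem_subgroup: "subgroup K G \<Longrightarrow> x \<in> K \<Longrightarrow> x [^] (m :: nat) \<in> K"
  by (induction m) (simp_all add: subgroup.one_closed subgroup.m_closed)

lemma L_Suc_subset: "L (Suc n) \<subseteq> L n"
proof (cases n)
  case (Suc m)
  have "L (Suc (Suc m)) \<subseteq> L (Suc m)"
    by (rule L_minimal[OF L_closed_subgroup])
      (auto intro: comm_normal[OF L_normal] simp: pow_mem_subgroup[OF L_subgroup])
  then show ?thesis using Suc by simp
qed simp

lemma comm_mult_left:
  "\<lbrakk>g \<in> carrier G; h \<in> carrier G; k \<in> carrier G\<rbrakk> \<Longrightarrow>
     comm (h \<otimes> k) g = (inv k \<otimes> comm h g \<otimes> k) \<otimes> comm k g"
  by (simp add: word_simps)

lemma centralizer_mod_normal: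
  assumes N: "N \<lhd> G" and b: "b \<in> carrier G"
  shows "subgroup {a \<in> carrier G. comm a b \<in> N} G"
proof -
  have sub: "subgroup N G" and conj: "\<And>x h. x \<in> carrier G \<Longrightarrow> h \<in> N \<Longrightarrow> x \<otimes> h \<otimes> inv x \<in> N"
    using N by (auto simp: normal_inv_iff)
  show ?thesis
  proof (rule subgroupI)
    show "{a \<in> carrier G. comm a b \<in> N} \<noteq> {}" using b subgroup.one_closed[OF sub] by (auto intro!: exI[of _ \<one>])
  next
    fix a assume a: "a \<in> {a \<in> carrier G. comm a b \<in> N}"
    then have "a \<otimes> inv (comm a b) \<otimes> inv a \<in> N" using conj subgroup.m_inv_closed[OF sub] by blast
    moreover have "a \<otimes> inv (comm a b) \<otimes> inv a = comm (inv a) b" using a b by (simp add: word_simps)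
    ultimately show "inv a \<in> {a \<in> carrier G. comm a b \<in> N}" using a by simp
  next
    fix a c assume a: "a \<in> {a \<in> carrier G. comm a b \<in> N}" and c: "c \<in> {a \<in> carrier G. comm a b \<in> N}"
    have "inv c \<otimes> comm a b \<otimes> inv (inv c) \<in> N" using conj[of "inv c"] a c by blast
    then show "a \<otimes> c \<in> {a \<in> carrier G. comm a b \<in> N}"
      using a b c comm_mult_left[of b a c] subgroup.m_closed[OF sub] by auto
  qed auto
qed

text \<open>Induction on the first index, for all \<open>j\<close>: the elements \<open>a\<close>
  with \<open>[a, b]\<close> in the target term form a closed subgroup, to be tested on generators.
  For p-th powers, \<open>[h^p, b] = h^(-p) (h c)^p\<close> with \<open>c = [h, b]\<close>, and
  \<open>c\<close> is central modulo the target. For commutators the three subgroups argument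
  applies.\<close>

lemma L_comm_Suc: "a \<in> L (Suc i) \<Longrightarrow> b \<in> L (Suc j) \<Longrightarrow> comm a b \<in> L (Suc i + Suc j)"
proof (induction i arbitrary: j a b)
  case 0
  then show ?case using L_comm_carrier by simp
next
  case (Suc i)
  let ?N = "L (Suc (Suc (Suc (i + j))))"
  have b: "b \<in> carrier G" using Suc.prems(2) L_carrier by blast
  have sub: "subgroup ?N G" using L_subgroup .
  have N: "comm c g \<in> ?N" "comm g c \<in> ?N" if "c \<in> L (Suc (Suc (i + j)))" "g \<in> carrier G" for c g
  proof -
    show "comm g c \<in> ?N" using L_comm_carrier that by simp
    then show "comm c g \<in> ?N"
      using comm_swap[of g c] that L_carrier subgroup.m_inv_closed[OF sub] by metis
  qed
  have IH: "comm h b' \<in> L (Suc (Suc (i + j)))" if "h \<in> L (Suc i)" "b' \<in> L (Suc j)" for h b'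
    using Suc.IH[OF that] by simp
  let ?K = "{a \<in> carrier G. comm a b \<in> ?N}"
  have "closedin T ?K"
    by (rule closed_preimage[OF cont_comm[OF cont_id cont_const]])
      (use b L_closed closedin_topspace[of T] in \<open>auto simp: topspace_carrier\<close>)
  then have "closed_subgroup ?K"
    using centralizer_mod_normal[OF L_normal b] by (simp add: closed_subgroup_def)
  then have "L (Suc (Suc i)) \<subseteq> ?K"
  proof (rule L_minimal)
    fix h assume h: "h \<in> L (Suc i)"
    define c where "c = comm h b"
    have hc: "h \<in> carrier G" "c \<in> carrier G" using h L_carrier b by (auto simp: c_def)
    have c: "c \<in> L (Suc (Suc (i + j)))" unfolding c_def using IH[OF h Suc.prems(2)] .
    obtain k where k: "k \<in> ?N" "(h \<otimes> c) [^] p = h [^] p \<otimes> c [^] p \<otimes> k"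
      using mult_pow_modulo[OF L_normal hc N(1)[OF c hc(1)]] by blast
    interpret cb: group_hom G G "\<lambda>h. inv b \<otimes> h \<otimes> b"
      using conj_hom[OF b] by unfold_locales
    have "inv b \<otimes> h \<otimes> b = h \<otimes> c" unfolding c_def using hc b by (simp add: word_simps)
    then have "inv b \<otimes> h [^] p \<otimes> b = (h \<otimes> c) [^] p" using cb.hom_nat_pow[OF hc(1), of p] by simp
    then have "comm (h [^] p) b = inv (h [^] p) \<otimes> (h \<otimes> c) [^] p"
      using hc b by (simp add: commutator_def m_assoc)
    also have "\<dots> = c [^] p \<otimes> k" 
      using k hc L_carrier[OF k(1)] by (simp add: m_assoc cancel_left')
    also have "\<dots> \<in> ?N" using k(1) L_pow[OF c] subgroup.m_closed[OF sub] by blast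
    finally show "h [^] p \<in> ?K" using hc by simp
  next
    fix g h assume g: "g \<in> carrier G" and h: "h \<in> L (Suc i)"
    have hc: "h \<in> carrier G" using h L_carrier by blast
    have inv: "inv h \<in> L (Suc i)" "inv b \<in> L (Suc j)"
      using h Suc.prems(2) subgroup.m_inv_closed[OF L_subgroup] by blast+
    \<comment> \<open>The Hall-Witt identity is taken at \<open>g\<close>, the inverse of
      \<open>h\<close>, and \<open>b\<close>; then its first factor is a conjugate of
      \<open>[[g, h], b]\<close>, the commutator in question.\<close>
    define u where "u = inv (inv h) \<otimes> comm (comm g (inv (inv h))) b \<otimes> inv h"
    define v where "v = inv b \<otimes> comm (comm (inv h) (inv b)) g \<otimes> b"
    define w where "w = inv g \<otimes> comm (comm b (inv g)) (inv h) \<otimes> g"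
    have "v \<in> ?N" unfolding v_def using L_conj[OF b] N(1)[OF IH[OF inv] g] by blast
    moreover have "comm b (inv g) \<in> L (Suc (Suc j))"
      using L_comm_carrier[of "inv g" b j] Suc.prems(2) g b comm_swap[of "inv g" b]
        subgroup.m_inv_closed[OF L_subgroup] by (metis inv_closed)
    then have "comm (inv h) (comm b (inv g)) \<in> ?N" using Suc.IH[OF inv(1), of _ "Suc j"] by simp
    then have "comm (comm b (inv g)) (inv h) \<in> ?N"
      using comm_swap[of "inv h" "comm b (inv g)"] hc b g subgroup.m_inv_closed[OF sub] by simp
    then have "w \<in> ?N" unfolding w_def using L_conj[OF g] by blast
    ultimately have vw: "inv (v \<otimes> w) \<in> ?N" using subgroup.m_closed[OF sub] subgroup.m_inv_closed[OF sub] by blast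
    have car: "u \<in> carrier G" "v \<in> carrier G" "w \<in> carrier G" using g b hc by (auto simp: u_def v_def w_def)
    have "u \<otimes> v \<otimes> w = \<one>" unfolding u_def v_def w_def using hall_witt[of g "inv h" b] g hc b by blast
    then have "u \<in> ?N" using vw car by (metis inv_equality m_assoc m_closed)
    then have "inv h \<otimes> u \<otimes> h \<in> ?N" using L_conj[OF hc] by blast
    moreover have "inv h \<otimes> u \<otimes> h = comm (comm g h) b" unfolding u_def using g hc b by (simp add: m_assoc cancel_left cancel_left')
    ultimately show "comm g h \<in> ?K" using g hc by simp
  qed
  then show ?case using Suc.prems by auto
qed

lemma L_comm: "a \<in> L i \<Longrightarrow> b \<in> L j \<Longrightarrow> comm a b \<in> L (i + j)"
proof (cases i; cases j)
  fix i' assume a: "a \<in> L i" "b \<in> L j" "i = Suc i'" "j = 0"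
  then have "comm b a \<in> L i" using comm_normal[OF L_normal] by auto
  then show ?thesis
    using a comm_swap[of b a] L_carrier subgroup.m_inv_closed[OF L_subgroup] by (metis add.right_neutral)
next
  fix i' j' assume "a \<in> L i" "b \<in> L j" "i = Suc i'" "j = Suc j'"
  then show ?thesis using L_comm_Suc by blast
qed (auto intro: comm_normal[OF L_normal])

end

sublocale topological_grp \<subseteq> central_filtration G "lower_p_central p G T"
proof (intro central_filtration.intro central_filtration_axioms.intro is_group)
  show "subgroup (L i) G" for i by (rule L_subgroup)
  show "L (Suc i) \<subseteq> L i" for i by (rule L_Suc_subset)
  show "comm g h \<in> L (i + j)" if "g \<in> L i" "h \<in> L j" for g h i j using L_comm that .
qed simp

section \<open>Topological generators of the lower p-central filtration\<close>

locale lyndon_topological_grp = topological_grp G T p + ordered_alphabet X r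
  for G :: "('a, 'm) monoid_scheme" (structure) and T and p and X :: "'a set" and r +
  assumes X_carrier: "X \<subseteq> carrier G"
    and X_dense: "T closure_of (generate G X) = carrier G"

sublocale lyndon_topological_grp \<subseteq> lyndon_commutators G "lower_p_central p G T" X r
  by unfold_locales (rule X_carrier)

context lyndon_topological_grp
begin

definition vgen :: "nat \<Rightarrow> 'a list \<Rightarrow> 'a" where
  "vgen n w = tau w [^] (p ^ (n - length w))"

lemma L_pow_iterate: "h \<in> L k \<Longrightarrow> 1 \<le> k \<Longrightarrow> h [^] (p ^ j) \<in> L (k + j)"
proof (induction j)
  case (Suc j)
  then have "(h [^] (p ^ j)) [^] p \<in> L (Suc (k + j))"
    using L_pow[of "h [^] (p ^ j)" "k + j - 1"] by simp
  then show ?case using Suc.prems F_carrier by (simp add: nat_pow_pow mult.commute)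
qed (use F_carrier in simp)

lemma vgen_mem:
  assumes "w \<in> lists X" "w \<noteq> []" "length w \<le> n"
  shows "vgen n w \<in> L n"
  using L_pow_iterate[OF tau_filtration[OF assms(1,2)], of "n - length w"] assms
  by (cases w) (auto simp: vgen_def)

lemma vgen_Suc:
  assumes "w \<in> lists X" "w \<noteq> []" "length w \<le> n"
  shows "vgen (Suc n) w = vgen n w [^] p"
  using assms tau_carrier[OF assms(1,2)] by (simp add: vgen_def nat_pow_pow Suc_diff_le mult.commute)

text \<open>On \<open>L n\<close> taking p-th powers is multiplicative modulo \<open>K\<close>,
  because the commutators of \<open>L n\<close> lie in \<open>K\<close>. For \<open>n = 1\<close>
  this does not follow from the inclusion of the term with index 3, so it is assumed; for
  \<open>n >= 2\<close> it comes from the weight \<open>2 n\<close>.\<close>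

lemma pow_closed_subgroup:
  assumes K: "closed_subgroup K" "L (Suc (Suc n)) \<subseteq> K" "1 \<le> n"
    and comm: "\<And>g h. g \<in> L n \<Longrightarrow> h \<in> L n \<Longrightarrow> comm g h \<in> K"
  shows "closed_subgroup {h \<in> L n. h [^] p \<in> K}" "L (Suc n) \<subseteq> {h \<in> L n. h [^] p \<in> K}"
proof -
  have sub: "subgroup K G" "closedin T K" using K by (auto simp: closed_subgroup_def)
  have N: "K \<inter> L (Suc n) \<lhd> G" using normal_Int[OF sub(1) K(2)] .
  have "subgroup {h \<in> L n. h [^] p \<in> K} G"
  proof (rule subgroupI)
    show "{h \<in> L n. h [^] p \<in> K} \<subseteq> carrier G" using F_carrier by blast
    show "{h \<in> L n. h [^] p \<in> K} \<noteq> {}"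
      using subgroup.one_closed[OF F_subgroup] subgroup.one_closed[OF sub(1)]
      by (metis (mono_tags, lifting) empty_Collect_eq nat_pow_one)
  next
    fix h assume "h \<in> {h \<in> L n. h [^] p \<in> K}"
    then show "inv h \<in> {h \<in> L n. h [^] p \<in> K}"
      using F_carrier[of h n] subgroup.m_inv_closed[OF F_subgroup] subgroup.m_inv_closed[OF sub(1)]
      by (auto simp: nat_pow_inv)
  next
    fix g h assume g: "g \<in> {h \<in> L n. h [^] p \<in> K}" and h: "h \<in> {h \<in> L n. h [^] p \<in> K}"
    have "n + n = Suc n + (n - 1)" using K(3) by simp
    then have "L (n + n) \<subseteq> L (Suc n)" using F_mono[of "Suc n" "n + n"] by simp
    then have "comm h g \<in> K \<inter> L (Suc n)" using comm F_comm[of h n g n] g h by auto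
    then obtain k where "k \<in> K \<inter> L (Suc n)" "(g \<otimes> h) [^] p = g [^] p \<otimes> h [^] p \<otimes> k"
      using mult_pow_modulo[OF N] F_carrier g h by blast
    then show "g \<otimes> h \<in> {h \<in> L n. h [^] p \<in> K}"
      using g h subgroup.m_closed[OF F_subgroup] subgroup.m_closed[OF sub(1)] by auto
  qed
  moreover have "closedin T {h \<in> L n. h [^] p \<in> K}"
    by (rule closed_preimage[OF cont_pow[OF cont_id] sub(2) L_closed])
  ultimately show "closed_subgroup {h \<in> L n. h [^] p \<in> K}" by (simp add: closed_subgroup_def)
  show "L (Suc n) \<subseteq> {h \<in> L n. h [^] p \<in> K}"
    using F_Suc[of n] L_pow[of _ n] K(2) by blast
qed

lemma closed_subgroup_comm_right:
  assumes K: "closed_subgroup K" "L (Suc (i + j)) \<subseteq> K" and g: "g \<in> L i"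
  shows "closed_subgroup {h \<in> L j. comm g h \<in> K}"
  using comm_subgroup_right[OF _ K(2) g] closed_preimage[OF cont_comm[OF cont_const cont_id] _ L_closed] K
    F_carrier[OF g] by (auto simp: closed_subgroup_def)

lemma closed_subgroup_comm_left:
  assumes K: "closed_subgroup K" "L (Suc (i + j)) \<subseteq> K" and g: "g \<in> L j"
  shows "closed_subgroup {h \<in> L i. comm h g \<in> K}"
  using comm_subgroup_left[OF _ K(2) g] closed_preimage[OF cont_comm[OF cont_id cont_const] _ L_closed] K
    F_carrier[OF g] by (auto simp: closed_subgroup_def)

lemma lyndon_words_iff: "w \<in> lyndon_words X r n \<longleftrightarrow> w \<in> lists X \<and> lyndon r w \<and> length w \<le> n"
  unfolding lyndon_words_def using lyndon_not_Nil by (cases w) auto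

text \<open>The next term is generated by p-th powers of \<open>L n\<close> and commutators with
  \<open>L n\<close>. Both conditions on an element of \<open>L n\<close> define closed subgroups
  that contain \<open>L (Suc n)\<close>, so the induction hypothesis reduces them to the elements
  \<open>vgen n w\<close>. The p-th power of \<open>vgen n w\<close> is
  \<open>vgen (Suc n) w\<close>; its commutators with letters are the substantial case.\<close>

theorem filtration_generators:
  assumes "1 \<le> n" "closed_subgroup K" "L (Suc n) \<subseteq> K"
    and "\<And>w. w \<in> lyndon_words X r n \<Longrightarrow> vgen n w \<in> K"
  shows "L n \<subseteq> K"
  using assms
proof (induction n arbitrary: K rule: dec_induct)
  case base
  have "x \<in> K" if "x \<in> X" for x
    using base(3)[of "[x]"] that X_carrier lyndon_letter by (auto simp: lyndon_words_iff vgen_def)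
  then show ?case using closure_generate_minimal[OF base(1), of X] X_dense by auto
next
  case (step n K)
  note K = step.prems(1,2) and gens = step.prems(3) and n = step.hyps(1)
  have sub: "subgroup K G" using K by (simp add: closed_subgroup_def)
  define K' where "K' = K \<inter> L (Suc n)"
  have N: "K' \<lhd> G" unfolding K'_def using normal_Int[OF sub K(2)] .
  have subK': "subgroup K' G" using N by (simp add: normal_def)
  have w: "w \<in> lists X" "lyndon r w" "w \<noteq> []" "length w \<le> n" "tau w \<in> carrier G" "tau w \<in> L (length w)"
    "vgen n w \<in> L n" "vgen (Suc n) w \<in> K" if "w \<in> lyndon_words X r n" for w
    using that gens[of w] vgen_mem tau_carrier tau_filtration lyndon_not_Nil
    by (auto simp: lyndon_words_iff)
  \<comment> \<open>For a word of length \<open>n\<close> the generator is \<open>tau w\<close>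
    without a p-power. Its bracket with a letter is rewritten by Lyndon commutators of length
    \<open>n + 1\<close>, which are among the generators assumed to lie in \<open>K\<close>.\<close>
  have letter: "comm x (tau w) \<in> K" if x: "x \<in> X" and "w \<in> lists X" "lyndon r w" "length w = n" for x w
  proof -
    have "comm (tau [x]) (tau w) \<in> K"
    proof (rule comm_tau[OF _ _ _ _ sub])
      fix u assume "u \<in> lists X" "lyndon r u" "length u = length [x] + length w"
      then have "vgen (Suc n) u \<in> K" "vgen (Suc n) u = tau u"
        using gens[of u] that tau_carrier[of u] lyndon_not_Nil by (auto simp: lyndon_words_iff vgen_def)
      then show "tau u \<in> K" by simp
    qed (use that K lyndon_letter in auto)
    then show ?thesis by simp
  qed
  have comm_vgen: "comm x (vgen n w) \<in> K" if x: "x \<in> X" and W: "w \<in> lyndon_words X r n" for x w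
  proof (cases "length w = n")
    case True
    then show ?thesis using letter x w[OF W] by (simp add: vgen_def)
  next
    case False
    then have lw: "length w \<le> n - 1" and n2: "2 \<le> n" using w[OF W] by (cases w; simp)+
    then obtain m where m: "n = Suc m" "1 \<le> m" by (cases n) auto
    define h where "h = vgen m w"
    have h: "h \<in> L m" using vgen_mem[of w m] w[OF W] lw m by (simp add: h_def)
    have hp: "vgen n w = h [^] p" using vgen_Suc[of w m] w[OF W] lw m by (simp add: h_def)
    have xc: "x \<in> carrier G" and hc: "h \<in> carrier G" using x X_carrier h F_carrier by auto
    define c where "c = comm h x"
    \<comment> \<open>\<open>[h\<^sup>p, x] = h\<^sup>-\<^sup>p (h c)\<^sup>p\<close>, which is \<open>c\<^sup>p\<close> modulo \<open>K'\<close> since \<open>[c, h] \<in> K'\<close>.\<close>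
    have cL: "c \<in> L n" using F_comm[OF h, of x 1] xc m by (simp add: c_def)
    have cc: "c \<in> carrier G" using F_carrier[OF cL] .
    have n_n: "L (n + n) \<subseteq> L (Suc (Suc n))" using n2 by (intro F_mono) simp
    \<comment> \<open>The p-th powers of all of \<open>L n\<close> are already within reach here,
      since \<open>n >= 2\<close> puts the commutators of \<open>L n\<close> into
      \<open>K\<close>.\<close>
    have "L n \<subseteq> {a \<in> L n. a [^] p \<in> K}"
    proof (rule step.IH)
      show "closed_subgroup {a \<in> L n. a [^] p \<in> K}" "L (Suc n) \<subseteq> {a \<in> L n. a [^] p \<in> K}"
        using pow_closed_subgroup[OF K n] F_comm[of _ n _ n] n_n K(2) by blast+
      show "vgen n u \<in> {a \<in> L n. a [^] p \<in> K}" if U: "u \<in> lyndon_words X r n" for u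
        using w[OF U] vgen_Suc[of u n] by simp
    qed
    then have cp: "c [^] p \<in> K" using cL by blast
    have ch: "comm c h \<in> K'"
    proof -
      have L1: "comm c h \<in> L (Suc n)"
        using F_comm[OF cL h] F_mono[of "Suc n" "n + m"] m by auto
      have "comm c h \<in> K"
      proof (cases "n = 2")
        case False
        then have "Suc (Suc n) \<le> n + m" using m by simp
        then show ?thesis using F_comm[OF cL h] F_mono K(2) by blast
      next
        case True
        then have "m = 1" "length w = 1" using m lw w(3)[OF W] by (cases w; simp)+
        then obtain y where wy: "w = [y]" by (auto simp: length_Suc_conv)
        then have hy: "h = y" "y \<in> X" using \<open>m = 1\<close> w[OF W] by (auto simp: h_def vgen_def)
        \<comment> \<open>For \<open>n = 2\<close> the commutator \<open>[c, h]\<close> lies only in \<open>L 3\<close>; it has the form \<open>[[y, x], y]\<close>.\<close>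
        have two: "comm (tau u) y \<in> K \<and> comm (inv (tau u)) y \<in> K" if "u \<in> lists X" "lyndon r u" "length u = n" for u
        proof -
          have yL: "y \<in> L 1" using hy X_carrier by auto
          have S: "subgroup {g \<in> L n. comm g y \<in> K} G"
            by (rule comm_subgroup_left[OF sub _ yL]) (use K in simp)
          have "tau u \<in> L n" "tau u \<in> carrier G"
            using tau_filtration[of u] tau_carrier[of u] that lyndon_not_Nil by auto
          moreover have "comm (tau u) y \<in> K"
            using letter[OF hy(2) that] comm_swap_mem[OF sub] X_carrier hy(2) \<open>tau u \<in> carrier G\<close> by blast
          ultimately have "tau u \<in> {g \<in> L n. comm g y \<in> K}" by blast
          then show ?thesis using subgroup.m_inv_closed[OF S] by blast
        qed
        consider "x = y" | "lt [x] [y]" | "lt [y] [x]" using lt_linear[of "[x]" "[y]"] x hy by auto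
        then show ?thesis
        proof cases
          case 1
          then show ?thesis using c_def hy xc sub by (simp add: subgroup.one_closed)
        next
          case 2
          have "tau ([x] @ [y]) = comm x y" by (simp only: tau_append[OF std_letter[OF lyndon_letter]] tau_letter)
          moreover have "c = inv (comm x y)" using comm_swap[OF xc hc] by (simp only: c_def hy(1))
          ultimately have "c = inv (tau [x, y])" by simp
          moreover have "lyndon r [x, y]" using lyndon_append[OF lyndon_letter lyndon_letter 2] by simp
          ultimately show ?thesis using two[of "[x, y]"] x hy True by simp
        next
          case 3
          have "tau ([y] @ [x]) = comm y x" by (simp only: tau_append[OF std_letter[OF lyndon_letter]] tau_letter)
          then have "c = tau [y, x]" by (simp add: c_def hy(1))
          moreover have "lyndon r [y, x]" using lyndon_append[OF lyndon_letter lyndon_letter 3] by simp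
          ultimately show ?thesis using two[of "[y, x]"] x hy True by simp
        qed
      qed
      then show ?thesis using L1 by (simp add: K'_def)
    qed
    obtain k where k: "k \<in> K'" "(h \<otimes> c) [^] p = h [^] p \<otimes> c [^] p \<otimes> k"
      using mult_pow_modulo[OF N hc cc ch] by blast
    interpret cx: group_hom G G "\<lambda>h. inv x \<otimes> h \<otimes> x"
      using conj_hom[OF xc] by unfold_locales
    have "inv x \<otimes> h \<otimes> x = h \<otimes> c" unfolding c_def using hc xc by (simp add: word_simps)
    then have "inv x \<otimes> h [^] p \<otimes> x = (h \<otimes> c) [^] p" using cx.hom_nat_pow[OF hc, of p] by simp
    then have "comm (h [^] p) x = inv (h [^] p) \<otimes> (h \<otimes> c) [^] p"
      using hc xc by (simp add: commutator_def m_assoc)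
    also have "\<dots> = c [^] p \<otimes> k"
      using k hc cc subgroup.mem_carrier[OF subK' k(1)] by (simp add: m_assoc cancel_left')
    also have "\<dots> \<in> K" using k(1) cp subgroup.m_closed[OF sub] by (simp add: K'_def)
    finally show ?thesis unfolding hp using comm_swap_mem[OF sub] hc xc by simp
  qed
  \<comment> \<open>From letters to all \<open>g\<close>: for fixed \<open>vgen n u\<close> the
    admissible left factors form a closed subgroup containing \<open>X\<close>, hence everything by
    density. Then the right factor is extended from the generators to \<open>L n\<close>.\<close>
  have comm: "comm g h \<in> K" if g: "g \<in> carrier G" and h: "h \<in> L n" for g h
  proof -
    have K1: "L (Suc (1 + n)) \<subseteq> K" using K by simp
    have "L n \<subseteq> {h \<in> L n. comm g h \<in> K}"
    proof (rule step.IH)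
      show "closed_subgroup {h \<in> L n. comm g h \<in> K}"
        by (rule closed_subgroup_comm_right[OF K(1) K1]) (use g in simp)
      show "L (Suc n) \<subseteq> {h \<in> L n. comm g h \<in> K}"
        by (rule comm_next_right[OF K1]) (use g in simp)
      fix u assume U: "u \<in> lyndon_words X r n"
      have "closed_subgroup {a \<in> L 1. comm a (vgen n u) \<in> K}"
        by (rule closed_subgroup_comm_left[OF K(1) K1 w(7)[OF U]])
      moreover have "X \<subseteq> {a \<in> L 1. comm a (vgen n u) \<in> K}"
        using comm_vgen U X_carrier by auto
      ultimately have "carrier G \<subseteq> {a \<in> L 1. comm a (vgen n u) \<in> K}"
        using closure_generate_minimal X_dense by metis
      then show "vgen n u \<in> {h \<in> L n. comm g h \<in> K}" using g w(7)[OF U] by auto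
    qed
    then show ?thesis using h by blast
  qed
  have "L n \<subseteq> {h \<in> L n. h [^] p \<in> K}"
  proof (rule step.IH)
    show "closed_subgroup {a \<in> L n. a [^] p \<in> K}" "L (Suc n) \<subseteq> {a \<in> L n. a [^] p \<in> K}"
      using pow_closed_subgroup[OF K n] comm F_carrier by blast+
    show "vgen n u \<in> {a \<in> L n. a [^] p \<in> K}" if U: "u \<in> lyndon_words X r n" for u
      using w[OF U] vgen_Suc[of u n] by simp
  qed
  then have pow: "h [^] p \<in> K" if "h \<in> L n" for h using that by blast
  obtain m where "n = Suc m" using n by (cases n) auto
  then show ?case using L_minimal[OF K(1), of m] pow comm by simp
qed

end

section \<open>Locally constant functions\<close>

text \<open>Continuity into a discrete space without a named codomain, so that it passes to
  compositions with arbitrary functions.\<close>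

definition loc_const :: "'z topology \<Rightarrow> ('z \<Rightarrow> 'k) \<Rightarrow> bool" where
  "loc_const Z f \<longleftrightarrow> (\<forall>k. openin Z {z \<in> topspace Z. f z = k})"

lemma loc_const_open: "loc_const Z f \<Longrightarrow> openin Z {z \<in> topspace Z. P (f z)}"
proof -
  assume "loc_const Z f"
  then have "openin Z (\<Union>k\<in>Collect P. {z \<in> topspace Z. f z = k})"
    by (intro openin_Union) (auto simp: loc_const_def)
  moreover have "(\<Union>k\<in>Collect P. {z \<in> topspace Z. f z = k}) = {z \<in> topspace Z. P (f z)}" by auto
  ultimately show ?thesis by simp
qed

lemma loc_const_closed: "loc_const Z f \<Longrightarrow> closedin Z {z \<in> topspace Z. P (f z)}"
proof -
  assume "loc_const Z f"
  then have "openin Z {z \<in> topspace Z. \<not> P (f z)}" by (rule loc_const_open)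
  moreover have "topspace Z - {z \<in> topspace Z. P (f z)} = {z \<in> topspace Z. \<not> P (f z)}" by auto
  ultimately show ?thesis by (simp add: closedin_def)
qed

lemma loc_const_const: "loc_const Z (\<lambda>z. c)"
proof -
  have "{z \<in> topspace Z. c = k} = (if c = k then topspace Z else {})" for k by auto
  then show ?thesis by (simp add: loc_const_def)
qed

lemma loc_const_comp: "loc_const Z f \<Longrightarrow> loc_const Z (\<lambda>z. h (f z))"
  unfolding loc_const_def[of Z "\<lambda>z. h (f z)"] using loc_const_open[of Z f] by auto

lemma loc_const_Pair: "loc_const Z f \<Longrightarrow> loc_const Z g \<Longrightarrow> loc_const Z (\<lambda>z. (f z, g z))"
  unfolding loc_const_def[of Z "\<lambda>z. (f z, g z)"]
proof
  fix k assume "loc_const Z f" "loc_const Z g"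
  then have "openin Z ({z \<in> topspace Z. f z = fst k} \<inter> {z \<in> topspace Z. g z = snd k})"
    by (intro openin_Int) (auto simp: loc_const_def)
  moreover have "{z \<in> topspace Z. f z = fst k} \<inter> {z \<in> topspace Z. g z = snd k} = {z \<in> topspace Z. (f z, g z) = k}"
    by auto
  ultimately show "openin Z {z \<in> topspace Z. (f z, g z) = k}" by simp
qed

lemma loc_const_comp2: "loc_const Z f \<Longrightarrow> loc_const Z g \<Longrightarrow> loc_const Z (\<lambda>z. h (f z) (g z))"
  using loc_const_comp[OF loc_const_Pair, of Z f g "\<lambda>(a, b). h a b"] by simp

lemma loc_const_sum:
  "finite I \<Longrightarrow> (\<And>i. i \<in> I \<Longrightarrow> loc_const Z (f i)) \<Longrightarrow> loc_const Z (\<lambda>z. \<Sum>i\<in>I. f i z)"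
  by (induction I rule: finite_induct) (auto intro: loc_const_const loc_const_comp2[of _ _ _ "(+)"])

lemma loc_const_compose: "continuous_map Y Z g \<Longrightarrow> loc_const Z f \<Longrightarrow> loc_const Y (\<lambda>y. f (g y))"
  unfolding loc_const_def
proof
  fix k assume g: "continuous_map Y Z g" and f: "\<forall>k. openin Z {z \<in> topspace Z. f z = k}"
  have "openin Y {y \<in> topspace Y. g y \<in> {z \<in> topspace Z. f z = k}}"
    using openin_continuous_map_preimage[OF g] f by blast
  moreover have "{y \<in> topspace Y. g y \<in> {z \<in> topspace Z. f z = k}} = {y \<in> topspace Y. f (g y) = k}"
    using continuous_map_funspace[OF g] by auto
  ultimately show "openin Y {y \<in> topspace Y. f (g y) = k}" by simp
qed

lemma continuous_map_discrete_iff: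
  "continuous_map Z (discrete_topology A) f \<longleftrightarrow> f \<in> topspace Z \<rightarrow> A \<and> loc_const Z f"
proof
  assume c: "continuous_map Z (discrete_topology A) f"
  then have "f \<in> topspace Z \<rightarrow> A" using continuous_map_funspace by fastforce
  moreover have "loc_const Z f"
    unfolding loc_const_def
  proof
    fix k
    have "openin Z {z \<in> topspace Z. f z \<in> {k} \<inter> A}"
      by (rule openin_continuous_map_preimage[OF c]) simp
    moreover have "{z \<in> topspace Z. f z \<in> {k} \<inter> A} = {z \<in> topspace Z. f z = k}"
      using \<open>f \<in> topspace Z \<rightarrow> A\<close> by auto
    ultimately show "openin Z {z \<in> topspace Z. f z = k}" by simp
  qed
  ultimately show "f \<in> topspace Z \<rightarrow> A \<and> loc_const Z f" by simp
next
  assume "f \<in> topspace Z \<rightarrow> A \<and> loc_const Z f"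
  then show "continuous_map Z (discrete_topology A) f"
    unfolding continuous_map_def using loc_const_open[of Z f "\<lambda>x. x \<in> _"] by auto
qed

section \<open>Profinite groups\<close>

text \<open>Separation puts every nontrivial point outside some open normal subgroup, so
  \<open>W\<close> and the complements of these subgroups cover the group. By compactness finitely
  many suffice, and the intersection of the corresponding subgroups lies inside
  \<open>W\<close>.\<close>

lemma profinite_open_normal_nbhd:
  fixes G (structure)
  assumes prof: "profinite_group G T" and W: "openin T W" "\<one>\<^bsub>G\<^esub> \<in> W"
  obtains N where "N \<lhd> G" "openin T N" "N \<subseteq> W"
proof -
  have tg: "topological_group G T" and comp: "compact_space T" and top: "topspace T = carrier G"
    using prof by (auto simp: profinite_group_def topological_group_def)
  interpret group G using tg by (simp add: topological_group_def)
  define \<N> where "\<N> = {N. N \<lhd> G \<and> openin T N}"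
  have closed: "closedin T N" if "N \<in> \<N>" for N
  proof -
    have N: "N \<lhd> G" "openin T N" using that by (auto simp: \<N>_def)
    then have "subgroup N G" by (simp add: normal_def)
    then have "N = N #> \<one>" using subgroup.subset by (metis coset_mult_one)
    then have "N \<in> rcosets N" by (auto simp: RCOSETS_def)
    then show ?thesis using closed_coset[OF tg N] by blast
  qed
  let ?\<U> = "insert W ((\<lambda>N. topspace T - N) ` \<N>)"
  have "topspace T \<subseteq> \<Union>?\<U>"
  proof
    fix x assume x: "x \<in> topspace T"
    show "x \<in> \<Union>?\<U>"
    proof (cases "x = \<one>")
      case False
      then obtain N where "N \<lhd> G" "openin T N" "x \<notin> N"
        using profinite_separation[OF prof, of x] x top by blast
      then show ?thesis using x by (auto simp: \<N>_def)
    qed (use W in simp)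
  qed
  moreover have "\<forall>U\<in>?\<U>. openin T U" using W closed by (auto intro: openin_diff)
  ultimately obtain \<F> where F: "finite \<F>" "\<F> \<subseteq> ?\<U>" "topspace T \<subseteq> \<Union>\<F>"
    using comp[unfolded compact_space_alt] by meson
  then have "finite (\<F> - {W})" "\<F> - {W} \<subseteq> (\<lambda>N. topspace T - N) ` \<N>" by auto
  then obtain \<M> where M: "finite \<M>" "\<M> \<subseteq> \<N>" "\<F> - {W} = (\<lambda>N. topspace T - N) ` \<M>"
    by (meson finite_subset_image)
  have inN: "carrier G \<in> \<N>"
    using subgroup_self openin_topspace[of T] by (auto simp: \<N>_def normal_inv_iff top)
  have "\<exists>N\<in>\<N>. N \<subseteq> \<Inter>\<M>"
    using M(1,2)
  proof (induction rule: finite_induct)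
    case empty
    then show ?case using inN by auto
  next
    case (insert A \<M>)
    then obtain N where "N \<in> \<N>" "N \<subseteq> \<Inter>\<M>" by auto
    moreover have "A \<in> \<N>" using insert by simp
    ultimately have "A \<inter> N \<in> \<N>" "A \<inter> N \<subseteq> \<Inter>(insert A \<M>)"
      using normal_subgroup_intersect[of A N] by (auto simp: \<N>_def)
    then show ?case by blast
  qed
  then obtain N where N: "N \<in> \<N>" "N \<subseteq> \<Inter>\<M>" by blast
  have "N \<subseteq> W"
  proof
    fix x assume x: "x \<in> N"
    then have "x \<in> topspace T" using N closedin_subset[OF closed] by blast
    then obtain U where "U \<in> \<F>" "x \<in> U" using F by blast
    then show "x \<in> W" using M(3) N x by blast
  qed
  then show ?thesis using that N by (auto simp: \<N>_def)
qed

text \<open>The pairs of a unit and its inverse form a closed subset of the product of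
  \<open>T\<close> with itself, and projections along a compact factor are closed maps. This shows
  both that the units are closed and that inversion is continuous.\<close>

lemma profinite_units:
  fixes M (structure)
  assumes mon: "monoid M" and top: "topspace T = carrier M"
    and mult: "continuous_map (prod_topology T T) T (\<lambda>(x, y). x \<otimes> y)"
    and comp: "compact_space T" and hd: "Hausdorff_space T"
    and td: "\<And>C. connectedin T C \<Longrightarrow> \<exists>x. C \<subseteq> {x}"
  shows "profinite_group (units_of M) (subtopology T (Units M))"
proof -
  interpret monoid M by fact
  let ?U = "Units M"
  let ?T = "subtopology T ?U"
  have UM: "?U \<subseteq> carrier M" using Units_closed by blast
  have topU: "topspace ?T = ?U" using UM top by auto
  have car: "carrier (units_of M) = ?U" by (simp add: units_of_carrier)
  define P where "P = {z \<in> topspace (prod_topology T T). fst z \<otimes> snd z = \<one> \<and> snd z \<otimes> fst z = \<one>}"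
  have one: "closedin T {\<one>}" using closedin_Hausdorff_singleton[OF hd] top by simp
  have mult': "continuous_map (prod_topology T T) T (\<lambda>z. fst z \<otimes> snd z)"
    using mult by (simp add: case_prod_beta')
  have sw: "continuous_map (prod_topology T T) (prod_topology T T) (\<lambda>z. (snd z, fst z))"
    by (intro continuous_intros)
  have mult2: "continuous_map (prod_topology T T) T (\<lambda>z. snd z \<otimes> fst z)"
    using continuous_map_compose[OF sw mult'] by (simp add: o_def)
  have P: "closedin (prod_topology T T) P"
  proof -
    have "P = {z \<in> topspace (prod_topology T T). fst z \<otimes> snd z \<in> {\<one>}} \<inter>
        {z \<in> topspace (prod_topology T T). snd z \<otimes> fst z \<in> {\<one>}}"
      by (auto simp: P_def)
    with closedin_Int[OF closedin_continuous_map_preimage[OF mult' one]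
        closedin_continuous_map_preimage[OF mult2 one]]
    show ?thesis by (simp only:)
  qed
  have compT: "compact_space (prod_topology T T)" using comp by (simp add: compact_space_prod_topology)
  have proj: "closedin T (fst ` Q)" if "closedin (prod_topology T T) Q" for Q
    using closed_map_fst[OF comp, of T] that unfolding closed_map_def by blast
  have Punit: "z \<in> P \<longleftrightarrow> fst z \<in> ?U \<and> snd z = inv (fst z)" for z
  proof
    assume "z \<in> P"
    then have z: "fst z \<in> carrier M" "snd z \<in> carrier M" "fst z \<otimes> snd z = \<one>" "snd z \<otimes> fst z = \<one>"
      by (auto simp: P_def top)
    then have "fst z \<in> ?U" by (auto simp: Units_def)
    then show "fst z \<in> ?U \<and> snd z = inv (fst z)" using z inv_unique' by metis
  next
    assume "fst z \<in> ?U \<and> snd z = inv (fst z)"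
    then show "z \<in> P" by (cases z) (auto simp: P_def top)
  qed
  have "fst ` P = ?U"
  proof
    show "fst ` P \<subseteq> ?U" using Punit by auto
    show "?U \<subseteq> fst ` P"
    proof
      fix u assume "u \<in> ?U"
      then have "(u, inv u) \<in> P" using Punit by simp
      then show "u \<in> fst ` P" by force
    qed
  qed
  then have Ucl: "closedin T ?U" using proj[OF P] by simp
  have "compact_space ?T"
    using closedin_compact_space[OF comp Ucl] by (simp add: compact_space_subtopology)
  moreover have "Hausdorff_space ?T" using hd by (rule Hausdorff_space_subtopology)
  moreover have "\<exists>x. C \<subseteq> {x}" if "connectedin ?T C" for C
    using td that by (simp add: connectedin_subtopology)
  moreover have "topological_group (units_of M) ?T"
    unfolding topological_group_def
  proof (intro conjI)
    show "Group.group (units_of M)" by (rule units_group)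
    show "topspace ?T = carrier (units_of M)" using topU car by simp
    have "prod_topology ?T ?T = subtopology (prod_topology T T) (?U \<times> ?U)"
      by (simp add: subtopology_Times)
    then show "continuous_map (prod_topology ?T ?T) ?T (\<lambda>(x, y). x \<otimes>\<^bsub>units_of M\<^esub> y)"
      using mult by (auto simp: continuous_map_in_subtopology units_of_mult continuous_map_from_subtopology)
    show "continuous_map ?T ?T (\<lambda>x. inv\<^bsub>units_of M\<^esub> x)"
      unfolding continuous_map_closedin topU
    proof (intro conjI allI impI)
      show "(\<lambda>x. inv\<^bsub>units_of M\<^esub> x) \<in> ?U \<rightarrow> ?U" using units_of_inv by auto
      fix C assume "closedin ?T C"
      then have C: "closedin T C" "C \<subseteq> ?U"
        using closedin_trans_full[OF _ Ucl] closedin_subset[of ?T C] topU by auto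
      let ?Q = "P \<inter> {z \<in> topspace (prod_topology T T). snd z \<in> C}"
      have "closedin (prod_topology T T) ?Q"
        by (intro closedin_Int P closedin_continuous_map_preimage[OF continuous_map_snd C(1)])
      then have "closedin T (fst ` ?Q)" by (rule proj)
      moreover have "fst ` ?Q = {x \<in> ?U. inv\<^bsub>units_of M\<^esub> x \<in> C}"
      proof (intro equalityI subsetI)
        fix x assume "x \<in> fst ` ?Q"
        then show "x \<in> {x \<in> ?U. inv\<^bsub>units_of M\<^esub> x \<in> C}" using Punit units_of_inv by auto
      next
        fix x assume "x \<in> {x \<in> ?U. inv\<^bsub>units_of M\<^esub> x \<in> C}"
        then have "(x, inv x) \<in> ?Q" using Punit[of "(x, inv x)"] units_of_inv top by auto
        then show "x \<in> fst ` ?Q" by force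
      qed
      ultimately show "closedin ?T {x \<in> ?U. inv\<^bsub>units_of M\<^esub> x \<in> C}"
        using closedin_subset_topspace[of T "{x \<in> ?U. inv\<^bsub>units_of M\<^esub> x \<in> C}" ?U] by auto
    qed
  qed
  ultimately show ?thesis by (simp add: profinite_group_def)
qed

section \<open>The Magnus homomorphism\<close>

text \<open>The Cauchy product with integer coefficients. Reduction modulo \<open>m\<close> and
  restriction to \<open>lists X\<close> are postponed, which makes recursion on the first or the
  last letter possible.\<close>

definition conv :: "('x list \<Rightarrow> int) \<Rightarrow> ('x list \<Rightarrow> int) \<Rightarrow> 'x list \<Rightarrow> int" where
  "conv f g w = (\<Sum>i\<le>length w. f (take i w) * g (drop i w))"

lemma conv_Nil [simp]: "conv f g [] = f [] * g []"
  by (simp add: conv_def)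

lemma conv_Cons: "conv f g (x # w) = f [] * g (x # w) + conv (\<lambda>u. f (x # u)) g w"
  unfolding conv_def by (simp add: sum.atMost_Suc_shift del: sum.atMost_Suc)

lemma conv_snoc: "conv f g (w @ [x]) = conv f (\<lambda>u. g (u @ [x])) w + f (w @ [x]) * g []"
  unfolding conv_def by simp

lemma conv_linear: "conv (\<lambda>u. c * f u + f' u) g w = c * conv f g w + conv f' g w"
  by (simp add: conv_def sum_distrib_left sum.distrib algebra_simps)

lemma conv_assoc: "conv (conv f g) h w = conv f (conv g h) w"
proof (induction w arbitrary: f)
  case (Cons x w)
  then show ?case
    by (simp add: conv_Cons conv_linear algebra_simps)
qed simp

lemma conv_zero_left: "(\<And>u. f u = 0) \<Longrightarrow> conv f g w = 0"
  by (simp add: conv_def)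

lemma conv_zero_right: "(\<And>u. g u = 0) \<Longrightarrow> conv f g w = 0"
  by (simp add: conv_def)

lemma conv_one_left: "conv (\<lambda>w. if w = [] then 1 else 0) g w = g w"
  by (cases w) (simp_all add: conv_Cons conv_zero_left)

lemma conv_one_right: "conv f (\<lambda>w. if w = [] then 1 else 0) w = f w"
  by (cases w rule: rev_cases) (simp_all add: conv_snoc conv_zero_right)

lemma conv_mod_cong:
  assumes "\<And>u v. w = u @ v \<Longrightarrow> f u mod m = f' u mod m"
    and "\<And>u v. w = u @ v \<Longrightarrow> g v mod m = g' v mod m"
  shows "conv f g w mod m = conv f' g' w mod m"
proof -
  have "(f (take i w) * g (drop i w)) mod m = (f' (take i w) * g' (drop i w)) mod m" for i
    using assms[of "take i w" "drop i w"] by (metis append_take_drop_id mod_mult_cong)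
  then show ?thesis unfolding conv_def by (metis (mono_tags, lifting) mod_sum_eq sum.cong)
qed

section \<open>The ring of non-commuting power series and its profinite unit group\<close>

locale nc_series_mod =
  fixes m :: int and X :: "'x set"
  assumes m_gt_1: "1 < m"
begin

abbreviation R where "R \<equiv> nc_series m X"

lemma carrier_R: "f \<in> carrier R \<longleftrightarrow> f \<in> lists X \<rightarrow>\<^sub>E {0..m - 1}"
  by (simp add: nc_series_def)

lemma mult_R: "f \<otimes>\<^bsub>R\<^esub> g = (\<lambda>w \<in> lists X. conv f g w mod m)"
  by (simp add: nc_series_def conv_def)

lemma one_R: "\<one>\<^bsub>R\<^esub> = (\<lambda>w \<in> lists X. if w = [] then 1 else 0)"
  by (simp add: nc_series_def)

lemma restrict_R: "(\<lambda>w \<in> lists X. f w mod m) \<in> carrier R"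
  using m_gt_1 by (auto simp: carrier_R)

lemma R_mod: "f \<in> carrier R \<Longrightarrow> w \<in> lists X \<Longrightarrow> f w mod m = f w"
  using m_gt_1 by (auto simp: carrier_R PiE_iff)

lemma R_eqI: "f \<in> carrier R \<Longrightarrow> g \<in> carrier R \<Longrightarrow> (\<And>w. w \<in> lists X \<Longrightarrow> f w mod m = g w mod m) \<Longrightarrow> f = g"
  using R_mod unfolding carrier_R by (metis PiE_ext)

lemma conv_restrict_left: "w \<in> lists X \<Longrightarrow> conv (\<lambda>w \<in> lists X. f w mod m) g w mod m = conv f g w mod m"
  and conv_restrict_right: "w \<in> lists X \<Longrightarrow> conv f (\<lambda>w \<in> lists X. g w mod m) w mod m = conv f g w mod m"
  by (rule conv_mod_cong; auto)+

lemma one_R': "\<one>\<^bsub>R\<^esub> = (\<lambda>w \<in> lists X. (if w = [] then 1 else 0) mod m)"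
  using m_gt_1 by (auto simp: one_R)

lemma monoid_R: "monoid R"
proof (rule monoidI)
  fix f g assume fg: "f \<in> carrier R" "g \<in> carrier R"
  show "f \<otimes>\<^bsub>R\<^esub> g \<in> carrier R" unfolding mult_R by (rule restrict_R)
next
  show "\<one>\<^bsub>R\<^esub> \<in> carrier R" unfolding one_R' by (rule restrict_R)
next
  fix f g h assume "f \<in> carrier R" "g \<in> carrier R" "h \<in> carrier R"
  show "f \<otimes>\<^bsub>R\<^esub> g \<otimes>\<^bsub>R\<^esub> h = f \<otimes>\<^bsub>R\<^esub> (g \<otimes>\<^bsub>R\<^esub> h)"
    unfolding mult_R by (rule restrict_ext) (simp add: conv_restrict_left conv_restrict_right conv_assoc)
next
  fix f assume f: "f \<in> carrier R"
  show "\<one>\<^bsub>R\<^esub> \<otimes>\<^bsub>R\<^esub> f = f"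
    by (rule R_eqI) (use f restrict_R in \<open>auto simp: mult_R one_R' conv_restrict_left conv_one_left\<close>)
  show "f \<otimes>\<^bsub>R\<^esub> \<one>\<^bsub>R\<^esub> = f"
    by (rule R_eqI) (use f restrict_R in \<open>auto simp: mult_R one_R' conv_restrict_right conv_one_right\<close>)
qed

definition gen :: "'x \<Rightarrow> 'x list \<Rightarrow> int" where
  "gen x = (\<lambda>w \<in> lists X. (if w = [] \<or> w = [x] then 1 else 0) mod m)"

lemma gen_eq: "\<one>\<^bsub>R\<^esub> \<oplus>\<^bsub>R\<^esub> nc_var X x = gen x"
  by (auto simp: nc_series_def nc_var_def gen_def intro!: restrict_ext)

lemma gen_unit: "gen x \<in> Units R"
proof -
  let ?a = "\<lambda>w. if w = [] \<or> w = [x] then 1 else 0 :: int"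
  \<comment> \<open>The geometric series: the inverse of \<open>1 + x\<close> is the alternating sum
    of the powers of \<open>x\<close>.\<close>
  let ?b = "\<lambda>w. if set w \<subseteq> {x} then (- 1) ^ length w else 0 :: int"
  have a: "(\<lambda>u. ?a (y # u)) = (if y = x then (\<lambda>u. if u = [] then 1 else 0) else (\<lambda>u. 0))"
     "(\<lambda>u. ?a (u @ [y])) = (if y = x then (\<lambda>u. if u = [] then 1 else 0) else (\<lambda>u. 0))" for y
    by (auto simp: fun_eq_iff)
  have 1: "conv ?a ?b w = (if w = [] then 1 else 0)" for w
    by (cases w) (simp_all only: conv_Cons a, simp_all add: conv_one_left conv_zero_left)
  have 2: "conv ?b ?a w = (if w = [] then 1 else 0)" for w
    by (cases w rule: rev_cases) (simp_all only: conv_snoc a, simp_all add: conv_one_right conv_zero_right)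
  let ?g = "\<lambda>w \<in> lists X. ?b w mod m"
  have "gen x \<otimes>\<^bsub>R\<^esub> ?g = \<one>\<^bsub>R\<^esub>" "?g \<otimes>\<^bsub>R\<^esub> gen x = \<one>\<^bsub>R\<^esub>"
    unfolding mult_R gen_def one_R'
    by (rule restrict_ext, simp only: conv_restrict_left conv_restrict_right 1 2)+
  moreover have "gen x \<in> carrier R" "?g \<in> carrier R" unfolding gen_def by (rule restrict_R)+
  ultimately show ?thesis unfolding Units_def by blast
qed

abbreviation TR where "TR \<equiv> nc_series_topology m X"

lemma topspace_TR: "topspace TR = carrier R"
  by (simp add: nc_series_topology_def nc_series_def)

lemma loc_const_coord: "w \<in> lists X \<Longrightarrow> loc_const TR (\<lambda>f. f w)"
  using continuous_map_product_projection[of w "lists X" "\<lambda>_. discrete_topology {0..m - 1}"]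
  by (simp add: nc_series_topology_def continuous_map_discrete_iff)

lemma mult_continuous: "continuous_map (prod_topology TR TR) TR (\<lambda>(f, g). f \<otimes>\<^bsub>R\<^esub> g)"
proof -
  have lc: "loc_const (prod_topology TR TR) (\<lambda>z. (fst z \<otimes>\<^bsub>R\<^esub> snd z) w)" if w: "w \<in> lists X" for w
  proof -
    have wi: "take i w \<in> lists X" "drop i w \<in> lists X" for i
      using w by (auto dest: in_set_takeD in_set_dropD)
    have "loc_const (prod_topology TR TR) (\<lambda>z. conv (fst z) (snd z) w mod m)"
      unfolding conv_def
      by (intro loc_const_comp[where h = "\<lambda>k. k mod m"] loc_const_sum loc_const_comp2[where h = "(*)"]
          loc_const_compose[OF continuous_map_fst loc_const_coord[OF wi(1)]]
          loc_const_compose[OF continuous_map_snd loc_const_coord[OF wi(2)]]) simp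
    then show ?thesis using w by (simp add: mult_R)
  qed
  show ?thesis
    unfolding nc_series_topology_def continuous_map_componentwise
    unfolding nc_series_topology_def[symmetric]
  proof (intro conjI ballI)
    show "(\<lambda>(f, g). f \<otimes>\<^bsub>R\<^esub> g) ` topspace (prod_topology TR TR) \<subseteq> extensional (lists X)"
      by (auto simp: mult_R)
    show "continuous_map (prod_topology TR TR) (discrete_topology {0..m - 1}) (\<lambda>z. (case z of (f, g) \<Rightarrow> f \<otimes>\<^bsub>R\<^esub> g) w)"
      if "w \<in> lists X" for w
      unfolding continuous_map_discrete_iff using lc[OF that] m_gt_1 that by (auto simp: case_prod_beta' mult_R)
  qed
qed

lemma profinite_units_R: "profinite_group (units_of R) (subtopology TR (Units R))"
proof (rule profinite_units[OF monoid_R topspace_TR mult_continuous])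
  show "compact_space TR" "Hausdorff_space TR"
    by (auto simp: nc_series_topology_def compact_space_product_topology Hausdorff_space_product_topology
        compact_space_discrete_topology)
  fix C assume C: "connectedin TR C"
  have "f = g" if fg: "f \<in> C" "g \<in> C" for f g
  proof -
    have CR: "C \<subseteq> carrier R" using connectedin_subset_topspace[OF C] topspace_TR by simp
    have "f w = g w" if w: "w \<in> lists X" for w
    proof -
      have "continuous_map TR (discrete_topology {0..m - 1}) (\<lambda>f. f w)"
        using continuous_map_product_projection[of w "lists X" "\<lambda>_. discrete_topology {0..m - 1}"] w
        by (simp add: nc_series_topology_def)
      then have "connectedin (discrete_topology {0..m - 1}) ((\<lambda>f. f w) ` C)"
        using C by (rule connectedin_continuous_map_image)
      then show ?thesis using fg by (auto simp: connectedin_discrete_topology)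
    qed
    then show ?thesis by (intro R_eqI) (use CR fg in auto)
  qed
  then have "C \<subseteq> {SOME f. f \<in> C}" by (intro subsetI) (metis singleton_iff someI)
  then show "\<exists>x. C \<subseteq> {x}" by (rule exI[where x = "SOME f. f \<in> C"])
qed

text \<open>A basic neighbourhood of 1 restricts only finitely many coefficients, and
  \<open>1 + x\<close> differs from 1 only at the one-letter word \<open>[x]\<close>.\<close>

lemma gen_converges: "converges_to_1 X gen (units_of R) (subtopology TR (Units R))"
  unfolding converges_to_1_def
proof (intro conjI allI impI)
  show "gen \<in> X \<rightarrow> carrier (units_of R)" using gen_unit by (auto simp: units_of_carrier)
  fix N assume N: "N \<lhd> units_of R \<and> openin (subtopology TR (Units R)) N"
  then have "\<one>\<^bsub>units_of R\<^esub> \<in> N" by (meson normal_def subgroup.one_closed)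
  then have 1: "\<one>\<^bsub>R\<^esub> \<in> N" by (simp add: units_of_one)
  obtain V where V: "openin TR V" "N = V \<inter> Units R" using N by (auto simp: openin_subtopology)
  from V 1 have "\<one>\<^bsub>R\<^esub> \<in> V" by simp
  from bspec[OF V(1)[unfolded nc_series_topology_def openin_product_topology_alt] this]
  obtain B where B: "finite {w \<in> lists X. B w \<noteq> topspace (discrete_topology {0..m - 1})}"
    "\<one>\<^bsub>R\<^esub> \<in> PiE (lists X) B" "PiE (lists X) B \<subseteq> V"
    by (elim exE conjE)
  have "gen x \<in> N" if "x \<in> X" "B [x] = topspace (discrete_topology {0..m - 1})" for x
  proof -
    have "gen x w \<in> B w" if w: "w \<in> lists X" for w
    proof (cases "w = [x]")
      case True
      then show ?thesis using \<open>B [x] = _\<close> m_gt_1 w by (simp add: gen_def)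
    next
      case False
      then have "gen x w = \<one>\<^bsub>R\<^esub> w" using w by (simp add: gen_def one_R')
      then show ?thesis using B(2) w by (simp add: PiE_mem)
    qed
    then have "gen x \<in> PiE (lists X) B" by (auto simp: gen_def)
    then show ?thesis using B(3) V gen_unit by blast
  qed
  then have "(\<lambda>x. [x]) ` {x \<in> X. gen x \<notin> N} \<subseteq> {w \<in> lists X. B w \<noteq> topspace (discrete_topology {0..m - 1})}"
    by auto
  then have "finite ((\<lambda>x. [x]) ` {x \<in> X. gen x \<notin> N})" using B(1) finite_subset by blast
  then show "finite {x \<in> X. gen x \<notin> N}" by (rule finite_imageD) (auto simp: inj_on_def)
qed

end

locale magnus_expansion = nc_series_mod m X + S: topological_grp S T p
  for m :: int and X :: "'a set" and S :: "('a, 'm) monoid_scheme" and T and p +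
  assumes free: "free_profinite_group S T X"
begin

abbreviation eps :: "'a list \<Rightarrow> 'a \<Rightarrow> int" where "eps w \<sigma> \<equiv> magnus_coeff S T X w m \<sigma>"

text \<open>The unit group of the series ring is profinite and the elements \<open>1 + x\<close>
  converge to 1, so the universal property for targets of arbitrary type shows that the definite
  description in \<open>magnus\<close> denotes.\<close>

lemma magnus_hom:
  "magnus m S T X \<in> continuous_hom S T (units_of R) (subtopology TR (Units R))"
  and magnus_gen: "x \<in> X \<Longrightarrow> magnus m S T X x = gen x"
proof -
  have "free_extension_property TYPE('a list \<Rightarrow> int) S T X"
    by (rule free_profinite_group_universal[OF free])
  then have "\<exists>!f. f \<in> continuous_hom S T (units_of R) (subtopology TR (Units R)) \<and> (\<forall>x\<in>X. f x = gen x)"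
    unfolding free_extension_property_def
    by (elim allE impE) (rule conjI[OF profinite_units_R gen_converges])
  from theI'[OF this] have *: "magnus m S T X \<in> continuous_hom S T (units_of R) (subtopology TR (Units R)) \<and>
     (\<forall>x\<in>X. magnus m S T X x = gen x)"
    unfolding magnus_def gen_eq .
  then show "magnus m S T X \<in> continuous_hom S T (units_of R) (subtopology TR (Units R))"
    "x \<in> X \<Longrightarrow> magnus m S T X x = gen x" by blast+
qed

lemma X_subset: "X \<subseteq> carrier S" and X_dense: "T closure_of (generate S X) = carrier S"
  using free by (auto simp: free_profinite_group_def)

lemma magnus_hom': "magnus m S T X \<in> hom S (units_of R)"
  using magnus_hom unfolding continuous_hom_def by blast

lemma magnus_R: "\<sigma> \<in> carrier S \<Longrightarrow> magnus m S T X \<sigma> \<in> carrier R"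
  using hom_in_carrier[OF magnus_hom'] monoid.Units_closed[OF monoid_R]
  by (simp add: units_of_carrier)

lemma eps_range: "\<sigma> \<in> carrier S \<Longrightarrow> w \<in> lists X \<Longrightarrow> eps w \<sigma> \<in> {0..m - 1}"
  using magnus_R by (auto simp: magnus_coeff_def carrier_R PiE_iff)

lemma eps_mod: "\<sigma> \<in> carrier S \<Longrightarrow> w \<in> lists X \<Longrightarrow> eps w \<sigma> mod m = eps w \<sigma>"
  using eps_range[of \<sigma> w] by simp

lemma eps_mult:
  assumes "\<sigma> \<in> carrier S" "\<tau> \<in> carrier S" "w \<in> lists X"
  shows "eps w (\<sigma> \<otimes>\<^bsub>S\<^esub> \<tau>) = conv (\<lambda>u. eps u \<sigma>) (\<lambda>u. eps u \<tau>) w mod m"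
proof -
  have "magnus m S T X (\<sigma> \<otimes>\<^bsub>S\<^esub> \<tau>) = magnus m S T X \<sigma> \<otimes>\<^bsub>R\<^esub> magnus m S T X \<tau>"
    using hom_mult[OF magnus_hom' assms(1,2)] by (simp add: units_of_mult)
  then show ?thesis using assms(3) by (simp add: magnus_coeff_def mult_R)
qed

lemma eps_one:
  assumes "w \<in> lists X" shows "eps w \<one>\<^bsub>S\<^esub> = (if w = [] then 1 else 0)"
proof -
  have "magnus m S T X \<one>\<^bsub>S\<^esub> = \<one>\<^bsub>units_of R\<^esub>"
    by (rule hom_one[OF magnus_hom' S.is_group monoid.units_group[OF monoid_R]])
  then show ?thesis using assms by (simp add: magnus_coeff_def units_of_one one_R)
qed

lemma eps_letter:
  "x \<in> X \<Longrightarrow> w \<in> lists X \<Longrightarrow> eps w x = (if w = [] \<or> w = [x] then 1 else 0)"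
  using magnus_gen m_gt_1 by (simp add: magnus_coeff_def gen_def)

lemma eps_loc_const:
  assumes "w \<in> lists X" shows "loc_const T (\<lambda>\<sigma>. eps w \<sigma>)"
proof -
  have "continuous_map T TR (magnus m S T X)"
    using magnus_hom unfolding continuous_hom_def continuous_map_in_subtopology by blast
  then show ?thesis unfolding magnus_coeff_def by (rule loc_const_compose[OF _ loc_const_coord[OF assms]])
qed

text \<open>The constant term is multiplicative and locally constant, so the elements with constant
  term 1 form a closed subgroup; it contains \<open>X\<close>.\<close>

lemma eps_Nil: "\<sigma> \<in> carrier S \<Longrightarrow> eps [] \<sigma> = 1"
proof -
  assume \<sigma>: "\<sigma> \<in> carrier S"
  let ?K = "{\<sigma> \<in> carrier S. eps [] \<sigma> = 1}"
  have mult: "eps [] (\<sigma> \<otimes>\<^bsub>S\<^esub> \<tau>) = eps [] \<sigma> * eps [] \<tau> mod m" if "\<sigma> \<in> carrier S" "\<tau> \<in> carrier S" for \<sigma> \<tau>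
    using eps_mult[OF that, of "[]"] by simp
  have "subgroup ?K S"
  proof (rule S.subgroupI)
    show "?K \<noteq> {}" using eps_one[of "[]"] by auto
  next
    fix a assume a: "a \<in> ?K"
    then have "eps [] (a \<otimes>\<^bsub>S\<^esub> inv\<^bsub>S\<^esub> a) = eps [] (inv\<^bsub>S\<^esub> a) mod m" using mult[of a "inv\<^bsub>S\<^esub> a"] by simp
    then show "inv\<^bsub>S\<^esub> a \<in> ?K" using a eps_one[of "[]"] eps_mod[of "inv\<^bsub>S\<^esub> a" "[]"] by simp
  next
    fix a b assume "a \<in> ?K" "b \<in> ?K"
    then show "a \<otimes>\<^bsub>S\<^esub> b \<in> ?K" using mult[of a b] m_gt_1 by simp
  qed auto
  moreover have "closedin T ?K"
    using loc_const_closed[OF eps_loc_const, of "[]" "\<lambda>k. k = 1"] S.topspace_carrier by simp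
  moreover have "X \<subseteq> ?K" using X_subset eps_letter[of _ "[]"] by auto
  ultimately have "T closure_of (generate S X) \<subseteq> ?K"
    using S.closure_generate_minimal[of ?K X] by (simp add: S.closed_subgroup_def)
  then show "eps [] \<sigma> = 1" using \<sigma> X_dense by blast
qed

end

section \<open>Unitriangular matrices\<close>

lemma elements_mat_subset_iff:
  "A \<in> carrier_mat d d \<Longrightarrow> elements_mat A \<subseteq> B \<longleftrightarrow> (\<forall>i<d. \<forall>j<d. A $$ (i, j) \<in> B)"
  by (auto simp: elements_mat_def UN_subset_iff image_subset_iff)

locale unitriangular_group =
  fixes d :: nat and p M :: nat
  assumes p_gt_1: "1 < p" and M_pos: "1 \<le> M"
begin

abbreviation m :: int where "m \<equiv> int p ^ M"
abbreviation U where "U \<equiv> unitriangular d (int p ^ M)"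

lemma m_gt_1: "1 < m"
  using p_gt_1 M_pos by (metis of_nat_1 of_nat_less_iff one_less_power Suc_le_lessD One_nat_def)

lemma mod_range: "k mod m \<in> {0..m - 1}"
proof -
  have "0 < m" using m_gt_1 by linarith
  then have "0 \<le> k mod m" "k mod m < m" by (rule pos_mod_sign, rule pos_mod_bound)
  then show ?thesis unfolding atLeastAtMost_iff zle_diff1_eq by blast
qed

lemma U_iff: "A \<in> carrier U \<longleftrightarrow> A \<in> carrier_mat d d \<and> (\<forall>i<d. \<forall>j<d. A $$ (i, j) \<in> {0..m - 1}) \<and>
    (\<forall>i<d. \<forall>j<i. A $$ (i, j) = 0) \<and> (\<forall>i<d. A $$ (i, i) = 1)"
  unfolding unitriangular_def by (auto simp: elements_mat_subset_iff upper_triangular_def)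

lemma mat_eqI:
  assumes "A \<in> carrier_mat d d" "B \<in> carrier_mat d d"
    "\<And>i j. i < d \<Longrightarrow> j < d \<Longrightarrow> A $$ (i, j) = B $$ (i, j)"
  shows "A = B"
  by (rule eq_matI) (use assms in auto)

lemma U_carrier_mat: "A \<in> carrier U \<Longrightarrow> A \<in> carrier_mat d d"
  by (simp add: U_iff)

lemma U_mod: "A \<in> carrier U \<Longrightarrow> i < d \<Longrightarrow> j < d \<Longrightarrow> A $$ (i, j) mod m = A $$ (i, j)"
  by (simp add: U_iff)

lemma U_eqI:
  assumes "A \<in> carrier U" "B \<in> carrier U"
    "\<And>i j. i < j \<Longrightarrow> j < d \<Longrightarrow> A $$ (i, j) mod m = B $$ (i, j) mod m"
  shows "A = B"
proof (rule eq_matI)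
  fix i j assume "i < dim_row B" "j < dim_col B"
  then have ij: "i < d" "j < d" using assms(2) by (auto simp: U_iff)
  consider "i < j" | "i = j" | "j < i" by linarith
  then show "A $$ (i, j) = B $$ (i, j)"
  proof cases
    case 1
    then show ?thesis using assms(3)[OF 1 ij(2)] U_mod[OF assms(1) ij] U_mod[OF assms(2) ij] by simp
  qed (use assms(1,2) ij in \<open>auto simp: U_iff\<close>)
qed (use assms in \<open>auto simp: U_iff\<close>)

lemma mult_U: "A \<otimes>\<^bsub>U\<^esub> B = map_mat (\<lambda>a. a mod m) (A * B)"
  by (simp add: unitriangular_def)

lemma one_U: "\<one>\<^bsub>U\<^esub> = 1\<^sub>m d"
  by (simp add: unitriangular_def)

lemma mult_entry_sum:
  assumes "A \<in> carrier_mat d d" "B \<in> carrier_mat d d" "i < d" "j < d"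
  shows "(A \<otimes>\<^bsub>U\<^esub> B) $$ (i, j) = (\<Sum>k<d. A $$ (i, k) * B $$ (k, j)) mod m"
  using assms by (simp add: mult_U scalar_prod_def lessThan_atLeast0)

text \<open>For unitriangular \<open>A\<close> and \<open>B\<close> this is the entry of
  \<open>(A - 1)(B - 1)\<close> at a place above the diagonal.\<close>

definition strict_conv :: "(nat \<Rightarrow> nat \<Rightarrow> int) \<Rightarrow> (nat \<Rightarrow> nat \<Rightarrow> int) \<Rightarrow> nat \<Rightarrow> nat \<Rightarrow> int" where
  "strict_conv a b i j = (\<Sum>k\<in>{i<..<j}. a i k * b k j)"

abbreviation ent :: "int mat \<Rightarrow> nat \<Rightarrow> nat \<Rightarrow> int" where "ent A i j \<equiv> A $$ (i, j)"

lemma mult_entry: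
  assumes A: "A \<in> carrier U" and B: "B \<in> carrier U" and ij: "i < j" "j < d"
  shows "(A \<otimes>\<^bsub>U\<^esub> B) $$ (i, j) = (ent A i j + ent B i j + strict_conv (ent A) (ent B) i j) mod m"
proof -
  let ?t = "\<lambda>k. A $$ (i, k) * B $$ (k, j)"
  have "(\<Sum>k<d. ?t k) = (\<Sum>k\<in>insert i (insert j {i<..<j}). ?t k)"
  proof (rule sum.mono_neutral_right)
    show "\<forall>k\<in>{..<d} - insert i (insert j {i<..<j}). ?t k = 0"
    proof
      fix k assume k: "k \<in> {..<d} - insert i (insert j {i<..<j})"
      then consider "k < i" | "j < k" "k < d" by force
      then show "?t k = 0"
      proof cases
        case 1
        then have "A $$ (i, k) = 0" using A ij by (simp add: U_iff)
        then show ?thesis by simp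
      next
        case 2
        then have "B $$ (k, j) = 0" using B by (simp add: U_iff)
        then show ?thesis by simp
      qed
    qed
  qed (use ij in auto)
  also have "\<dots> = ?t i + (?t j + (\<Sum>k\<in>{i<..<j}. ?t k))" using ij by simp
  also have "\<dots> = ent A i j + ent B i j + strict_conv (ent A) (ent B) i j"
    using A B ij by (simp add: U_iff strict_conv_def)
  finally show ?thesis using mult_entry_sum A B ij by (simp add: U_iff)
qed

lemma mult_closed_U:
  assumes A: "A \<in> carrier U" and B: "B \<in> carrier U"
  shows "A \<otimes>\<^bsub>U\<^esub> B \<in> carrier U"
  unfolding U_iff
proof (intro conjI allI impI)
  have c: "A \<in> carrier_mat d d" "B \<in> carrier_mat d d" using A B by (auto simp: U_iff)
  then show "A \<otimes>\<^bsub>U\<^esub> B \<in> carrier_mat d d" by (simp add: mult_U)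
  show "(A \<otimes>\<^bsub>U\<^esub> B) $$ (i, j) \<in> {0..m - 1}" if "i < d" "j < d" for i j
    unfolding mult_entry_sum[OF c that] by (rule mod_range)
  show "(A \<otimes>\<^bsub>U\<^esub> B) $$ (i, j) = 0" if "i < d" "j < i" for i j
  proof -
    have "A $$ (i, k) * B $$ (k, j) = 0" if "k < d" for k
      using A B that \<open>i < d\<close> \<open>j < i\<close> by (cases "k < i") (auto simp: U_iff)
    then have "(\<Sum>k<d. A $$ (i, k) * B $$ (k, j)) = 0" by (intro sum.neutral) blast
    then show ?thesis using mult_entry_sum[OF c, of i j] that by simp
  qed
  show "(A \<otimes>\<^bsub>U\<^esub> B) $$ (i, i) = 1" if "i < d" for i
  proof -
    have "(\<Sum>k<d. A $$ (i, k) * B $$ (k, i)) = (\<Sum>k\<in>{i}. A $$ (i, k) * B $$ (k, i))"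
      using A B that by (intro sum.mono_neutral_right) (auto simp: U_iff neq_iff)
    then show ?thesis using mult_entry_sum[OF c that that] A B that m_gt_1 by (simp add: U_iff)
  qed
qed

lemma one_closed_U: "1\<^sub>m d \<in> carrier U"
  using m_gt_1 p_gt_1 by (auto simp: U_iff)

lemma finite_U: "finite (carrier U)"
proof -
  let ?f = "\<lambda>A. restrict (\<lambda>ij. A $$ ij) ({..<d} \<times> {..<d})"
  have "inj_on ?f (carrier U)"
  proof (rule inj_onI)
    fix A B assume A: "A \<in> carrier U" and B: "B \<in> carrier U" and eq: "?f A = ?f B"
    have "A $$ (i, j) = B $$ (i, j)" if "i < d" "j < d" for i j
      using fun_cong[OF eq, of "(i, j)"] that by simp
    then show "A = B" using A B by (intro eq_matI) (auto simp: U_iff)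
  qed
  moreover have "?f ` carrier U \<subseteq> ({..<d} \<times> {..<d}) \<rightarrow>\<^sub>E {0..m - 1}"
  proof (rule image_subsetI)
    fix A assume "A \<in> carrier U"
    then have "\<forall>i<d. \<forall>j<d. A $$ (i, j) \<in> {0..m - 1}" unfolding U_iff by blast
    then show "?f A \<in> ({..<d} \<times> {..<d}) \<rightarrow>\<^sub>E {0..m - 1}" unfolding restrict_PiE_iff by blast
  qed
  moreover have "finite (({..<d} \<times> {..<d}) \<rightarrow>\<^sub>E {0..m - 1})" by (intro finite_PiE) auto
  ultimately show ?thesis by (rule inj_on_finite)
qed

lemma mod_cancel: "(a + b) mod m = (a + c) mod m \<Longrightarrow> b mod m = (c :: int) mod m"
  by (metis add_diff_cancel_left' mod_diff_left_eq)

text \<open>Induction on the distance from the diagonal: the strict product at \<open>(i, j)\<close>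
  involves only entries of \<open>B\<close> and \<open>C\<close> that are closer to it.\<close>

lemma left_cancel_U:
  assumes A: "A \<in> carrier U" and B: "B \<in> carrier U" and C: "C \<in> carrier U"
    and eq: "A \<otimes>\<^bsub>U\<^esub> B = A \<otimes>\<^bsub>U\<^esub> C"
  shows "B = C"
proof -
  have "B $$ (i, j) = C $$ (i, j)" if "i < j" "j < d" for i j
    using that
  proof (induction "j - i" arbitrary: i rule: less_induct)
    case less
    have "strict_conv (ent A) (ent B) i j = strict_conv (ent A) (ent C) i j"
      unfolding strict_conv_def by (intro sum.cong refl) (use less in auto)
    moreover have "(ent A i j + ent B i j + strict_conv (ent A) (ent B) i j) mod m
        = (ent A i j + ent C i j + strict_conv (ent A) (ent C) i j) mod m"
      using mult_entry[OF A B less.prems] mult_entry[OF A C less.prems] eq by simp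
    ultimately have "((ent A i j + strict_conv (ent A) (ent B) i j) + ent B i j) mod m
        = ((ent A i j + strict_conv (ent A) (ent B) i j) + ent C i j) mod m"
      by (simp add: algebra_simps)
    then have "ent B i j mod m = ent C i j mod m" by (rule mod_cancel)
    then show ?case using U_mod[OF B] U_mod[OF C] less.prems by simp
  qed
  then show ?thesis using U_eqI[OF B C] by simp
qed

lemma sum_mod_cong: "(\<And>k. k \<in> I \<Longrightarrow> f k mod m = g k mod m) \<Longrightarrow> sum f I mod m = sum g I mod m"
  by (metis (mono_tags, lifting) mod_sum_eq sum.cong)

lemma mult_mod_left:
  assumes "A \<in> carrier_mat d d" "B \<in> carrier_mat d d"
  shows "map_mat (\<lambda>a. a mod m) A \<otimes>\<^bsub>U\<^esub> B = A \<otimes>\<^bsub>U\<^esub> B"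
    "B \<otimes>\<^bsub>U\<^esub> map_mat (\<lambda>a. a mod m) A = B \<otimes>\<^bsub>U\<^esub> A"
proof -
  have c: "map_mat (\<lambda>a. a mod m) A \<in> carrier_mat d d" using assms by simp
  have "(map_mat (\<lambda>a. a mod m) A \<otimes>\<^bsub>U\<^esub> B) $$ (i, j) = (A \<otimes>\<^bsub>U\<^esub> B) $$ (i, j)"
    "(B \<otimes>\<^bsub>U\<^esub> map_mat (\<lambda>a. a mod m) A) $$ (i, j) = (B \<otimes>\<^bsub>U\<^esub> A) $$ (i, j)" if "i < d" "j < d" for i j
    using that assms mult_entry_sum[OF c assms(2) that] mult_entry_sum[OF assms that]
      mult_entry_sum[OF assms(2) c that] mult_entry_sum[OF assms(2,1) that]
    by (auto intro!: sum_mod_cong simp: mod_mult_left_eq mod_mult_right_eq)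
  moreover have cm: "X \<otimes>\<^bsub>U\<^esub> Y \<in> carrier_mat d d" if "X \<in> carrier_mat d d" "Y \<in> carrier_mat d d" for X Y
    using that by (simp add: mult_U)
  ultimately show "map_mat (\<lambda>a. a mod m) A \<otimes>\<^bsub>U\<^esub> B = A \<otimes>\<^bsub>U\<^esub> B"
    "B \<otimes>\<^bsub>U\<^esub> map_mat (\<lambda>a. a mod m) A = B \<otimes>\<^bsub>U\<^esub> A"
    using mat_eqI[OF cm[OF c assms(2)] cm[OF assms]] mat_eqI[OF cm[OF assms(2) c] cm[OF assms(2,1)]]
    by blast+
qed

text \<open>Inverses come from counting: left multiplication is injective on a finite set, hence
  onto, so right inverses exist; in a monoid where every element has a right inverse they are
  two-sided.\<close>

lemma group_U: "Group.group U"
proof -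
  have mon: "monoid U"
  proof (rule monoidI)
    fix A B C assume "A \<in> carrier U" "B \<in> carrier U" "C \<in> carrier U"
    then have c: "A \<in> carrier_mat d d" "B \<in> carrier_mat d d" "C \<in> carrier_mat d d" by (auto simp: U_iff)
    have "A \<otimes>\<^bsub>U\<^esub> B \<otimes>\<^bsub>U\<^esub> C = (A * B) \<otimes>\<^bsub>U\<^esub> C"
      unfolding mult_U[of A B] using mult_mod_left(1)[of "A * B" C] c by simp
    also have "\<dots> = A \<otimes>\<^bsub>U\<^esub> (B * C)" unfolding mult_U using c by (simp add: assoc_mult_mat)
    also have "\<dots> = A \<otimes>\<^bsub>U\<^esub> (B \<otimes>\<^bsub>U\<^esub> C)"
      unfolding mult_U[of B C] using mult_mod_left(2)[of "B * C" A] c by simp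
    finally show "A \<otimes>\<^bsub>U\<^esub> B \<otimes>\<^bsub>U\<^esub> C = A \<otimes>\<^bsub>U\<^esub> (B \<otimes>\<^bsub>U\<^esub> C)" .
  next
    fix A assume A: "A \<in> carrier U"
    have "map_mat (\<lambda>a. a mod m) A = A" by (rule eq_matI) (use A U_mod in \<open>auto simp: U_iff\<close>)
    then show "\<one>\<^bsub>U\<^esub> \<otimes>\<^bsub>U\<^esub> A = A" "A \<otimes>\<^bsub>U\<^esub> \<one>\<^bsub>U\<^esub> = A"
      using U_carrier_mat[OF A] by (simp_all add: mult_U one_U)
  qed (auto simp: mult_closed_U one_U one_closed_U)
  interpret monoid U by fact
  have rinv: "\<exists>B\<in>carrier U. A \<otimes>\<^bsub>U\<^esub> B = \<one>\<^bsub>U\<^esub>" if A: "A \<in> carrier U" for A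
  proof -
    have "inj_on (\<lambda>B. A \<otimes>\<^bsub>U\<^esub> B) (carrier U)" using left_cancel_U[OF A] by (auto simp: inj_on_def)
    moreover have "(\<lambda>B. A \<otimes>\<^bsub>U\<^esub> B) ` carrier U \<subseteq> carrier U" using A by auto
    ultimately have "(\<lambda>B. A \<otimes>\<^bsub>U\<^esub> B) ` carrier U = carrier U" using finite_U by (simp add: endo_inj_surj)
    then show ?thesis by (metis (no_types, lifting) imageE one_closed)
  qed
  show ?thesis
  proof (rule group_l_invI)
    fix A assume A: "A \<in> carrier U"
    then obtain B where B: "B \<in> carrier U" "A \<otimes>\<^bsub>U\<^esub> B = \<one>\<^bsub>U\<^esub>" using rinv by blast
    then obtain C where C: "C \<in> carrier U" "B \<otimes>\<^bsub>U\<^esub> C = \<one>\<^bsub>U\<^esub>" using rinv by blast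
    have "A = A \<otimes>\<^bsub>U\<^esub> (B \<otimes>\<^bsub>U\<^esub> C)" using A C by simp
    also have "\<dots> = (A \<otimes>\<^bsub>U\<^esub> B) \<otimes>\<^bsub>U\<^esub> C" by (rule m_assoc[OF A B(1) C(1), symmetric])
    also have "\<dots> = C" unfolding B(2) using C(1) by (rule l_one)
    finally show "\<exists>B\<in>carrier U. B \<otimes>\<^bsub>U\<^esub> A = \<one>\<^bsub>U\<^esub>" using B C by auto
  qed
qed

text \<open>A weight that is additive under the strictly triangular product and grows by 1 under
  multiplication by \<open>p\<close>; so the matrices of weight \<open>k\<close> contain the \<open>k\<close>-th term of the lower
  p-central filtration.\<close>

definition small :: "nat \<Rightarrow> (nat \<Rightarrow> nat \<Rightarrow> int) \<Rightarrow> bool" where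
  "small e a \<longleftrightarrow> (\<forall>i j. i < j \<and> j < d \<longrightarrow> int p ^ min M (e - (j - i)) dvd a i j)"

lemma small_mono: "small e a \<Longrightarrow> e' \<le> e \<Longrightarrow> small e' a"
  unfolding small_def by (meson diff_le_mono dvd_trans le_imp_power_dvd min.mono order_refl)

lemma small_add: "small e a \<Longrightarrow> small e b \<Longrightarrow> small e (\<lambda>i j. a i j + b i j)"
  by (simp add: small_def)

lemma small_diff: "small e a \<Longrightarrow> small e b \<Longrightarrow> small e (\<lambda>i j. a i j - b i j)"
  by (simp add: small_def)

lemma dvd_cong_mod: "k \<le> M \<Longrightarrow> a mod m = b mod m \<Longrightarrow> int p ^ k dvd a \<longleftrightarrow> int p ^ k dvd b"
  by (metis dvd_mod_iff le_imp_power_dvd)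

lemma small_cong:
  assumes "small e a" "\<And>i j. i < j \<Longrightarrow> j < d \<Longrightarrow> a i j mod m = b i j mod m"
  shows "small e b"
  unfolding small_def
proof (intro allI impI)
  fix i j assume ij: "i < j \<and> j < d"
  then have "int p ^ min M (e - (j - i)) dvd a i j" using assms(1) by (simp add: small_def)
  then show "int p ^ min M (e - (j - i)) dvd b i j"
    using dvd_cong_mod[OF min.cobounded1 assms(2)] ij by blast
qed

text \<open>Entries above the diagonal have distance at least 1 from it, and the subtraction in the
  exponent is truncated at 0.\<close>

lemma small_1: "small 1 a"
  by (auto simp: small_def)

lemma dvd_mult_min:
  assumes "int p ^ min M e dvd a" "int p ^ min M f dvd b" "g \<le> e + f"
  shows "int p ^ min M g dvd a * b"
proof -
  have "min M g \<le> min M e + min M f" using assms(3) by auto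
  then have "int p ^ min M g dvd int p ^ min M e * int p ^ min M f"
    by (metis le_imp_power_dvd power_add)
  then show ?thesis using mult_dvd_mono[OF assms(1,2)] dvd_trans by blast
qed

text \<open>The distances of the two factors add up to \<open>j - i\<close>, and truncation of the
  subtractions can only increase the sum of the two exponents.\<close>

lemma small_conv: "small e a \<Longrightarrow> small f b \<Longrightarrow> small (e + f) (strict_conv a b)"
  unfolding small_def[of "e + f"] strict_conv_def
proof (intro allI impI dvd_sum)
  fix i j k assume a: "small e a" and b: "small f b" and ij: "i < j \<and> j < d" and k: "k \<in> {i<..<j}"
  have "int p ^ min M (e - (k - i)) dvd a i k" "int p ^ min M (f - (j - k)) dvd b k j"
    using a b ij k by (auto simp: small_def)
  then show "int p ^ min M (e + f - (j - i)) dvd a i k * b k j"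
    by (rule dvd_mult_min) (use k in auto)
qed

definition F :: "nat \<Rightarrow> int mat set" where
  "F k = {A \<in> carrier U. small k (ent A)}"

lemma F_one: "1\<^sub>m d \<in> F k"
  using one_closed_U by (auto simp: F_def small_def)

lemma F_subgroup:
  assumes "1 \<le> k" shows "subgroup (F k) U"
proof -
  interpret group U by (rule group_U)
  show ?thesis
  proof (rule subgroupI)
    show "F k \<noteq> {}" using F_one by blast
  next
    fix A assume A: "A \<in> F k"
    then have c: "A \<in> carrier U" "inv\<^bsub>U\<^esub> A \<in> carrier U" and s: "small k (ent A)" by (auto simp: F_def)
    have "small k (\<lambda>i j. 0 - (ent A i j + strict_conv (ent A) (ent (inv\<^bsub>U\<^esub> A)) i j))"
      using s small_mono[OF small_conv[OF s small_1[of "ent (inv\<^bsub>U\<^esub> A)"]], of k]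
      by (intro small_diff small_add) (auto simp: small_def)
    then have "small k (ent (inv\<^bsub>U\<^esub> A))"
    proof (rule small_cong)
      fix i j assume ij: "i < j" "j < d"
      have "(A \<otimes>\<^bsub>U\<^esub> inv\<^bsub>U\<^esub> A) $$ (i, j) = 0" using c ij by (simp add: one_U)
      then have "m dvd ent A i j + ent (inv\<^bsub>U\<^esub> A) i j + strict_conv (ent A) (ent (inv\<^bsub>U\<^esub> A)) i j"
        using mult_entry[OF c ij] by (simp add: dvd_eq_mod_eq_0)
      then show "(0 - (ent A i j + strict_conv (ent A) (ent (inv\<^bsub>U\<^esub> A)) i j)) mod m = ent (inv\<^bsub>U\<^esub> A) i j mod m"
        unfolding mod_eq_dvd_iff
        by (subst dvd_minus_iff[symmetric]) (simp only: minus_diff_eq diff_0 ac_simps diff_minus_eq_add)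
    qed
    then show "inv\<^bsub>U\<^esub> A \<in> F k" using c by (simp add: F_def)
  next
    fix A B assume A: "A \<in> F k" and B: "B \<in> F k"
    then have c: "A \<in> carrier U" "B \<in> carrier U" and s: "small k (ent A)" "small k (ent B)" by (auto simp: F_def)
    have "small k (\<lambda>i j. ent A i j + ent B i j + strict_conv (ent A) (ent B) i j)"
      using small_add[OF small_add[OF s] small_mono[OF small_conv[OF s]]] by simp
    then have "small k (ent (A \<otimes>\<^bsub>U\<^esub> B))"
      by (rule small_cong) (simp add: mult_entry[OF c])
    then show "A \<otimes>\<^bsub>U\<^esub> B \<in> F k" using c by (simp add: F_def)
  qed (auto simp: F_def)
qed

text \<open>The entries of the \<open>l\<close>-th power agree with \<open>l\<close> times those of
  \<open>A\<close> up to weight \<open>k + 1\<close>, since the strict product of two matrices of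
  weight \<open>k\<close> has weight \<open>2 k\<close>. For \<open>l = p\<close> the factor
  \<open>p\<close> itself raises the weight by 1.\<close>

lemma F_pow:
  assumes A: "A \<in> F k" and k: "1 \<le> k"
  shows "A [^]\<^bsub>U\<^esub> p \<in> F (Suc k)"
proof -
  interpret group U by (rule group_U)
  have c: "A \<in> carrier U" and s: "small k (ent A)" using A by (auto simp: F_def)
  have "small (Suc k) (\<lambda>i j. ent (A [^]\<^bsub>U\<^esub> l) i j - int l * ent A i j) \<and> small k (ent (A [^]\<^bsub>U\<^esub> l))" for l :: nat
  proof (induction l)
    case 0
    then show ?case by (auto simp: one_U small_def)
  next
    case (Suc l)
    let ?B = "A [^]\<^bsub>U\<^esub> l"
    have B: "?B \<in> carrier U" "small k (ent ?B)" using c Suc by auto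
    have "small (Suc k) (\<lambda>i j. (ent ?B i j - int l * ent A i j) + strict_conv (ent ?B) (ent A) i j)"
      using Suc small_mono[OF small_conv[OF B(2) s], of "Suc k"] k by (intro small_add) auto
    then have 1: "small (Suc k) (\<lambda>i j. ent (A [^]\<^bsub>U\<^esub> Suc l) i j - int (Suc l) * ent A i j)"
    proof (rule small_cong)
      fix i j assume ij: "i < j" "j < d"
      have "(A [^]\<^bsub>U\<^esub> Suc l) $$ (i, j) = (ent ?B i j + ent A i j + strict_conv (ent ?B) (ent A) i j) mod m"
        using mult_entry[OF B(1) c ij] by simp
      then have "(ent (A [^]\<^bsub>U\<^esub> Suc l) i j - int (Suc l) * ent A i j) mod m
        = ((ent ?B i j + ent A i j + strict_conv (ent ?B) (ent A) i j) - int (Suc l) * ent A i j) mod m"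
        by (simp add: mod_diff_left_eq)
      also have "(ent ?B i j + ent A i j + strict_conv (ent ?B) (ent A) i j) - int (Suc l) * ent A i j =
         (ent ?B i j - int l * ent A i j) + strict_conv (ent ?B) (ent A) i j"
        by (simp add: algebra_simps)
      finally show "(ent ?B i j - int l * ent A i j + strict_conv (ent ?B) (ent A) i j) mod m =
        (ent (A [^]\<^bsub>U\<^esub> Suc l) i j - int (Suc l) * ent A i j) mod m" by simp
    qed
    have "small k (\<lambda>i j. (ent (A [^]\<^bsub>U\<^esub> Suc l) i j - int (Suc l) * ent A i j) + int (Suc l) * ent A i j)"
      using small_mono[OF 1, of k] s by (intro small_add) (auto simp: small_def)
    then show ?case using 1 by simp
  qed
  from this[of p] have 1: "small (Suc k) (\<lambda>i j. ent (A [^]\<^bsub>U\<^esub> p) i j - int p * ent A i j)" by blast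
  have 2: "small (Suc k) (\<lambda>i j. int p * ent A i j)"
    unfolding small_def
  proof (intro allI impI)
    fix i j assume "i < j \<and> j < d"
    then have "int p ^ min M (k - (j - i)) dvd ent A i j" using s by (simp add: small_def)
    moreover have "int p ^ min M 1 dvd int p" using M_pos by simp
    ultimately show "int p ^ min M (Suc k - (j - i)) dvd int p * ent A i j"
      by (intro dvd_mult_min[of 1 _ "k - (j - i)"]) auto
  qed
  have "small (Suc k) (ent (A [^]\<^bsub>U\<^esub> p))" using small_add[OF 1 2] by simp
  then show ?thesis using c by (simp add: F_def)
qed

lemma dvd_difference:
  assumes "k dvd v + c + x - (a + b + y)" "k dvd v - (b + a + z :: int)"
  shows "k dvd c - (y - z - x)"
  using dvd_diff[OF assms] by (simp add: algebra_simps)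

text \<open>The entries of \<open>A B\<close> and \<open>B A C\<close> are compared, where
  \<open>C\<close> is the commutator: the linear parts of \<open>A\<close> and \<open>B\<close>
  cancel, the difference of their strict products has weight \<open>k + 1\<close>, and the remaining
  term involves entries of \<open>C\<close> nearer to the diagonal, which the induction
  covers.\<close>

lemma F_commutator:
  assumes A: "A \<in> carrier U" and B: "B \<in> F k"
  shows "commutator U A B \<in> F (Suc k)"
proof -
  interpret group U by (rule group_U)
  have c: "B \<in> carrier U" and s: "small k (ent B)" using B by (auto simp: F_def)
  define C where "C = commutator U A B"
  have C: "C \<in> carrier U" using A c by (simp add: C_def)
  define V where "V = B \<otimes>\<^bsub>U\<^esub> A"
  have V: "V \<in> carrier U" using A c by (simp add: V_def)
  have eq: "A \<otimes>\<^bsub>U\<^esub> B = V \<otimes>\<^bsub>U\<^esub> C" using mult_comm[OF A c] by (simp add: V_def C_def)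
  let ?D = "\<lambda>i j. strict_conv (ent A) (ent B) i j - strict_conv (ent B) (ent A) i j"
  have D: "small (Suc k) ?D"
    using small_diff[OF small_conv[OF small_1[of "ent A"] s] , of "strict_conv (ent B) (ent A)"]
      small_conv[OF s small_1[of "ent A"]] by (simp add: ac_simps)
  have "int p ^ min M (Suc k - (j - i)) dvd ent C i j" if "i < j" "j < d" for i j
    using that
  proof (induction "j - i" arbitrary: i rule: less_induct)
    case less
    have "(ent V i j + ent C i j + strict_conv (ent V) (ent C) i j) mod m
        = (ent A i j + ent B i j + strict_conv (ent A) (ent B) i j) mod m"
      using mult_entry[OF A c less.prems] mult_entry[OF V C less.prems] eq by simp
    moreover have "ent V i j mod m = (ent B i j + ent A i j + strict_conv (ent B) (ent A) i j) mod m"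
      using mult_entry[OF c A less.prems] by (simp add: V_def)
    ultimately have "(ent C i j) mod m = (?D i j - strict_conv (ent V) (ent C) i j) mod m"
      unfolding mod_eq_dvd_iff by (rule dvd_difference)
    moreover have "int p ^ min M (Suc k - (j - i)) dvd strict_conv (ent V) (ent C) i j"
      unfolding strict_conv_def
    proof (rule dvd_sum)
      fix l assume l: "l \<in> {i<..<j}"
      then have "int p ^ min M (Suc k - (j - l)) dvd ent C l j" using less.hyps[of l] less.prems by auto
      then show "int p ^ min M (Suc k - (j - i)) dvd ent V i l * ent C l j"
        by (intro dvd_mult_min[of 0 _ "Suc k - (j - l)"]) (use l in auto)
    qed
    moreover have "int p ^ min M (Suc k - (j - i)) dvd ?D i j" using D less.prems by (simp add: small_def)
    ultimately show ?case using dvd_cong_mod[OF min.cobounded1] by (metis dvd_diff)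
  qed
  then show ?thesis using C by (auto simp: F_def small_def C_def)
qed

lemma topological_grp_U: "topological_grp U (discrete_topology (carrier U))"
  using finite_discrete_profinite[OF group_U finite_U] group_U
  by (simp add: topological_grp_def topological_grp_axioms_def profinite_group_def)

lemma lower_p_central_U: "1 \<le> k \<Longrightarrow> lower_p_central p U (discrete_topology (carrier U)) k \<subseteq> F k"
proof -
  interpret U: topological_grp U "discrete_topology (carrier U)" p by (rule topological_grp_U)
  show "lower_p_central p U (discrete_topology (carrier U)) k \<subseteq> F k" if "1 \<le> k"
    using that
  proof (induction k rule: dec_induct)
    case base
    then show ?case using small_1 by (auto simp: F_def)
  next
    case (step k)
    then obtain l where l: "k = Suc l" by (cases k) auto
    have "U.L (Suc (Suc l)) \<subseteq> F (Suc k)"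
    proof (rule U.L_minimal)
      show "U.closed_subgroup (F (Suc k))"
        using F_subgroup[of "Suc k"] by (auto simp: U.closed_subgroup_def F_def)
    qed (use step l F_pow F_commutator in blast)+
    then show ?case using l by simp
  qed
qed

end

section \<open>The n-th filtration term of the unitriangular group\<close>

locale UU_group =
  fixes p n s :: nat
  assumes p_gt_1: "1 < p" and s_pos: "1 \<le> s" and s_le: "s \<le> n"
begin

sublocale unitriangular_group "s + 1" p "n - s + 1"
  by unfold_locales (use p_gt_1 in auto)

lemma UU_U: "UU p n s = U"
  by (simp add: UU_def)

lemma corner_mem: "a \<in> {0..int p - 1} \<Longrightarrow> corner p n s a \<in> carrier U"
proof -
  assume a: "a \<in> {0..int p - 1}"
  have "a * int p ^ (n - s) \<le> (int p - 1) * int p ^ (n - s)" using a by (intro mult_right_mono) auto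
  also have "\<dots> = m - int p ^ (n - s)" by (simp add: algebra_simps)
  also have "\<dots> \<le> m - 1" using p_gt_1 by simp
  finally show ?thesis using a m_gt_1 unfolding U_iff by (auto simp: corner_def)
qed

lemma corner_mult:
  assumes a: "a \<in> {0..int p - 1}" and A: "A \<in> carrier U" and ij: "i < j" "j < s + 1"
  shows "(corner p n s a \<otimes>\<^bsub>U\<^esub> A) $$ (i, j) = (A $$ (i, j) + (if i = 0 \<and> j = s then a * int p ^ (n - s) else 0)) mod m"
proof -
  have "strict_conv (ent (corner p n s a)) (ent A) i j = 0"
    unfolding strict_conv_def by (rule sum.neutral) (use ij in \<open>auto simp: corner_def\<close>)
  then show ?thesis using mult_entry[OF corner_mem[OF a] A ij] ij by (simp add: corner_def add.commute)
qed

text \<open>Weight \<open>n\<close> forces an entry at distance less than \<open>s\<close> from the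
  diagonal to be divisible by the modulus \<open>p^(n - s + 1)\<close>, hence to vanish, while for
  the corner at distance \<open>s\<close> it gives only the divisor
  \<open>p^(n - s)\<close>.\<close>

lemma UU_filt_corner:
  assumes "A \<in> UU_filt p n s"
  obtains a where "a \<in> {0..int p - 1}" "A = corner p n s a"
proof -
  have "A \<in> F n" using lower_p_central_U[of n] assms s_pos s_le unfolding UU_filt_def UU_U by auto
  then have A: "A \<in> carrier U" and sm: "small n (ent A)" unfolding F_def by blast+
  have zero: "A $$ (i, j) = 0" if "i < j" "j < s + 1" "\<not> (i = 0 \<and> j = s)" for i j
  proof -
    have "j - i < s" using that by linarith
    then have "min (n - s + 1) (n - (j - i)) = n - s + 1" using s_le by linarith
    then have "m dvd A $$ (i, j)" using sm that unfolding small_def by metis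
    then have "A $$ (i, j) mod m = 0" by simp
    then show ?thesis using U_mod[OF A, of i j] that by simp
  qed
  have "min (n - s + 1) (n - (s - 0)) = n - s" by simp
  then have "int p ^ (n - s) dvd A $$ (0, s)" using sm s_pos unfolding small_def
    by (metis less_add_one less_eq_Suc_le One_nat_def)
  then obtain a where a: "A $$ (0, s) = int p ^ (n - s) * a" by (elim dvdE)
  have pp: "int p ^ (n - s) > 0" using p_gt_1 by simp
  have r: "A $$ (0, s) \<in> {0..m - 1}" using conjunct1[OF conjunct2[OF A[unfolded U_iff]]] by simp
  have "0 \<le> int p ^ (n - s) * a" "int p ^ (n - s) * a < int p ^ (n - s) * int p"
    using r a by (auto simp: mult.commute)
  then have "0 \<le> a" "a < int p" using pp by (auto simp: zero_le_mult_iff)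
  then have a': "a \<in> {0..int p - 1}" by simp
  have "A = corner p n s a"
    by (rule U_eqI[OF A corner_mem[OF a']]) (use zero a in \<open>auto simp: corner_def mult.commute\<close>)
  then show ?thesis using that a' by blast
qed

end

section \<open>Magnus coefficients of Lyndon commutators\<close>

locale magnus_lyndon = lyndon_topological_grp S T p X r + magnus_expansion m X S T p
  for S :: "('a, 'm) monoid_scheme" (structure) and T p X r m
begin

section \<open>Magnus coefficients of products and commutators\<close>

lemma eps_mult_split:
  assumes "\<sigma> \<in> carrier S" "\<tau> \<in> carrier S" "w \<in> lists X" "w \<noteq> []"
  shows "eps w (\<sigma> \<otimes> \<tau>) = (eps w \<sigma> + eps w \<tau> +
     (\<Sum>l\<in>{0<..<length w}. eps (take l w) \<sigma> * eps (drop l w) \<tau>)) mod m"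
proof -
  have "{..length w} = insert 0 (insert (length w) {0<..<length w})" using assms(4) by (cases w) auto
  then have "conv (\<lambda>u. eps u \<sigma>) (\<lambda>u. eps u \<tau>) w = eps w \<sigma> + eps w \<tau> +
     (\<Sum>l\<in>{0<..<length w}. eps (take l w) \<sigma> * eps (drop l w) \<tau>)"
    using assms eps_Nil by (simp add: conv_def)
  then show ?thesis using eps_mult[OF assms(1-3)] by simp
qed

lemma eps_mult_low:
  assumes "\<sigma> \<in> carrier S" "\<tau> \<in> carrier S" "w \<in> lists X" "w \<noteq> []"
    "\<And>a b. w = a @ b \<Longrightarrow> a \<noteq> [] \<Longrightarrow> b \<noteq> [] \<Longrightarrow> eps a \<sigma> * eps b \<tau> = 0"
  shows "eps w (\<sigma> \<otimes> \<tau>) = (eps w \<sigma> + eps w \<tau>) mod m"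
proof -
  have "(\<Sum>l\<in>{0<..<length w}. eps (take l w) \<sigma> * eps (drop l w) \<tau>) = 0"
    by (rule sum.neutral) (use assms(4,5) in auto)
  then show ?thesis using eps_mult_split[OF assms(1-4)] by simp
qed

text \<open>In \<open>\<sigma> \<tau> = \<tau> \<sigma> c\<close> the commutator \<open>c\<close> is
  the right factor, so only its coefficients at proper suffixes of \<open>w\<close> enter the mixed
  terms. These vanish by induction.\<close>

lemma eps_comm:
  assumes \<sigma>: "\<sigma> \<in> carrier S" and \<tau>: "\<tau> \<in> carrier S"
  shows "\<lbrakk>w \<in> lists X; w \<noteq> [];
      \<And>a b. w = a @ b \<Longrightarrow> a \<noteq> [] \<Longrightarrow> b \<noteq> [] \<Longrightarrow> eps b (\<sigma> \<otimes> \<tau>) = eps b (\<tau> \<otimes> \<sigma>)\<rbrakk>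
    \<Longrightarrow> eps w (comm \<sigma> \<tau>) = (eps w (\<sigma> \<otimes> \<tau>) - eps w (\<tau> \<otimes> \<sigma>)) mod m"
proof (induction "length w" arbitrary: w rule: less_induct)
  case less
  note wX = less.prems(1) and ne = less.prems(2) and eq = less.prems(3)
  let ?c = "comm \<sigma> \<tau>"
  have c: "?c \<in> carrier S" using \<sigma> \<tau> by simp
  have zero: "eps b ?c = 0" if ab: "w = a @ b" "a \<noteq> []" "b \<noteq> []" for a b
  proof -
    have "eps b ?c = (eps b (\<sigma> \<otimes> \<tau>) - eps b (\<tau> \<otimes> \<sigma>)) mod m"
    proof (rule less.hyps)
      fix a' b' assume "b = a' @ b'" "a' \<noteq> []" "b' \<noteq> []"
      then show "eps b' (\<sigma> \<otimes> \<tau>) = eps b' (\<tau> \<otimes> \<sigma>)" using eq[of "a @ a'" b'] ab by simp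
    qed (use ab wX in auto)
    then show ?thesis using eq[OF ab] by simp
  qed
  have "eps w (\<tau> \<otimes> \<sigma> \<otimes> ?c) = (eps w (\<tau> \<otimes> \<sigma>) + eps w ?c) mod m"
    by (rule eps_mult_low) (use \<sigma> \<tau> c wX ne zero in auto)
  then have "eps w (\<sigma> \<otimes> \<tau>) = (eps w (\<tau> \<otimes> \<sigma>) + eps w ?c) mod m"
    using mult_comm[OF \<sigma> \<tau>] by simp
  then have "(eps w (\<sigma> \<otimes> \<tau>) - eps w (\<tau> \<otimes> \<sigma>)) mod m = (eps w (\<tau> \<otimes> \<sigma>) + eps w ?c - eps w (\<tau> \<otimes> \<sigma>)) mod m"
    by (simp add: mod_diff_left_eq)
  then show ?case using eps_mod[OF c wX] by simp
qed

text \<open>Says that the Magnus expansion becomes 1 when all letters outside \<open>A\<close> are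
  set to zero.\<close>

definition trivial_on :: "'a set \<Rightarrow> 'a \<Rightarrow> bool" where
  "trivial_on A \<sigma> \<longleftrightarrow> (\<forall>w\<in>lists X. w \<noteq> [] \<and> set w \<subseteq> A \<longrightarrow> eps w \<sigma> = 0)"

lemma trivial_on_mult:
  assumes \<sigma>: "\<sigma> \<in> carrier S" and \<tau>: "\<tau> \<in> carrier S" and triv: "trivial_on A \<sigma>"
    and w: "w \<in> lists X" "w \<noteq> []" "set w \<subseteq> A"
  shows "eps w (\<sigma> \<otimes> \<tau>) = eps w \<tau>" "eps w (\<tau> \<otimes> \<sigma>) = eps w \<tau>"
proof -
  have z: "eps u \<sigma> = 0" if "u \<in> lists X" "u \<noteq> []" "set u \<subseteq> A" for u
    using triv that by (simp add: trivial_on_def)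
  have "eps w (\<sigma> \<otimes> \<tau>) = (eps w \<sigma> + eps w \<tau>) mod m"
    by (rule eps_mult_low) (use assms z in auto)
  then show "eps w (\<sigma> \<otimes> \<tau>) = eps w \<tau>" using z w eps_mod[OF \<tau>] by simp
  have "eps w (\<tau> \<otimes> \<sigma>) = (eps w \<tau> + eps w \<sigma>) mod m"
    by (rule eps_mult_low) (use assms z in auto)
  then show "eps w (\<tau> \<otimes> \<sigma>) = eps w \<tau>" using z w eps_mod[OF \<tau>] by simp
qed

lemma trivial_on_pow: "\<sigma> \<in> carrier S \<Longrightarrow> trivial_on A \<sigma> \<Longrightarrow> trivial_on A (\<sigma> [^] (k :: nat))"
proof (induction k)
  case 0
  then show ?case by (simp add: trivial_on_def eps_one)
next
  case (Suc k)
  then have "eps w (\<sigma> [^] k \<otimes> \<sigma>) = 0" if "w \<in> lists X" "w \<noteq> []" "set w \<subseteq> A" for w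
    using trivial_on_mult(2)[of \<sigma> "\<sigma> [^] k" A w] that by (simp add: trivial_on_def)
  then show ?case by (simp add: trivial_on_def)
qed

lemma trivial_on_comm:
  assumes \<sigma>: "\<sigma> \<in> carrier S" and \<tau>: "\<tau> \<in> carrier S" and triv: "trivial_on A \<sigma> \<or> trivial_on A \<tau>"
  shows "trivial_on A (comm \<sigma> \<tau>)"
  unfolding trivial_on_def
proof (intro ballI impI)
  fix w assume w: "w \<in> lists X" "w \<noteq> [] \<and> set w \<subseteq> A"
  have eq: "eps u (\<sigma> \<otimes> \<tau>) = eps u (\<tau> \<otimes> \<sigma>)" if "u \<in> lists X" "u \<noteq> []" "set u \<subseteq> A" for u
    using triv
  proof
    assume "trivial_on A \<sigma>"
    then show ?thesis using trivial_on_mult[OF \<sigma> \<tau> _ that] by simp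
  next
    assume "trivial_on A \<tau>"
    then show ?thesis using trivial_on_mult[OF \<tau> \<sigma> _ that] by simp
  qed
  have "eps w (comm \<sigma> \<tau>) = (eps w (\<sigma> \<otimes> \<tau>) - eps w (\<tau> \<otimes> \<sigma>)) mod m"
    by (rule eps_comm[OF \<sigma> \<tau>]) (use w eq in auto)
  then show "eps w (comm \<sigma> \<tau>) = 0" using eq w by simp
qed

text \<open>A letter outside \<open>A\<close> is itself trivial over \<open>A\<close>, and a
  commutator is trivial as soon as one of its entries is. The letter \<open>x\<close> occurs in one
  half of the standard factorization.\<close>

lemma trivial_on_tau:
  "w \<in> lists X \<Longrightarrow> x \<in> set w \<Longrightarrow> x \<notin> A \<Longrightarrow> trivial_on A (tau w)"
proof (induction "length w" arbitrary: w rule: less_induct)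
  case less
  show ?case
  proof (cases "2 \<le> length w")
    case False
    then have w: "w = [x]" using less.prems by (cases w) (auto simp: Suc_le_eq)
    then have "x \<in> X" using less.prems by simp
    then show ?thesis unfolding w trivial_on_def using less.prems(3) by (auto simp: eps_letter)
  next
    case True
    then obtain u v where w: "w = u @ v" "std u v" using std_exists less.prems(1) by blast
    then have ne: "u \<noteq> []" "v \<noteq> []" by (auto simp: std_def)
    have "trivial_on A (tau u) \<or> trivial_on A (tau v)"
      using less.hyps[of u] less.hyps[of v] less.prems w ne by auto
    then show ?thesis unfolding w(1) tau_append[OF w(2)]
      using trivial_on_comm tau_carrier less.prems(1) w(1) ne by auto
  qed
qed

text \<open>Both parts go by one induction on the length: as the expansions of \<open>tau a\<close>
  and \<open>tau b\<close> have no terms in positive degrees below \<open>|a|\<close> and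
  \<open>|b|\<close>, the group commutator has the Lie bracket of their parts in these degrees as
  its part of degree \<open>|w|\<close>.\<close>

lemma eps_tau_low:
  "w \<in> lists X \<Longrightarrow> u \<in> lists X \<Longrightarrow> u \<noteq> [] \<Longrightarrow> length u < length w \<Longrightarrow> eps u (tau w) = 0"
  and eps_tau_comm: "w \<in> lists X \<Longrightarrow> std a b \<Longrightarrow> w = a @ b \<Longrightarrow> u \<in> lists X \<Longrightarrow> length u = length w \<Longrightarrow>
      eps u (tau w) = (eps (take (length a) u) (tau a) * eps (drop (length a) u) (tau b)
        - eps (take (length b) u) (tau b) * eps (drop (length b) u) (tau a)) mod m"
proof (induction "length w" arbitrary: w u a b rule: less_induct)
  case less
  \<comment> \<open>Up to degree \<open>|a| + |b|\<close> every cut except the one after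
    \<open>length a\<close> letters meets a vanishing coefficient of \<open>tau a\<close> or of
    \<open>tau b\<close>.\<close>
  have prod: "eps z (tau a \<otimes> tau b) = (eps z (tau a) + eps z (tau b) +
        (if length z = length a + length b then eps (take (length a) z) (tau a) * eps (drop (length a) z) (tau b) else 0)) mod m"
    if ab: "a \<in> lists X" "b \<in> lists X" "a \<noteq> []" "b \<noteq> []" "length a < length w" "length b < length w"
      and z: "z \<in> lists X" "z \<noteq> []" "length z \<le> length a + length b" for a b z
  proof -
    have zi: "take l z \<in> lists X" "drop l z \<in> lists X" for l
      using z(1) by (auto dest: in_set_takeD in_set_dropD)
    have "(\<Sum>l\<in>{0<..<length z}. eps (take l z) (tau a) * eps (drop l z) (tau b)) =
        (\<Sum>l\<in>{0<..<length z}. if l = length a then (if length z = length a + length b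
           then eps (take (length a) z) (tau a) * eps (drop (length a) z) (tau b) else 0) else 0)"
    proof (intro sum.cong refl)
      fix l assume l: "l \<in> {0<..<length z}"
      then have ne: "take l z \<noteq> []" "drop l z \<noteq> []" by auto
      have 1: "eps (take l z) (tau a) = 0" if "l < length a"
        using less.hyps(1)[OF ab(5) ab(1) zi(1) ne(1)] that l by auto
      have 2: "eps (drop l z) (tau b) = 0" if "length z - l < length b"
        using less.hyps(1)[OF ab(6) ab(2) zi(2) ne(2)] that l by auto
      show "eps (take l z) (tau a) * eps (drop l z) (tau b) = (if l = length a then (if length z = length a + length b
           then eps (take (length a) z) (tau a) * eps (drop (length a) z) (tau b) else 0) else 0)"
        using 1 2 z(3) l by (cases "l < length a"; cases "length z - l < length b") auto
    qed
    also have "\<dots> = (if length z = length a + length b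
           then eps (take (length a) z) (tau a) * eps (drop (length a) z) (tau b) else 0)"
      using ab by (auto simp: sum.delta)
    finally show ?thesis using eps_mult_split[OF tau_carrier tau_carrier z(1,2), OF ab(1,3,2,4)] by simp
  qed
  have main: "eps u (tau w) = (if length u = length w then eps (take (length a) u) (tau a) * eps (drop (length a) u) (tau b)
        - eps (take (length b) u) (tau b) * eps (drop (length b) u) (tau a) else 0) mod m"
    if w: "w \<in> lists X" "std a b" "w = a @ b" and u: "u \<in> lists X" "u \<noteq> []" "length u \<le> length w" for a b u
  proof -
    have ne: "a \<noteq> []" "b \<noteq> []" using w by (auto simp: std_def)
    have aX: "a \<in> lists X" "b \<in> lists X" using w by auto
    have c: "tau a \<in> carrier S" "tau b \<in> carrier S" using tau_carrier aX ne by auto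
    have len: "length a < length w" "length b < length w" using w ne by auto
    have low: "eps z (tau a \<otimes> tau b) = eps z (tau b \<otimes> tau a)"
      if "z \<in> lists X" "z \<noteq> []" "length z < length w" for z
      using prod[OF aX ne len, of z] prod[OF aX(2,1) ne(2,1) len(2,1), of z] that w by (simp add: add.commute)
    have "eps u (tau w) = (eps u (tau a \<otimes> tau b) - eps u (tau b \<otimes> tau a)) mod m"
      unfolding w(3) tau_append[OF w(2)]
    proof (rule eps_comm[OF c u(1,2)])
      fix y z assume "u = y @ z" "y \<noteq> []" "z \<noteq> []"
      then show "eps z (tau a \<otimes> tau b) = eps z (tau b \<otimes> tau a)" using low[of z] u by (cases y) auto
    qed
    also have "\<dots> = (if length u = length w then eps (take (length a) u) (tau a) * eps (drop (length a) u) (tau b)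
        - eps (take (length b) u) (tau b) * eps (drop (length b) u) (tau a) else 0) mod m"
      using prod[OF aX ne len u(1,2)] prod[OF aX(2,1) ne(2,1) len(2,1) u(1,2)] u(3) w(3)
      by (auto simp: mod_simps algebra_simps)
    finally show ?thesis .
  qed
  {
    case 1
    then have "2 \<le> length w" by (cases u) auto
    then obtain a b where "w = a @ b" "std a b" using std_exists 1 by blast
    then show ?case using main[of a b u] 1 by simp
  next
    case 2
    then have "u \<noteq> []" by (auto simp: std_def)
    then show ?case using main[of a b u] 2 by simp
  }
qed

text \<open>In the bracket of the leading parts for \<open>w = a b\<close>, the first product gives
  words \<open>x y\<close> with \<open>x >= a\<close> and \<open>y >= b\<close>, so at least
  \<open>w\<close>, and \<open>w\<close> itself with coefficient 1. The second product gives words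
  that start with some \<open>x >= b\<close>, and \<open>b\<close> is larger than
  \<open>w\<close>.\<close>

lemma eps_tau:
  "w \<in> lists X \<Longrightarrow> lyndon r w \<Longrightarrow> u \<in> lists X \<Longrightarrow> length u = length w \<Longrightarrow> eps u (tau w) \<noteq> 0 \<Longrightarrow> u = w \<or> lt w u"
  and eps_tau_self: "w \<in> lists X \<Longrightarrow> lyndon r w \<Longrightarrow> eps w (tau w) = 1"
proof (induction "length w" arbitrary: w u rule: less_induct)
  case less
  have main: "(eps u (tau w) \<noteq> 0 \<longrightarrow> u = w \<or> lt w u) \<and> eps w (tau w) = 1"
    if w: "w \<in> lists X" "lyndon r w" and u: "u \<in> lists X" "length u = length w" for u
  proof (cases "2 \<le> length w")
    case False
    then obtain x where x: "w = [x]" using lyndon_not_Nil[OF w(2)] by (cases w) (auto simp: Suc_le_eq)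
    then have "x \<in> X" using w by simp
    then show ?thesis using u x w(1) by (auto simp: eps_letter)
  next
    case True
    then obtain a b where ab: "w = a @ b" "std a b" using std_exists w by blast
    have ne: "a \<noteq> []" "b \<noteq> []" using ab by (auto simp: std_def)
    have aX: "a \<in> lists X" "b \<in> lists X" using w ab by auto
    have len: "length a < length w" "length b < length w" using ab ne by auto
    have L: "lyndon r a" "lyndon r b" "lt a b" using std_lyndon[of a b] w ab by auto
    have wb: "lt w b" using lyndon_append_lt[OF L] ab by simp
    have second: "lt w z"
      if z: "z \<in> lists X" "length z = length w" "eps (take (length b) z) (tau b) \<noteq> 0" for z
    proof -
      have "take (length b) z = b \<or> lt b (take (length b) z)"
        using less.hyps(1)[OF len(2) aX(2) L(2) _ _ z(3)] z(1,2) len by (auto dest: in_set_takeD)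
      then have "lt w (take (length b) z)" using wb lt_trans by auto
      then show ?thesis using lt_append_right by (metis append_take_drop_id)
    qed
    have first: "z = w \<or> lt w z"
      if z: "z \<in> lists X" "length z = length w" "eps (take (length a) z) (tau a) \<noteq> 0" "eps (drop (length a) z) (tau b) \<noteq> 0" for z
    proof -
      have 1: "take (length a) z = a \<or> lt a (take (length a) z)"
        using less.hyps(1)[OF len(1) aX(1) L(1) _ _ z(3)] z(1,2) len by (auto dest: in_set_takeD)
      have 2: "drop (length a) z = b \<or> lt b (drop (length a) z)"
        using less.hyps(1)[OF len(2) aX(2) L(2) _ _ z(4)] z(1,2) ab by (auto dest: in_set_dropD)
      show ?thesis using 1
      proof
        assume a: "take (length a) z = a"
        then have "z = a @ drop (length a) z" by (metis append_take_drop_id)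
        then show ?thesis using 2 ab lt_append_same by metis
      next
        assume "lt a (take (length a) z)"
        then have "lt (a @ b) (take (length a) z @ drop (length a) z)" by (rule lt_append_length) simp
        then show ?thesis using ab by simp
      qed
    qed
    have E: "eps z (tau w) = (eps (take (length a) z) (tau a) * eps (drop (length a) z) (tau b)
        - eps (take (length b) z) (tau b) * eps (drop (length b) z) (tau a)) mod m"
      if "z \<in> lists X" "length z = length w" for z
      using eps_tau_comm[OF w(1) ab(2,1) that] .
    have "eps (take (length b) w) (tau b) = 0" using second[of w] w lt_irrefl by blast
    then have "eps w (tau w) = (eps a (tau a) * eps b (tau b)) mod m" using E[OF w(1) refl] ab by simp
    then have "eps w (tau w) = 1"
      using less.hyps(2)[OF len(1) aX(1) L(1)] less.hyps(2)[OF len(2) aX(2) L(2)] m_gt_1 by simp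
    moreover have "u = w \<or> lt w u" if "eps u (tau w) \<noteq> 0"
    proof -
      have "eps (take (length b) u) (tau b) \<noteq> 0 \<or>
          (eps (take (length a) u) (tau a) \<noteq> 0 \<and> eps (drop (length a) u) (tau b) \<noteq> 0)"
        using E[OF u] that by auto
      then show ?thesis using first[OF u] second[OF u] by blast
    qed
    ultimately show ?thesis by blast
  qed
  {
    case 1
    then show ?case using main[of u] by blast
  next
    case 2
    then show ?case using main[of w] by blast
  }
qed

text \<open>A mixed term at \<open>w\<close> would contain a coefficient of \<open>\<sigma>\<close>
  at a nonempty word shorter than \<open>k\<close>. So every further factor \<open>\<sigma>\<close>
  just adds its coefficient.\<close>

lemma eps_pow_low:
  assumes \<sigma>: "\<sigma> \<in> carrier S" and low: "\<And>u. u \<in> lists X \<Longrightarrow> u \<noteq> [] \<Longrightarrow> length u < k \<Longrightarrow> eps u \<sigma> = 0"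
    and w: "w \<in> lists X" "w \<noteq> []" "length w \<le> k"
  shows "eps w (\<sigma> [^] (N :: nat)) = (int N * eps w \<sigma>) mod m"
proof (induction N)
  case 0
  then show ?case using w by (simp add: eps_one)
next
  case (Suc N)
  have "eps w (\<sigma> [^] N \<otimes> \<sigma>) = (eps w (\<sigma> [^] N) + eps w \<sigma>) mod m"
  proof (rule eps_mult_low)
    fix a b assume "w = a @ b" "a \<noteq> []" "b \<noteq> []"
    then show "eps a (\<sigma> [^] N) * eps b \<sigma> = 0" using low[of b] w by (cases a) auto
  qed (use \<sigma> w in auto)
  then show ?case using Suc by (simp add: mod_simps algebra_simps)
qed

lemma eps_vgen:
  assumes w: "w \<in> lists X" "w \<noteq> []" and u: "u \<in> lists X" "u \<noteq> []" "length u \<le> length w"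
  shows "eps u (vgen n w) = (int (p ^ (n - length w)) * eps u (tau w)) mod m"
  unfolding vgen_def
  by (rule eps_pow_low[where k = "length w", OF tau_carrier[OF w] eps_tau_low[OF w(1)] u])

text \<open>The source of the condition on letters in \<open>prec\<close>: a letter of
  \<open>w\<close> that is missing from \<open>u\<close> makes the element trivial over the letters
  of \<open>u\<close>.\<close>

lemma eps_vgen_support:
  assumes "w \<in> lists X" "w \<noteq> []" "u \<in> lists X" "u \<noteq> []" "eps u (vgen n w) \<noteq> 0"
  shows "set w \<subseteq> set u"
proof
  fix x assume "x \<in> set w"
  then have "x \<notin> set u \<Longrightarrow> trivial_on (set u) (vgen n w)"
    unfolding vgen_def using trivial_on_pow[OF tau_carrier] trivial_on_tau assms(1,2) by blast
  then show "x \<in> set u" using assms(3-5) by (auto simp: trivial_on_def)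
qed

end

text \<open>The modulus depends on the length of \<open>w\<close>, so every word comes with its own
  Magnus expansion, while \<open>tau\<close> and \<open>vgen\<close> are shared by all of
  them.\<close>

locale rho_setting = magnus_lyndon S T p X r "int p ^ (n - length w + 1)"
  for S :: "('a, 'm) monoid_scheme" (structure) and T p and X :: "'a set" and r n and w :: "'a list" +
  assumes p_gt_1: "1 < p" and w_lists: "w \<in> lists X" and w_len: "1 \<le> length w" "length w \<le> n"
begin

sublocale UU: UU_group p n "length w"
  by unfold_locales (use p_gt_1 w_len in auto)

abbreviation \<rho> where "\<rho> \<equiv> rho p S T X n w"
abbreviation sub where "sub i j \<equiv> take (j - i) (drop i w)"

lemma sub_lists: "sub i j \<in> lists X"
  using w_lists by (auto dest!: in_set_takeD in_set_dropD)

lemma rho_entry: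
  "i < j \<Longrightarrow> j < length w + 1 \<Longrightarrow> \<rho> \<sigma> $$ (i, j) = eps (sub i j) \<sigma>"
  by (simp add: rho_def Let_def)

lemma rho_carrier: "\<sigma> \<in> carrier S \<Longrightarrow> \<rho> \<sigma> \<in> carrier UU.U"
  unfolding UU.U_iff using UU.m_gt_1 eps_range[OF _ sub_lists]
  by (auto simp: rho_def Let_def)

text \<open>A cut of the subword from \<open>i\<close> to \<open>j\<close> after \<open>l\<close>
  letters corresponds to the summation index \<open>l + i\<close> of the matrix product, so the
  product rule for Magnus coefficients is matrix multiplication.\<close>

lemma rho_mult:
  assumes s: "\<sigma> \<in> carrier S" "\<tau> \<in> carrier S"
  shows "\<rho> (\<sigma> \<otimes> \<tau>) = \<rho> \<sigma> \<otimes>\<^bsub>UU.U\<^esub> \<rho> \<tau>"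
proof (rule UU.U_eqI)
  fix i j assume ij: "i < j" "j < length w + 1"
  have len: "length (sub i j) = j - i" using ij by simp
  have ne: "sub i j \<noteq> []" using len ij by auto
  have "(\<Sum>l\<in>{0<..<j - i}. eps (take l (sub i j)) \<sigma> * eps (drop l (sub i j)) \<tau>) =
      (\<Sum>k\<in>{i<..<j}. eps (sub i k) \<sigma> * eps (sub k j) \<tau>)"
  proof (rule sum.reindex_bij_witness[where i = "\<lambda>k. k - i" and j = "\<lambda>l. l + i"])
    fix l assume l: "l \<in> {0<..<j - i}"
    have "take l (sub i j) = sub i (l + i)" using l by (simp add: min_def)
    moreover have "drop l (sub i j) = sub (l + i) j" by (simp add: drop_take add.commute)
    ultimately show "eps (sub i (l + i)) \<sigma> * eps (sub (l + i) j) \<tau> = eps (take l (sub i j)) \<sigma> * eps (drop l (sub i j)) \<tau>"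
      by simp
  qed auto
  also have "\<dots> = UU.strict_conv (UU.ent (\<rho> \<sigma>)) (UU.ent (\<rho> \<tau>)) i j"
    unfolding UU.strict_conv_def by (rule sum.cong) (use ij rho_entry in auto)
  finally have "eps (sub i j) (\<sigma> \<otimes> \<tau>) =
      (eps (sub i j) \<sigma> + eps (sub i j) \<tau> + UU.strict_conv (UU.ent (\<rho> \<sigma>)) (UU.ent (\<rho> \<tau>)) i j) mod UU.m"
    using eps_mult_split[OF s sub_lists ne] len by simp
  then show "\<rho> (\<sigma> \<otimes> \<tau>) $$ (i, j) mod UU.m = (\<rho> \<sigma> \<otimes>\<^bsub>UU.U\<^esub> \<rho> \<tau>) $$ (i, j) mod UU.m"
    using UU.mult_entry[OF rho_carrier[OF s(1)] rho_carrier[OF s(2)] ij] rho_entry[OF ij] by simp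
qed (use s rho_carrier UU.mult_closed_U in auto)

lemma rho_hom: "\<rho> \<in> hom S UU.U"
  by (rule homI) (rule rho_carrier, assumption, rule rho_mult)

lemma rho_loc_const: "loc_const T \<rho>"
  unfolding loc_const_def
proof
  fix A
  have "openin T (\<Inter>(i, j) \<in> {..<length w + 1} \<times> {..<length w + 1}.
      {\<sigma> \<in> topspace T. \<rho> \<sigma> $$ (i, j) = A $$ (i, j)})"
  proof (intro openin_INT2)
    fix ij assume "ij \<in> {..<length w + 1} \<times> {..<length w + 1}"
    then obtain i j where ij: "ij = (i, j)" "i < length w + 1" "j < length w + 1" by auto
    have "loc_const T (\<lambda>\<sigma>. \<rho> \<sigma> $$ (i, j))"
    proof (cases "i < j")
      case True
      then show ?thesis using eps_loc_const[OF sub_lists[of j i]] ij by (simp add: rho_entry)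
    next
      case False
      then have "(\<lambda>\<sigma>. \<rho> \<sigma> $$ (i, j)) = (\<lambda>\<sigma>. if i = j then 1 else 0)" using ij by (auto simp: rho_def Let_def)
      then show ?thesis by (simp add: loc_const_const)
    qed
    then show "openin T (case ij of (i, j) \<Rightarrow> {\<sigma> \<in> topspace T. \<rho> \<sigma> $$ (i, j) = A $$ (i, j)})"
      using ij by (simp add: loc_const_def)
  qed auto
  note op = this
  have eq: "(\<Inter>(i, j) \<in> {..<length w + 1} \<times> {..<length w + 1}.
      {\<sigma> \<in> topspace T. \<rho> \<sigma> $$ (i, j) = A $$ (i, j)}) = {\<sigma> \<in> topspace T. \<rho> \<sigma> = A}"
    if "A \<in> carrier_mat (length w + 1) (length w + 1)"
  proof -
    have "\<rho> \<sigma> = A \<longleftrightarrow> (\<forall>i<length w + 1. \<forall>j<length w + 1. \<rho> \<sigma> $$ (i, j) = A $$ (i, j))" if "\<sigma> \<in> topspace T" for \<sigma>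
      using UU.mat_eqI[OF UU.U_carrier_mat[OF rho_carrier] \<open>A \<in> _\<close>, of \<sigma>] that topspace_carrier by auto
    then show ?thesis by auto
  qed
  have empty: "{\<sigma> \<in> topspace T. \<rho> \<sigma> = A} = {}" if "A \<notin> carrier_mat (length w + 1) (length w + 1)"
    using that by (auto simp: rho_def Let_def)
  show "openin T {\<sigma> \<in> topspace T. \<rho> \<sigma> = A}"
  proof (cases "A \<in> carrier_mat (length w + 1) (length w + 1)")
    case True
    show ?thesis using op by (simp only: eq[OF True])
  next
    case False
    show ?thesis unfolding empty[OF False] by (rule openin_empty)
  qed
qed

text \<open>The preimage of a filtration term is a closed subgroup, because \<open>\<rho>\<close> is
  a locally constant homomorphism, and it contains the required p-th powers and commutators.\<close>

lemma rho_filtration: "1 \<le> k \<Longrightarrow> \<sigma> \<in> L k \<Longrightarrow> \<rho> \<sigma> \<in> lower_p_central p UU.U (discrete_topology (carrier UU.U)) k"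
proof (induction k arbitrary: \<sigma> rule: dec_induct)
  case base
  then show ?case using rho_carrier by simp
next
  case (step k)
  interpret V: topological_grp UU.U "discrete_topology (carrier UU.U)" p by (rule UU.topological_grp_U)
  interpret h: group_hom S UU.U \<rho>
    using rho_hom by unfold_locales
  obtain l where l: "k = Suc l" using step.hyps by (cases k) auto
  let ?K = "{\<sigma> \<in> carrier S. \<rho> \<sigma> \<in> V.L (Suc k)}"
  have "L (Suc (Suc l)) \<subseteq> ?K"
  proof (rule L_minimal)
    have "subgroup ?K S"
    proof (rule subgroupI)
      show "?K \<noteq> {}" using h.hom_one subgroup.one_closed[OF V.L_subgroup] by (metis (mono_tags, lifting) empty_Collect_eq one_closed)
    next
      fix a assume "a \<in> ?K"
      then show "inv a \<in> ?K"
        using subgroup.m_inv_closed[OF V.L_subgroup, of "\<rho> a"] h.hom_inv[of a] by simp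
    next
      fix a b assume "a \<in> ?K" "b \<in> ?K"
      then show "a \<otimes> b \<in> ?K"
        using subgroup.m_closed[OF V.L_subgroup, of "\<rho> a" _ "\<rho> b"] h.hom_mult[of a b] by simp
    qed simp
    moreover have "closedin T ?K"
      using loc_const_closed[OF rho_loc_const, of "\<lambda>A. A \<in> V.L (Suc k)"] topspace_carrier by simp
    ultimately show "closed_subgroup ?K" by (simp add: closed_subgroup_def)
  next
    fix h assume h: "h \<in> L (Suc l)"
    then show "h [^] p \<in> ?K" using step.IH[of h] l V.L_pow[of "\<rho> h" l] L_carrier[OF h] h.hom_nat_pow[of h p] by simp
  next
    fix g h assume g: "g \<in> carrier S" and h: "h \<in> L (Suc l)"
    have "\<rho> (comm g h) = commutator UU.U (\<rho> g) (\<rho> h)"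
      using g L_carrier[OF h] by (simp add: commutator_def)
    then show "comm g h \<in> ?K"
      using step.IH[of h] l V.L_comm_carrier[of "\<rho> g" "\<rho> h" l] L_carrier[OF h] g h h.hom_closed[OF g] by simp
  qed
  then show ?case using step.prems l by blast
qed

lemma rho_UU_filt: "\<sigma> \<in> L n \<Longrightarrow> \<rho> \<sigma> \<in> UU_filt p n (length w)"
  using rho_filtration[of n \<sigma>] w_len by (simp add: UU_filt_def UU.UU_U)

lemma rho_corner:
  assumes "\<rho> \<sigma> = corner p n (length w) a"
  shows "eps w \<sigma> = a * int p ^ (n - length w)"
proof -
  have "\<rho> \<sigma> $$ (0, length w) = a * int p ^ (n - length w)" unfolding assms using w_len by (auto simp: corner_def)
  then show ?thesis using rho_entry[of 0 "length w" \<sigma>] w_len by (cases "w = []") auto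
qed

end

section \<open>Bases from triangular families of functionals\<close>

lemma sum_cong_mod:
  fixes m :: int
  shows "(\<And>k. k \<in> I \<Longrightarrow> f k mod m = g k mod m) \<Longrightarrow> sum f I mod m = sum g I mod m"
  by (induction I rule: infinite_finite_induct) (auto intro: mod_add_cong)

text \<open>Independence: in a linear relation the functional of an \<open>R\<close>-maximal index
  sees only its own vector. Spanning: a vector whose support lies in a finite set closed under
  predecessors is reduced to zero by removing maximal indices, and \<open>inj\<close> identifies the
  vector with empty support. No dimension enters, so \<open>I\<close> may be infinite.\<close>

lemma triangular_functionals_basis:
  fixes p :: nat and V :: "(int, 'v, 'z) module_scheme" and I :: "'i set"
    and b :: "'i \<Rightarrow> 'v" and \<phi> :: "'i \<Rightarrow> 'v \<Rightarrow> int" and R :: "'i \<Rightarrow> 'i \<Rightarrow> bool"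
  defines "K \<equiv> residue_ring (int p)"
  assumes p: "prime p" and vs: "vectorspace K V"
    and b: "\<And>i. i \<in> I \<Longrightarrow> b i \<in> carrier V"
    and add: "\<And>i x y. \<lbrakk>i \<in> I; x \<in> carrier V; y \<in> carrier V\<rbrakk> \<Longrightarrow> \<phi> i (x \<oplus>\<^bsub>V\<^esub> y) mod p = (\<phi> i x + \<phi> i y) mod p"
    and smult: "\<And>i k x. \<lbrakk>i \<in> I; k \<in> carrier K; x \<in> carrier V\<rbrakk> \<Longrightarrow> \<phi> i (k \<odot>\<^bsub>V\<^esub> x) mod p = (k * \<phi> i x) mod p"
    and inj: "\<And>x. x \<in> carrier V \<Longrightarrow> (\<And>i. i \<in> I \<Longrightarrow> \<phi> i x mod p = 0) \<Longrightarrow> x = \<zero>\<^bsub>V\<^esub>"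
    and finsupp: "\<And>x. x \<in> carrier V \<Longrightarrow> finite {i \<in> I. \<phi> i x mod p \<noteq> 0}"
    and diag: "\<And>i. i \<in> I \<Longrightarrow> \<phi> i (b i) mod p \<noteq> 0"
    and tri: "\<And>i j. \<lbrakk>i \<in> I; j \<in> I; \<phi> i (b j) mod p \<noteq> 0\<rbrakk> \<Longrightarrow> i = j \<or> R i j"
    and asym: "asymp_on I R" and trans: "transp_on I R"
    and fin_R: "\<And>j. j \<in> I \<Longrightarrow> finite {i \<in> I. R i j}"
  shows "inj_on b I \<and> vectorspace.basis K V (b ` I)"
proof -
  interpret vectorspace K V by fact
  have p1: "1 < p" using p prime_gt_1_nat by blast
  have K: "carrier K = {0..int p - 1}" "\<And>x y. x \<oplus>\<^bsub>K\<^esub> y = (x + y) mod int p" "\<zero>\<^bsub>K\<^esub> = 0"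
    by (simp_all add: K_def residue_ring_def)
  have Kmod: "k mod int p \<in> carrier K" for k
    using p1 pos_mod_sign[of "int p" k] pos_mod_bound[of "int p" k] by (auto simp: K(1))
  have bI: "b ` I \<subseteq> carrier V" using b by auto
  have zero: "\<phi> i \<zero>\<^bsub>V\<^esub> mod p = 0" if "i \<in> I" for i
    using smult[OF that, of 0 "\<zero>\<^bsub>V\<^esub>"] p1 by (simp add: K(1))
  have "inj_on b I"
  proof (rule inj_onI)
    fix i j assume ij: "i \<in> I" "j \<in> I" "b i = b j"
    then have "i = j \<or> R i j" "j = i \<or> R j i" using diag[of i] diag[of j] tri[of i j] tri[of j i] by auto
    then show "i = j" using asym ij by (meson asymp_onD)
  qed
  have lin: "\<phi> i (lincomb a A) mod p = (\<Sum>v\<in>A. a v * \<phi> i v) mod p"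
    if i: "i \<in> I" and A: "finite A" "A \<subseteq> carrier V" "a \<in> A \<rightarrow> carrier K" for i a A
    using A
  proof (induction A rule: finite_induct)
    case empty
    then show ?case using zero[OF i] by (simp add: lincomb_def)
  next
    case (insert v A)
    have c: "(\<lambda>v. a v \<odot>\<^bsub>V\<^esub> v) \<in> A \<rightarrow> carrier V" "a v \<odot>\<^bsub>V\<^esub> v \<in> carrier V" "v \<in> carrier V" "a v \<in> carrier K"
      using insert.prems by (auto simp: Pi_iff subset_iff)
    then have "lincomb a (insert v A) = (a v \<odot>\<^bsub>V\<^esub> v) \<oplus>\<^bsub>V\<^esub> lincomb a A"
      unfolding lincomb_def using insert.hyps by (simp add: M.finsum_insert)
    moreover have "lincomb a A \<in> carrier V" by (rule lincomb_closed) (use insert.prems in auto)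
    ultimately have "\<phi> i (lincomb a (insert v A)) mod p = (\<phi> i (a v \<odot>\<^bsub>V\<^esub> v) + \<phi> i (lincomb a A)) mod p"
      using add[OF i] c(2) by simp
    also have "\<dots> = (a v * \<phi> i v + (\<Sum>v\<in>A. a v * \<phi> i v)) mod p"
      using smult[OF i c(4,3)] insert.IH insert.prems by (intro mod_add_cong) auto
    finally show ?case using insert.hyps by simp
  qed
  have indep: "lin_indpt (b ` I)"
  proof
    assume "lin_dep (b ` I)"
    then obtain A a v where A: "finite A" "A \<subseteq> b ` I" "a \<in> A \<rightarrow> carrier K" "lincomb a A = \<zero>\<^bsub>V\<^esub>"
       "v \<in> A" "a v \<noteq> \<zero>\<^bsub>K\<^esub>" unfolding lin_dep_def by blast
    define J where "J = {i \<in> I. b i \<in> A \<and> a (b i) \<noteq> 0}"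
    have "b ` J \<subseteq> A" by (auto simp: J_def)
    then have "finite (b ` J)" using A(1) finite_subset by blast
    moreover have "inj_on b J" using \<open>inj_on b I\<close> by (auto simp: J_def inj_on_def)
    ultimately have "finite J" by (rule finite_imageD)
    moreover have "J \<noteq> {}" using A K(3) by (auto simp: J_def)
    moreover have "asymp_on J R" "transp_on J R"
      using asym trans by (auto simp: J_def intro: asymp_on_subset transp_on_subset)
    ultimately obtain i where i: "i \<in> J" "\<forall>j\<in>J. j \<noteq> i \<longrightarrow> \<not> R i j"
      using Finite_Set.bex_max_element[of J R] by blast
    have iI: "i \<in> I" "b i \<in> A" "a (b i) \<noteq> 0" using i by (auto simp: J_def)
    have "(\<Sum>v\<in>A. a v * \<phi> i v) mod p = (\<Sum>v\<in>A. if v = b i then a (b i) * \<phi> i (b i) else 0) mod p"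
    proof -
      have "(a v * \<phi> i v) mod p = (if v = b i then a (b i) * \<phi> i (b i) else 0) mod p" if v: "v \<in> A" for v
      proof (cases "v = b i \<or> a v = 0")
        case False
        obtain j where j: "j \<in> I" "v = b j" using v A by auto
        then have "j \<in> J" "j \<noteq> i" using False v by (auto simp: J_def)
        then have "\<phi> i (b j) mod p = 0" using i tri[OF iI(1) j(1)] by blast
        then show ?thesis using False j by (simp add: mod_mult_right_eq[symmetric])
      qed auto
      then show ?thesis by (rule sum_cong_mod)
    qed
    also have "\<dots> = (a (b i) * \<phi> i (b i)) mod p" using iI A(1) by simp
    finally have "(a (b i) * \<phi> i (b i)) mod p = 0"
      using lin[OF iI(1) A(1) _ A(3)] A(2,4) bI zero[OF iI(1)] by auto
    then have "int p dvd a (b i) \<or> int p dvd \<phi> i (b i)"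
      using p by (simp add: prime_dvd_mult_iff flip: dvd_eq_mod_eq_0)
    moreover have "\<not> int p dvd \<phi> i (b i)" using diag[OF iI(1)] by auto
    moreover have "\<not> int p dvd a (b i)"
      using A(3) iI by (auto simp: K(1) Pi_iff dest!: bspec zdvd_imp_le)
    ultimately show False by blast
  qed
  have sm: "LinearCombinations.submodule K (span (b ` I)) V" by (rule span_is_submodule[OF bI])
  \<comment> \<open>\<open>D\<close> contains the support of \<open>x\<close> and is closed under
    \<open>R\<close>-predecessors. The induction removes one \<open>R\<close>-maximal element at a
    time, which keeps \<open>D\<close> closed.\<close>
  have spanned: "x \<in> span (b ` I)"
    if "finite D" "D \<subseteq> I" "\<And>i j. j \<in> D \<Longrightarrow> i \<in> I \<Longrightarrow> R i j \<Longrightarrow> i \<in> D"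
      "x \<in> carrier V" "{i \<in> I. \<phi> i x mod p \<noteq> 0} \<subseteq> D" for D x
    using that
  proof (induction D arbitrary: x rule: finite_psubset_induct)
    case (psubset D)
    show ?case
    proof (cases "D = {}")
      case True
      then have "x = \<zero>\<^bsub>V\<^esub>" using inj psubset.prems by auto
      then show ?thesis using LinearCombinations.submodule.zero_closed[OF sm] by simp
    next
      case False
      have "asymp_on D R" "transp_on D R"
        using asym trans psubset.prems(1) by (auto intro: asymp_on_subset transp_on_subset)
      then obtain m where m: "m \<in> D" "\<forall>j\<in>D. j \<noteq> m \<longrightarrow> \<not> R m j"
        using Finite_Set.bex_max_element[of D R] psubset.hyps False by blast
      have mI: "m \<in> I" using m psubset.prems(1) by blast
      have "coprime (\<phi> m (b m)) (int p)"
        using diag[OF mI] p by (metis coprime_commute dvd_imp_mod_0 prime_imp_coprime prime_nat_int_transfer)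
      then obtain c where c: "[\<phi> m (b m) * c = 1] (mod int p)" using cong_solve_coprime_int by blast
      \<comment> \<open>\<open>k\<close> is minus the value at \<open>x\<close> divided by the
        diagonal value, so that the functional of index \<open>m\<close> vanishes on
        \<open>y\<close>.\<close>
      define k where "k = (- (\<phi> m x * c)) mod int p"
      define k' where "k' = (- k) mod int p"
      have kK: "k \<in> carrier K" "k' \<in> carrier K" unfolding k_def k'_def by (rule Kmod)+
      have kk: "k \<oplus>\<^bsub>K\<^esub> k' = \<zero>\<^bsub>K\<^esub>" by (simp add: K(2,3) k'_def mod_simps)
      define y where "y = x \<oplus>\<^bsub>V\<^esub> (k \<odot>\<^bsub>V\<^esub> b m)"
      have kb: "k \<odot>\<^bsub>V\<^esub> b m \<in> carrier V" "k' \<odot>\<^bsub>V\<^esub> b m \<in> carrier V" using kK b[OF mI] by auto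
      have yV: "y \<in> carrier V" using psubset.prems kb by (simp add: y_def)
      have \<phi>y: "\<phi> i y mod p = (\<phi> i x + k * \<phi> i (b m)) mod p" if "i \<in> I" for i
        unfolding y_def add[OF that psubset.prems(3) kb(1)]
        by (rule mod_add_cong[OF refl smult[OF that kK(1) b[OF mI]]])
      have "\<phi> m y mod p = 0"
      proof -
        have "(\<phi> m x + k * \<phi> m (b m)) mod p = (\<phi> m x - \<phi> m x * (\<phi> m (b m) * c)) mod p"
        proof -
          have "(\<phi> m x + k * \<phi> m (b m)) mod p = (\<phi> m x + - (\<phi> m x * c) * \<phi> m (b m)) mod p"
            unfolding k_def by (intro mod_add_cong mod_mult_cong refl) simp
          then show ?thesis by (simp add: algebra_simps)
        qed
        also have "\<dots> = (\<phi> m x - \<phi> m x * 1) mod p"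
          using c unfolding cong_def by (intro mod_diff_cong mod_mult_cong refl)
        finally show ?thesis using \<phi>y[OF mI] by simp
      qed
      moreover have "i \<in> D" if i: "i \<in> I" "\<phi> i y mod p \<noteq> 0" for i
      proof (rule ccontr)
        assume "i \<notin> D"
        then have "\<phi> i x mod p = 0" "\<not> R i m" "i \<noteq> m" using psubset.prems(2,4) i m by auto
        then have "\<phi> i (b m) mod p = 0" using tri[OF i(1) mI] by blast
        then have "(\<phi> i x + k * \<phi> i (b m)) mod p = 0" using \<open>\<phi> i x mod p = 0\<close>
          by (metis add.right_neutral mod_add_eq mod_mult_right_eq mult_zero_right mod_0)
        then show False using \<phi>y i by simp
      qed
      ultimately have supp: "{i \<in> I. \<phi> i y mod p \<noteq> 0} \<subseteq> D - {m}" by auto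
      have "y \<in> span (b ` I)"
      proof (rule psubset.IH[OF _ _ _ yV supp])
        show "D - {m} \<subset> D" using m by blast
        show "D - {m} \<subseteq> I" using psubset.prems by blast
        show "i \<in> D - {m}" if "j \<in> D - {m}" "i \<in> I" "R i j" for i j
          using that psubset.prems(2) m by auto
      qed
      moreover have "k' \<odot>\<^bsub>V\<^esub> b m \<in> span (b ` I)"
        using in_own_span[OF bI] mI kK LinearCombinations.submodule.smult_closed[OF sm] by blast
      ultimately have "y \<oplus>\<^bsub>V\<^esub> (k' \<odot>\<^bsub>V\<^esub> b m) \<in> span (b ` I)"
        by (rule LinearCombinations.submodule.m_closed[OF sm])
      moreover have "y \<oplus>\<^bsub>V\<^esub> (k' \<odot>\<^bsub>V\<^esub> b m) = x"
      proof -
        have "y \<oplus>\<^bsub>V\<^esub> (k' \<odot>\<^bsub>V\<^esub> b m) = x \<oplus>\<^bsub>V\<^esub> ((k \<oplus>\<^bsub>K\<^esub> k') \<odot>\<^bsub>V\<^esub> b m)"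
          unfolding y_def smult_l_distr[OF kK b[OF mI]] using psubset.prems kb by (simp add: M.a_assoc)
        then show ?thesis unfolding kk using b[OF mI] psubset.prems(3) by simp
      qed
      ultimately show ?thesis by simp
    qed
  qed
  have "carrier V \<subseteq> span (b ` I)"
  proof
    fix x assume x: "x \<in> carrier V"
    define E where "E = {i \<in> I. \<phi> i x mod p \<noteq> 0}"
    have E: "finite E" "E \<subseteq> I" using finsupp[OF x] by (auto simp: E_def)
    show "x \<in> span (b ` I)"
    \<comment> \<open>The support together with all its predecessors: finite by
      \<open>fin_R\<close>, closed by transitivity.\<close>
    proof (rule spanned[of "E \<union> (\<Union>j\<in>E. {i \<in> I. R i j})", OF _ _ _ x])
      show "finite (E \<union> (\<Union>j\<in>E. {i \<in> I. R i j}))" using E fin_R by auto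
      show "i \<in> E \<union> (\<Union>j\<in>E. {i \<in> I. R i j})"
        if "j \<in> E \<union> (\<Union>j\<in>E. {i \<in> I. R i j})" "i \<in> I" "R i j" for i j
        using that E(2) trans by (auto dest: transp_onD)
    qed (auto simp: E_def)
  qed
  moreover have "span (b ` I) \<subseteq> carrier V"
    using LinearCombinations.submodule.subset[OF sm] .
  ultimately have "basis (b ` I)" unfolding basis_def using indep bI by blast
  then show ?thesis using \<open>inj_on b I\<close> by blast
qed

section \<open>Quotient modules\<close>

text \<open>The union in the definition of scalar multiplication runs over equal cosets, because
  \<open>B\<close> is stable under scalars.\<close>

lemma quotient_module_coset_smult:
  assumes mod: "module K M" and B: "subgroup B (add_monoid M)"
    and Bs: "\<And>k x. k \<in> carrier K \<Longrightarrow> x \<in> B \<Longrightarrow> k \<odot>\<^bsub>M\<^esub> x \<in> B"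
    and k: "k \<in> carrier K" and x: "x \<in> carrier M"
  shows "k \<odot>\<^bsub>quotient_module M B\<^esub> (B +>\<^bsub>M\<^esub> x) = B +>\<^bsub>M\<^esub> (k \<odot>\<^bsub>M\<^esub> x)"
proof -
  interpret module K M by fact
  interpret abelian_subgroup B M
    by (rule abelian_subgroupI3[OF additive_subgroupI[OF B] M.abelian_group_axioms])
  have eq: "B +>\<^bsub>M\<^esub> (k \<odot>\<^bsub>M\<^esub> f) = B +>\<^bsub>M\<^esub> (k \<odot>\<^bsub>M\<^esub> x)" if f: "f \<in> B +>\<^bsub>M\<^esub> x" for f
  proof -
    obtain y where y: "y \<in> B" "f = y \<oplus>\<^bsub>M\<^esub> x" using f by (auto simp: a_r_coset_def r_coset_def)
    then have "k \<odot>\<^bsub>M\<^esub> f = k \<odot>\<^bsub>M\<^esub> y \<oplus>\<^bsub>M\<^esub> k \<odot>\<^bsub>M\<^esub> x"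
      using smult_r_distr[OF k _ x, of y] a_subset by blast
    then have "k \<odot>\<^bsub>M\<^esub> f \<in> B +>\<^bsub>M\<^esub> (k \<odot>\<^bsub>M\<^esub> x)"
      using Bs[OF k y(1)] by (auto simp: a_r_coset_def r_coset_def)
    then show ?thesis using a_repr_independence' k x by (metis smult_closed)
  qed
  have "(\<Union>f\<in>B +>\<^bsub>M\<^esub> x. B +>\<^bsub>M\<^esub> (k \<odot>\<^bsub>M\<^esub> f)) = B +>\<^bsub>M\<^esub> (k \<odot>\<^bsub>M\<^esub> x)"
  proof
    show "(\<Union>f\<in>B +>\<^bsub>M\<^esub> x. B +>\<^bsub>M\<^esub> (k \<odot>\<^bsub>M\<^esub> f)) \<subseteq> B +>\<^bsub>M\<^esub> (k \<odot>\<^bsub>M\<^esub> x)"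
      by (rule UN_least) (simp only: eq)
    show "B +>\<^bsub>M\<^esub> (k \<odot>\<^bsub>M\<^esub> x) \<subseteq> (\<Union>f\<in>B +>\<^bsub>M\<^esub> x. B +>\<^bsub>M\<^esub> (k \<odot>\<^bsub>M\<^esub> f))"
      using a_rcos_self[OF x] by (rule UN_upper)
  qed
  then show ?thesis by (simp add: quotient_module_def)
qed

lemma quotient_module_module:
  assumes mod: "module K M" and B: "subgroup B (add_monoid M)"
    and Bs: "\<And>k x. k \<in> carrier K \<Longrightarrow> x \<in> B \<Longrightarrow> k \<odot>\<^bsub>M\<^esub> x \<in> B"
  shows "module K (quotient_module M B)"
proof -
  interpret module K M by fact
  interpret abelian_subgroup B M
    by (rule abelian_subgroupI3[OF additive_subgroupI[OF B] M.abelian_group_axioms])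
  let ?V = "quotient_module M B"
  have car: "C \<in> carrier ?V \<longleftrightarrow> (\<exists>x\<in>carrier M. C = B +>\<^bsub>M\<^esub> x)" for C
    by (auto simp: quotient_module_def A_RCOSETS_def')
  have add: "(B +>\<^bsub>M\<^esub> x) \<oplus>\<^bsub>?V\<^esub> (B +>\<^bsub>M\<^esub> y) = B +>\<^bsub>M\<^esub> (x \<oplus>\<^bsub>M\<^esub> y)" if "x \<in> carrier M" "y \<in> carrier M" for x y
    using a_rcos_sum[OF that] by (simp add: quotient_module_def)
  have zero: "\<zero>\<^bsub>?V\<^esub> = B +>\<^bsub>M\<^esub> \<zero>\<^bsub>M\<^esub>"
    using M.a_coset_add_zero[OF a_subset] by (simp add: quotient_module_def)
  note smult = quotient_module_coset_smult[OF mod B Bs]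
  have ag: "abelian_group ?V"
  proof (rule abelian_groupI)
    fix C assume "C \<in> carrier ?V"
    then obtain x where x: "x \<in> carrier M" "C = B +>\<^bsub>M\<^esub> x" using car by blast
    then have "(B +>\<^bsub>M\<^esub> (\<ominus>\<^bsub>M\<^esub> x)) \<oplus>\<^bsub>?V\<^esub> C = \<zero>\<^bsub>?V\<^esub>"
      using add[of "\<ominus>\<^bsub>M\<^esub> x" x] zero by (simp add: M.l_neg)
    then show "\<exists>D\<in>carrier ?V. D \<oplus>\<^bsub>?V\<^esub> C = \<zero>\<^bsub>?V\<^esub>" using x car by blast
  qed (auto simp: car add zero M.a_ac)
  show ?thesis
  proof (rule moduleI[OF R.is_cring ag])
    fix a C assume "a \<in> carrier K" "C \<in> carrier ?V"
    then show "a \<odot>\<^bsub>?V\<^esub> C \<in> carrier ?V" by (auto simp: car smult)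
  next
    fix a b C assume "a \<in> carrier K" "b \<in> carrier K" "C \<in> carrier ?V"
    then show "(a \<oplus>\<^bsub>K\<^esub> b) \<odot>\<^bsub>?V\<^esub> C = a \<odot>\<^bsub>?V\<^esub> C \<oplus>\<^bsub>?V\<^esub> b \<odot>\<^bsub>?V\<^esub> C"
      by (auto simp: car smult add smult_l_distr)
  next
    fix a C D assume "a \<in> carrier K" "C \<in> carrier ?V" "D \<in> carrier ?V"
    then show "a \<odot>\<^bsub>?V\<^esub> (C \<oplus>\<^bsub>?V\<^esub> D) = a \<odot>\<^bsub>?V\<^esub> C \<oplus>\<^bsub>?V\<^esub> a \<odot>\<^bsub>?V\<^esub> D"
      by (auto simp: car smult add smult_r_distr)
  next
    fix a b C assume "a \<in> carrier K" "b \<in> carrier K" "C \<in> carrier ?V"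
    then show "(a \<otimes>\<^bsub>K\<^esub> b) \<odot>\<^bsub>?V\<^esub> C = a \<odot>\<^bsub>?V\<^esub> (b \<odot>\<^bsub>?V\<^esub> C)"
      by (auto simp: car smult smult_assoc1)
  next
    fix C assume "C \<in> carrier ?V"
    then show "\<one>\<^bsub>K\<^esub> \<odot>\<^bsub>?V\<^esub> C = C" by (auto simp: car smult)
  qed
qed

section \<open>The second cohomology group\<close>

locale cohomology2 = topological_grp G T p for G :: "('a, 'm) monoid_scheme" (structure) and T p +
  assumes p_prime: "prime p"
begin

abbreviation K where "K \<equiv> residue_ring (int p)"
abbreviation Z where "Z \<equiv> cocycles2 p G T"
abbreviation B where "B \<equiv> coboundaries2 p G T"
abbreviation C2 where "C2 \<equiv> carrier G \<times> carrier G"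

lemma p_gt_1: "1 < int p"
  using p_prime prime_gt_1_nat by auto

lemma K_simps: "carrier K = {0..int p - 1}" "x \<oplus>\<^bsub>K\<^esub> y = (x + y) mod int p" "x \<otimes>\<^bsub>K\<^esub> y = (x * y) mod int p"
   "\<zero>\<^bsub>K\<^esub> = 0" "\<one>\<^bsub>K\<^esub> = 1"
  by (simp_all add: residue_ring_def)

lemma field_K: "field K"
proof -
  interpret residues_prime p K by unfold_locales (use p_prime in auto)
  show ?thesis by (rule field_axioms)
qed

lemma mod_range: "k mod int p \<in> {0..int p - 1}"
  using p_gt_1 pos_mod_sign[of "int p" k] pos_mod_bound[of "int p" k] by auto

definition coboundary :: "('a \<Rightarrow> int) \<Rightarrow> 'a \<Rightarrow> 'a \<Rightarrow> int" where
  "coboundary u a b = u b - u (a \<otimes> b) + u a"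

lemma coboundary_add: "coboundary (\<lambda>a. u a + v a) a b = coboundary u a b + coboundary v a b"
  by (simp add: coboundary_def)

lemma coboundary_smult: "coboundary (\<lambda>a. k * u a) a b = k * coboundary u a b"
  by (simp add: coboundary_def algebra_simps)

definition defect :: "('a \<times> 'a \<Rightarrow> int) \<Rightarrow> 'a \<Rightarrow> 'a \<Rightarrow> 'a \<Rightarrow> int" where
  "defect f a b c = f (b, c) - f (a \<otimes> b, c) + f (a, b \<otimes> c) - f (a, b)"

lemma Z_iff: "f \<in> carrier Z \<longleftrightarrow> f \<in> extensional C2 \<and> (\<forall>x\<in>C2. f x \<in> {0..int p - 1}) \<and>
    loc_const (prod_topology T T) f \<and>
    (\<forall>a\<in>carrier G. \<forall>b\<in>carrier G. \<forall>c\<in>carrier G. defect f a b c mod p = 0)"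
  by (auto simp: cocycles2_def continuous_map_discrete_iff topspace_carrier defect_def)

lemma Z_add: "f \<oplus>\<^bsub>Z\<^esub> g = (\<lambda>x \<in> C2. (f x + g x) mod int p)"
  and Z_zero: "\<zero>\<^bsub>Z\<^esub> = (\<lambda>x \<in> C2. 0)"
  and Z_smult: "k \<odot>\<^bsub>Z\<^esub> f = (\<lambda>x \<in> C2. (k * f x) mod int p)"
  by (simp_all add: cocycles2_def)

lemma Z_defect: "f \<in> carrier Z \<Longrightarrow> a \<in> carrier G \<Longrightarrow> b \<in> carrier G \<Longrightarrow> c \<in> carrier G \<Longrightarrow> int p dvd defect f a b c"
  unfolding Z_iff by (simp add: dvd_eq_mod_eq_0)

lemma Z_mod: "f \<in> carrier Z \<Longrightarrow> x \<in> C2 \<Longrightarrow> f x mod int p = f x"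
  unfolding Z_iff by (metis atLeastAtMost_iff mod_pos_pos_trivial zle_diff1_eq)

lemma Z_eqI: "f \<in> carrier Z \<Longrightarrow> g \<in> carrier Z \<Longrightarrow> (\<And>x. x \<in> C2 \<Longrightarrow> f x mod int p = g x mod int p) \<Longrightarrow> f = g"
  by (rule extensionalityI[of _ C2]) (auto simp: Z_mod, auto simp: Z_iff)

lemma loc_const_restrict:
  assumes "loc_const (prod_topology T T) f"
  shows "loc_const (prod_topology T T) (\<lambda>x \<in> C2. h (f x))"
proof -
  have "{z \<in> topspace (prod_topology T T). (\<lambda>x \<in> C2. h (f x)) z = k} = {z \<in> topspace (prod_topology T T). h (f z) = k}" for k
    by (auto simp: topspace_carrier)
  then show ?thesis using loc_const_comp[OF assms, of h] unfolding loc_const_def by simp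
qed

text \<open>Cochains are formed with integer values and reduced modulo \<open>p\<close> only at the
  end; the cocycle identity is then a divisibility.\<close>

lemma Z_intro:
  assumes lc: "loc_const (prod_topology T T) f"
    and d: "\<And>a b c. a \<in> carrier G \<Longrightarrow> b \<in> carrier G \<Longrightarrow> c \<in> carrier G \<Longrightarrow> int p dvd defect f a b c"
  shows "(\<lambda>x \<in> C2. f x mod int p) \<in> carrier Z"
  unfolding Z_iff
proof (intro conjI ballI)
  show "loc_const (prod_topology T T) (\<lambda>x \<in> C2. f x mod int p)" by (rule loc_const_restrict[OF lc])
  fix a b c assume "a \<in> carrier G" "b \<in> carrier G" "c \<in> carrier G"
  note abc = this
  have "defect (\<lambda>x \<in> C2. f x mod int p) a b c mod p = defect f a b c mod p"
    unfolding defect_def by (intro mod_diff_cong mod_add_cong) (use abc in simp_all)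
  then show "defect (\<lambda>x \<in> C2. f x mod int p) a b c mod p = 0" using d[OF abc] by simp
qed (use mod_range in auto)

lemma Z_add_closed:
  assumes f: "f \<in> carrier Z" and g: "g \<in> carrier Z" shows "f \<oplus>\<^bsub>Z\<^esub> g \<in> carrier Z"
  unfolding Z_add
proof (rule Z_intro)
  show "loc_const (prod_topology T T) (\<lambda>x. f x + g x)"
    using f g by (intro loc_const_comp2[where h = "(+)"]) (auto simp: Z_iff)
  fix a b c assume "a \<in> carrier G" "b \<in> carrier G" "c \<in> carrier G"
  then have "int p dvd defect f a b c + defect g a b c" using Z_defect[OF f] Z_defect[OF g] by (intro dvd_add)
  then show "int p dvd defect (\<lambda>x. f x + g x) a b c" by (simp add: defect_def algebra_simps)
qed

lemma Z_smult_closed: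
  assumes f: "f \<in> carrier Z" shows "k \<odot>\<^bsub>Z\<^esub> f \<in> carrier Z"
  unfolding Z_smult
proof (rule Z_intro)
  show "loc_const (prod_topology T T) (\<lambda>x. k * f x)"
    using f by (intro loc_const_comp[where h = "\<lambda>y. k * y"]) (auto simp: Z_iff)
  fix a b c assume "a \<in> carrier G" "b \<in> carrier G" "c \<in> carrier G"
  then have "int p dvd k * defect f a b c" using Z_defect[OF f] by (intro dvd_mult)
  then show "int p dvd defect (\<lambda>x. k * f x) a b c" by (simp add: defect_def algebra_simps)
qed

lemma Z_zero_closed: "\<zero>\<^bsub>Z\<^esub> \<in> carrier Z"
  using Z_intro[of "\<lambda>x. 0"] by (simp add: Z_zero loc_const_const defect_def)

lemma module_Z: "module K Z"
proof (rule moduleI)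
  show "cring K" using field_K by (simp add: field_def domain_def)
  show "abelian_group Z"
  proof (rule abelian_groupI)
    fix f assume f: "f \<in> carrier Z"
    have "((- 1) \<odot>\<^bsub>Z\<^esub> f) \<oplus>\<^bsub>Z\<^esub> f = \<zero>\<^bsub>Z\<^esub>"
      by (rule Z_eqI[OF Z_add_closed[OF Z_smult_closed[OF f] f] Z_zero_closed])
        (simp add: Z_add Z_smult Z_zero mod_simps)
    then show "\<exists>g\<in>carrier Z. g \<oplus>\<^bsub>Z\<^esub> f = \<zero>\<^bsub>Z\<^esub>" using Z_smult_closed[OF f] by blast
    show "\<zero>\<^bsub>Z\<^esub> \<oplus>\<^bsub>Z\<^esub> f = f"
      by (rule Z_eqI[OF Z_add_closed[OF Z_zero_closed f] f]) (simp add: Z_add Z_zero)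
  next
    fix f g h assume f: "f \<in> carrier Z" and g: "g \<in> carrier Z" and h: "h \<in> carrier Z"
    show "f \<oplus>\<^bsub>Z\<^esub> g \<oplus>\<^bsub>Z\<^esub> h = f \<oplus>\<^bsub>Z\<^esub> (g \<oplus>\<^bsub>Z\<^esub> h)"
      by (rule Z_eqI[OF Z_add_closed[OF Z_add_closed[OF f g] h] Z_add_closed[OF f Z_add_closed[OF g h]]])
        (simp add: Z_add mod_simps add.assoc)
  qed (rule Z_add_closed, assumption, assumption, rule Z_zero_closed, simp add: Z_add add.commute)
next
  fix a b f assume f: "f \<in> carrier Z"
  show "(a \<oplus>\<^bsub>K\<^esub> b) \<odot>\<^bsub>Z\<^esub> f = a \<odot>\<^bsub>Z\<^esub> f \<oplus>\<^bsub>Z\<^esub> b \<odot>\<^bsub>Z\<^esub> f"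
    by (rule Z_eqI[OF Z_smult_closed[OF f] Z_add_closed[OF Z_smult_closed[OF f] Z_smult_closed[OF f]]])
      (simp add: Z_add Z_smult K_simps mod_simps distrib_right)
  show "(a \<otimes>\<^bsub>K\<^esub> b) \<odot>\<^bsub>Z\<^esub> f = a \<odot>\<^bsub>Z\<^esub> (b \<odot>\<^bsub>Z\<^esub> f)"
    by (rule Z_eqI[OF Z_smult_closed[OF f] Z_smult_closed[OF Z_smult_closed[OF f]]])
      (simp add: Z_smult K_simps mod_simps mult.assoc)
  show "\<one>\<^bsub>K\<^esub> \<odot>\<^bsub>Z\<^esub> f = f"
    by (rule Z_eqI[OF Z_smult_closed[OF f] f]) (simp add: Z_smult K_simps)
next
  fix a f g assume f: "f \<in> carrier Z" and g: "g \<in> carrier Z"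
  show "a \<odot>\<^bsub>Z\<^esub> (f \<oplus>\<^bsub>Z\<^esub> g) = a \<odot>\<^bsub>Z\<^esub> f \<oplus>\<^bsub>Z\<^esub> a \<odot>\<^bsub>Z\<^esub> g"
    by (rule Z_eqI[OF Z_smult_closed[OF Z_add_closed[OF f g]] Z_add_closed[OF Z_smult_closed[OF f] Z_smult_closed[OF g]]])
      (simp add: Z_add Z_smult mod_simps distrib_left)
qed (rule Z_smult_closed)

text \<open>Reducing an integer-valued \<open>u\<close> modulo \<open>p\<close> does not change its
  coboundary modulo \<open>p\<close>, so no bound on the values of \<open>u\<close> has to be
  carried along.\<close>

lemma B_iff: "f \<in> B \<longleftrightarrow> (\<exists>u. loc_const T u \<and> f = (\<lambda>x \<in> C2. coboundary u (fst x) (snd x) mod int p))"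
proof
  assume "f \<in> B"
  then show "\<exists>u. loc_const T u \<and> f = (\<lambda>x \<in> C2. coboundary u (fst x) (snd x) mod int p)"
    by (auto simp: coboundaries2_def continuous_map_discrete_iff coboundary_def case_prod_beta')
next
  assume "\<exists>u. loc_const T u \<and> f = (\<lambda>x \<in> C2. coboundary u (fst x) (snd x) mod int p)"
  then obtain u where u: "loc_const T u" "f = (\<lambda>x \<in> C2. coboundary u (fst x) (snd x) mod int p)" by blast
  let ?u = "\<lambda>a. u a mod int p"
  have "continuous_map T (discrete_topology {0..int p - 1}) ?u"
    unfolding continuous_map_discrete_iff
    using mod_range loc_const_comp[OF u(1), of "\<lambda>k. k mod int p"] by (intro conjI funcsetI)
  moreover have "f = (\<lambda>(a, b) \<in> C2. (?u b - ?u (a \<otimes> b) + ?u a) mod int p)"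
    unfolding u(2) coboundary_def case_prod_beta'
    by (intro restrict_ext mod_add_cong mod_diff_cong) simp_all
  ultimately show "f \<in> B"
    unfolding coboundaries2_def mem_Collect_eq by (intro exI[of _ ?u] conjI)
qed

lemma B_intro: "loc_const T u \<Longrightarrow> (\<lambda>x \<in> C2. coboundary u (fst x) (snd x) mod int p) \<in> B"
  using B_iff by blast

lemma B_subset: "B \<subseteq> carrier Z"
proof
  fix f assume "f \<in> B"
  then obtain u where u: "loc_const T u" "f = (\<lambda>x \<in> C2. coboundary u (fst x) (snd x) mod int p)"
    using B_iff by blast
  have m: "continuous_map (prod_topology T T) T (\<lambda>z. fst z \<otimes> snd z)"
    by (rule cont_mult[OF continuous_map_fst continuous_map_snd])
  show "f \<in> carrier Z" unfolding u(2)
  proof (rule Z_intro)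
    show "loc_const (prod_topology T T) (\<lambda>x. coboundary u (fst x) (snd x))"
      unfolding coboundary_def
      by (intro loc_const_comp2[where h = "(+)"] loc_const_comp2[where h = "(-)"]
          loc_const_compose[OF continuous_map_fst u(1)] loc_const_compose[OF continuous_map_snd u(1)]
          loc_const_compose[OF m u(1)])
  qed (simp add: defect_def coboundary_def m_assoc)
qed

lemma B_smult: "f \<in> B \<Longrightarrow> k \<odot>\<^bsub>Z\<^esub> f \<in> B"
proof -
  assume "f \<in> B"
  then obtain u where u: "loc_const T u" "f = (\<lambda>x \<in> C2. coboundary u (fst x) (snd x) mod int p)"
    using B_iff[THEN iffD1] by blast
  have "k \<odot>\<^bsub>Z\<^esub> f = (\<lambda>x \<in> C2. coboundary (\<lambda>a. k * u a) (fst x) (snd x) mod int p)"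
    unfolding Z_smult u(2) by (rule restrict_ext) (simp add: mod_simps coboundary_smult)
  then show ?thesis using B_intro[OF loc_const_comp[OF u(1), of "\<lambda>y. k * y"]] by simp
qed

lemma B_subgroup: "subgroup B (add_monoid Z)"
proof -
  interpret module K Z by (rule module_Z)
  have zero: "\<zero>\<^bsub>Z\<^esub> \<in> B" using B_intro[OF loc_const_const[of T 0]] by (simp add: Z_zero coboundary_def)
  have add: "f \<oplus>\<^bsub>Z\<^esub> g \<in> B" if fg: "f \<in> B" "g \<in> B" for f g
  proof -
    obtain u where u: "loc_const T u" "f = (\<lambda>x \<in> C2. coboundary u (fst x) (snd x) mod int p)"
      using B_iff[THEN iffD1, OF fg(1)] by blast
    obtain v where v: "loc_const T v" "g = (\<lambda>x \<in> C2. coboundary v (fst x) (snd x) mod int p)"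
      using B_iff[THEN iffD1, OF fg(2)] by blast
    have "f \<oplus>\<^bsub>Z\<^esub> g = (\<lambda>x \<in> C2. coboundary (\<lambda>a. u a + v a) (fst x) (snd x) mod int p)"
      unfolding Z_add u(2) v(2) by (rule restrict_ext) (simp add: mod_simps coboundary_add)
    then show ?thesis using B_intro[OF loc_const_comp2[OF u(1) v(1), of "(+)"]] by simp
  qed
  have "\<ominus>\<^bsub>Z\<^esub> f \<in> B" if "f \<in> B" for f
  proof -
    have fZ: "f \<in> carrier Z" using that B_subset by blast
    have "((- 1) \<odot>\<^bsub>Z\<^esub> f) \<oplus>\<^bsub>Z\<^esub> f = \<zero>\<^bsub>Z\<^esub>"
      by (rule Z_eqI[OF Z_add_closed[OF Z_smult_closed[OF fZ] fZ] Z_zero_closed])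
        (simp add: Z_add Z_smult Z_zero mod_simps)
    then have "\<ominus>\<^bsub>Z\<^esub> f = (- 1) \<odot>\<^bsub>Z\<^esub> f" using fZ Z_smult_closed M.minus_equality by blast
    then show ?thesis using B_smult[OF that] by simp
  qed
  then show ?thesis
    by (intro group.subgroupI[OF M.a_group]) (use B_subset zero add in \<open>auto simp: a_inv_def\<close>)
qed

lemma vectorspace_H2: "vectorspace K (H2 p G T)"
  unfolding vectorspace_def H2_def
  using quotient_module_module[OF module_Z B_subgroup B_smult] field_K by blast

sublocale BZ: abelian_subgroup B Z
  by (rule abelian_subgroupI3[OF additive_subgroupI[OF B_subgroup]])
    (use module_Z in \<open>simp add: module_def\<close>)

lemma H2_carrier: "x \<in> carrier (H2 p G T) \<longleftrightarrow> (\<exists>f\<in>carrier Z. x = class2 p G T f)"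
  by (auto simp: H2_def class2_def quotient_module_def A_RCOSETS_def')

lemma H2_add: "f \<in> carrier Z \<Longrightarrow> g \<in> carrier Z \<Longrightarrow>
    class2 p G T f \<oplus>\<^bsub>H2 p G T\<^esub> class2 p G T g = class2 p G T (f \<oplus>\<^bsub>Z\<^esub> g)"
  using BZ.a_rcos_sum by (simp add: H2_def class2_def quotient_module_def)

lemma H2_smult: "k \<in> carrier K \<Longrightarrow> f \<in> carrier Z \<Longrightarrow>
    k \<odot>\<^bsub>H2 p G T\<^esub> class2 p G T f = class2 p G T (k \<odot>\<^bsub>Z\<^esub> f)"
  unfolding H2_def class2_def by (rule quotient_module_coset_smult[OF module_Z B_subgroup B_smult])

lemma H2_zero: "\<zero>\<^bsub>H2 p G T\<^esub> = B"
  by (simp add: H2_def quotient_module_def)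

lemma class2_eq_iff:
  assumes f: "f \<in> carrier Z" and g: "g \<in> carrier Z"
  shows "class2 p G T f = class2 p G T g \<longleftrightarrow>
    (\<exists>u. loc_const T u \<and> (\<forall>a\<in>carrier G. \<forall>b\<in>carrier G. (f (a, b) - g (a, b) - coboundary u a b) mod int p = 0))"
    (is "?l \<longleftrightarrow> ?r")
proof
  assume ?l
  then have "f \<in> B +>\<^bsub>Z\<^esub> g" using BZ.a_rcos_self[OF f] by (simp add: class2_def)
  then obtain h where h: "h \<in> B" "f = h \<oplus>\<^bsub>Z\<^esub> g" by (auto simp: a_r_coset_def r_coset_def)
  then obtain u where u: "loc_const T u" "h = (\<lambda>x \<in> C2. coboundary u (fst x) (snd x) mod int p)"
    using B_iff[THEN iffD1] by blast
  have "(f (a, b) - g (a, b) - coboundary u a b) mod int p = 0" if "a \<in> carrier G" "b \<in> carrier G" for a b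
    unfolding h(2) Z_add u(2) using that by (simp add: mod_add_left_eq diff_diff_eq mod_diff_left_eq)
  then show ?r using u(1) by blast
next
  assume ?r
  then obtain u where u: "loc_const T u"
    "\<And>a b. a \<in> carrier G \<Longrightarrow> b \<in> carrier G \<Longrightarrow> (f (a, b) - g (a, b) - coboundary u a b) mod int p = 0" by blast
  define h where "h = (\<lambda>x \<in> C2. coboundary u (fst x) (snd x) mod int p)"
  have h: "h \<in> B" unfolding h_def by (rule B_intro[OF u(1)])
  have "f = h \<oplus>\<^bsub>Z\<^esub> g"
  proof (rule Z_eqI[OF f])
    show "h \<oplus>\<^bsub>Z\<^esub> g \<in> carrier Z" using Z_add_closed h g B_subset by blast
    fix x assume x: "x \<in> C2"
    then obtain a b where ab: "x = (a, b)" "a \<in> carrier G" "b \<in> carrier G" by auto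
    have "(f x - (coboundary u a b + g x)) mod int p = 0" using u(2)[OF ab(2,3)] ab by (simp add: algebra_simps)
    then have "f x mod int p = (coboundary u a b + g x) mod int p"
      by (simp add: mod_eq_dvd_iff dvd_eq_mod_eq_0)
    then show "f x mod int p = (h \<oplus>\<^bsub>Z\<^esub> g) x mod int p" using x ab by (simp add: Z_add h_def mod_simps)
  qed
  then have "f \<in> B +>\<^bsub>Z\<^esub> g" using h by (auto simp: a_r_coset_def r_coset_def)
  then show ?l unfolding class2_def using BZ.a_repr_independence'[OF _ g] by blast
qed

lemma class2_eq_B_iff:
  assumes "f \<in> carrier Z" shows "class2 p G T f = B \<longleftrightarrow> f \<in> B"
proof
  assume "class2 p G T f = B"
  then show "f \<in> B" using BZ.a_rcos_self[OF assms] by (simp add: class2_def)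
next
  assume "f \<in> B"
  then show "class2 p G T f = B" unfolding class2_def
    using BZ.a_coset_join2[OF assms B_subgroup] by simp
qed

end

section \<open>Quotients of topological groups\<close>

context topological_grp
begin

context
  fixes N assumes N: "N \<lhd> G"
begin

abbreviation (input) TN where "TN \<equiv> quotient_topology G T N"

lemma N_subgroup: "subgroup N G"
  using N by (simp add: normal_def)

lemma coset_self: "g \<in> carrier G \<Longrightarrow> g \<in> N #> g"
  using rcos_self N_subgroup by blast

lemma coset_mem: "g \<in> carrier G \<Longrightarrow> N #> g \<in> rcosets N"
  by (auto simp: RCOSETS_def)

lemma coset_unique: "C \<in> rcosets N \<Longrightarrow> g \<in> C \<Longrightarrow> C = N #> g"
  using repr_independence N_subgroup by (auto simp: RCOSETS_def)

lemma coset_carrier: "C \<in> rcosets N \<Longrightarrow> g \<in> C \<Longrightarrow> g \<in> carrier G"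
  using rcosets_part_G[OF N_subgroup] by blast

lemma Union_cosets: "U \<subseteq> rcosets N \<Longrightarrow> \<Union>U = {g \<in> carrier G. N #> g \<in> U}"
  using coset_unique coset_carrier coset_self by blast

lemma openin_quotient: "openin (quotient_topology G T N) U \<longleftrightarrow> U \<subseteq> rcosets N \<and> openin T (\<Union>U)"
proof -
  have "istopology (\<lambda>U. U \<subseteq> rcosets N \<and> openin T (\<Union>U))"
    unfolding istopology_def
  proof (intro conjI allI impI)
    fix U V assume U: "U \<subseteq> rcosets N \<and> openin T (\<Union>U)" and V: "V \<subseteq> rcosets N \<and> openin T (\<Union>V)"
    have "\<Union>(U \<inter> V) = \<Union>U \<inter> \<Union>V"
      using U V by (simp add: Union_cosets le_infI1) blast
    then show "openin T (\<Union>(U \<inter> V))" using U V by auto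
  next
    fix \<K> assume "\<forall>U\<in>\<K>. U \<subseteq> rcosets N \<and> openin T (\<Union>U)"
    then have "openin T (\<Union>U\<in>\<K>. \<Union>U)" by (intro openin_Union) auto
    moreover have "\<Union>(\<Union>\<K>) = (\<Union>U\<in>\<K>. \<Union>U)" by blast
    ultimately show "openin T (\<Union>(\<Union>\<K>))" by simp
  qed auto
  then show ?thesis by (simp add: quotient_topology_def topology_inverse')
qed

lemma topspace_quotient: "topspace (quotient_topology G T N) = rcosets N"
proof
  show "topspace (quotient_topology G T N) \<subseteq> rcosets N"
    using openin_topspace[of "quotient_topology G T N"] unfolding openin_quotient by blast
  have "\<Union>(rcosets N) = topspace T" using rcosets_part_G[OF N_subgroup] topspace_carrier by simp
  then have "openin (quotient_topology G T N) (rcosets N)" unfolding openin_quotient by simp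
  then show "rcosets N \<subseteq> topspace (quotient_topology G T N)" by (rule openin_subset)
qed

lemma proj_continuous: "continuous_map T (quotient_topology G T N) (\<lambda>g. N #> g)"
  unfolding continuous_map_def topspace_quotient topspace_carrier
  using coset_mem by (auto simp: openin_quotient Union_cosets)

lemma continuous_from_quotient:
  assumes "continuous_map T Z (\<lambda>g. f (N #> g))"
  shows "continuous_map (quotient_topology G T N) Z f"
  unfolding continuous_map_def topspace_quotient
proof (intro conjI allI impI)
  show "f \<in> rcosets N \<rightarrow> topspace Z"
    using continuous_map_funspace[OF assms] by (auto simp: topspace_carrier RCOSETS_def)
  fix U assume "openin Z U"
  then have "openin T {g \<in> topspace T. f (N #> g) \<in> U}" using assms by (rule openin_continuous_map_preimage[rotated])
  moreover have "\<Union>{C \<in> rcosets N. f C \<in> U} = {g \<in> topspace T. f (N #> g) \<in> U}"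
    by (subst Union_cosets) (use coset_mem in \<open>auto simp: topspace_carrier\<close>)
  ultimately show "openin (quotient_topology G T N) {C \<in> rcosets N. f C \<in> U}"
    unfolding openin_quotient by auto
qed

lemma loc_const_from_quotient:
  assumes "loc_const T (\<lambda>g. f (N #> g))" shows "loc_const (quotient_topology G T N) f"
  using continuous_from_quotient[of "discrete_topology UNIV" f] assms
  by (simp add: continuous_map_discrete_iff)

text \<open>The union of the image cosets is the union of the translates \<open>h V\<close> with
  \<open>h\<close> in \<open>N\<close>, hence open.\<close>

lemma proj_open:
  assumes V: "openin T V" shows "openin (quotient_topology G T N) ((\<lambda>g. N #> g) ` V)"
  unfolding openin_quotient
proof
  have VG: "V \<subseteq> carrier G" using openin_subset[OF V] topspace_carrier by simp
  then show "(\<lambda>g. N #> g) ` V \<subseteq> rcosets N" using coset_mem by auto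
  have "openin T {g \<in> topspace T. inv h \<otimes> g \<in> V}" if "h \<in> N" for h
    using openin_continuous_map_preimage[OF cont_mult[OF cont_const cont_id] V, of "inv h"]
      subgroup.mem_carrier[OF N_subgroup that] by simp
  then have "openin T (\<Union>h\<in>N. {g \<in> topspace T. inv h \<otimes> g \<in> V})" by auto
  moreover have "(\<Union>h\<in>N. {g \<in> topspace T. inv h \<otimes> g \<in> V}) = \<Union>((\<lambda>g. N #> g) ` V)"
  proof (intro equalityI subsetI)
    fix g assume "g \<in> (\<Union>h\<in>N. {g \<in> topspace T. inv h \<otimes> g \<in> V})"
    then obtain h where h: "h \<in> N" "g \<in> carrier G" "inv h \<otimes> g \<in> V" by (auto simp: topspace_carrier)
    then have "g = h \<otimes> (inv h \<otimes> g)" using subgroup.mem_carrier[OF N_subgroup] by (simp add: cancel_left)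
    then have "g \<in> N #> (inv h \<otimes> g)" unfolding r_coset_def using h(1) by blast
    then show "g \<in> \<Union>((\<lambda>g. N #> g) ` V)" using h(3) by blast
  next
    fix g assume "g \<in> \<Union>((\<lambda>g. N #> g) ` V)"
    then obtain h v where hv: "h \<in> N" "v \<in> V" "g = h \<otimes> v" by (auto simp: r_coset_def)
    then have "h \<in> carrier G" "v \<in> carrier G" using subgroup.mem_carrier[OF N_subgroup] VG by auto
    then have "inv h \<otimes> g = v" "g \<in> topspace T" using hv(3) topspace_carrier by (auto simp: cancel_left')
    then show "g \<in> (\<Union>h\<in>N. {g \<in> topspace T. inv h \<otimes> g \<in> V})" using hv by blast
  qed
  ultimately show "openin T (\<Union>((\<lambda>g. N #> g) ` V))" by simp
qed

text \<open>Continuity of the multiplication uses that the projection is open: boxes around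
  representatives in \<open>G\<close> project to boxes around the cosets.\<close>

lemma topological_grp_quotient: "topological_grp (G Mod N) (quotient_topology G T N)"
proof -
  interpret normal N G by (rule N)
  interpret Q: group "G Mod N" by (rule factorgroup_is_group)
  let ?TQ = "quotient_topology G T N"
  have car: "carrier (G Mod N) = rcosets N" by (simp add: FactGroup_def)
  have mult: "(N #> a) \<otimes>\<^bsub>G Mod N\<^esub> (N #> b) = N #> (a \<otimes> b)" if "a \<in> carrier G" "b \<in> carrier G" for a b
    using rcos_sum[OF that] by (simp add: FactGroup_def)
  have "continuous_map (prod_topology ?TQ ?TQ) ?TQ (\<lambda>z. fst z \<otimes>\<^bsub>G Mod N\<^esub> snd z)"
    unfolding continuous_map_def
  proof (intro conjI allI impI)
    show "(\<lambda>z. fst z \<otimes>\<^bsub>G Mod N\<^esub> snd z) \<in> topspace (prod_topology ?TQ ?TQ) \<rightarrow> topspace ?TQ"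
      using Q.m_closed unfolding topspace_prod_topology topspace_quotient car by auto
    fix U assume U: "openin ?TQ U"
    let ?W = "{z \<in> topspace (prod_topology ?TQ ?TQ). fst z \<otimes>\<^bsub>G Mod N\<^esub> snd z \<in> U}"
    have pre: "openin (prod_topology T T) {z \<in> topspace (prod_topology T T). N #> (fst z \<otimes> snd z) \<in> U}"
      using openin_continuous_map_preimage[OF continuous_map_compose[OF cont_mult[OF continuous_map_fst continuous_map_snd] proj_continuous] U]
      by (simp add: o_def)
    show "openin (prod_topology ?TQ ?TQ) ?W"
      unfolding openin_prod_topology_alt
    proof (intro allI impI)
      fix C D assume "(C, D) \<in> ?W"
      then have CD: "C \<in> rcosets N" "D \<in> rcosets N" "C \<otimes>\<^bsub>G Mod N\<^esub> D \<in> U" by (auto simp: topspace_quotient)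
      then obtain a b where ab: "a \<in> carrier G" "C = N #> a" "b \<in> carrier G" "D = N #> b" by (auto simp: RCOSETS_def)
      then have "(a, b) \<in> {z \<in> topspace (prod_topology T T). N #> (fst z \<otimes> snd z) \<in> U}"
        using CD(3) mult by (simp add: topspace_carrier)
      from pre[unfolded openin_prod_topology_alt, rule_format, OF this]
      obtain A' B' where AB: "openin T A'" "openin T B'" "a \<in> A'" "b \<in> B'"
        "A' \<times> B' \<subseteq> {z \<in> topspace (prod_topology T T). N #> (fst z \<otimes> snd z) \<in> U}" by blast
      have "(\<lambda>g. N #> g) ` A' \<times> (\<lambda>g. N #> g) ` B' \<subseteq> ?W"
      proof
        fix z assume "z \<in> (\<lambda>g. N #> g) ` A' \<times> (\<lambda>g. N #> g) ` B'"
        then obtain x y where xy: "x \<in> A'" "y \<in> B'" "z = (N #> x, N #> y)" by blast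
        then have "(x, y) \<in> {z \<in> topspace (prod_topology T T). N #> (fst z \<otimes> snd z) \<in> U}" using AB(5) by blast
        then have "x \<in> carrier G" "y \<in> carrier G" "N #> (x \<otimes> y) \<in> U" by (auto simp: topspace_carrier)
        then show "z \<in> ?W" using xy(3) mult coset_mem by (simp add: topspace_quotient)
      qed
      then show "\<exists>U V. openin ?TQ U \<and> openin ?TQ V \<and> C \<in> U \<and> D \<in> V \<and> U \<times> V \<subseteq> ?W"
        using proj_open[OF AB(1)] proj_open[OF AB(2)] AB(3,4) ab(2,4) by blast
    qed
  qed
  moreover have "continuous_map ?TQ ?TQ (\<lambda>C. inv\<^bsub>G Mod N\<^esub> C)"
  proof (rule continuous_from_quotient)
    have c: "continuous_map T ?TQ (\<lambda>g. N #> (inv g))"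
      using continuous_map_compose[OF cont_inv[OF cont_id] proj_continuous] by (simp add: o_def)
    have i: "inv\<^bsub>G Mod N\<^esub> (N #> g) = N #> (inv g)" if "g \<in> carrier G" for g
      using inv_FactGroup[of "N #> g"] rcos_inv[OF that] coset_mem[OF that] by (simp add: car)
    show "continuous_map T ?TQ (\<lambda>g. inv\<^bsub>G Mod N\<^esub> (N #> g))"
      by (rule continuous_map_eq[OF c]) (simp add: topspace_carrier i)
  qed
  ultimately show ?thesis
    by (simp add: topological_grp_def topological_grp_axioms_def topological_group_def Q.is_group
        topspace_quotient car case_prod_beta')
qed

end

end

section \<open>Extensions defined by cocycles\<close>

context cohomology2
begin

text \<open>The cocycle need not be normalized, hence the unit has the first component
  \<open>- f (\<one>, \<one>)\<close> modulo \<open>p\<close>.\<close>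

definition ext_grp :: "('a \<times> 'a \<Rightarrow> int) \<Rightarrow> (int \<times> 'a) monoid" where
  "ext_grp f = \<lparr>carrier = {0..int p - 1} \<times> carrier G,
     monoid.mult = (\<lambda>z z'. ((fst z + fst z' + f (snd z, snd z')) mod int p, snd z \<otimes> snd z')),
     one = ((- f (\<one>, \<one>)) mod int p, \<one>)\<rparr>"

definition ext_topology :: "(int \<times> 'a) topology" where
  "ext_topology = prod_topology (discrete_topology {0..int p - 1}) T"

lemma Z_one_left:
  assumes f: "f \<in> carrier Z" and a: "a \<in> carrier G" shows "f (\<one>, a) = f (\<one>, \<one>)"
proof -
  have "int p dvd f (\<one>, a) - f (\<one>, \<one>)" using Z_defect[OF f one_closed one_closed a] a by (simp add: defect_def)
  then have "f (\<one>, a) mod int p = f (\<one>, \<one>) mod int p" by (simp add: mod_eq_dvd_iff)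
  then show ?thesis using Z_mod[OF f, of "(\<one>, a)"] Z_mod[OF f, of "(\<one>, \<one>)"] a by simp
qed

lemma Z_one_right:
  assumes f: "f \<in> carrier Z" and a: "a \<in> carrier G" shows "f (a, \<one>) = f (\<one>, \<one>)"
proof -
  have "int p dvd f (\<one>, \<one>) - f (a, \<one>)" using Z_defect[OF f a one_closed one_closed] a by (simp add: defect_def)
  then have "f (\<one>, \<one>) mod int p = f (a, \<one>) mod int p" by (simp add: mod_eq_dvd_iff)
  then show ?thesis using Z_mod[OF f, of "(a, \<one>)"] Z_mod[OF f, of "(\<one>, \<one>)"] a by simp
qed

lemma mod_id: "k \<in> {0..int p - 1} \<Longrightarrow> k mod int p = k"
  by simp

lemma ext_inverse_mult:
  assumes f: "f \<in> carrier Z" and z: "z \<in> carrier (ext_grp f)"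
  shows "((- fst z - f (inv (snd z), snd z) - f (\<one>, \<one>)) mod int p, inv (snd z)) \<otimes>\<^bsub>ext_grp f\<^esub> z = \<one>\<^bsub>ext_grp f\<^esub>"
proof -
  have "((- fst z - f (inv (snd z), snd z) - f (\<one>, \<one>)) mod int p + fst z + f (inv (snd z), snd z)) mod int p
      = ((- fst z - f (inv (snd z), snd z) - f (\<one>, \<one>)) + fst z + f (inv (snd z), snd z)) mod int p"
    by (intro mod_add_cong refl) simp
  then show ?thesis using z by (auto simp: ext_grp_def)
qed

lemma ext_group:
  assumes f: "f \<in> carrier Z" shows "Group.group (ext_grp f)"
proof (rule groupI)
  fix x y assume "x \<in> carrier (ext_grp f)" "y \<in> carrier (ext_grp f)"
  then show "x \<otimes>\<^bsub>ext_grp f\<^esub> y \<in> carrier (ext_grp f)" using mod_range by (auto simp: ext_grp_def simp del: atLeastAtMost_iff)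
next
  show "\<one>\<^bsub>ext_grp f\<^esub> \<in> carrier (ext_grp f)" using mod_range by (simp add: ext_grp_def del: atLeastAtMost_iff)
next
  fix x y z assume "x \<in> carrier (ext_grp f)" "y \<in> carrier (ext_grp f)" "z \<in> carrier (ext_grp f)"
  then have c: "snd x \<in> carrier G" "snd y \<in> carrier G" "snd z \<in> carrier G" by (auto simp: ext_grp_def)
  let ?l = "fst x + fst y + f (snd x, snd y)" and ?r = "fst y + fst z + f (snd y, snd z)"
  have "int p dvd (?l + fst z + f (snd x \<otimes> snd y, snd z)) - (fst x + ?r + f (snd x, snd y \<otimes> snd z))"
    using Z_defect[OF f c] by (subst dvd_minus_iff[symmetric]) (simp add: defect_def algebra_simps)
  then have "(?l + fst z + f (snd x \<otimes> snd y, snd z)) mod int p = (fst x + ?r + f (snd x, snd y \<otimes> snd z)) mod int p"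
    by (simp only: mod_eq_dvd_iff)
  moreover have "(?l mod int p + fst z + f (snd x \<otimes> snd y, snd z)) mod int p = (?l + fst z + f (snd x \<otimes> snd y, snd z)) mod int p"
    by (intro mod_add_cong refl) simp
  moreover have "(fst x + ?r mod int p + f (snd x, snd y \<otimes> snd z)) mod int p = (fst x + ?r + f (snd x, snd y \<otimes> snd z)) mod int p"
    by (intro mod_add_cong refl) simp
  ultimately have "(?l mod int p + fst z + f (snd x \<otimes> snd y, snd z)) mod int p = (fst x + ?r mod int p + f (snd x, snd y \<otimes> snd z)) mod int p"
    by (simp only:)
  then show "x \<otimes>\<^bsub>ext_grp f\<^esub> y \<otimes>\<^bsub>ext_grp f\<^esub> z = x \<otimes>\<^bsub>ext_grp f\<^esub> (y \<otimes>\<^bsub>ext_grp f\<^esub> z)"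
    using c by (simp add: ext_grp_def m_assoc)
next
  fix x assume x: "x \<in> carrier (ext_grp f)"
  then have c: "snd x \<in> carrier G" "fst x \<in> {0..int p - 1}" by (auto simp: ext_grp_def)
  have "((- f (\<one>, \<one>)) mod int p + fst x + f (\<one>, snd x)) mod int p = ((- f (\<one>, \<one>)) + fst x + f (\<one>, snd x)) mod int p"
    by (intro mod_add_cong refl) simp
  also have "\<dots> = fst x" using mod_id[OF c(2)] Z_one_left[OF f c(1)] by simp
  finally show "\<one>\<^bsub>ext_grp f\<^esub> \<otimes>\<^bsub>ext_grp f\<^esub> x = x" using c by (simp add: ext_grp_def prod_eq_iff)
  show "\<exists>y\<in>carrier (ext_grp f). y \<otimes>\<^bsub>ext_grp f\<^esub> x = \<one>\<^bsub>ext_grp f\<^esub>"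
    by (rule bexI[where x = "((- fst x - f (inv (snd x), snd x) - f (\<one>, \<one>)) mod int p, inv (snd x))"],
        rule ext_inverse_mult[OF f x]) (use mod_range c(1) in \<open>simp add: ext_grp_def del: atLeastAtMost_iff\<close>)
qed

lemma ext_profinite:
  assumes f: "f \<in> carrier Z" and prof: "profinite_group G T"
  shows "profinite_group (ext_grp f) ext_topology"
proof -
  interpret E: group "ext_grp f" by (rule ext_group[OF f])
  let ?D = "discrete_topology {0..int p - 1}"
  have car: "carrier (ext_grp f) = {0..int p - 1} \<times> carrier G" by (simp add: ext_grp_def)
  have flc: "loc_const (prod_topology T T) f" using f by (simp add: Z_iff)
  have top: "topspace ext_topology = carrier (ext_grp f)"
    by (simp add: ext_topology_def car topspace_carrier)
  have c1: "loc_const ext_topology fst"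
    using continuous_map_fst[of ?D T] by (simp add: continuous_map_discrete_iff ext_topology_def)
  have c2: "continuous_map ext_topology T snd"
    unfolding ext_topology_def by (rule continuous_map_snd)
  have pair: "continuous_map Y ext_topology h"
    if "\<And>y. y \<in> topspace Y \<Longrightarrow> fst (h y) \<in> {0..int p - 1}" "loc_const Y (\<lambda>y. fst (h y))" "continuous_map Y T (\<lambda>y. snd (h y))"
    for Y :: "'y topology" and h
    unfolding ext_topology_def continuous_map_pairwise
    using that by (auto simp: continuous_map_discrete_iff o_def)
  have pairT: "continuous_map Y (prod_topology T T) (\<lambda>y. (g y, h y))"
    if "continuous_map Y T g" "continuous_map Y T h" for Y :: "'y topology" and g h
    using that by (simp add: continuous_map_pairwise o_def)
  let ?P = "prod_topology ext_topology ext_topology"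
  have s: "continuous_map ?P T (\<lambda>z. snd (fst z))" "continuous_map ?P T (\<lambda>z. snd (snd z))"
    using continuous_map_compose[OF continuous_map_fst c2] continuous_map_compose[OF continuous_map_snd c2]
    by (auto simp: o_def)
  have mult: "continuous_map ?P ext_topology (\<lambda>z. fst z \<otimes>\<^bsub>ext_grp f\<^esub> snd z)"
  proof (rule pair)
    show "fst (fst z \<otimes>\<^bsub>ext_grp f\<^esub> snd z) \<in> {0..int p - 1}" for z
      using mod_range by (simp add: ext_grp_def del: atLeastAtMost_iff)
    have "loc_const ?P (\<lambda>z. (fst (fst z) + fst (snd z) + f (snd (fst z), snd (snd z))) mod int p)"
      by (intro loc_const_comp[where h = "\<lambda>k. k mod int p"] loc_const_comp2[where h = "(+)"]
         loc_const_compose[OF continuous_map_fst c1] loc_const_compose[OF continuous_map_snd c1]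
         loc_const_compose[OF pairT[OF s] flc])
    then show "loc_const ?P (\<lambda>z. fst (fst z \<otimes>\<^bsub>ext_grp f\<^esub> snd z))" by (simp add: ext_grp_def)
    show "continuous_map ?P T (\<lambda>z. snd (fst z \<otimes>\<^bsub>ext_grp f\<^esub> snd z))"
      using cont_mult[OF s] by (simp add: ext_grp_def)
  qed
  have inv_eq: "inv\<^bsub>ext_grp f\<^esub> z = ((- fst z - f (inv (snd z), snd z) - f (\<one>, \<one>)) mod int p, inv (snd z))"
    if z: "z \<in> carrier (ext_grp f)" for z
    by (rule E.inv_equality[OF ext_inverse_mult[OF f z] z])
      (use z mod_range in \<open>auto simp: car simp del: atLeastAtMost_iff\<close>)
  have inv: "continuous_map ext_topology ext_topology (\<lambda>z. inv\<^bsub>ext_grp f\<^esub> z)"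
  proof (rule continuous_map_eq)
    show "continuous_map ext_topology ext_topology
        (\<lambda>z. ((- fst z - f (inv (snd z), snd z) - f (\<one>, \<one>)) mod int p, inv (snd z)))"
    proof (rule pair)
      show "loc_const ext_topology (\<lambda>y. fst ((- fst y - f (inv snd y, snd y) - f (\<one>, \<one>)) mod int p, inv snd y))"
        unfolding fst_conv
        by (intro loc_const_comp[where h = "\<lambda>k. k mod int p"] loc_const_comp2[where h = "(-)"]
          loc_const_comp[where h = uminus] c1 loc_const_const loc_const_compose[OF pairT[OF cont_inv[OF c2] c2] flc])
    qed (use mod_range cont_inv[OF c2] in \<open>simp_all del: atLeastAtMost_iff\<close>)
  qed (use inv_eq top in auto)
  have "topological_group (ext_grp f) ext_topology"
    unfolding topological_group_def using E.is_group top mult inv by (simp add: case_prod_beta')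
  moreover have "compact_space ext_topology" "Hausdorff_space ext_topology"
    using prof by (auto simp: ext_topology_def compact_space_prod_topology compact_space_discrete_topology
        Hausdorff_space_prod_topology profinite_group_def)
  moreover have "\<exists>z. C \<subseteq> {z}" if C: "connectedin ext_topology C" for C
  proof -
    have "connectedin ?D (fst ` C)"
      using connectedin_continuous_map_image[OF continuous_map_fst] C unfolding ext_topology_def by blast
    then have "\<exists>k. fst ` C \<subseteq> {k}" by (auto simp: connectedin_discrete_topology)
    moreover have "connectedin T (snd ` C)" using connectedin_continuous_map_image[OF c2 C] .
    then have "\<exists>g. snd ` C \<subseteq> {g}" using prof by (simp add: profinite_group_def)
    ultimately obtain k g where kg: "fst ` C \<subseteq> {k}" "snd ` C \<subseteq> {g}" by blast
    have "C \<subseteq> {(k, g)}"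
    proof
      fix z assume "z \<in> C"
      then have "fst z = k" "snd z = g" using kg by auto
      then show "z \<in> {(k, g)}" by (simp add: prod_eq_iff)
    qed
    then show ?thesis by (rule exI[where x = "(k, g)"])
  qed
  ultimately show ?thesis by (simp add: profinite_group_def)
qed

text \<open>A free profinite group has cohomological dimension at most 1: the extension defined by a
  cocycle splits, as the basis can be lifted.\<close>

lemma free_cocycle_splits:
  assumes free: "free_profinite_group G T X" and f: "f \<in> carrier Z"
  shows "\<exists>u. loc_const T u \<and> (\<forall>a\<in>carrier G. \<forall>b\<in>carrier G. (f (a, b) - coboundary u a b) mod int p = 0)"
proof -
  have prof: "profinite_group G T" and XG: "X \<subseteq> carrier G" and dense: "T closure_of (generate G X) = carrier G"
    and conv: "converges_to_1 X (\<lambda>x. x) G T"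
    using free by (auto simp: free_profinite_group_def)
  \<comment> \<open>Letters are lifted with the first component of the unit. So the lifting map
    sends \<open>\<one>\<close> to the unit, and by continuity the lifted letters converge to
    1.\<close>
  let ?k = "(- f (\<one>, \<one>)) mod int p"
  let ?\<phi> = "\<lambda>x. (?k, x)"
  have cont: "continuous_map T ext_topology ?\<phi>"
    unfolding ext_topology_def continuous_map_pairwise
    using mod_range[of "- f (\<one>, \<one>)"] cont_id by (auto simp: o_def)
  have convE: "converges_to_1 X ?\<phi> (ext_grp f) ext_topology"
    unfolding converges_to_1_def
  proof (intro conjI allI impI)
    show "?\<phi> \<in> X \<rightarrow> carrier (ext_grp f)" using XG mod_range by (auto simp: ext_grp_def simp del: atLeastAtMost_iff)
    fix N assume N: "N \<lhd> ext_grp f \<and> openin ext_topology N"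
    then have "\<one>\<^bsub>ext_grp f\<^esub> \<in> N" by (meson normal_def subgroup.one_closed)
    then have "\<one> \<in> {g \<in> topspace T. ?\<phi> g \<in> N}" by (simp add: ext_grp_def topspace_carrier)
    then obtain M where M: "M \<lhd> G" "openin T M" "M \<subseteq> {g \<in> topspace T. ?\<phi> g \<in> N}"
      using profinite_open_normal_nbhd[OF prof openin_continuous_map_preimage[OF cont]] N by blast
    then have "finite {x \<in> X. x \<notin> M}" using conv by (auto simp: converges_to_1_def)
    moreover have "{x \<in> X. ?\<phi> x \<notin> N} \<subseteq> {x \<in> X. x \<notin> M}" using M(3) by blast
    ultimately show "finite {x \<in> X. ?\<phi> x \<notin> N}" by (rule rev_finite_subset)
  qed
  have ep: "free_extension_property TYPE(int \<times> 'a) G T X" by (rule free_profinite_group_universal[OF free])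
  have "\<exists>!\<psi>. \<psi> \<in> continuous_hom G T (ext_grp f) ext_topology \<and> (\<forall>x\<in>X. \<psi> x = ?\<phi> x)"
    using ep[unfolded free_extension_property_def] 
    by (elim allE impE) (rule conjI[OF ext_profinite[OF f prof] convE])
  then obtain \<psi> where \<psi>: "\<psi> \<in> continuous_hom G T (ext_grp f) ext_topology" "\<And>x. x \<in> X \<Longrightarrow> \<psi> x = ?\<phi> x" by blast
  have \<psi>h: "\<psi> \<in> hom G (ext_grp f)" and \<psi>c: "continuous_map T ext_topology \<psi>"
    using \<psi>(1) unfolding continuous_hom_def by blast+
  interpret E: group "ext_grp f" by (rule ext_group[OF f])
  interpret h: group_hom G "ext_grp f" \<psi>
    using \<psi>h by unfold_locales
  have snd_mult: "snd (x \<otimes>\<^bsub>ext_grp f\<^esub> y) = snd x \<otimes> snd y"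
    and fst_mult: "fst (x \<otimes>\<^bsub>ext_grp f\<^esub> y) = (fst x + fst y + f (snd x, snd y)) mod int p" for x y
    by (simp_all add: ext_grp_def)
  have snd_car: "snd x \<in> carrier G" if "x \<in> carrier (ext_grp f)" for x using that by (auto simp: ext_grp_def)
  have sh: "(\<lambda>g. snd (\<psi> g)) \<in> hom G G"
    by (rule homI) (simp_all add: snd_mult snd_car)
  interpret s: group_hom G G "\<lambda>g. snd (\<psi> g)"
    using sh by unfold_locales
  have sc: "continuous_map T T (\<lambda>g. snd (\<psi> g))"
    using continuous_map_compose[OF \<psi>c[unfolded ext_topology_def] continuous_map_snd] by (simp add: o_def)
  \<comment> \<open>The second component of \<open>\<psi>\<close> is a continuous endomorphism that
    fixes \<open>X\<close>; by density it is the identity, so \<open>\<psi>\<close> is a homomorphic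
    section.\<close>
  let ?K = "{g \<in> carrier G. inv g \<otimes> snd (\<psi> g) \<in> {\<one>}}"
  have K_iff: "g \<in> ?K \<longleftrightarrow> g \<in> carrier G \<and> snd (\<psi> g) = g" for g
  proof (cases "g \<in> carrier G")
    case True
    then have "inv g \<otimes> snd (\<psi> g) = \<one> \<longleftrightarrow> snd (\<psi> g) = g"
      using inv_equality[of "inv g" "snd (\<psi> g)"] s.hom_closed[OF True] by (auto simp: inv_inv)
    then show ?thesis by simp
  qed simp
  have "closed_subgroup ?K"
    unfolding closed_subgroup_def
  proof
    have "closedin T {\<one>}"
      using closedin_Hausdorff_singleton[of T \<one>] prof by (simp add: profinite_group_def topspace_carrier)
    then show "closedin T ?K"
      by (rule closed_preimage[OF cont_mult[OF cont_inv[OF cont_id] sc]])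
        (use closedin_topspace[of T] in \<open>simp add: topspace_carrier\<close>)
    show "subgroup ?K G"
    proof (rule subgroupI)
      show "?K \<noteq> {}" using K_iff[of \<one>] s.hom_one by blast
      show "inv a \<in> ?K" if "a \<in> ?K" for a using that s.hom_inv[of a] unfolding K_iff by simp
      show "a \<otimes> b \<in> ?K" if "a \<in> ?K" "b \<in> ?K" for a b
        using that s.hom_mult[of a b] unfolding K_iff by simp
    qed auto
  qed
  moreover have "X \<subseteq> ?K"
  proof
    fix x assume x: "x \<in> X"
    show "x \<in> ?K" unfolding K_iff using \<psi>(2)[OF x] x XG by auto
  qed
  ultimately have "carrier G \<subseteq> ?K" using closure_generate_minimal[of ?K X] dense by metis
  then have snd_id: "snd (\<psi> g) = g" if "g \<in> carrier G" for g using that K_iff by blast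
  \<comment> \<open>The sign: the first components of a homomorphic section add up with the error
    \<open>f\<close>, so \<open>f\<close> is the coboundary of their negative.\<close>
  let ?u = "\<lambda>g. - fst (\<psi> g)"
  have "loc_const T (\<lambda>g. fst (\<psi> g))"
    using continuous_map_compose[OF \<psi>c[unfolded ext_topology_def] continuous_map_fst]
    by (simp add: o_def continuous_map_discrete_iff)
  then have "loc_const T ?u" by (rule loc_const_comp)
  moreover have "(f (a, b) - coboundary ?u a b) mod int p = 0" if ab: "a \<in> carrier G" "b \<in> carrier G" for a b
  proof -
    have "fst (\<psi> (a \<otimes> b)) = (fst (\<psi> a) + fst (\<psi> b) + f (a, b)) mod int p"
      using h.hom_mult[OF ab] snd_id ab by (simp add: fst_mult)
    then have e: "(f (a, b) - coboundary ?u a b) = (fst (\<psi> a) + fst (\<psi> b) + f (a, b)) - (fst (\<psi> a) + fst (\<psi> b) + f (a, b)) mod int p"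
      by (simp add: coboundary_def)
    show ?thesis unfolding e by (simp add: mod_diff_right_eq)
  qed
  ultimately show ?thesis by blast
qed

end

section \<open>Classes of central extensions\<close>

locale central_extension = topological_grp E "discrete_topology (carrier E)" p
  for E :: "('e, 'm) monoid_scheme" (structure) and p +
  fixes N :: "'e set" and \<iota> :: "int \<Rightarrow> 'e"
  assumes p_prime: "prime p" and N_normal: "N \<lhd> E"
    and \<iota>_carrier: "a \<in> {0..int p - 1} \<Longrightarrow> \<iota> a \<in> carrier E"
    and \<iota>_mult: "a \<in> {0..int p - 1} \<Longrightarrow> b \<in> {0..int p - 1} \<Longrightarrow> \<iota> a \<otimes> \<iota> b = \<iota> ((a + b) mod int p)"
    and \<iota>_central: "a \<in> {0..int p - 1} \<Longrightarrow> x \<in> carrier E \<Longrightarrow> \<iota> a \<otimes> x = x \<otimes> \<iota> a"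
    and \<iota>_inj: "inj_on \<iota> {0..int p - 1}"
    and N_\<iota>: "N \<subseteq> \<iota> ` {0..int p - 1}"
begin

abbreviation TE where "TE \<equiv> discrete_topology (carrier E)"

sublocale Q: cohomology2 "E Mod N" "quotient_topology E TE N" p
  by (rule cohomology2.intro[OF topological_grp_quotient[OF N_normal]]) (rule cohomology2_axioms.intro[OF p_prime])

lemma mod_range: "k mod int p \<in> {0..int p - 1}"
  by (rule Q.mod_range)

text \<open>The identification \<open>\<iota>\<close> extended to a homomorphism on all integers, so
  that factor sets can be calculated without reductions.\<close>

definition j :: "int \<Rightarrow> 'e" where "j k = \<iota> (k mod int p)"

lemma j_carrier [simp]: "j k \<in> carrier E"
  unfolding j_def by (rule \<iota>_carrier[OF mod_range])

lemma j_add: "j a \<otimes> j b = j (a + b)"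
  unfolding j_def using \<iota>_mult[OF mod_range mod_range] by (simp add: mod_add_eq)

lemma j_central: "x \<in> carrier E \<Longrightarrow> j a \<otimes> x = x \<otimes> j a"
  unfolding j_def by (rule \<iota>_central[OF mod_range])

lemma j_eq: "j a = j b \<longleftrightarrow> int p dvd a - b"
  unfolding j_def using inj_on_eq_iff[OF \<iota>_inj mod_range mod_range] by (simp add: mod_eq_dvd_iff)

lemma j_range: "a \<in> {0..int p - 1} \<Longrightarrow> j a = \<iota> a"
  by (simp add: j_def)

lemma N_j: "x \<in> N \<Longrightarrow> \<exists>a\<in>{0..int p - 1}. x = j a"
  using N_\<iota> j_range by fastforce

lemma j_cancel:
  assumes "x \<in> carrier E" "j a \<otimes> x = j b \<otimes> x" shows "int p dvd a - b"
proof -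
  have "j a = j b" using assms by simp
  then show ?thesis by (simp add: j_eq)
qed

lemma carQ: "carrier (E Mod N) = rcosets N"
  by (simp add: FactGroup_def)

lemma loc_const_Q: "loc_const (quotient_topology E TE N) f"
  by (rule loc_const_from_quotient[OF N_normal]) (auto simp: loc_const_def)

lemma topspace_Q: "topspace (quotient_topology E TE N) = rcosets N"
  by (rule topspace_quotient[OF N_normal])

lemma loc_const_QQ: "loc_const (prod_topology (quotient_topology E TE N) (quotient_topology E TE N)) f"
proof -
  let ?TQ = "quotient_topology E TE N"
  have "loc_const (prod_topology ?TQ ?TQ) (\<lambda>z. f (fst z, snd z))"
    by (rule loc_const_comp2[OF loc_const_compose[OF continuous_map_fst loc_const_Q[of "\<lambda>x. x"]]
        loc_const_compose[OF continuous_map_snd loc_const_Q[of "\<lambda>x. x"]]])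
  then show ?thesis by simp
qed

lemma same_coset:
  assumes C: "C \<in> rcosets N" and x: "x \<in> C" and y: "y \<in> C"
  shows "\<exists>a\<in>{0..int p - 1}. x = j a \<otimes> y"
proof -
  have yc: "y \<in> carrier E" using coset_carrier[OF N_normal C y] .
  have "C = N #> y" by (rule coset_unique[OF N_normal C y])
  then obtain k where "k \<in> N" "x = k \<otimes> y" using x by (auto simp: r_coset_def)
  then show ?thesis using N_j by blast
qed

lemma mult_coset:
  assumes "C \<in> rcosets N" "D \<in> rcosets N" "x \<in> C" "y \<in> D"
  shows "x \<otimes> y \<in> C \<otimes>\<^bsub>E Mod N\<^esub> D"
  using assms by (auto simp: FactGroup_def set_mult_def)

definition is_section :: "('e set \<Rightarrow> 'e) \<Rightarrow> bool" where
  "is_section s \<longleftrightarrow> (\<forall>C\<in>rcosets N. s C \<in> C)"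

definition factors :: "('e set \<times> 'e set \<Rightarrow> int) \<Rightarrow> ('e set \<Rightarrow> 'e) \<Rightarrow> bool" where
  "factors f s \<longleftrightarrow> f \<in> carrier Q.Z \<and> is_section s \<and>
     (\<forall>C\<in>rcosets N. \<forall>D\<in>rcosets N. s C \<otimes> s D = j (f (C, D)) \<otimes> s (C \<otimes>\<^bsub>E Mod N\<^esub> D))"

lemma section_carrier: "is_section s \<Longrightarrow> C \<in> rcosets N \<Longrightarrow> s C \<in> carrier E"
  unfolding is_section_def using coset_carrier[OF N_normal] by blast

lemma factor_sets_iff: "f \<in> factor_sets p E TE N \<iota> \<longleftrightarrow> (\<exists>s. factors f s)"
proof -
  have cont: "continuous_map (quotient_topology E TE N) TE s" if "is_section s" for s
    unfolding continuous_map_discrete_iff topspace_Q using loc_const_Q section_carrier[OF that] by blast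
  have j: "\<iota> (f (C, D)) = j (f (C, D))" if "f \<in> carrier Q.Z" "C \<in> rcosets N" "D \<in> rcosets N" for C D
    using that j_range[of "f (C, D)"] unfolding Q.Z_iff carQ by (metis SigmaI)
  have eq: "(\<forall>C\<in>rcosets N. \<forall>D\<in>rcosets N. s C \<otimes> s D = \<iota> (f (C, D)) \<otimes> s (C \<otimes>\<^bsub>E Mod N\<^esub> D)) \<longleftrightarrow>
      (\<forall>C\<in>rcosets N. \<forall>D\<in>rcosets N. s C \<otimes> s D = j (f (C, D)) \<otimes> s (C \<otimes>\<^bsub>E Mod N\<^esub> D))"
    if "f \<in> carrier Q.Z" for s
    by (intro ball_cong refl) (simp only: j[OF that])
  show ?thesis
    unfolding factor_sets_def factors_def mem_Collect_eq carQ is_section_def[symmetric]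
  proof (rule iffI; elim exE conjE)
    fix s assume Z: "f \<in> carrier Q.Z" and s: "is_section s"
      and A: "\<forall>C\<in>rcosets N. \<forall>D\<in>rcosets N. s C \<otimes> s D = \<iota> (f (C, D)) \<otimes> s (C \<otimes>\<^bsub>E Mod N\<^esub> D)"
    show "\<exists>s. f \<in> carrier Q.Z \<and> is_section s \<and>
        (\<forall>C\<in>rcosets N. \<forall>D\<in>rcosets N. s C \<otimes> s D = j (f (C, D)) \<otimes> s (C \<otimes>\<^bsub>E Mod N\<^esub> D))"
      by (intro exI[of _ s] conjI Z s eq[OF Z, THEN iffD1] A)
  next
    fix s assume Z: "f \<in> carrier Q.Z" and s: "is_section s"
      and A: "\<forall>C\<in>rcosets N. \<forall>D\<in>rcosets N. s C \<otimes> s D = j (f (C, D)) \<otimes> s (C \<otimes>\<^bsub>E Mod N\<^esub> D)"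
    show "f \<in> carrier Q.Z \<and> (\<exists>s. continuous_map (quotient_topology E TE N) TE s \<and> is_section s \<and>
        (\<forall>C\<in>rcosets N. \<forall>D\<in>rcosets N. s C \<otimes> s D = \<iota> (f (C, D)) \<otimes> s (C \<otimes>\<^bsub>E Mod N\<^esub> D)))"
      by (intro exI[of _ s] conjI Z s eq[OF Z, THEN iffD2] A cont[OF s])
  qed
qed

text \<open>Any choice of representatives is a section, and continuity is automatic since
  \<open>E\<close> is discrete. Evaluating a product of three representatives in two ways gives the
  cocycle identity.\<close>

lemma factors_exist: "\<exists>f s. factors f s"
proof -
  define s where "s = (\<lambda>C. SOME x. x \<in> (C :: 'e set))"
  have s: "s C \<in> C" if "C \<in> rcosets N" for C
  proof -
    obtain a where "a \<in> carrier E" "C = N #> a" using \<open>C \<in> rcosets N\<close> by (auto simp: RCOSETS_def)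
    then have "a \<in> C" using coset_self[OF N_normal] by simp
    then show ?thesis unfolding s_def by (rule someI)
  qed
  then have sec: "is_section s" by (simp add: is_section_def)
  have mc: "C \<otimes>\<^bsub>E Mod N\<^esub> D \<in> rcosets N" if "C \<in> rcosets N" "D \<in> rcosets N" for C D
    using Q.m_closed that unfolding carQ by blast
  have "\<exists>a\<in>{0..int p - 1}. s C \<otimes> s D = j a \<otimes> s (C \<otimes>\<^bsub>E Mod N\<^esub> D)"
    if "C \<in> rcosets N" "D \<in> rcosets N" for C D
    using same_coset[OF mc[OF that] mult_coset[OF that s[OF that(1)] s[OF that(2)]] s[OF mc[OF that]]] .
  then obtain f0 where f0: "f0 C D \<in> {0..int p - 1}" "s C \<otimes> s D = j (f0 C D) \<otimes> s (C \<otimes>\<^bsub>E Mod N\<^esub> D)"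
    if "C \<in> rcosets N" "D \<in> rcosets N" for C D by metis
  define f where "f = (\<lambda>z \<in> Q.C2. f0 (fst z) (snd z) mod int p)"
  have fj: "j (f (C, D)) = j (f0 C D)" if "C \<in> rcosets N" "D \<in> rcosets N" for C D
    using that by (simp add: f_def carQ j_def)
  have "f \<in> carrier Q.Z" unfolding f_def
  proof (rule Q.Z_intro[OF loc_const_QQ])
    fix A B C assume "A \<in> carrier (E Mod N)" "B \<in> carrier (E Mod N)" "C \<in> carrier (E Mod N)"
    then have ABC: "A \<in> rcosets N" "B \<in> rcosets N" "C \<in> rcosets N" by (simp_all only: carQ)
    let ?AB = "A \<otimes>\<^bsub>E Mod N\<^esub> B" and ?BC = "B \<otimes>\<^bsub>E Mod N\<^esub> C"
    have m: "?AB \<in> rcosets N" "?BC \<in> rcosets N" "?AB \<otimes>\<^bsub>E Mod N\<^esub> C \<in> rcosets N"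
      using ABC mc by blast+
    have assoc: "A \<otimes>\<^bsub>E Mod N\<^esub> ?BC = ?AB \<otimes>\<^bsub>E Mod N\<^esub> C"
      using Q.m_assoc[of A B C] ABC unfolding carQ by simp
    note c = section_carrier[OF sec ABC(1)] section_carrier[OF sec ABC(2)] section_carrier[OF sec ABC(3)]
      section_carrier[OF sec m(1)] section_carrier[OF sec m(2)] section_carrier[OF sec m(3)]
    have "s A \<otimes> s B \<otimes> s C = j (f0 A B) \<otimes> (s ?AB \<otimes> s C)"
      using f0(2)[OF ABC(1,2)] c by (simp add: m_assoc)
    also have "\<dots> = j (f0 A B + f0 ?AB C) \<otimes> s (?AB \<otimes>\<^bsub>E Mod N\<^esub> C)"
      using f0(2)[OF m(1) ABC(3)] c by (simp add: m_assoc flip: j_add)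
    finally have 1: "s A \<otimes> s B \<otimes> s C = j (f0 A B + f0 ?AB C) \<otimes> s (?AB \<otimes>\<^bsub>E Mod N\<^esub> C)" .
    have "s A \<otimes> (s B \<otimes> s C) = s A \<otimes> (j (f0 B C) \<otimes> s ?BC)"
      using f0(2)[OF ABC(2,3)] by simp
    also have "\<dots> = j (f0 B C) \<otimes> (s A \<otimes> s ?BC)"
      using c j_central[OF c(1), of "f0 B C"] by (simp flip: m_assoc)
    also have "\<dots> = j (f0 B C + f0 A ?BC) \<otimes> s (?AB \<otimes>\<^bsub>E Mod N\<^esub> C)"
      using f0(2)[OF ABC(1) m(2)] c assoc by (simp add: m_assoc flip: j_add)
    finally have "j (f0 B C + f0 A ?BC) \<otimes> s (?AB \<otimes>\<^bsub>E Mod N\<^esub> C) = j (f0 A B + f0 ?AB C) \<otimes> s (?AB \<otimes>\<^bsub>E Mod N\<^esub> C)"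
      using 1 c by (simp add: m_assoc)
    from j_cancel[OF c(6) this]
    show "int p dvd Q.defect (\<lambda>z. f0 (fst z) (snd z)) A B C"
      by (simp add: Q.defect_def algebra_simps)
  qed
  then have "factors f s" unfolding factors_def using sec f0(2) fj by simp
  then show ?thesis by blast
qed

text \<open>Two sections differ by a function \<open>u\<close> with values in a central subgroup,
  and the factor sets then differ by the coboundary of \<open>u\<close>.\<close>

lemma factors_class:
  assumes f: "factors f s" and g: "factors g t"
  shows "class2 p (E Mod N) (quotient_topology E TE N) f = class2 p (E Mod N) (quotient_topology E TE N) g"
proof -
  have sec: "is_section s" "is_section t" and Z: "f \<in> carrier Q.Z" "g \<in> carrier Q.Z"
    using f g by (auto simp: factors_def)
  have "\<exists>a\<in>{0..int p - 1}. s C = j a \<otimes> t C" if "C \<in> rcosets N" for C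
    using same_coset[OF that] sec that unfolding is_section_def by blast
  then obtain u where u: "s C = j (u C) \<otimes> t C" if "C \<in> rcosets N" for C by metis
  have "(f (C, D) - g (C, D) - Q.coboundary u C D) mod int p = 0"
    if "C \<in> carrier (E Mod N)" "D \<in> carrier (E Mod N)" for C D
  proof -
    have CD: "C \<in> rcosets N" "D \<in> rcosets N" using that by (simp_all only: carQ)
    let ?CD = "C \<otimes>\<^bsub>E Mod N\<^esub> D"
    have m: "?CD \<in> rcosets N" using Q.m_closed[OF that] by (simp only: carQ)
    note c = section_carrier[OF sec(2) CD(1)] section_carrier[OF sec(2) CD(2)] section_carrier[OF sec(2) m]
    have "s C \<otimes> s D = j (u C) \<otimes> (t C \<otimes> j (u D)) \<otimes> t D"
      using u[OF CD(1)] u[OF CD(2)] c by (simp add: m_assoc)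
    also have "\<dots> = j (u C) \<otimes> (j (u D) \<otimes> t C) \<otimes> t D" by (simp only: j_central[OF c(1)])
    also have "\<dots> = j (u C + u D) \<otimes> (t C \<otimes> t D)"
      using c by (simp add: m_assoc flip: j_add)
    also have "\<dots> = j (u C + u D + g (C, D)) \<otimes> t ?CD"
      using g CD c unfolding factors_def by (simp add: m_assoc flip: j_add)
    finally have "j (u C + u D + g (C, D)) \<otimes> t ?CD = s C \<otimes> s D" ..
    also have "\<dots> = j (f (C, D) + u ?CD) \<otimes> t ?CD"
      using f CD u[OF m] c unfolding factors_def by (simp add: m_assoc flip: j_add)
    finally have "int p dvd (u C + u D + g (C, D)) - (f (C, D) + u ?CD)" by (rule j_cancel[OF c(3)])
    then have "int p dvd f (C, D) - g (C, D) - Q.coboundary u C D"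
      by (subst dvd_minus_iff[symmetric]) (simp add: Q.coboundary_def algebra_simps)
    then show ?thesis by simp
  qed
  then show ?thesis using Q.class2_eq_iff[OF Z] loc_const_Q by blast
qed

lemma extension_class_eq:
  assumes "factors f s"
  shows "extension_class p E TE N \<iota> = class2 p (E Mod N) (quotient_topology E TE N) f"
  unfolding extension_class_def
proof (rule the_elem_image_unique)
  show "factor_sets p E TE N \<iota> \<noteq> {}" using assms factor_sets_iff by blast
  fix g assume "g \<in> factor_sets p E TE N \<iota>"
  then obtain t where "factors g t" using factor_sets_iff by blast
  then show "class2 p (E Mod N) (quotient_topology E TE N) g = class2 p (E Mod N) (quotient_topology E TE N) f"
    using factors_class assms by blast
qed

end

section \<open>The transgression\<close>

context cohomology2
begin

lemma additive_kernel:
  assumes N: "closed_subgroup N" and lc: "loc_const T d"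
    and add: "\<And>a b. a \<in> N \<Longrightarrow> b \<in> N \<Longrightarrow> int p dvd d (a \<otimes> b) - d a - d b"
  shows "closed_subgroup {h \<in> N. int p dvd d h}"
    and "\<And>h. h \<in> N \<Longrightarrow> int p dvd d (h [^] p)"
    and "\<And>h. h \<in> N \<Longrightarrow> int p dvd d (inv h) + d h"
proof -
  have sub: "subgroup N G" using N by (simp add: closed_subgroup_def)
  have Nc: "h \<in> carrier G" if "h \<in> N" for h using subgroup.mem_carrier[OF sub that] .
  have one: "int p dvd d \<one>"
    using add[OF subgroup.one_closed[OF sub] subgroup.one_closed[OF sub]] by simp
  show inv: "int p dvd d (inv h) + d h" if h: "h \<in> N" for h
  proof -
    have "int p dvd d \<one> - d (inv h) - d h"
      using add[OF subgroup.m_inv_closed[OF sub h] h] Nc[OF h] by simp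
    from dvd_diff[OF one this] show ?thesis by simp
  qed
  show "int p dvd d (h [^] p)" if h: "h \<in> N" for h
  proof -
    have "int p dvd d (h [^] k) - int k * d h" for k :: nat
    proof (induction k)
      case (Suc k)
      have "int p dvd d (h [^] k \<otimes> h) - d (h [^] k) - d h" by (rule add[OF pow_mem_subgroup[OF sub h] h])
      from dvd_add[OF this Suc] show ?case by (simp add: algebra_simps)
    qed (use one in simp)
    from this[of p] show ?thesis by (metis diff_add_cancel dvd_add dvd_triv_left)
  qed
  show "closed_subgroup {h \<in> N. int p dvd d h}"
    unfolding closed_subgroup_def
  proof
    have "{h \<in> N. int p dvd d h} = N \<inter> {h \<in> topspace T. int p dvd d h}"
      using Nc topspace_carrier by auto
    then show "closedin T {h \<in> N. int p dvd d h}"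
      using N loc_const_closed[OF lc, of "\<lambda>k. int p dvd k"] by (simp add: closed_subgroup_def closedin_Int)
    show "subgroup {h \<in> N. int p dvd d h} G"
    proof (rule subgroupI)
      show "{h \<in> N. int p dvd d h} \<noteq> {}" using one subgroup.one_closed[OF sub] by blast
      show "inv h \<in> {h \<in> N. int p dvd d h}" if "h \<in> {h \<in> N. int p dvd d h}" for h
        using that inv[of h] subgroup.m_inv_closed[OF sub] by (simp add: dvd_add_left_iff)
      show "a \<otimes> b \<in> {h \<in> N. int p dvd d h}" if "a \<in> {h \<in> N. int p dvd d h}" "b \<in> {h \<in> N. int p dvd d h}" for a b
      proof -
        have "int p dvd (d (a \<otimes> b) - d a - d b) + (d a + d b)"
          using that by (intro dvd_add add) auto
        then show ?thesis using that subgroup.m_closed[OF sub] by simp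
      qed
    qed (use Nc in auto)
  qed
qed

text \<open>Modulo \<open>p\<close> the function \<open>d\<close> is a continuous homomorphism to an
  abelian group of exponent \<open>p\<close>, so it kills p-th powers and commutators.\<close>

lemma additive_vanishes_on_L2:
  assumes lc: "loc_const T d"
    and add: "\<And>a b. a \<in> carrier G \<Longrightarrow> b \<in> carrier G \<Longrightarrow> int p dvd d (a \<otimes> b) - d a - d b"
    and h: "h \<in> L 2"
  shows "int p dvd d h"
proof -
  have N: "closed_subgroup (carrier G)"
    using subgroup_self closedin_topspace[of T] by (simp add: closed_subgroup_def topspace_carrier)
  note K = additive_kernel[OF N lc add]
  have sub: "subgroup {h \<in> carrier G. int p dvd d h} G" using K(1) by (simp add: closed_subgroup_def)
  have "L (Suc (Suc 0)) \<subseteq> {h \<in> carrier G. int p dvd d h}"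
  proof (rule L_minimal[OF K(1)])
    fix h assume "h \<in> L (Suc 0)"
    then show "h [^] p \<in> {h \<in> carrier G. int p dvd d h}" using K(2) by simp
  next
    fix g h assume "g \<in> carrier G" "h \<in> L (Suc 0)"
    then have c: "g \<in> carrier G" "h \<in> carrier G" by auto
    have a: "int p dvd d (inv g \<otimes> inv h) - d (inv g) - d (inv h)" "int p dvd d (inv g \<otimes> inv h \<otimes> g) - d (inv g \<otimes> inv h) - d g"
      "int p dvd d (inv g \<otimes> inv h \<otimes> g \<otimes> h) - d (inv g \<otimes> inv h \<otimes> g) - d h"
      using add c by simp_all
    have "int p dvd (d (inv g \<otimes> inv h) - d (inv g) - d (inv h)) + (d (inv g \<otimes> inv h \<otimes> g) - d (inv g \<otimes> inv h) - d g)
       + (d (inv g \<otimes> inv h \<otimes> g \<otimes> h) - d (inv g \<otimes> inv h \<otimes> g) - d h) + (d (inv g) + d g) + (d (inv h) + d h)"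
      by (intro dvd_add a K(3) c)
    then have "int p dvd d (comm g h)" by (simp add: commutator_def)
    then show "comm g h \<in> {h \<in> carrier G. int p dvd d h}" using c by simp
  qed
  then show ?thesis using h by (auto simp: numeral_2_eq_2)
qed

end

section \<open>The transgression for a free profinite group\<close>

locale lyndon_free = lyndon_topological_grp S T p X r
  for S :: "('a, 'm) monoid_scheme" (structure) and T p X r +
  fixes n :: nat
  assumes free: "free_profinite_group S T X" and p_prime: "prime p" and n_ge_2: "2 \<le> n"
begin

sublocale CS: cohomology2 S T p
  by unfold_locales (rule p_prime)

abbreviation Q where "Q \<equiv> S Mod L n"
abbreviation TQ where "TQ \<equiv> quotient_topology S T (L n)"

sublocale CQ: cohomology2 Q TQ p
  by (rule cohomology2.intro[OF topological_grp_quotient[OF L_normal]]) (rule cohomology2_axioms.intro[OF p_prime])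

abbreviation pi :: "'a \<Rightarrow> 'a set" where "pi g \<equiv> L n #> g"

lemma carQ: "carrier Q = rcosets (L n)"
  by (simp add: FactGroup_def)

lemma pi_carrier: "g \<in> carrier S \<Longrightarrow> pi g \<in> carrier Q"
  using coset_mem[OF L_normal] by (simp add: carQ)

lemma pi_mult: "a \<in> carrier S \<Longrightarrow> b \<in> carrier S \<Longrightarrow> pi a \<otimes>\<^bsub>Q\<^esub> pi b = pi (a \<otimes> b)"
  using normal.rcos_sum[OF L_normal] by (simp add: FactGroup_def)

lemma Q_cases: assumes "C \<in> carrier Q" obtains g where "g \<in> carrier S" "C = pi g"
  using assms unfolding carQ RCOSETS_def by blast

lemma pi_kernel: "h \<in> L n \<Longrightarrow> pi h = pi \<one>"
  using coset_join2[of h "L n"] L_subgroup coset_join2[of \<one> "L n"] F_carrier subgroup.one_closed[OF L_subgroup]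
  by simp

lemma L_n_subset: "L n \<subseteq> L 2"
  by (rule F_mono[OF n_ge_2])

definition splits :: "('a set \<times> 'a set \<Rightarrow> int) \<Rightarrow> ('a \<Rightarrow> int) \<Rightarrow> bool" where
  "splits c u \<longleftrightarrow> loc_const T u \<and>
     (\<forall>a\<in>carrier S. \<forall>b\<in>carrier S. int p dvd c (pi a, pi b) - CS.coboundary u a b)"

lemma splitsD: "splits c u \<Longrightarrow> a \<in> carrier S \<Longrightarrow> b \<in> carrier S \<Longrightarrow> int p dvd c (pi a, pi b) - (u b - u (a \<otimes> b) + u a)"
  by (simp add: splits_def CS.coboundary_def)

lemma splits_exists:
  assumes c: "c \<in> carrier CQ.Z" shows "\<exists>u. splits c u"
proof -
  let ?f = "\<lambda>x \<in> CS.C2. c (pi (fst x), pi (snd x)) mod int p"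
  have "continuous_map (prod_topology T T) (prod_topology TQ TQ) (\<lambda>x. (pi (fst x), pi (snd x)))"
    unfolding continuous_map_pairwise
    using continuous_map_compose[OF continuous_map_fst[of T T] proj_continuous[OF L_normal]]
      continuous_map_compose[OF continuous_map_snd[of T T] proj_continuous[OF L_normal]] by (simp add: o_def)
  then have "loc_const (prod_topology T T) (\<lambda>x. c (pi (fst x), pi (snd x)))"
    by (rule loc_const_compose) (use c in \<open>simp add: CQ.Z_iff\<close>)
  then have "?f \<in> carrier CS.Z"
  proof (rule CS.Z_intro)
    fix x y z assume xyz: "x \<in> carrier S" "y \<in> carrier S" "z \<in> carrier S"
    then show "int p dvd CS.defect (\<lambda>x. c (pi (fst x), pi (snd x))) x y z"
      using CQ.Z_defect[OF c pi_carrier pi_carrier pi_carrier, OF xyz] pi_mult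
      by (simp add: CS.defect_def CQ.defect_def)
  qed
  from CS.free_cocycle_splits[OF free this]
  obtain u where u: "loc_const T u" "\<And>a b. a \<in> carrier S \<Longrightarrow> b \<in> carrier S \<Longrightarrow> (?f (a, b) - CS.coboundary u a b) mod int p = 0"
    by blast
  have "int p dvd c (pi a, pi b) - CS.coboundary u a b" if "a \<in> carrier S" "b \<in> carrier S" for a b
  proof -
    have "(c (pi a, pi b) mod int p - CS.coboundary u a b) mod int p = 0" using u(2)[OF that] that by simp
    then show ?thesis unfolding mod_diff_left_eq by presburger
  qed
  then show ?thesis using u(1) unfolding splits_def by blast
qed

text \<open>The difference of the two splittings, corrected by the cochain \<open>g\<close> that
  relates the cocycles, is a homomorphism modulo \<open>p\<close> and so vanishes on
  \<open>L 2\<close>. Here \<open>n >= 2\<close> enters, through the inclusion of \<open>L n\<close>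
  in \<open>L 2\<close>; on \<open>L n\<close> the correction is constant.\<close>

lemma splits_unique:
  assumes c: "c \<in> carrier CQ.Z" "c' \<in> carrier CQ.Z" and eq: "class2 p Q TQ c = class2 p Q TQ c'"
    and u: "splits c u" "splits c' u'" and h: "h \<in> L n"
  shows "(u h - u \<one>) mod int p = (u' h - u' \<one>) mod int p"
proof -
  obtain g where g: "loc_const TQ g"
    "\<And>a b. a \<in> carrier Q \<Longrightarrow> b \<in> carrier Q \<Longrightarrow> (c (a, b) - c' (a, b) - CQ.coboundary g a b) mod int p = 0"
    using CQ.class2_eq_iff[OF c] eq by blast
  define d where "d = (\<lambda>x. u x - u' x - g (pi x))"
  have lc: "loc_const T d" unfolding d_def
    by (intro loc_const_comp2[where h = "(-)"] loc_const_compose[OF proj_continuous[OF L_normal] g(1)])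
      (use u in \<open>auto simp: splits_def\<close>)
  have "int p dvd d (a \<otimes> b) - d a - d b" if ab: "a \<in> carrier S" "b \<in> carrier S" for a b
  proof -
    have "int p dvd c (pi a, pi b) - c' (pi a, pi b) - (g (pi b) - g (pi (a \<otimes> b)) + g (pi a))"
      using g(2)[OF pi_carrier pi_carrier, OF ab] pi_mult[OF ab] by (simp add: CQ.coboundary_def dvd_eq_mod_eq_0)
    from dvd_add[OF dvd_diff[OF splitsD[OF u(1) ab] splitsD[OF u(2) ab]] dvd_minus_iff[THEN iffD2, OF this]]
    show ?thesis by (simp add: d_def algebra_simps)
  qed
  then have dL: "int p dvd d x" if "x \<in> L 2" for x using CS.additive_vanishes_on_L2[OF lc] that by blast
  have "int p dvd d h" "int p dvd d \<one>"
    using dL L_n_subset h subgroup.one_closed[OF L_subgroup] by blast+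
  then have "int p dvd d h - d \<one>" by (rule dvd_diff)
  then show ?thesis unfolding mod_eq_dvd_iff d_def using pi_kernel[OF h] by (simp add: algebra_simps)
qed

text \<open>A representing cocycle and its splitting are chosen together; for \<open>h\<close> in
  \<open>L n\<close> the value does not depend on the choice. Subtracting the value at
  \<open>\<one>\<close> accounts for cocycles that are not normalized.\<close>

definition tra :: "'a \<Rightarrow> ('a set \<times> 'a set \<Rightarrow> int) set \<Rightarrow> int" where
  "tra h x = (let z = (SOME z. fst z \<in> carrier CQ.Z \<and> class2 p Q TQ (fst z) = x \<and> splits (fst z) (snd z))
     in (snd z h - snd z \<one>) mod int p)"

lemma tra_eq:
  assumes c: "c \<in> carrier CQ.Z" and u: "splits c u" and h: "h \<in> L n"
  shows "tra h (class2 p Q TQ c) = (u h - u \<one>) mod int p"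
proof -
  let ?P = "\<lambda>z. fst z \<in> carrier CQ.Z \<and> class2 p Q TQ (fst z) = class2 p Q TQ c \<and> splits (fst z) (snd z)"
  have "?P (c, u)" using c u by simp
  then have "?P (SOME z. ?P z)" by (rule someI)
  then show ?thesis unfolding tra_def Let_def using splits_unique c u h by blast
qed

lemma H2_cases:
  assumes "x \<in> carrier (H2 p Q TQ)"
  obtains c u where "c \<in> carrier CQ.Z" "splits c u" "x = class2 p Q TQ c"
  using assms splits_exists unfolding CQ.H2_carrier by blast

lemma tra_add:
  assumes h: "h \<in> L n" and x: "x \<in> carrier (H2 p Q TQ)" and y: "y \<in> carrier (H2 p Q TQ)"
  shows "tra h (x \<oplus>\<^bsub>H2 p Q TQ\<^esub> y) mod int p = (tra h x + tra h y) mod int p"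
proof -
  obtain c u where c: "c \<in> carrier CQ.Z" "splits c u" "x = class2 p Q TQ c" using H2_cases[OF x] .
  obtain d v where d: "d \<in> carrier CQ.Z" "splits d v" "y = class2 p Q TQ d" using H2_cases[OF y] .
  have "splits (c \<oplus>\<^bsub>CQ.Z\<^esub> d) (\<lambda>a. u a + v a)"
    unfolding splits_def
  proof (intro conjI ballI)
    show "loc_const T (\<lambda>a. u a + v a)"
      using c(2) d(2) by (intro loc_const_comp2[where h = "(+)"]) (auto simp: splits_def)
    fix a b assume ab: "a \<in> carrier S" "b \<in> carrier S"
    let ?s = "c (pi a, pi b) + d (pi a, pi b)"
    have "int p dvd ?s - CS.coboundary (\<lambda>a. u a + v a) a b"
      using dvd_add[OF splitsD[OF c(2) ab] splitsD[OF d(2) ab]] by (simp add: CS.coboundary_def algebra_simps)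
    then have "?s mod int p = CS.coboundary (\<lambda>a. u a + v a) a b mod int p" by (simp only: mod_eq_dvd_iff)
    then have "(?s mod int p) mod int p = CS.coboundary (\<lambda>a. u a + v a) a b mod int p" by simp
    then have "int p dvd ?s mod int p - CS.coboundary (\<lambda>a. u a + v a) a b" by (simp only: mod_eq_dvd_iff)
    then show "int p dvd (c \<oplus>\<^bsub>CQ.Z\<^esub> d) (pi a, pi b) - CS.coboundary (\<lambda>a. u a + v a) a b"
      using pi_carrier ab by (simp add: CQ.Z_add)
  qed
  from tra_eq[OF CQ.Z_add_closed[OF c(1) d(1)] this h]
  show ?thesis using tra_eq[OF c(1,2) h] tra_eq[OF d(1,2) h] CQ.H2_add[OF c(1) d(1)] c(3) d(3)
    by (simp add: mod_add_eq algebra_simps)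
qed

lemma tra_smult:
  assumes h: "h \<in> L n" and k: "k \<in> carrier (residue_ring (int p))" and x: "x \<in> carrier (H2 p Q TQ)"
  shows "tra h (k \<odot>\<^bsub>H2 p Q TQ\<^esub> x) mod int p = (k * tra h x) mod int p"
proof -
  obtain c u where c: "c \<in> carrier CQ.Z" "splits c u" "x = class2 p Q TQ c" using H2_cases[OF x] .
  have "splits (k \<odot>\<^bsub>CQ.Z\<^esub> c) (\<lambda>a. k * u a)"
    unfolding splits_def
  proof (intro conjI ballI)
    show "loc_const T (\<lambda>a. k * u a)"
      using c(2) by (intro loc_const_comp[where h = "\<lambda>y. k * y"]) (auto simp: splits_def)
    fix a b assume ab: "a \<in> carrier S" "b \<in> carrier S"
    let ?s = "k * c (pi a, pi b)"
    have "int p dvd ?s - CS.coboundary (\<lambda>a. k * u a) a b"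
      using dvd_mult[OF splitsD[OF c(2) ab], of k] by (simp add: CS.coboundary_def algebra_simps)
    then have "?s mod int p = CS.coboundary (\<lambda>a. k * u a) a b mod int p" by (simp only: mod_eq_dvd_iff)
    then have "(?s mod int p) mod int p = CS.coboundary (\<lambda>a. k * u a) a b mod int p" by simp
    then have "int p dvd ?s mod int p - CS.coboundary (\<lambda>a. k * u a) a b" by (simp only: mod_eq_dvd_iff)
    then show "int p dvd (k \<odot>\<^bsub>CQ.Z\<^esub> c) (pi a, pi b) - CS.coboundary (\<lambda>a. k * u a) a b"
      using pi_carrier ab by (simp add: CQ.Z_smult)
  qed
  from tra_eq[OF CQ.Z_smult_closed[OF c(1)] this h]
  show ?thesis using tra_eq[OF c(1,2) h] CQ.H2_smult[OF k c(1)] c(3)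
    by (simp add: mod_mult_right_eq right_diff_distrib)
qed

context
  fixes c u assumes c: "c \<in> carrier CQ.Z" and u: "splits c u"
begin

abbreviation (input) f where "f \<equiv> \<lambda>h. u h - u \<one>"

lemma u_one: "int p dvd c (pi \<one>, pi \<one>) - u \<one>"
  using splitsD[OF u one_closed one_closed] by simp

lemma c_one:
  assumes g: "g \<in> carrier S" shows "c (pi g, pi \<one>) = c (pi \<one>, pi \<one>)" "c (pi \<one>, pi g) = c (pi \<one>, pi \<one>)"
proof -
  have "\<one>\<^bsub>Q\<^esub> = pi \<one>" using coset_join2[of \<one> "L n"] L_subgroup subgroup.one_closed[OF L_subgroup]
    by (simp add: FactGroup_def)
  then show "c (pi g, pi \<one>) = c (pi \<one>, pi \<one>)" "c (pi \<one>, pi g) = c (pi \<one>, pi \<one>)"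
    using CQ.Z_one_right[OF c pi_carrier[OF g]] CQ.Z_one_left[OF c pi_carrier[OF g]] by simp_all
qed

text \<open>A cocycle is constant on pairs with one trivial entry, with the value
  \<open>u \<one>\<close> modulo \<open>p\<close>. So \<open>u\<close> changes additively under
  multiplication by elements of \<open>L n\<close>.\<close>

lemma u_left: assumes g: "g \<in> carrier S" and h: "h \<in> L n" shows "int p dvd u (g \<otimes> h) - u g - f h"
proof -
  have hc: "h \<in> carrier S" using F_carrier[OF h] .
  have "int p dvd c (pi \<one>, pi \<one>) - (u h - u (g \<otimes> h) + u g)"
    using splitsD[OF u g hc] pi_kernel[OF h] c_one(1)[OF g] by simp
  from dvd_diff[OF this u_one] show ?thesis by (simp add: algebra_simps)
qed

lemma u_right: assumes g: "g \<in> carrier S" and h: "h \<in> L n" shows "int p dvd u (h \<otimes> g) - u g - f h"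
proof -
  have hc: "h \<in> carrier S" using F_carrier[OF h] .
  have "int p dvd c (pi \<one>, pi \<one>) - (u g - u (h \<otimes> g) + u h)"
    using splitsD[OF u hc g] pi_kernel[OF h] c_one(2)[OF g] by simp
  from dvd_diff[OF this u_one] show ?thesis by (simp add: algebra_simps)
qed

lemma f_add: assumes "a \<in> L n" "b \<in> L n" shows "int p dvd f (a \<otimes> b) - f a - f b"
  using u_left[OF F_carrier[OF assms(1)] assms(2)] by (simp add: algebra_simps)

lemma f_loc_const: "loc_const T f"
  using loc_const_comp[of T u "\<lambda>k. k - u \<one>"] u by (simp add: splits_def)

text \<open>On \<open>L n\<close> the function is additive modulo \<open>p\<close> and invariant
  under conjugation, so its kernel is a closed subgroup containing \<open>L (Suc n)\<close>, and the
  generators decide.\<close>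

lemma f_vanishes:
  assumes gens: "\<And>w. w \<in> lyndon_words X r n \<Longrightarrow> int p dvd f (vgen n w)" and h: "h \<in> L n"
  shows "int p dvd f h"
proof -
  let ?K = "{h \<in> L n. int p dvd f h}"
  have K1: "closed_subgroup ?K"
    by (rule CS.additive_kernel(1)[OF L_closed_subgroup f_loc_const]) (rule f_add)
  have K2: "int p dvd f (h [^] p)" if "h \<in> L n" for h
    by (rule CS.additive_kernel(2)[of "L n" f, OF L_closed_subgroup f_loc_const _ that]) (rule f_add)
  have K3: "int p dvd f (inv h) + f h" if "h \<in> L n" for h
    by (rule CS.additive_kernel(3)[of "L n" f, OF L_closed_subgroup f_loc_const _ that]) (rule f_add)
  have sub: "subgroup ?K S" using K1 by (simp add: closed_subgroup_def)
  obtain m where m: "n = Suc m" using n_ge_2 by (cases n) auto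
  have "L (Suc (Suc m)) \<subseteq> ?K"
  proof (rule L_minimal[OF K1])
    fix h assume "h \<in> L (Suc m)"
    then show "h [^] p \<in> ?K" using K2[of h] pow_mem_subgroup[OF L_subgroup, of h "Suc m" p] m by simp
  next
    fix g h assume g: "g \<in> carrier S" and "h \<in> L (Suc m)"
    then have h: "h \<in> L n" "h \<in> carrier S" using m F_carrier by auto
    define y where "y = inv g \<otimes> h \<otimes> g"
    have y: "y \<in> L n" unfolding y_def by (rule L_conj[OF g h(1)])
    have yc: "y \<in> carrier S" using F_carrier[OF y] .
    have gy: "g \<otimes> y = h \<otimes> g" unfolding y_def using g h(2) by (simp add: m_assoc cancel_left)
    \<comment> \<open>Invariance under conjugation: the two one-sided rules are applied to the same
      element \<open>g y = h g\<close>.\<close>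
    have "int p dvd (u (g \<otimes> y) - u g - f y) - (u (h \<otimes> g) - u g - f h)"
      using u_left[OF g y] u_right[OF g h(1)] by (rule dvd_diff)
    then have fy: "int p dvd f h - f y" unfolding gy by (simp add: algebra_simps)
    have iy: "inv y \<in> L n" using subgroup.m_inv_closed[OF L_subgroup y] .
    have eq: "comm g h = inv y \<otimes> h" unfolding y_def commutator_def using g h(2) by (simp add: m_assoc inv_mult_group)
    have "int p dvd (f (inv y \<otimes> h) - f (inv y) - f h) + (f (inv y) + f y) + (f h - f y)"
      by (intro dvd_add f_add[OF iy h(1)] K3[OF y] fy)
    then have "int p dvd (f (inv y \<otimes> h) + f y) - f y + (f h - f h)" by (simp add: algebra_simps)
    then have "int p dvd f (comm g h)" unfolding eq by simp
    moreover have "comm g h \<in> L n" unfolding eq using subgroup.m_closed[OF L_subgroup iy h(1)] .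
    ultimately show "comm g h \<in> ?K" by simp
  qed
  then have "L n \<subseteq> ?K"
    using filtration_generators[OF _ K1] n_ge_2 gens vgen_mem m lyndon_not_Nil
    by (auto simp: lyndon_words_iff)
  then show ?thesis using h by blast
qed

text \<open>When the transgression vanishes, \<open>u\<close> is constant modulo \<open>p\<close> on
  cosets of \<open>L n\<close> and descends to a cochain on the quotient.\<close>

lemma splits_coboundary:
  assumes van: "\<And>h. h \<in> L n \<Longrightarrow> int p dvd f h"
  shows "c \<in> CQ.B"
proof -
  define v where "v = (\<lambda>C. u (SOME a. a \<in> C) mod int p)"
  have v: "v (pi g) = u g mod int p" if g: "g \<in> carrier S" for g
  proof -
    have "g \<in> pi g" by (rule coset_self[OF L_normal g])
    then have "(SOME a. a \<in> pi g) \<in> pi g" by (rule someI)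
    then obtain h where h: "h \<in> L n" "(SOME a. a \<in> pi g) = h \<otimes> g" by (auto simp: r_coset_def)
    have "int p dvd (u (h \<otimes> g) - u g - f h) + f h"
      using u_right[OF g h(1)] van[OF h(1)] by (rule dvd_add)
    then have "u (h \<otimes> g) mod int p = u g mod int p" by (simp add: mod_eq_dvd_iff)
    then show ?thesis by (simp add: v_def h(2))
  qed
  have lc: "loc_const TQ v"
  proof (rule loc_const_from_quotient[OF L_normal])
    have "loc_const T (\<lambda>g. u g mod int p)"
      using loc_const_comp[of T u "\<lambda>k. k mod int p"] u by (simp add: splits_def)
    moreover have "{g \<in> topspace T. u g mod int p = k} = {g \<in> topspace T. v (pi g) = k}" for k
      using v topspace_carrier by auto
    ultimately show "loc_const T (\<lambda>g. v (pi g))" by (simp add: loc_const_def)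
  qed
  have "c = (\<lambda>x \<in> CQ.C2. CQ.coboundary v (fst x) (snd x) mod int p)" (is "c = ?b")
  proof (rule CQ.Z_eqI[OF c])
    show "?b \<in> carrier CQ.Z" using CQ.B_subset CQ.B_intro[OF lc] by blast
    fix x assume x: "x \<in> CQ.C2"
    have xQ: "fst x \<in> carrier Q" "snd x \<in> carrier Q" using x by auto
    obtain a where a: "a \<in> carrier S" "fst x = pi a" by (rule Q_cases[OF xQ(1)])
    obtain b where b: "b \<in> carrier S" "snd x = pi b" by (rule Q_cases[OF xQ(2)])
    have "int p dvd c (pi a, pi b) - (u b - u (a \<otimes> b) + u a)" by (rule splitsD[OF u a(1) b(1)])
    then have "c (pi a, pi b) mod int p = (u b - u (a \<otimes> b) + u a) mod int p" by (simp only: mod_eq_dvd_iff)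
    also have "\<dots> = (v (pi b) - v (pi (a \<otimes> b)) + v (pi a)) mod int p"
      using v a(1) b(1) by (intro mod_add_cong mod_diff_cong) simp_all
    also have "\<dots> = CQ.coboundary v (pi a) (pi b) mod int p"
      using pi_mult[OF a(1) b(1)] by (simp add: CQ.coboundary_def)
    finally have "c (pi a, pi b) mod int p = CQ.coboundary v (pi a) (pi b) mod int p" .
    moreover have "x = (pi a, pi b)" using a b by (simp add: prod_eq_iff)
    ultimately show "c x mod int p = ?b x mod int p" using x by simp
  qed
  then show ?thesis using CQ.B_intro[OF lc] by (simp only:)
qed

text \<open>By local constancy \<open>f\<close> vanishes on an open normal subgroup
  \<open>M\<close>. All but finitely many letters lie in \<open>M\<close>, and an iterated
  commutator containing such a letter lies in \<open>M\<close> as well, so only words over finitely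
  many letters remain.\<close>

lemma finite_support: "finite {w \<in> lyndon_words X r n. \<not> int p dvd f (vgen n w)}"
proof -
  have prof: "profinite_group S T" and conv: "converges_to_1 X (\<lambda>x. x) S T"
    using free by (auto simp: free_profinite_group_def)
  have "openin T {g \<in> topspace T. f g = 0}" by (rule loc_const_open[OF f_loc_const])
  moreover have "\<one> \<in> {g \<in> topspace T. f g = 0}" by (simp add: topspace_carrier)
  ultimately obtain M where M: "M \<lhd> S" "openin T M" "M \<subseteq> {g \<in> topspace T. f g = 0}"
    using profinite_open_normal_nbhd[OF prof] by blast
  have subM: "subgroup M S" using M(1) by (simp add: normal_def)
  define Y where "Y = {x \<in> X. x \<notin> M}"
  have Y: "finite Y" unfolding Y_def using conv M by (auto simp: converges_to_1_def)
  have tauM: "tau w \<in> M" if "w \<in> lists X" "x \<in> set w" "x \<in> M" for w x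
    using that
  proof (induction "length w" arbitrary: w rule: less_induct)
    case less
    show ?case
    proof (cases "2 \<le> length w")
      case False
      then have "w = [x]" using less.prems by (cases w) (auto simp: Suc_le_eq)
      then show ?thesis using less.prems by simp
    next
      case True
      then obtain a b where w: "w = a @ b" "std a b" using std_exists less.prems(1) by blast
      then have ne: "a \<noteq> []" "b \<noteq> []" by (auto simp: std_def)
      have car: "tau a \<in> carrier S" "tau b \<in> carrier S" using tau_carrier less.prems(1) w ne by auto
      have "tau a \<in> M \<or> tau b \<in> M" using less.hyps[of a] less.hyps[of b] less.prems w ne by auto
      then have "comm (tau a) (tau b) \<in> M"
        using comm_normal[OF M(1)] comm_swap_mem[OF subM] car by blast
      then show ?thesis unfolding w(1) tau_append[OF w(2)] .
    qed
  qed
  have "{w \<in> lyndon_words X r n. \<not> int p dvd f (vgen n w)} \<subseteq> {w. set w \<subseteq> Y \<and> length w \<le> n}"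
  proof
    fix w assume w: "w \<in> {w \<in> lyndon_words X r n. \<not> int p dvd f (vgen n w)}"
    then have wX: "w \<in> lists X" "length w \<le> n" by (auto simp: lyndon_words_iff)
    have "x \<in> Y" if x: "x \<in> set w" for x
    proof (rule ccontr)
      assume "x \<notin> Y"
      then have "x \<in> M" using x wX by (auto simp: Y_def)
      then have "vgen n w \<in> M" unfolding vgen_def using pow_mem_subgroup[OF subM tauM[OF wX(1) x]] by blast
      then have "f (vgen n w) = 0" using M(3) by blast
      then show False using w by simp
    qed
    then show "w \<in> {w. set w \<subseteq> Y \<and> length w \<le> n}" using wX by blast
  qed
  then show ?thesis using finite_lists_length_le[OF Y] finite_subset by blast
qed

end

end

section \<open>The classes of Lyndon words under the transgression\<close>

context UU_group
begin

lemma corner_mult_right: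
  assumes a: "a \<in> {0..int p - 1}" and A: "A \<in> carrier U" and ij: "i < j" "j < s + 1"
  shows "(A \<otimes>\<^bsub>U\<^esub> corner p n s a) $$ (i, j) = (A $$ (i, j) + (if i = 0 \<and> j = s then a * int p ^ (n - s) else 0)) mod m"
proof -
  have "strict_conv (ent A) (ent (corner p n s a)) i j = 0"
    unfolding strict_conv_def by (rule sum.neutral) (use ij in \<open>auto simp: corner_def\<close>)
  then show ?thesis using mult_entry[OF A corner_mem[OF a] ij] ij by (simp add: corner_def)
qed

lemma corner_central:
  assumes a: "a \<in> {0..int p - 1}" and A: "A \<in> carrier U"
  shows "corner p n s a \<otimes>\<^bsub>U\<^esub> A = A \<otimes>\<^bsub>U\<^esub> corner p n s a"
  by (rule U_eqI[OF mult_closed_U[OF corner_mem[OF a] A] mult_closed_U[OF A corner_mem[OF a]]])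
    (simp only: corner_mult[OF a A] corner_mult_right[OF a A])

lemma corner_entry: "corner p n s a $$ (0, s) = a * int p ^ (n - s)"
  using s_pos by (auto simp: corner_def)

lemma corner_inj: "inj_on (corner p n s) {0..int p - 1}"
proof (rule inj_onI)
  fix a b assume "corner p n s a = corner p n s b"
  then have "a * int p ^ (n - s) = b * int p ^ (n - s)" using corner_entry by metis
  then show "a = b" using p_gt_1 by simp
qed

lemma corner_add:
  assumes a: "a \<in> {0..int p - 1}" and b: "b \<in> {0..int p - 1}"
  shows "corner p n s a \<otimes>\<^bsub>U\<^esub> corner p n s b = corner p n s ((a + b) mod int p)"
proof -
  have ab: "(a + b) mod int p \<in> {0..int p - 1}"
    using p_gt_1 pos_mod_sign[of "int p" "a + b"] pos_mod_bound[of "int p" "a + b"] by auto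
  show ?thesis
  proof (rule U_eqI[OF mult_closed_U[OF corner_mem[OF a] corner_mem[OF b]] corner_mem[OF ab]])
    fix i j assume ij: "i < j" "j < s + 1"
    have "((a + b) * int p ^ (n - s)) mod (int p * int p ^ (n - s)) = ((a + b) mod int p) * int p ^ (n - s)"
      by (rule mod_mult_mult2)
    then have "(b * int p ^ (n - s) + a * int p ^ (n - s)) mod m = ((a + b) mod int p) * int p ^ (n - s)"
      by (simp add: algebra_simps)
    then have "(b * int p ^ (n - s) + a * int p ^ (n - s)) mod m mod m = ((a + b) mod int p) * int p ^ (n - s) mod m"
      by (metis mod_mod_trivial)
    then show "(corner p n s a \<otimes>\<^bsub>U\<^esub> corner p n s b) $$ (i, j) mod m = corner p n s ((a + b) mod int p) $$ (i, j) mod m"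
      unfolding corner_mult[OF a corner_mem[OF b] ij] using ij by (auto simp: corner_def)
  qed
qed

lemma central_extension_UU:
  assumes "prime p" shows "central_extension U p (UU_filt p n s) (corner p n s)"
proof (intro central_extension.intro central_extension_axioms.intro)
  show "topological_grp U (discrete_topology (carrier U))" by (rule topological_grp_U)
  interpret V: topological_grp U "discrete_topology (carrier U)" p by (rule topological_grp_U)
  show "UU_filt p n s \<lhd> U" unfolding UU_filt_def UU_U by (rule V.L_normal)
  show "UU_filt p n s \<subseteq> corner p n s ` {0..int p - 1}" using UU_filt_corner by blast
qed (fact assms | rule corner_mem, assumption | rule corner_add, assumption, assumption
  | rule corner_central, assumption, assumption | rule corner_inj)+

end

section \<open>Pullbacks along the representations and the triangular matrix of values\<close>

context lyndon_free
begin

lemma rho_setting_word: "w \<in> lyndon_words X r n \<Longrightarrow> rho_setting S T p X r n w"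
proof -
  assume w: "w \<in> lyndon_words X r n"
  have p1: "1 < p" using p_prime prime_gt_1_nat by blast
  then have "1 < p ^ (n - length w + 1)" by (intro one_less_power) auto
  then have "1 < int p ^ (n - length w + 1)" by (metis of_nat_1 of_nat_less_iff of_nat_power)
  then show ?thesis
    using w p1 free lyndon_not_Nil
    by unfold_locales (auto simp: lyndon_words_iff Suc_le_eq)
qed

text \<open>Each \<open>\<rho> g\<close> is a central element times the chosen representative of its
  coset, and minus the exponent of the central element splits the pulled-back factor set. Comparing
  the exponents at \<open>h\<close> and at \<open>\<one>\<close> gives the value and its
  sign.\<close>

lemma tra_pullback:
  fixes E :: "('e, 'k) monoid_scheme"
  assumes ext: "central_extension E p N \<iota>" and hom: "\<rho> \<in> hom S E" and lc: "loc_const T \<rho>"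
    and rho_N: "\<And>h. h \<in> L n \<Longrightarrow> \<rho> h \<in> N"
    and \<alpha>: "\<alpha> = pullback2 p Q TQ (induced_hom E N \<rho>)
      (extension_class p E (discrete_topology (carrier E)) N \<iota>)"
  shows "\<alpha> \<in> carrier (H2 p Q TQ)"
    and "\<And>h \<theta>. h \<in> L n \<Longrightarrow> \<theta> \<in> {0..int p - 1} \<Longrightarrow> \<rho> h = \<iota> \<theta> \<Longrightarrow> tra h \<alpha> = (- \<theta>) mod int p"
proof -
  interpret C: central_extension E p N \<iota> by (rule ext)
  interpret rh: group_hom S E \<rho>
    using hom by unfold_locales
  let ?\<phi> = "induced_hom E N \<rho>"
  have phi: "?\<phi> (pi g) = N #>\<^bsub>E\<^esub> \<rho> g" if g: "g \<in> carrier S" for g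
    unfolding induced_hom_def
  proof (rule the_elem_image_unique)
    show "pi g \<noteq> {}" using coset_self[OF L_normal g] by blast
    fix x assume "x \<in> pi g"
    then obtain k where k: "k \<in> L n" "x = k \<otimes> g" by (auto simp: r_coset_def)
    have "\<rho> x = \<rho> k \<otimes>\<^bsub>E\<^esub> \<rho> g" using k F_carrier[OF k(1)] g by simp
    then have "\<rho> x \<in> N #>\<^bsub>E\<^esub> \<rho> g"
      using rho_N[OF k(1)] unfolding r_coset_def by blast
    then show "N #>\<^bsub>E\<^esub> \<rho> x = N #>\<^bsub>E\<^esub> \<rho> g"
      using C.repr_independence[OF _ rh.hom_closed[OF g] C.N_subgroup[OF C.N_normal]] by simp
  qed
  have phi_carrier: "?\<phi> a \<in> carrier (E Mod N)" if a: "a \<in> carrier Q" for a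
  proof -
    obtain g where g: "g \<in> carrier S" "a = pi g" by (rule Q_cases[OF a])
    show ?thesis unfolding g(2) phi[OF g(1)] C.carQ by (rule C.coset_mem[OF C.N_normal rh.hom_closed[OF g(1)]])
  qed
  have phi_mult: "?\<phi> (a \<otimes>\<^bsub>Q\<^esub> b) = ?\<phi> a \<otimes>\<^bsub>E Mod N\<^esub> ?\<phi> b" if a: "a \<in> carrier Q" and b: "b \<in> carrier Q" for a b
  proof -
    obtain g where g: "g \<in> carrier S" "a = pi g" by (rule Q_cases[OF a])
    obtain k where k: "k \<in> carrier S" "b = pi k" by (rule Q_cases[OF b])
    have "?\<phi> (pi (g \<otimes> k)) = N #>\<^bsub>E\<^esub> (\<rho> g \<otimes>\<^bsub>E\<^esub> \<rho> k)" using phi[of "g \<otimes> k"] g k by simp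
    also have "\<dots> = ?\<phi> (pi g) \<otimes>\<^bsub>E Mod N\<^esub> ?\<phi> (pi k)"
      using normal.rcos_sum[OF C.N_normal rh.hom_closed[OF g(1)] rh.hom_closed[OF k(1)]] phi g k
      by (simp add: FactGroup_def)
    finally show ?thesis using pi_mult[OF g(1) k(1)] g k by simp
  qed
  have phi_lc: "loc_const TQ ?\<phi>"
  proof (rule loc_const_from_quotient[OF L_normal])
    have "loc_const T (\<lambda>g. N #>\<^bsub>E\<^esub> \<rho> g)" by (rule loc_const_comp[OF lc])
    moreover have "{g \<in> topspace T. N #>\<^bsub>E\<^esub> \<rho> g = k} = {g \<in> topspace T. ?\<phi> (pi g) = k}" for k
      using phi topspace_carrier by auto
    ultimately show "loc_const T (\<lambda>g. ?\<phi> (pi g))" by (simp add: loc_const_def)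
  qed
  define pb where "pb = (\<lambda>f. \<lambda>(a, b) \<in> CQ.C2. f (?\<phi> a, ?\<phi> b) :: int)"
  have pb_Z: "pb f \<in> carrier CQ.Z" if f: "f \<in> carrier C.Q.Z" for f
  proof -
    have "(\<lambda>x \<in> CQ.C2. f (?\<phi> (fst x), ?\<phi> (snd x)) mod int p) \<in> carrier CQ.Z"
    proof (rule CQ.Z_intro)
      show "loc_const (prod_topology TQ TQ) (\<lambda>x. f (?\<phi> (fst x), ?\<phi> (snd x)))"
        by (rule loc_const_comp2[OF loc_const_compose[OF continuous_map_fst phi_lc] loc_const_compose[OF continuous_map_snd phi_lc]])
      fix a b c assume abc: "a \<in> carrier Q" "b \<in> carrier Q" "c \<in> carrier Q"
      show "int p dvd CQ.defect (\<lambda>x. f (?\<phi> (fst x), ?\<phi> (snd x))) a b c"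
        using C.Q.Z_defect[OF f phi_carrier[OF abc(1)] phi_carrier[OF abc(2)] phi_carrier[OF abc(3)]]
          phi_mult[OF abc(1,2)] phi_mult[OF abc(2,3)]
        by (simp add: CQ.defect_def C.Q.defect_def)
    qed
    moreover have "pb f = (\<lambda>x \<in> CQ.C2. f (?\<phi> (fst x), ?\<phi> (snd x)) mod int p)"
      unfolding pb_def
    proof (rule restrict_ext)
      fix x assume "x \<in> CQ.C2"
      then have "(?\<phi> (fst x), ?\<phi> (snd x)) \<in> C.Q.C2" using phi_carrier by auto
      then show "(case x of (a, b) \<Rightarrow> f (?\<phi> a, ?\<phi> b)) = f (?\<phi> (fst x), ?\<phi> (snd x)) mod int p"
        using C.Q.Z_mod[OF f] by (simp add: case_prod_beta')
    qed
    ultimately show ?thesis by simp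
  qed
  obtain f s where fs: "C.factors f s" using C.factors_exist by blast
  have fZ: "f \<in> carrier C.Q.Z" and sec: "C.is_section s"
    and fs_mult: "\<And>A B. A \<in> rcosets\<^bsub>E\<^esub> N \<Longrightarrow> B \<in> rcosets\<^bsub>E\<^esub> N \<Longrightarrow>
        s A \<otimes>\<^bsub>E\<^esub> s B = C.j (f (A, B)) \<otimes>\<^bsub>E\<^esub> s (A \<otimes>\<^bsub>E Mod N\<^esub> B)"
    using fs unfolding C.factors_def by blast+
  \<comment> \<open>Cohomologous cocycles pull back to cohomologous ones, so the pullback of the
    class may be computed with the factor set \<open>f\<close>.\<close>
  have "the_elem ((\<lambda>g. class2 p Q TQ (pb g)) ` class2 p (E Mod N) (quotient_topology E C.TE N) f) = class2 p Q TQ (pb f)"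
  proof (rule the_elem_image_unique)
    show "class2 p (E Mod N) (quotient_topology E C.TE N) f \<noteq> {}"
      using C.Q.BZ.a_rcos_self[OF fZ] unfolding class2_def by blast
    fix g assume g: "g \<in> class2 p (E Mod N) (quotient_topology E C.TE N) f"
    then obtain b where b: "b \<in> C.Q.B" "g = b \<oplus>\<^bsub>C.Q.Z\<^esub> f" by (auto simp: class2_def a_r_coset_def r_coset_def)
    then have gZ: "g \<in> carrier C.Q.Z" using C.Q.Z_add_closed fZ C.Q.B_subset by blast
    have "class2 p (E Mod N) (quotient_topology E C.TE N) f = class2 p (E Mod N) (quotient_topology E C.TE N) g"
      using C.Q.BZ.a_repr_independence'[OF g[unfolded class2_def] fZ] by (simp add: class2_def)
    then obtain u where u: "\<And>a b. a \<in> carrier (E Mod N) \<Longrightarrow> b \<in> carrier (E Mod N) \<Longrightarrow> (g (a, b) - f (a, b) - C.Q.coboundary u a b) mod int p = 0"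
      using C.Q.class2_eq_iff[OF gZ fZ] by metis
    have "(pb g (a, b) - pb f (a, b) - CQ.coboundary (\<lambda>x. u (?\<phi> x)) a b) mod int p = 0"
      if ab: "a \<in> carrier Q" "b \<in> carrier Q" for a b
      using u[OF phi_carrier phi_carrier, OF ab] phi_mult[OF ab] ab
      by (simp add: pb_def CQ.coboundary_def C.Q.coboundary_def)
    then show "class2 p Q TQ (pb g) = class2 p Q TQ (pb f)"
      using CQ.class2_eq_iff[OF pb_Z[OF gZ] pb_Z[OF fZ]] loc_const_comp[OF phi_lc, of u] by blast
  qed
  then have alph: "\<alpha> = class2 p Q TQ (pb f)"
    unfolding \<alpha> pullback2_def C.extension_class_eq[OF fs] pb_def .
  show "\<alpha> \<in> carrier (H2 p Q TQ)"
    unfolding alph CQ.H2_carrier using pb_Z[OF fZ] by blast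
  \<comment> \<open>The exponent of the central factor, determined modulo \<open>p\<close>. It is
    chosen as a function of the value of \<open>\<rho>\<close> alone, so that \<open>?t\<close>
    inherits local constancy from \<open>\<rho>\<close>.\<close>
  define \<tau> where "\<tau> = (\<lambda>A. SOME a. A = C.j a \<otimes>\<^bsub>E\<^esub> s (N #>\<^bsub>E\<^esub> A))"
  have tau: "A = C.j (\<tau> A) \<otimes>\<^bsub>E\<^esub> s (N #>\<^bsub>E\<^esub> A)" if A: "A \<in> carrier E" for A
  proof -
    have m: "N #>\<^bsub>E\<^esub> A \<in> rcosets\<^bsub>E\<^esub> N" by (rule C.coset_mem[OF C.N_normal A])
    have "\<exists>a\<in>{0..int p - 1}. A = C.j a \<otimes>\<^bsub>E\<^esub> s (N #>\<^bsub>E\<^esub> A)"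
      using C.same_coset[OF m C.coset_self[OF C.N_normal A]] sec m unfolding C.is_section_def by blast
    then have "\<exists>a. A = C.j a \<otimes>\<^bsub>E\<^esub> s (N #>\<^bsub>E\<^esub> A)" by blast
    then show ?thesis unfolding \<tau>_def by (rule someI_ex)
  qed
  let ?t = "\<lambda>g. \<tau> (\<rho> g)"
  have rho_t: "\<rho> g = C.j (?t g) \<otimes>\<^bsub>E\<^esub> s (?\<phi> (pi g))" if "g \<in> carrier S" for g
    using tau[OF rh.hom_closed[OF that]] phi[OF that] by simp
  have "splits (pb f) (\<lambda>g. - ?t g)"
    unfolding splits_def
  proof (intro conjI ballI)
    show "loc_const T (\<lambda>g. - ?t g)" by (rule loc_const_comp[OF lc])
    fix a b assume ab: "a \<in> carrier S" "b \<in> carrier S"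
    let ?A = "?\<phi> (pi a)" and ?B = "?\<phi> (pi b)"
    have m: "?A \<in> rcosets\<^bsub>E\<^esub> N" "?B \<in> rcosets\<^bsub>E\<^esub> N" "?A \<otimes>\<^bsub>E Mod N\<^esub> ?B \<in> rcosets\<^bsub>E\<^esub> N"
      using phi_carrier pi_carrier ab C.Q.m_closed by (simp_all only: C.carQ[symmetric])
    note c = C.section_carrier[OF sec m(1)] C.section_carrier[OF sec m(2)] C.section_carrier[OF sec m(3)]
    have phi_ab: "?\<phi> (pi (a \<otimes> b)) = ?A \<otimes>\<^bsub>E Mod N\<^esub> ?B"
      by (simp only: pi_mult[OF ab, symmetric] phi_mult[OF pi_carrier[OF ab(1)] pi_carrier[OF ab(2)]])
    have "C.j (?t (a \<otimes> b)) \<otimes>\<^bsub>E\<^esub> s (?A \<otimes>\<^bsub>E Mod N\<^esub> ?B) = \<rho> (a \<otimes> b)"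
      using rho_t[OF m_closed[OF ab]] unfolding phi_ab by (rule sym)
    also have "\<dots> = \<rho> a \<otimes>\<^bsub>E\<^esub> \<rho> b" by (rule rh.hom_mult[OF ab])
    also have "\<dots> = (C.j (?t a) \<otimes>\<^bsub>E\<^esub> s ?A) \<otimes>\<^bsub>E\<^esub> (C.j (?t b) \<otimes>\<^bsub>E\<^esub> s ?B)"
      by (rule arg_cong2[OF rho_t[OF ab(1)] rho_t[OF ab(2)]])
    also have "\<dots> = C.j (?t a) \<otimes>\<^bsub>E\<^esub> (s ?A \<otimes>\<^bsub>E\<^esub> C.j (?t b)) \<otimes>\<^bsub>E\<^esub> s ?B"
      using c C.j_carrier[of "?t a"] C.j_carrier[of "?t b"] by (simp only: C.m_assoc C.m_closed)
    also have "\<dots> = C.j (?t a) \<otimes>\<^bsub>E\<^esub> (C.j (?t b) \<otimes>\<^bsub>E\<^esub> s ?A) \<otimes>\<^bsub>E\<^esub> s ?B"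
      by (simp only: C.j_central[OF c(1)])
    also have "\<dots> = C.j (?t a) \<otimes>\<^bsub>E\<^esub> C.j (?t b) \<otimes>\<^bsub>E\<^esub> (s ?A \<otimes>\<^bsub>E\<^esub> s ?B)"
      using c C.j_carrier[of "?t a"] C.j_carrier[of "?t b"] by (simp only: C.m_assoc C.m_closed)
    also have "\<dots> = C.j (?t a + ?t b + f (?A, ?B)) \<otimes>\<^bsub>E\<^esub> s (?A \<otimes>\<^bsub>E Mod N\<^esub> ?B)"
      unfolding fs_mult[OF m(1,2)] using c C.j_carrier
      by (simp only: C.m_assoc[symmetric] C.m_closed C.j_add)
    finally have "int p dvd ?t (a \<otimes> b) - (?t a + ?t b + f (?A, ?B))" by (rule C.j_cancel[OF c(3)])
    then have "int p dvd f (?A, ?B) - CS.coboundary (\<lambda>g. - ?t g) a b"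
      by (subst dvd_minus_iff[symmetric]) (simp add: CS.coboundary_def algebra_simps)
    then show "int p dvd pb f (pi a, pi b) - CS.coboundary (\<lambda>g. - ?t g) a b"
      using pi_carrier ab by (simp add: pb_def)
  qed
  then have spl: "splits (pb f) (\<lambda>g. - ?t g)" .
  fix h \<theta> assume h: "h \<in> L n" and \<theta>: "\<theta> \<in> {0..int p - 1}" "\<rho> h = \<iota> \<theta>"
  from tra_eq[OF pb_Z[OF fZ] spl h]
  have tra: "tra h \<alpha> = (?t \<one> - ?t h) mod int p" unfolding alph by simp
  have hc: "h \<in> carrier S" using F_carrier[OF h] .
  have mN: "?\<phi> (pi \<one>) \<in> rcosets\<^bsub>E\<^esub> N" using phi_carrier[OF pi_carrier[OF one_closed]] by (simp only: C.carQ)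
  note c1 = C.section_carrier[OF sec mN]
  have "\<rho> h = C.j \<theta> \<otimes>\<^bsub>E\<^esub> \<rho> \<one>"
    using C.j_range[OF \<theta>(1)] \<theta>(2) rh.hom_one C.j_carrier[of \<theta>] by simp
  then have "C.j (?t h) \<otimes>\<^bsub>E\<^esub> s (?\<phi> (pi \<one>)) = C.j \<theta> \<otimes>\<^bsub>E\<^esub> (C.j (?t \<one>) \<otimes>\<^bsub>E\<^esub> s (?\<phi> (pi \<one>)))"
    using rho_t[OF hc, symmetric] rho_t[OF one_closed, symmetric] by (simp only: pi_kernel[OF h])
  also have "\<dots> = C.j (\<theta> + ?t \<one>) \<otimes>\<^bsub>E\<^esub> s (?\<phi> (pi \<one>))"
    using c1 C.j_carrier by (simp only: C.m_assoc[symmetric] C.j_add)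
  finally have "int p dvd ?t h - (\<theta> + ?t \<one>)" by (rule C.j_cancel[OF c1])
  then have "int p dvd (?t \<one> - ?t h) - (- \<theta>)"
    by (subst dvd_minus_iff[symmetric]) (simp add: algebra_simps)
  then show "tra h \<alpha> = (- \<theta>) mod int p" unfolding tra by (simp only: mod_eq_dvd_iff)
qed

lemma tra_alpha:
  assumes w: "w \<in> lyndon_words X r n" and h: "h \<in> L n"
  shows "alpha p S T X n w \<in> carrier (H2 p Q TQ)"
    and "\<exists>\<theta>\<in>{0..int p - 1}. magnus_coeff S T X w (int p ^ (n - length w + 1)) h = \<theta> * int p ^ (n - length w) \<and>
        tra h (alpha p S T X n w) = (- \<theta>) mod int p"
proof -
  interpret R: rho_setting S T p X r n w by (rule rho_setting_word[OF w])
  have alpha: "alpha p S T X n w = pullback2 p Q TQ (induced_hom R.UU.U (UU_filt p n (length w)) R.\<rho>)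
      (extension_class p R.UU.U (discrete_topology (carrier R.UU.U)) (UU_filt p n (length w)) (corner p n (length w)))"
    unfolding alpha_def p_quotient_def p_quotient_topology_def rho_bar_def gamma_def R.UU.UU_U ..
  note t = tra_pullback[OF R.UU.central_extension_UU[OF p_prime] R.rho_hom R.rho_loc_const R.rho_UU_filt alpha]
  show "alpha p S T X n w \<in> carrier (H2 p Q TQ)" by (rule t(1))
  obtain \<theta> where \<theta>: "\<theta> \<in> {0..int p - 1}" "R.\<rho> h = corner p n (length w) \<theta>"
    using R.UU.UU_filt_corner[OF R.rho_UU_filt[OF h]] by blast
  have "tra h (alpha p S T X n w) = (- \<theta>) mod int p" by (rule t(2)[OF _ h \<theta>])
  then show "\<exists>\<theta>\<in>{0..int p - 1}. magnus_coeff S T X w (int p ^ (n - length w + 1)) h = \<theta> * int p ^ (n - length w) \<and>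
        tra h (alpha p S T X n w) = (- \<theta>) mod int p"
    using \<theta>(1) R.rho_corner[OF \<theta>(2)] by blast
qed

text \<open>The inclusion of the letter sets leaves only finitely many Lyndon predecessors of a
  word, even if \<open>X\<close> is infinite.\<close>

definition prec :: "'a list \<Rightarrow> 'a list \<Rightarrow> bool" where
  "prec u w \<longleftrightarrow> set u \<subseteq> set w \<and> (length u < length w \<or> length u = length w \<and> lt u w)"

text \<open>The inclusion of letters comes from the support of \<open>vgen n u\<close>. If
  \<open>w\<close> is not longer than \<open>u\<close>, the leading part of \<open>tau u\<close>
  decides: the lengths must agree, and a nonzero coefficient at \<open>w\<close> means that
  \<open>w\<close> equals \<open>u\<close> or comes after it.\<close>

lemma tra_alpha_nonzero:
  assumes u: "u \<in> lyndon_words X r n" and w: "w \<in> lyndon_words X r n"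
    and nz: "tra (vgen n u) (alpha p S T X n w) mod int p \<noteq> 0"
  shows "u = w \<or> prec u w"
proof -
  interpret R: rho_setting S T p X r n w by (rule rho_setting_word[OF w])
  have uX: "u \<in> lists X" "lyndon r u" "u \<noteq> []" "length u \<le> n" and wX: "w \<in> lists X" "w \<noteq> []"
    using u w lyndon_not_Nil by (auto simp: lyndon_words_iff)
  have h: "vgen n u \<in> L n" by (rule vgen_mem[OF uX(1,3,4)])
  obtain \<theta> where \<theta>: "R.eps w (vgen n u) = \<theta> * int p ^ (n - length w)"
    "tra (vgen n u) (alpha p S T X n w) = (- \<theta>) mod int p" using tra_alpha(2)[OF w h] by blast
  then have "R.eps w (vgen n u) \<noteq> 0" using nz R.p_gt_1 by auto
  then have sup: "set u \<subseteq> set w" using R.eps_vgen_support[OF uX(1,3) wX] by blast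
  have "length u < length w \<or> length u = length w \<and> (u = w \<or> lt u w)"
  proof (cases "length w \<le> length u")
    case True
    have "R.eps w (tau u) \<noteq> 0"
      using R.eps_vgen[OF uX(1,3) wX True, of n] \<open>R.eps w (vgen n u) \<noteq> 0\<close> by auto
    moreover from this have "length w = length u"
      using R.eps_tau_low[OF uX(1) wX] True by (meson le_neq_implies_less)
    ultimately show ?thesis using R.eps_tau[OF uX(1,2) wX(1)] by metis
  qed simp
  then show ?thesis using sup by (auto simp: prec_def)
qed

text \<open>The coefficient of \<open>tau w\<close> at \<open>w\<close> is 1, so that of
  \<open>vgen n w\<close> is \<open>p^(n - |w|)\<close>, which is nonzero modulo
  \<open>p^(n - |w| + 1)\<close>. Hence \<open>\<theta> = 1\<close>, and the value is -1 modulo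
  \<open>p\<close>.\<close>

lemma tra_alpha_diag:
  assumes w: "w \<in> lyndon_words X r n"
  shows "tra (vgen n w) (alpha p S T X n w) mod int p \<noteq> 0"
proof -
  interpret R: rho_setting S T p X r n w by (rule rho_setting_word[OF w])
  have wX: "w \<in> lists X" "lyndon r w" "w \<noteq> []" "length w \<le> n"
    using w lyndon_not_Nil by (auto simp: lyndon_words_iff)
  have h: "vgen n w \<in> L n" by (rule vgen_mem[OF wX(1,3,4)])
  obtain \<theta> where \<theta>: "R.eps w (vgen n w) = \<theta> * int p ^ (n - length w)"
    "tra (vgen n w) (alpha p S T X n w) = (- \<theta>) mod int p" using tra_alpha(2)[OF w h] by blast
  have "R.eps w (vgen n w) = int (p ^ (n - length w)) mod int p ^ (n - length w + 1)"
    unfolding R.eps_vgen[OF wX(1,3) wX(1,3) order_refl] R.eps_tau_self[OF wX(1,2)] by (simp only: mult_1_right)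
  also have "\<dots> = int p ^ (n - length w)"
    unfolding of_nat_power using R.p_gt_1 by (intro mod_pos_pos_trivial power_strict_increasing) auto
  finally have "\<theta> = 1" using \<theta>(1) R.p_gt_1 by simp
  then have "\<not> int p dvd - \<theta>" using R.p_gt_1 by simp
  then show ?thesis using \<theta>(2) by (simp add: dvd_eq_mod_eq_0)
qed

theorem lyndon_basis:
  "vectorspace (residue_ring (int p)) (H2 p Q TQ) \<and>
   inj_on (alpha p S T X n) (lyndon_words X r n) \<and>
   vectorspace.basis (residue_ring (int p)) (H2 p Q TQ) (alpha p S T X n ` lyndon_words X r n)"
proof -
  let ?I = "lyndon_words X r n"
  have v: "vgen n w \<in> L n" if "w \<in> ?I" for w
    using that vgen_mem lyndon_not_Nil by (auto simp: lyndon_words_iff)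
  have "inj_on (alpha p S T X n) ?I \<and> vectorspace.basis (residue_ring (int p)) (H2 p Q TQ) (alpha p S T X n ` ?I)"
  \<comment> \<open>The same words index vectors and functionals: the functional of \<open>w\<close>
    is the transgression evaluated at \<open>vgen n w\<close>.\<close>
  proof (rule triangular_functionals_basis[where \<phi> = "\<lambda>w. tra (vgen n w)" and R = prec,
        OF p_prime CQ.vectorspace_H2 _ tra_add[OF v] tra_smult[OF v] _ _ tra_alpha_diag tra_alpha_nonzero])
    show "alpha p S T X n w \<in> carrier (H2 p Q TQ)" if "w \<in> ?I" for w
      by (rule tra_alpha(1)[OF that v[OF that]])
    show "x = \<zero>\<^bsub>H2 p Q TQ\<^esub>"
      if x: "x \<in> carrier (H2 p Q TQ)" and z: "\<And>w. w \<in> ?I \<Longrightarrow> tra (vgen n w) x mod int p = 0" for x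
    proof -
      obtain c u where c: "c \<in> carrier CQ.Z" "splits c u" "x = class2 p Q TQ c" using H2_cases[OF x] .
      have "int p dvd u (vgen n w) - u \<one>" if "w \<in> ?I" for w
        using z[OF that] tra_eq[OF c(1,2) v[OF that]] c(3) by (simp add: dvd_eq_mod_eq_0)
      then have "int p dvd u h - u \<one>" if "h \<in> L n" for h using f_vanishes[OF c(1,2) _ that] by blast
      then have "c \<in> CQ.B" by (rule splits_coboundary[OF c(1,2)])
      then show ?thesis unfolding c(3) CQ.H2_zero using CQ.class2_eq_B_iff[OF c(1)] by blast
    qed
    show "finite {w \<in> ?I. tra (vgen n w) x mod int p \<noteq> 0}" if x: "x \<in> carrier (H2 p Q TQ)" for x
    proof -
      obtain c u where c: "c \<in> carrier CQ.Z" "splits c u" "x = class2 p Q TQ c" using H2_cases[OF x] .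
      have "{w \<in> ?I. tra (vgen n w) x mod int p \<noteq> 0} \<subseteq> {w \<in> ?I. \<not> int p dvd u (vgen n w) - u \<one>}"
        using tra_eq[OF c(1,2) v] c(3) by (auto simp: dvd_eq_mod_eq_0)
      then show ?thesis using finite_support[OF c(1,2)] finite_subset by blast
    qed
    show "asymp_on ?I prec"
      by (rule asymp_onI) (auto simp: prec_def dest: lt_trans simp: lt_irrefl)
    show "transp_on ?I prec"
      by (rule transp_onI) (auto simp: prec_def intro: lt_trans)
    show "finite {u \<in> ?I. prec u w}" if "w \<in> ?I" for w
    proof -
      have "{u \<in> ?I. prec u w} \<subseteq> {u. set u \<subseteq> set w \<and> length u \<le> n}"
        by (auto simp: prec_def lyndon_words_iff)
      then show ?thesis using finite_lists_length_le[of "set w" n] finite_subset by blast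
    qed
  qed
  then show ?thesis using CQ.vectorspace_H2 by blast
qed

end

theorem mainTheorem1:
  fixes p n :: nat and S :: "('a, 'm) monoid_scheme" and T :: "'a topology"
    and X :: "'a set" and r :: "'a rel"
  assumes "prime p" and "n \<ge> 2"
    and "X \<noteq> {}" and "linear_order_on X r"
    and "free_profinite_group S T X"
  shows "vectorspace (residue_ring (int p))
           (H2 p (p_quotient p S T n) (p_quotient_topology p S T n)) \<and>
         inj_on (alpha p S T X n) (lyndon_words X r n) \<and>
         vectorspace.basis (residue_ring (int p))
           (H2 p (p_quotient p S T n) (p_quotient_topology p S T n))
           (alpha p S T X n ` lyndon_words X r n)"
proof -
  have tg: "topological_group S T" and X: "X \<subseteq> carrier S" "T closure_of (generate S X) = carrier S"
    using assms(5) by (auto simp: free_profinite_group_def profinite_group_def)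
  have "Group.group S" using tg by (simp add: topological_group_def)
  then interpret lyndon_free S T p X r n
    by (intro lyndon_free.intro lyndon_free_axioms.intro lyndon_topological_grp.intro
        lyndon_topological_grp_axioms.intro topological_grp.intro topological_grp_axioms.intro
        ordered_alphabet.intro) (use assms tg X in auto)
  show ?thesis unfolding p_quotient_def p_quotient_topology_def by (rule lyndon_basis)
qed

end
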